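(* Let $\Omega$ be a bounded convex Reinhardt domain in $\mathbb{C}^2$ and let $\phi\in C(\overline{\Omega})$. Then the Hankel operator $H_{\phi}$ is compact on $A^2(\Omega)$ if and only if $\phi\circ f$ is holomorphic on $\mathbb{D}$ for every holomorphic function $f:\mathbb{D}\rightarrow b\Omega$.
   Context: $\mathbb{D}$ is the open unit disc in $\mathbb{C}$. A domain $\Omega\subset\mathbb{C}^2$ is Reinhardt if $(e^{i\theta_1}z,e^{i\theta_2}w)\in\Omega$ whenever $(z,w)\in\Omega$ and $\theta_1,\theta_2\in\mathbb{R}$. $b\Omega$ denotes the topological boundary of $\Omega$; a holomorphic function $f:\mathbb{D}\to b\Omega$ is a holomorphic map $f:\mathbb{D}\to\mathbb{C}^2$ with $f(\mathbb{D})\subset b\Omega$. $L^2(\Omega)$ is the space of square integrable functions with respect to Lebesgue measure, $A^2(\Omega)$ is the Bergman space, i.e. the closed subspace of holomorphic functions in $L^2(\Omega)$, and $P:L^2(\Omega)\to A^2(\Omega)$ is the orthogonal (Bergman) projection. For $\phi\in L^{\infty}(\Omega)$ the Hankel operator $H_{\phi}:A^2(\Omega)\to L^2(\Omega)$ with symbol $\phi$ is $H_{\phi}f=(I-P)(\phi f)$. *)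

theory Defs
  imports "HOL-Complex_Analysis.Complex_Analysis"
begin

type_synonym C2 = "complex \<times> complex"

definition reinhardt :: "C2 set \<Rightarrow> bool" where
  "reinhardt \<Omega> \<longleftrightarrow>
     (\<forall>z w. (z, w) \<in> \<Omega> \<longrightarrow> (\<forall>\<theta>1 \<theta>2 :: real. (cis \<theta>1 * z, cis \<theta>2 * w) \<in> \<Omega>))"

(* The derivative must be complex linear on C2, i.e. of the form (h, k) |-> a h + b k. *)
definition holomorphic_C2 :: "(C2 \<Rightarrow> complex) \<Rightarrow> C2 set \<Rightarrow> bool" where
  "holomorphic_C2 f \<Omega> \<longleftrightarrow>
     (\<forall>p\<in>\<Omega>. \<exists>a b. (f has_derivative (\<lambda>(h, k). a * h + b * k)) (at p within \<Omega>))"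

definition holomorphic_map_C2 :: "(complex \<Rightarrow> C2) \<Rightarrow> complex set \<Rightarrow> bool" where
  "holomorphic_map_C2 f D \<longleftrightarrow>
     (\<lambda>t. fst (f t)) holomorphic_on D \<and> (\<lambda>t. snd (f t)) holomorphic_on D"

(* Elements of L2 are functions rather than classes modulo null sets; only their values on
   \<Omega> matter, and L2_norm is a seminorm vanishing exactly on functions that are 0 a.e. on \<Omega>. *)
definition L2 :: "C2 set \<Rightarrow> (C2 \<Rightarrow> complex) set" where
  "L2 \<Omega> = {f. f \<in> borel_measurable (lebesgue_on \<Omega>) \<and>
               integrable (lebesgue_on \<Omega>) (\<lambda>x. (cmod (f x))\<^sup>2)}"

definition L2_inner :: "C2 set \<Rightarrow> (C2 \<Rightarrow> complex) \<Rightarrow> (C2 \<Rightarrow> complex) \<Rightarrow> complex" where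
  "L2_inner \<Omega> f g = (LINT x|lebesgue_on \<Omega>. f x * cnj (g x))"

definition L2_norm :: "C2 set \<Rightarrow> (C2 \<Rightarrow> complex) \<Rightarrow> real" where
  "L2_norm \<Omega> f = sqrt (LINT x|lebesgue_on \<Omega>. (cmod (f x))\<^sup>2)"

definition bergman_space :: "C2 set \<Rightarrow> (C2 \<Rightarrow> complex) set" where
  "bergman_space \<Omega> = {f \<in> L2 \<Omega>. holomorphic_C2 f \<Omega>}"

(* The orthogonal projection onto the Bergman space. A holomorphic function on the open set
   \<Omega> is determined by its class modulo null sets; fixing the value 0 off \<Omega> makes the
   representative unique as a HOL function. *)
definition bergman_proj :: "C2 set \<Rightarrow> (C2 \<Rightarrow> complex) \<Rightarrow> C2 \<Rightarrow> complex" where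
  "bergman_proj \<Omega> g =
     (THE h. h \<in> bergman_space \<Omega> \<and> (\<forall>x. x \<notin> \<Omega> \<longrightarrow> h x = 0) \<and>
        (\<forall>k\<in>bergman_space \<Omega>. L2_inner \<Omega> (\<lambda>x. g x - h x) k = 0))"

definition hankel :: "C2 set \<Rightarrow> (C2 \<Rightarrow> complex) \<Rightarrow> (C2 \<Rightarrow> complex) \<Rightarrow> C2 \<Rightarrow> complex" where
  "hankel \<Omega> \<phi> f = (\<lambda>x. \<phi> x * f x - bergman_proj \<Omega> (\<lambda>y. \<phi> y * f y) x)"

(* Compactness of an operator from the Bergman space to L2: images of norm-bounded sequences
   have norm-convergent subsequences. *)
definition compact_on_bergman ::
    "C2 set \<Rightarrow> ((C2 \<Rightarrow> complex) \<Rightarrow> C2 \<Rightarrow> complex) \<Rightarrow> bool" where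
  "compact_on_bergman \<Omega> T \<longleftrightarrow>
     (\<forall>F :: nat \<Rightarrow> C2 \<Rightarrow> complex.
        (\<forall>n. F n \<in> bergman_space \<Omega>) \<and> (\<exists>B. \<forall>n. L2_norm \<Omega> (F n) \<le> B) \<longrightarrow>
        (\<exists>r g. strict_mono r \<and> g \<in> L2 \<Omega> \<and>
           (\<lambda>n. L2_norm \<Omega> (\<lambda>x. T (F (r n)) x - g x)) \<longlonglongrightarrow> 0))"

end

theory Submission
  imports Defs
begin

text \<open>
  A convex Reinhardt domain contains, with any point, the closed bidisc spanned by it, and the
  monomials z^m w^n form an orthogonal basis of the Bergman space. As m/(m+n) tends to t, the
  normalised monomials concentrate near the torus orbits on the closure where |z|^t |w|^(1-t) is
  maximal. For 0 < t < 1 there is exactly one such orbit; for t = 0 and t = 1 the maximisers form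
  the flat faces |w| = max and |z| = max.

  Sufficiency: by Fejer summation over the torus, \<phi> is a uniform limit of linear combinations of
  its torus modes. On every set of maximisers a mode agrees with a constant multiple of a Laurent
  monomial z^j w^k; on the two faces this is where holomorphy along the discs is needed. Hence \<phi>
  maps all but finitely many monomials close to multiples of monomials, and orthogonality of the
  images turns this into an estimate of dist(\<phi> f, holomorphic functions) by a small multiple of the
  norm of f plus finitely many coefficients of f, which gives compactness.

  Necessity: if |w| attains its maximum over the closure at w0, the normalised powers of w + w0 tend
  weakly to 0 and concentrate on the face w = w0. Compactness makes \<phi> times these functions nearly
  holomorphic, and restricting to slices w = const close to the face exhibits \<phi>(., w0) as an L2
  limit of holomorphic functions. Finally, supporting hyperplanes and the maximum principle show
  that every nonconstant disc in the boundary lies in one of the two faces.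
\<close>

text \<open>The constant that relates a mode to its Laurent monomial depends on the limiting ratio
  t, so a mode cannot be replaced by one holomorphic symbol. Each monomial instead receives its own
  correcting multiple, and the approximating operator is a weighted shift of the monomial basis. The
  errors belonging to different monomials have different weights under the torus; being orthogonal,
  they add up in squares, and a relative error e for each monomial gives e for the whole function.
  Only finitely many monomials escape because the ratios fill the compact interval [0, 1].

  The ends of that interval are delicate: there the exponent of one coordinate vanishes, |z|^t
  |w|^(1-t) is only upper semicontinuous in ratio and point jointly, and a Laurent monomial with a
  negative exponent has a pole on the face. Holomorphy along the discs forces such modes to vanish
  there.

  The boundary carries no regularity. Norms of monomials are therefore bounded below by the mean
  value inequality on small discs, not by integrals computed on the domain.\<close>

section \<open>The seminormed space L2\<close>

lemma L2_measurable: "f \<in> L2 \<Omega> \<Longrightarrow> f \<in> borel_measurable (lebesgue_on \<Omega>)"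
  by (simp add: L2_def)

lemma L2_integrable: "f \<in> L2 \<Omega> \<Longrightarrow> integrable (lebesgue_on \<Omega>) (\<lambda>x. (cmod (f x))\<^sup>2)"
  by (simp add: L2_def)

lemma L2_boundI:
  assumes "f \<in> borel_measurable (lebesgue_on \<Omega>)" "integrable (lebesgue_on \<Omega>) g"
    and "AE x in lebesgue_on \<Omega>. (cmod (f x))\<^sup>2 \<le> (g x :: real)"
  shows "f \<in> L2 \<Omega>"
proof -
  have "integrable (lebesgue_on \<Omega>) (\<lambda>x. (cmod (f x))\<^sup>2)"
  proof (rule Bochner_Integration.integrable_bound[OF assms(2)])
    show "(\<lambda>x. (cmod (f x))\<^sup>2) \<in> borel_measurable (lebesgue_on \<Omega>)"
      using assms(1) by measurable
    show "AE x in lebesgue_on \<Omega>. norm ((cmod (f x))\<^sup>2) \<le> norm (g x)"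
      using assms(3) by eventually_elim auto
  qed
  with assms(1) show ?thesis by (simp add: L2_def)
qed

lemma borel_measurable_cnj [measurable]: "cnj \<in> borel_measurable borel"
  by (intro borel_measurable_continuous_onI continuous_intros)

lemma L2_inner_integrable:
  assumes "f \<in> L2 \<Omega>" "g \<in> L2 \<Omega>"
  shows "integrable (lebesgue_on \<Omega>) (\<lambda>x. f x * cnj (g x))"
proof (rule Bochner_Integration.integrable_bound)
  show "integrable (lebesgue_on \<Omega>) (\<lambda>x. (cmod (f x))\<^sup>2 + (cmod (g x))\<^sup>2)"
    using assms by (simp add: L2_integrable)
  have [measurable]: "f \<in> borel_measurable (lebesgue_on \<Omega>)" "g \<in> borel_measurable (lebesgue_on \<Omega>)"
    using assms by (simp_all add: L2_measurable)
  show "(\<lambda>x. f x * cnj (g x)) \<in> borel_measurable (lebesgue_on \<Omega>)"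
    by measurable
  have "cmod (f x * cnj (g x)) \<le> (cmod (f x))\<^sup>2 + (cmod (g x))\<^sup>2" for x
  proof -
    have "2 * cmod (f x) * cmod (g x) \<le> (cmod (f x))\<^sup>2 + (cmod (g x))\<^sup>2"
      by (rule sum_squares_bound)
    moreover have "0 \<le> cmod (f x) * cmod (g x)" by simp
    ultimately show ?thesis by (simp add: norm_mult mult.assoc, linarith?)
  qed
  then show "AE x in lebesgue_on \<Omega>. norm (f x * cnj (g x)) \<le> norm ((cmod (f x))\<^sup>2 + (cmod (g x))\<^sup>2)"
    by (intro AE_I2) (simp only: real_norm_def, rule order_trans[OF _ abs_ge_self])
qed

lemma L2_cmult [intro]:
  assumes "f \<in> L2 \<Omega>" shows "(\<lambda>x. c * f x) \<in> L2 \<Omega>"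
proof -
  have "(\<lambda>x. c * f x) \<in> borel_measurable (lebesgue_on \<Omega>)"
    using L2_measurable[OF assms] by measurable
  moreover have "integrable (lebesgue_on \<Omega>) (\<lambda>x. (cmod c)\<^sup>2 * (cmod (f x))\<^sup>2)"
    using L2_integrable[OF assms] by simp
  ultimately show ?thesis by (simp add: L2_def norm_mult power_mult_distrib)
qed

lemma L2_add [intro]:
  assumes "f \<in> L2 \<Omega>" "g \<in> L2 \<Omega>" shows "(\<lambda>x. f x + g x) \<in> L2 \<Omega>"
proof (rule L2_boundI)
  show "(\<lambda>x. f x + g x) \<in> borel_measurable (lebesgue_on \<Omega>)"
    using assms[THEN L2_measurable] by measurable
  show "integrable (lebesgue_on \<Omega>) (\<lambda>x. 2 * (cmod (f x))\<^sup>2 + 2 * (cmod (g x))\<^sup>2)"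
    using assms[THEN L2_integrable] by simp
  have "(cmod (f x + g x))\<^sup>2 \<le> 2 * (cmod (f x))\<^sup>2 + 2 * (cmod (g x))\<^sup>2" for x
  proof -
    have "(cmod (f x + g x))\<^sup>2 \<le> (cmod (f x) + cmod (g x))\<^sup>2"
      by (intro power_mono norm_triangle_ineq norm_ge_zero)
    also have "\<dots> \<le> 2 * (cmod (f x))\<^sup>2 + 2 * (cmod (g x))\<^sup>2"
      using sum_squares_bound[of "cmod (f x)" "cmod (g x)"] by (simp add: power2_sum)
    finally show ?thesis .
  qed
  then show "AE x in lebesgue_on \<Omega>. (cmod (f x + g x))\<^sup>2 \<le> 2 * (cmod (f x))\<^sup>2 + 2 * (cmod (g x))\<^sup>2"
    by simp
qed

lemma L2_diff [intro]:
  assumes "f \<in> L2 \<Omega>" "g \<in> L2 \<Omega>" shows "(\<lambda>x. f x - g x) \<in> L2 \<Omega>"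
  using L2_add[OF assms(1) L2_cmult[OF assms(2), of "-1"]] by simp

lemma L2_zero [intro, simp]: "(\<lambda>x. 0) \<in> L2 \<Omega>"
  by (simp add: L2_def)

lemma L2_sum [intro]:
  assumes "\<And>i. i \<in> I \<Longrightarrow> f i \<in> L2 \<Omega>" shows "(\<lambda>x. \<Sum>i\<in>I. f i x) \<in> L2 \<Omega>"
  using assms by (induction I rule: infinite_finite_induct) auto

lemma L2_mult_bounded:
  assumes "f \<in> L2 \<Omega>" "u \<in> borel_measurable (lebesgue_on \<Omega>)" "\<And>x. x \<in> \<Omega> \<Longrightarrow> cmod (u x) \<le> M"
  shows "(\<lambda>x. u x * f x) \<in> L2 \<Omega>"
proof (rule L2_boundI)
  show "(\<lambda>x. u x * f x) \<in> borel_measurable (lebesgue_on \<Omega>)"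
    using assms(1)[THEN L2_measurable] assms(2) by measurable
  show "integrable (lebesgue_on \<Omega>) (\<lambda>x. M\<^sup>2 * (cmod (f x))\<^sup>2)"
    using assms(1)[THEN L2_integrable] by simp
  show "AE x in lebesgue_on \<Omega>. (cmod (u x * f x))\<^sup>2 \<le> M\<^sup>2 * (cmod (f x))\<^sup>2"
    by (rule AE_I2) (auto simp: norm_mult power_mult_distrib intro!: mult_right_mono power_mono assms)
qed

lemma L2_norm_sq: "(L2_norm \<Omega> f)\<^sup>2 = (LINT x|lebesgue_on \<Omega>. (cmod (f x))\<^sup>2)"
  by (simp add: L2_norm_def)

lemma L2_norm_nonneg [simp]: "0 \<le> L2_norm \<Omega> f"
  by (simp add: L2_norm_def)

lemma L2_norm_cong: "(\<And>x. x \<in> \<Omega> \<Longrightarrow> cmod (f x) = cmod (g x)) \<Longrightarrow> L2_norm \<Omega> f = L2_norm \<Omega> g"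
  unfolding L2_norm_def by (intro arg_cong[where f=sqrt] Bochner_Integration.integral_cong) auto

lemma L2_inner_cong:
  "(\<And>x. x \<in> \<Omega> \<Longrightarrow> f x = f' x) \<Longrightarrow> (\<And>x. x \<in> \<Omega> \<Longrightarrow> g x = g' x) \<Longrightarrow> L2_inner \<Omega> f g = L2_inner \<Omega> f' g'"
  unfolding L2_inner_def by (intro Bochner_Integration.integral_cong) auto

lemma L2_cong:
  assumes "\<And>x. x \<in> \<Omega> \<Longrightarrow> f x = g x" shows "f \<in> L2 \<Omega> \<longleftrightarrow> g \<in> L2 \<Omega>"
proof -
  have "f \<in> borel_measurable (lebesgue_on \<Omega>) \<longleftrightarrow> g \<in> borel_measurable (lebesgue_on \<Omega>)"
    by (rule measurable_cong) (use assms in auto)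
  moreover have "integrable (lebesgue_on \<Omega>) (\<lambda>x. (cmod (f x))\<^sup>2) \<longleftrightarrow> integrable (lebesgue_on \<Omega>) (\<lambda>x. (cmod (g x))\<^sup>2)"
    by (rule Bochner_Integration.integrable_cong) (use assms in auto)
  ultimately show ?thesis by (simp add: L2_def)
qed

lemma L2_inner_cnj: "L2_inner \<Omega> g f = cnj (L2_inner \<Omega> f g)"
  unfolding L2_inner_def using Bochner_Integration.integral_cnj[of "lebesgue_on \<Omega>" "\<lambda>x. f x * cnj (g x)"]
  by (simp add: mult.commute)

lemma L2_inner_add_left:
  assumes "f \<in> L2 \<Omega>" "g \<in> L2 \<Omega>" "h \<in> L2 \<Omega>"
  shows "L2_inner \<Omega> (\<lambda>x. f x + g x) h = L2_inner \<Omega> f h + L2_inner \<Omega> g h"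
  unfolding L2_inner_def
  by (subst Bochner_Integration.integral_add[symmetric])
     (use assms in \<open>auto intro: L2_inner_integrable simp: algebra_simps\<close>)

lemma L2_inner_cmult_left: "L2_inner \<Omega> (\<lambda>x. c * f x) h = c * L2_inner \<Omega> f h"
  unfolding L2_inner_def by (simp add: mult.assoc)

lemma L2_inner_cmult_right: "L2_inner \<Omega> h (\<lambda>x. c * f x) = cnj c * L2_inner \<Omega> h f"
  by (subst (1 2) L2_inner_cnj) (simp add: L2_inner_cmult_left)

lemma L2_inner_diff_left:
  assumes "f \<in> L2 \<Omega>" "g \<in> L2 \<Omega>" "h \<in> L2 \<Omega>"
  shows "L2_inner \<Omega> (\<lambda>x. f x - g x) h = L2_inner \<Omega> f h - L2_inner \<Omega> g h"
  using L2_inner_add_left[OF assms(1) L2_cmult[OF assms(2), of "-1"] assms(3)]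
  by (simp add: L2_inner_cmult_left[of \<Omega> "-1", simplified])

lemma L2_inner_diff_right:
  assumes "f \<in> L2 \<Omega>" "g \<in> L2 \<Omega>" "h \<in> L2 \<Omega>"
  shows "L2_inner \<Omega> h (\<lambda>x. f x - g x) = L2_inner \<Omega> h f - L2_inner \<Omega> h g"
  by (subst (1 2 3) L2_inner_cnj) (simp add: L2_inner_diff_left assms)

lemma L2_inner_add_right:
  assumes "f \<in> L2 \<Omega>" "g \<in> L2 \<Omega>" "h \<in> L2 \<Omega>"
  shows "L2_inner \<Omega> h (\<lambda>x. f x + g x) = L2_inner \<Omega> h f + L2_inner \<Omega> h g"
  by (subst (1 2 3) L2_inner_cnj) (simp add: L2_inner_add_left assms)

lemma L2_inner_zero_left [simp]: "L2_inner \<Omega> (\<lambda>x. 0) h = 0"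
  by (simp add: L2_inner_def)

lemma L2_inner_sum_left:
  assumes "\<And>i. i \<in> I \<Longrightarrow> f i \<in> L2 \<Omega>" "h \<in> L2 \<Omega>"
  shows "L2_inner \<Omega> (\<lambda>x. \<Sum>i\<in>I. f i x) h = (\<Sum>i\<in>I. L2_inner \<Omega> (f i) h)"
  using assms(1)
proof (induction I rule: infinite_finite_induct)
  case (insert i I)
  then show ?case by (simp add: L2_inner_add_left[OF _ L2_sum assms(2)])
qed auto

lemma L2_inner_self:
  assumes "f \<in> L2 \<Omega>"
  shows "L2_inner \<Omega> f f = of_real ((L2_norm \<Omega> f)\<^sup>2)"
  unfolding L2_norm_sq L2_inner_def
  by (subst integral_complex_of_real[symmetric]) (simp only: complex_norm_square)

lemma L2_norm_add_sq:
  assumes "f \<in> L2 \<Omega>" "g \<in> L2 \<Omega>"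
  shows "(L2_norm \<Omega> (\<lambda>x. f x + g x))\<^sup>2 = (L2_norm \<Omega> f)\<^sup>2 + (L2_norm \<Omega> g)\<^sup>2 + 2 * Re (L2_inner \<Omega> f g)"
proof -
  have "complex_of_real ((L2_norm \<Omega> (\<lambda>x. f x + g x))\<^sup>2) =
        L2_inner \<Omega> f f + L2_inner \<Omega> g g + (L2_inner \<Omega> f g + cnj (L2_inner \<Omega> f g))"
    by (subst L2_inner_self[symmetric])
       (use assms in \<open>auto simp: L2_inner_add_left L2_inner_add_right L2_add L2_inner_cnj[of \<Omega> g f]\<close>)
  from arg_cong[OF this, of Re] show ?thesis
    by (simp add: L2_inner_self assms del: of_real_power)
qed

lemma L2_norm_cmult: "L2_norm \<Omega> (\<lambda>x. c * f x) = cmod c * L2_norm \<Omega> f"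
  unfolding L2_norm_def by (simp add: norm_mult power_mult_distrib real_sqrt_mult)

lemma L2_norm_minus: "L2_norm \<Omega> (\<lambda>x. f x - g x) = L2_norm \<Omega> (\<lambda>x. g x - f x)"
  by (rule L2_norm_cong) (simp add: norm_minus_commute)

lemma L2_pythagoras:
  assumes "f \<in> L2 \<Omega>" "g \<in> L2 \<Omega>" "L2_inner \<Omega> f g = 0"
  shows "(L2_norm \<Omega> (\<lambda>x. f x + g x))\<^sup>2 = (L2_norm \<Omega> f)\<^sup>2 + (L2_norm \<Omega> g)\<^sup>2"
  using L2_norm_add_sq[OF assms(1,2)] assms(3) by simp

lemma L2_Cauchy_Schwarz:
  assumes "f \<in> L2 \<Omega>" "g \<in> L2 \<Omega>"
  shows "cmod (L2_inner \<Omega> f g) \<le> L2_norm \<Omega> f * L2_norm \<Omega> g"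
proof -
  define A B c where "A = (L2_norm \<Omega> f)\<^sup>2" and "B = (L2_norm \<Omega> g)\<^sup>2" and "c = L2_inner \<Omega> f g"
  \<comment> \<open>This is the squared norm of f - t c g, with c the inner product of f and g. The
    factor c makes the cross term real, so a real parameter suffices; t = 1/B will be the
    minimiser.\<close>
  have ineq: "0 \<le> A + t\<^sup>2 * (cmod c)\<^sup>2 * B - 2 * t * (cmod c)\<^sup>2" for t :: real
  proof -
    have "0 \<le> (L2_norm \<Omega> (\<lambda>x. f x + (- of_real t * c) * g x))\<^sup>2" by simp
    also have "\<dots> = A + (L2_norm \<Omega> (\<lambda>x. (- of_real t * c) * g x))\<^sup>2
        + 2 * Re (L2_inner \<Omega> f (\<lambda>x. (- of_real t * c) * g x))"
      unfolding A_def by (rule L2_norm_add_sq[OF assms(1) L2_cmult[OF assms(2)]])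
    also have "(L2_norm \<Omega> (\<lambda>x. (- of_real t * c) * g x))\<^sup>2 = t\<^sup>2 * (cmod c)\<^sup>2 * B"
      by (simp only: L2_norm_cmult) (simp add: B_def norm_mult power_mult_distrib)
    also have "L2_inner \<Omega> f (\<lambda>x. (- of_real t * c) * g x) = cnj (- of_real t * c) * c"
      by (simp only: L2_inner_cmult_right c_def)
    also have "\<dots> = of_real (- t * (cmod c)\<^sup>2)"
      by (simp add: complex_norm_square mult.assoc mult.commute del: of_real_power)
    finally show ?thesis by simp
  qed
  have "(cmod c)\<^sup>2 \<le> A * B"
  proof (cases "B = 0")
    case True
    have "cmod c = 0"
    proof (rule ccontr)
      assume "cmod c \<noteq> 0"
      \<comment> \<open>For B = 0 the expression is affine in t, and this value of t makes it equal
        to -1.\<close>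
      with ineq[of "(A + 1) / (2 * (cmod c)\<^sup>2)"] True show False
        by (simp add: field_simps)
    qed
    then show ?thesis using True by simp
  next
    case False
    then have "B > 0" by (simp add: B_def)
    then show ?thesis using ineq[of "1 / B"]
      by (simp add: field_simps power2_eq_square)
  qed
  then have "(cmod c)\<^sup>2 \<le> (L2_norm \<Omega> f * L2_norm \<Omega> g)\<^sup>2"
    by (simp add: A_def B_def power_mult_distrib)
  then show ?thesis unfolding c_def
    by (rule power2_le_imp_le) simp
qed

lemma L2_triangle:
  assumes "f \<in> L2 \<Omega>" "g \<in> L2 \<Omega>"
  shows "L2_norm \<Omega> (\<lambda>x. f x + g x) \<le> L2_norm \<Omega> f + L2_norm \<Omega> g"
proof (rule power2_le_imp_le)
  have "Re (L2_inner \<Omega> f g) \<le> L2_norm \<Omega> f * L2_norm \<Omega> g"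
    using L2_Cauchy_Schwarz[OF assms] complex_Re_le_cmod order_trans by blast
  then show "(L2_norm \<Omega> (\<lambda>x. f x + g x))\<^sup>2 \<le> (L2_norm \<Omega> f + L2_norm \<Omega> g)\<^sup>2"
    by (simp add: L2_norm_add_sq[OF assms] power2_sum)
qed simp

lemma L2_triangle_diff:
  assumes "f \<in> L2 \<Omega>" "g \<in> L2 \<Omega>" "h \<in> L2 \<Omega>"
  shows "L2_norm \<Omega> (\<lambda>x. f x - h x) \<le> L2_norm \<Omega> (\<lambda>x. f x - g x) + L2_norm \<Omega> (\<lambda>x. g x - h x)"
  using L2_triangle[OF L2_diff[OF assms(1,2)] L2_diff[OF assms(2,3)]] by simp

lemma L2_norm_sum_orthogonal:
  assumes "finite I" "\<And>i. i \<in> I \<Longrightarrow> f i \<in> L2 \<Omega>"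
    and "\<And>i j. i \<in> I \<Longrightarrow> j \<in> I \<Longrightarrow> i \<noteq> j \<Longrightarrow> L2_inner \<Omega> (f i) (f j) = 0"
  shows "(L2_norm \<Omega> (\<lambda>x. \<Sum>i\<in>I. f i x))\<^sup>2 = (\<Sum>i\<in>I. (L2_norm \<Omega> (f i))\<^sup>2)"
  using assms
proof (induction I rule: finite_induct)
  case empty
  then show ?case by (simp add: L2_norm_def)
next
  case (insert i I)
  have "L2_inner \<Omega> (\<lambda>x. \<Sum>j\<in>I. f j x) (f i) = (\<Sum>j\<in>I. L2_inner \<Omega> (f j) (f i))"
    by (rule L2_inner_sum_left) (use insert in auto)
  also have "\<dots> = 0" using insert by (intro sum.neutral) auto
  finally have "L2_inner \<Omega> (f i) (\<lambda>x. \<Sum>j\<in>I. f j x) = 0"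
    by (subst L2_inner_cnj) simp
  from L2_pythagoras[OF _ L2_sum this] insert show ?case by simp
qed

lemma L2_norm_mult_bounded:
  assumes "f \<in> L2 \<Omega>" "\<And>x. x \<in> \<Omega> \<Longrightarrow> cmod (u x) \<le> M" "0 \<le> M"
  shows "L2_norm \<Omega> (\<lambda>x. u x * f x) \<le> M * L2_norm \<Omega> f"
proof (rule power2_le_imp_le)
  have "(L2_norm \<Omega> (\<lambda>x. u x * f x))\<^sup>2 \<le> (LINT x|lebesgue_on \<Omega>. M\<^sup>2 * (cmod (f x))\<^sup>2)"
    unfolding L2_norm_sq
  proof (cases "integrable (lebesgue_on \<Omega>) (\<lambda>x. (cmod (u x * f x))\<^sup>2)")
    case True
    then show "(LINT x|lebesgue_on \<Omega>. (cmod (u x * f x))\<^sup>2) \<le> (LINT x|lebesgue_on \<Omega>. M\<^sup>2 * (cmod (f x))\<^sup>2)"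
      by (rule integral_mono)
         (use assms L2_integrable[OF assms(1)] in \<open>auto simp: norm_mult power_mult_distrib intro!: mult_right_mono power_mono\<close>)
  next
    \<comment> \<open>Measurability of \<open>u\<close> is not among the assumptions. A product that
      fails to be integrable has integral 0 by convention, so the bound survives.\<close>
    case False
    then show "(LINT x|lebesgue_on \<Omega>. (cmod (u x * f x))\<^sup>2) \<le> (LINT x|lebesgue_on \<Omega>. M\<^sup>2 * (cmod (f x))\<^sup>2)"
      by (simp add: not_integrable_integral_eq)
  qed
  then show "(L2_norm \<Omega> (\<lambda>x. u x * f x))\<^sup>2 \<le> (M * L2_norm \<Omega> f)\<^sup>2"
    by (simp add: power_mult_distrib L2_norm_sq)
qed (use assms in simp)

lemma L2_norm_eq_ennreal:
  assumes "f \<in> L2 \<Omega>"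
  shows "ennreal ((L2_norm \<Omega> f)\<^sup>2) = (\<integral>\<^sup>+x. ennreal ((cmod (f x))\<^sup>2) \<partial>lebesgue_on \<Omega>)"
  unfolding L2_norm_sq by (rule nn_integral_eq_integral[symmetric]) (use L2_integrable[OF assms] in auto)

text \<open>Fatou's lemma for |f m - f n|^2 as n grows turns the Cauchy condition into a bound on f
  m - h. The limit is supplied pointwise because in the Bergman space it is known as a locally
  uniform limit before it is known to be square integrable.\<close>

lemma L2_Cauchy_limit:
  fixes f :: "nat \<Rightarrow> C2 \<Rightarrow> complex"
  assumes f: "\<And>n. f n \<in> L2 \<Omega>"
    and Cauchy: "\<And>e. e > 0 \<Longrightarrow> \<exists>N. \<forall>m\<ge>N. \<forall>n\<ge>N. L2_norm \<Omega> (\<lambda>x. f m x - f n x) < e"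
    and AE: "AE x in lebesgue_on \<Omega>. (\<lambda>n. f n x) \<longlonglongrightarrow> h x"
    and h [measurable]: "h \<in> borel_measurable (lebesgue_on \<Omega>)"
  shows "h \<in> L2 \<Omega>" "(\<lambda>n. L2_norm \<Omega> (\<lambda>x. f n x - h x)) \<longlonglongrightarrow> 0"
proof -
  have [measurable]: "f n \<in> borel_measurable (lebesgue_on \<Omega>)" for n
    using f by (simp add: L2_measurable)
  have bound: "(\<integral>\<^sup>+x. ennreal ((cmod (f m x - h x))\<^sup>2) \<partial>lebesgue_on \<Omega>) \<le> ennreal (e\<^sup>2)"
    if N: "\<forall>m\<ge>N. \<forall>n\<ge>N. L2_norm \<Omega> (\<lambda>x. f m x - f n x) < e" and m: "m \<ge> N" for m N e
  proof -
    have "(\<integral>\<^sup>+x. ennreal ((cmod (f m x - h x))\<^sup>2) \<partial>lebesgue_on \<Omega>) =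
          (\<integral>\<^sup>+x. liminf (\<lambda>n. ennreal ((cmod (f m x - f n x))\<^sup>2)) \<partial>lebesgue_on \<Omega>)"
    proof (rule nn_integral_cong_AE)
      show "AE x in lebesgue_on \<Omega>. ennreal ((cmod (f m x - h x))\<^sup>2) = liminf (\<lambda>n. ennreal ((cmod (f m x - f n x))\<^sup>2))"
        using AE
      proof eventually_elim
        case (elim x)
        have "(\<lambda>n. ennreal ((cmod (f m x - f n x))\<^sup>2)) \<longlonglongrightarrow> ennreal ((cmod (f m x - h x))\<^sup>2)"
          by (intro tendsto_intros elim)
        then show ?case by (intro lim_imp_Liminf[symmetric]) auto
      qed
    qed
    also have "\<dots> \<le> liminf (\<lambda>n. \<integral>\<^sup>+x. ennreal ((cmod (f m x - f n x))\<^sup>2) \<partial>lebesgue_on \<Omega>)"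
      by (rule nn_integral_liminf) measurable
    also have "\<dots> \<le> ennreal (e\<^sup>2)"
    proof (rule Liminf_le)
      show "\<forall>\<^sub>F n in sequentially. (\<integral>\<^sup>+x. ennreal ((cmod (f m x - f n x))\<^sup>2) \<partial>lebesgue_on \<Omega>) \<le> ennreal (e\<^sup>2)"
        using eventually_ge_at_top[of N]
      proof eventually_elim
        case (elim n)
        have "L2_norm \<Omega> (\<lambda>x. f m x - f n x) \<le> e" using N m elim by (simp add: less_imp_le)
        then show ?case
          by (subst L2_norm_eq_ennreal[symmetric]) (auto intro!: L2_diff f ennreal_leI power_mono)
      qed
    qed simp
    finally show ?thesis .
  qed
  obtain N where N: "\<forall>m\<ge>N. \<forall>n\<ge>N. L2_norm \<Omega> (\<lambda>x. f m x - f n x) < 1"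
    using Cauchy[of 1] by auto
  have "(\<lambda>x. f N x - h x) \<in> L2 \<Omega>"
  proof -
    have "(\<integral>\<^sup>+x. ennreal ((cmod (f N x - h x))\<^sup>2) \<partial>lebesgue_on \<Omega>) < \<infinity>"
      using bound[OF N order_refl] by (rule order.strict_trans1) simp
    then have "integrable (lebesgue_on \<Omega>) (\<lambda>x. (cmod (f N x - h x))\<^sup>2)"
      by (intro integrableI_bounded) auto
    then show ?thesis by (simp add: L2_def)
  qed
  from L2_diff[OF f this, of N] show h2: "h \<in> L2 \<Omega>" by simp
  show "(\<lambda>n. L2_norm \<Omega> (\<lambda>x. f n x - h x)) \<longlonglongrightarrow> 0"
  proof (rule LIMSEQ_I)
    fix r :: real assume "r > 0"
    then obtain N where N: "\<forall>m\<ge>N. \<forall>n\<ge>N. L2_norm \<Omega> (\<lambda>x. f m x - f n x) < r / 2"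
      using Cauchy[of "r/2"] by auto
    have "L2_norm \<Omega> (\<lambda>x. f n x - h x) < r" if "n \<ge> N" for n
    proof -
      have "ennreal ((L2_norm \<Omega> (\<lambda>x. f n x - h x))\<^sup>2) \<le> ennreal ((r/2)\<^sup>2)"
        using bound[OF N that] by (subst L2_norm_eq_ennreal) (auto intro!: L2_diff f h2)
      then have "(L2_norm \<Omega> (\<lambda>x. f n x - h x))\<^sup>2 \<le> (r/2)\<^sup>2"
        by (simp add: ennreal_le_iff)
      then have "L2_norm \<Omega> (\<lambda>x. f n x - h x) \<le> r/2"
        by (rule power2_le_imp_le) (use \<open>r > 0\<close> in simp)
      then show ?thesis using \<open>r > 0\<close> by simp
    qed
    then show "\<exists>no. \<forall>n\<ge>no. norm (L2_norm \<Omega> (\<lambda>x. f n x - h x) - 0) < r"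
      by auto
  qed
qed


text \<open>The norms use the completed measure, while Fubini and image measures are applied below
  to Borel functions under \<open>lborel\<close>. This is the passage between the two.\<close>

lemma L2_lborel_integral:
  fixes f :: "C2 \<Rightarrow> 'b :: {banach, second_countable_topology}"
  assumes "\<Omega> \<in> sets borel" "(\<lambda>x. indicator \<Omega> x *\<^sub>R f x) \<in> borel_measurable borel"
  shows "(LINT x|lebesgue_on \<Omega>. f x) = (LINT x|lborel. indicator \<Omega> x *\<^sub>R f x)"
proof -
  have "\<Omega> \<in> sets lebesgue" using assms(1) by simp
  then have "(LINT x|lebesgue_on \<Omega>. f x) = (LINT x|lebesgue. indicator \<Omega> x *\<^sub>R f x)"
    by (subst integral_restrict_space) auto
  also have "\<dots> = (LINT x|lborel. indicator \<Omega> x *\<^sub>R f x)"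
    by (rule integral_completion) (use assms in simp)
  finally show ?thesis .
qed

text \<open>A convergent sequence is bounded, so the sets \<open>E l\<close> on which all F n are at
  most l exhaust \<Omega>. On \<open>E l\<close> dominated convergence applies; the part
  \<open>gl l\<close> of g outside \<open>E l\<close> has small norm and is paired with the norm
  bound B.\<close>

lemma L2_weakly_null:
  fixes F :: "nat \<Rightarrow> C2 \<Rightarrow> complex"
  assumes F: "\<And>n. F n \<in> L2 \<Omega>" and B: "\<And>n. L2_norm \<Omega> (F n) \<le> B" and g: "g \<in> L2 \<Omega>"
    and lim: "\<And>x. x \<in> \<Omega> \<Longrightarrow> (\<lambda>n. F n x) \<longlonglongrightarrow> 0"
    and fin: "finite_measure (lebesgue_on \<Omega>)"
  shows "(\<lambda>n. L2_inner \<Omega> g (F n)) \<longlonglongrightarrow> 0"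
proof -
  interpret finite_measure "lebesgue_on \<Omega>" by fact
  let ?M = "lebesgue_on \<Omega>"
  have [measurable]: "F n \<in> borel_measurable ?M" "g \<in> borel_measurable ?M" for n
    using F g by (simp_all add: L2_measurable)
  define E where "E = (\<lambda>l::nat. {x \<in> space ?M. \<forall>n. cmod (F n x) \<le> real l})"
  have [measurable]: "E l \<in> sets ?M" for l
    unfolding E_def by measurable
  have B0: "0 \<le> B" using B[of 0] L2_norm_nonneg order_trans by blast
  define gl where "gl = (\<lambda>l x. indicator (- E l) x * g x)"
  have gl2: "gl l \<in> L2 \<Omega>" for l
  proof -
    have "(\<lambda>x. indicator (E l) x :: complex) \<in> borel_measurable ?M" by measurable
    then have "(\<lambda>x. 1 - indicator (E l) x :: complex) \<in> borel_measurable ?M" by measurable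
    moreover have "(\<lambda>x. 1 - indicator (E l) x :: complex) = indicator (- E l)"
      by (auto simp: indicator_def)
    ultimately have "(\<lambda>x. indicator (- E l) x :: complex) \<in> borel_measurable ?M" by simp
    then show ?thesis unfolding gl_def
      by (rule L2_mult_bounded[OF g, where M=1]) (auto simp: indicator_def)
  qed
  have "(\<lambda>l. LINT x|?M. (cmod (gl l x))\<^sup>2) \<longlonglongrightarrow> (LINT x|?M. 0 :: real)"
  proof (rule integral_dominated_convergence[where w="\<lambda>x. (cmod (g x))\<^sup>2"])
    show "(\<lambda>x. (cmod (gl l x))\<^sup>2) \<in> borel_measurable ?M" for l
      using L2_measurable[OF gl2] by measurable
    show "integrable ?M (\<lambda>x. (cmod (g x))\<^sup>2)" by (rule L2_integrable[OF g])
    show "AE x in ?M. (\<lambda>l. (cmod (gl l x))\<^sup>2) \<longlonglongrightarrow> 0"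
    proof (rule AE_I2)
      fix x assume x: "x \<in> space ?M"
      then have "x \<in> \<Omega>" by simp
      from convergent_imp_bounded[OF lim[OF this]]
      obtain K where K: "\<And>n. cmod (F n x) \<le> K"
        by (auto simp: bounded_iff)
      obtain l0 :: nat where l0: "K \<le> real l0" using real_arch_simple by blast
      have "eventually (\<lambda>l. (cmod (gl l x))\<^sup>2 = 0) sequentially"
        using eventually_ge_at_top[of l0]
      proof eventually_elim
        case (elim l)
        have "cmod (F n x) \<le> real l" for n
          using K[of n] l0 elim by linarith
        then have "x \<in> E l" using x by (simp add: E_def)
        then show ?case by (simp add: gl_def)
      qed
      then show "(\<lambda>l. (cmod (gl l x))\<^sup>2) \<longlonglongrightarrow> 0" by (rule tendsto_eventually)
    qed
    show "AE x in ?M. norm ((cmod (gl l x))\<^sup>2) \<le> (cmod (g x))\<^sup>2" for l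
      by (rule AE_I2) (auto simp: gl_def norm_mult indicator_def)
  qed simp
  then have gl0: "(\<lambda>l. L2_norm \<Omega> (gl l)) \<longlonglongrightarrow> 0"
    unfolding L2_norm_def using tendsto_real_sqrt[of _ 0] by fastforce
  have main: "(\<lambda>n. L2_inner \<Omega> (\<lambda>x. g x - gl l x) (F n)) \<longlonglongrightarrow> 0" for l
  proof -
    have "(\<lambda>n. LINT x|?M. (g x - gl l x) * cnj (F n x)) \<longlonglongrightarrow> (LINT x|?M. 0 :: complex)"
    \<comment> \<open>On \<open>E l\<close> the functions F n are at most l, and |g| is at most
      |g|^2 + 1, which is integrable because the measure is finite.\<close>
    proof (rule integral_dominated_convergence[where w="\<lambda>x. ((cmod (g x))\<^sup>2 + 1) * real l"])
      show "(\<lambda>x. (g x - gl l x) * cnj (F n x)) \<in> borel_measurable ?M" for n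
        using L2_measurable[OF gl2] by measurable
      show "integrable ?M (\<lambda>x. ((cmod (g x))\<^sup>2 + 1) * real l)"
        using L2_integrable[OF g] by simp
      show "AE x in ?M. (\<lambda>n. (g x - gl l x) * cnj (F n x)) \<longlonglongrightarrow> 0"
      proof (rule AE_I2)
        fix x assume "x \<in> space ?M"
        then have "(\<lambda>n. cnj (F n x)) \<longlonglongrightarrow> cnj 0"
          using lim by (intro tendsto_cnj) auto
        then show "(\<lambda>n. (g x - gl l x) * cnj (F n x)) \<longlonglongrightarrow> 0"
          using tendsto_mult_right_zero by auto
      qed
      show "AE x in ?M. norm ((g x - gl l x) * cnj (F n x)) \<le> ((cmod (g x))\<^sup>2 + 1) * real l" for n
      proof (rule AE_I2)
        fix x assume x: "x \<in> space ?M"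
        show "norm ((g x - gl l x) * cnj (F n x)) \<le> ((cmod (g x))\<^sup>2 + 1) * real l"
        proof (cases "x \<in> E l")
          case True
          then have F: "cmod (F n x) \<le> real l" by (simp add: E_def)
          have "2 * cmod (g x) * 1 \<le> (cmod (g x))\<^sup>2 + 1\<^sup>2" by (rule sum_squares_bound)
          then have "cmod (g x) \<le> (cmod (g x))\<^sup>2 + 1" using zero_le_power2[of "cmod (g x)"] by simp (smt (verit) norm_ge_zero zero_le_power2)
          then show ?thesis using True F
            by (auto simp: gl_def norm_mult intro!: mult_mono)
        next
          case False
          then show ?thesis by (simp add: gl_def)
        qed
      qed
    qed simp
    then show ?thesis by (simp add: L2_inner_def)
  qed
  show ?thesis
  proof (rule LIMSEQ_I)
    fix r :: real assume r: "r > 0"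
    have "r / (2 * (B + 1)) > 0" using r B0 by simp
    from LIMSEQ_D[OF gl0 this] obtain l where l: "L2_norm \<Omega> (gl l) < r / (2 * (B + 1))" by auto
    from LIMSEQ_D[OF main[of l], of "r/2"] r obtain N
      where N: "\<And>n. n \<ge> N \<Longrightarrow> cmod (L2_inner \<Omega> (\<lambda>x. g x - gl l x) (F n)) < r / 2" by auto
    have "cmod (L2_inner \<Omega> g (F n)) < r" if "n \<ge> N" for n
    proof -
      have "L2_inner \<Omega> g (F n) = L2_inner \<Omega> (\<lambda>x. g x - gl l x) (F n) + L2_inner \<Omega> (gl l) (F n)"
        using L2_inner_diff_left[OF g gl2 F, of l n] by simp
      moreover have "cmod (L2_inner \<Omega> (gl l) (F n)) \<le> r / 2"
      proof -
        have "cmod (L2_inner \<Omega> (gl l) (F n)) \<le> L2_norm \<Omega> (gl l) * L2_norm \<Omega> (F n)"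
          by (rule L2_Cauchy_Schwarz[OF gl2 F])
        also have "\<dots> \<le> (r / (2 * (B + 1))) * (B + 1)"
          using l B[of n] r B0 by (intro mult_mono) auto
        also have "\<dots> = r / 2" using B0 by (simp add: field_simps)
        finally show ?thesis .
      qed
      ultimately show ?thesis
        using N[OF that] norm_triangle_ineq[of "L2_inner \<Omega> (\<lambda>x. g x - gl l x) (F n)" "L2_inner \<Omega> (gl l) (F n)"]
        by simp
    qed
    then show "\<exists>no. \<forall>n\<ge>no. norm (L2_inner \<Omega> g (F n) - 0) < r" by auto
  qed
qed


text \<open>On a finite measure space pairing with the constant 1 bounds the L1 norm by the L2 norm.
  A Cauchy sequence in L1 has a subsequence that is Cauchy almost everywhere, and its pointwise
  limit feeds \<open>L2_Cauchy_limit\<close>. Compactness asks only for a subsequence.\<close>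

lemma L2_Cauchy_subseq:
  fixes f :: "nat \<Rightarrow> C2 \<Rightarrow> complex"
  assumes fin: "finite_measure (lebesgue_on \<Omega>)"
    and f: "\<And>n. f n \<in> L2 \<Omega>"
    and Cauchy: "\<And>e. e > 0 \<Longrightarrow> \<exists>N. \<forall>m\<ge>N. \<forall>n\<ge>N. L2_norm \<Omega> (\<lambda>x. f m x - f n x) < e"
  obtains r h where "strict_mono r" "h \<in> L2 \<Omega>" "(\<lambda>n. L2_norm \<Omega> (\<lambda>x. f (r n) x - h x)) \<longlonglongrightarrow> 0"
proof -
  interpret finite_measure "lebesgue_on \<Omega>" by fact
  let ?M = "lebesgue_on \<Omega>"
  have [measurable]: "f n \<in> borel_measurable ?M" for n
    using f by (simp add: L2_measurable)
  have one: "(\<lambda>x. 1) \<in> L2 \<Omega>" by (simp add: L2_def)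
  have L1: "LINT x|?M. cmod (u x) \<le> L2_norm \<Omega> u * L2_norm \<Omega> (\<lambda>x. 1)" if "u \<in> L2 \<Omega>" for u
  proof -
    have n: "(\<lambda>x. complex_of_real (cmod (u x))) \<in> L2 \<Omega>"
      using L2_measurable[OF that] L2_integrable[OF that] by (simp add: L2_def)
    have "LINT x|?M. cmod (u x) = Re (L2_inner \<Omega> (\<lambda>x. of_real (cmod (u x))) (\<lambda>x. 1))"
      by (simp add: L2_inner_def)
    also have "\<dots> \<le> cmod (L2_inner \<Omega> (\<lambda>x. of_real (cmod (u x))) (\<lambda>x. 1))"
      by (rule complex_Re_le_cmod)
    also have "\<dots> \<le> L2_norm \<Omega> (\<lambda>x. of_real (cmod (u x))) * L2_norm \<Omega> (\<lambda>x. 1)"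
      by (rule L2_Cauchy_Schwarz[OF n one])
    also have "L2_norm \<Omega> (\<lambda>x. of_real (cmod (u x))) = L2_norm \<Omega> u"
      by (rule L2_norm_cong) simp
    finally show ?thesis .
  qed
  have int: "integrable ?M (f n)" for n
    using L2_inner_integrable[OF f one, of n] by simp
  have L1C: "\<exists>N. \<forall>i\<ge>N. \<forall>j\<ge>N. LINT x|?M. norm (f i x - f j x) < e" if "e > 0" for e
  proof -
    define K where "K = L2_norm \<Omega> (\<lambda>x. 1) + 1"
    have K: "K > 0" unfolding K_def using L2_norm_nonneg[of \<Omega> "\<lambda>x. 1"] by linarith
    obtain N where N: "\<forall>m\<ge>N. \<forall>n\<ge>N. L2_norm \<Omega> (\<lambda>x. f m x - f n x) < e / K"
      using Cauchy[of "e/K"] K \<open>e > 0\<close> by auto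
    have "LINT x|?M. norm (f i x - f j x) < e" if "i \<ge> N" "j \<ge> N" for i j
    proof -
      have "LINT x|?M. norm (f i x - f j x) \<le> L2_norm \<Omega> (\<lambda>x. f i x - f j x) * L2_norm \<Omega> (\<lambda>x. 1)"
        by (rule L1) (intro L2_diff f)
      also have "\<dots> \<le> L2_norm \<Omega> (\<lambda>x. f i x - f j x) * K"
        by (intro mult_left_mono) (auto simp: K_def)
      also have "\<dots> < e / K * K"
        using N that K by (intro mult_strict_right_mono) auto
      finally show ?thesis using K by simp
    qed
    then show ?thesis by blast
  qed
  obtain r where r: "strict_mono r" and AE: "AE x in ?M. Cauchy (\<lambda>i. f (r i) x)"
    using cauchy_L1_AE_cauchy_subseq[of ?M f, OF int L1C] by blast
  define h where "h = (\<lambda>x. lim (\<lambda>i. f (r i) x))"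
  have h: "h \<in> borel_measurable ?M" unfolding h_def by measurable
  have "AE x in ?M. (\<lambda>n. f (r n) x) \<longlonglongrightarrow> h x"
    using AE by eventually_elim (simp add: h_def Cauchy_convergent convergent_LIMSEQ_iff[symmetric])
  moreover have "\<exists>N. \<forall>m\<ge>N. \<forall>n\<ge>N. L2_norm \<Omega> (\<lambda>x. f (r m) x - f (r n) x) < e" if "e > 0" for e
    using Cauchy[OF that] r by (meson order_trans seq_suble)
  ultimately have "h \<in> L2 \<Omega>" "(\<lambda>n. L2_norm \<Omega> (\<lambda>x. f (r n) x - h x)) \<longlonglongrightarrow> 0"
    using L2_Cauchy_limit[of "\<lambda>n. f (r n)" \<Omega> h] f h by blast+
  with r that show thesis by blast
qed

section \<open>Rotation invariance of Lebesgue measure\<close>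

lemma nn_integral_lborel_shift:
  fixes f :: "real \<Rightarrow> ennreal"
  assumes [measurable]: "f \<in> borel_measurable borel"
  shows "(\<integral>\<^sup>+x. f (x + c) \<partial>lborel) = (\<integral>\<^sup>+x. f x \<partial>lborel)"
proof -
  have "(\<integral>\<^sup>+x. f x \<partial>lborel) = (\<integral>\<^sup>+x. f x \<partial>distr lborel borel ((+) c))"
    by (simp add: lborel_distr_plus)
  also have "\<dots> = (\<integral>\<^sup>+x. f (c + x) \<partial>lborel)"
    by (rule nn_integral_distr) auto
  finally show ?thesis by (simp add: add.commute)
qed

text \<open>For a fixed second coordinate a shear is a translation of the line, so Fubini reduces
  the claim to translation invariance.\<close>

lemma nn_integral_shear_fst:
  fixes f :: "real \<times> real \<Rightarrow> ennreal"
  assumes [measurable]: "f \<in> borel_measurable borel"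
  shows "(\<integral>\<^sup>+p. f (fst p + t * snd p, snd p) \<partial>lborel) = (\<integral>\<^sup>+p. f p \<partial>lborel)"
proof -
  have [measurable]: "f \<in> borel_measurable (borel \<Otimes>\<^sub>M borel)" by (simp add: borel_prod)
  have "(\<integral>\<^sup>+p. f (fst p + t * snd p, snd p) \<partial>lborel) =
        (\<integral>\<^sup>+p. f (fst p + t * snd p, snd p) \<partial>(lborel \<Otimes>\<^sub>M lborel))"
    by (simp add: lborel_prod)
  also have "\<dots> = (\<integral>\<^sup>+y. \<integral>\<^sup>+x. f (x + t * y, y) \<partial>lborel \<partial>lborel)"
    by (subst lborel_pair.nn_integral_snd[symmetric]) auto
  also have "\<dots> = (\<integral>\<^sup>+y. \<integral>\<^sup>+x. f (x, y) \<partial>lborel \<partial>lborel)"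
    by (intro nn_integral_cong nn_integral_lborel_shift) measurable
  also have "\<dots> = (\<integral>\<^sup>+p. f p \<partial>(lborel \<Otimes>\<^sub>M lborel))"
    by (subst lborel_pair.nn_integral_snd) auto
  finally show ?thesis by (simp add: lborel_prod)
qed

lemma nn_integral_shear_snd:
  fixes f :: "real \<times> real \<Rightarrow> ennreal"
  assumes [measurable]: "f \<in> borel_measurable borel"
  shows "(\<integral>\<^sup>+p. f (fst p, snd p + t * fst p) \<partial>lborel) = (\<integral>\<^sup>+p. f p \<partial>lborel)"
proof -
  have [measurable]: "f \<in> borel_measurable (borel \<Otimes>\<^sub>M borel)" by (simp add: borel_prod)
  have "(\<integral>\<^sup>+p. f (fst p, snd p + t * fst p) \<partial>lborel) =
        (\<integral>\<^sup>+p. f (fst p, snd p + t * fst p) \<partial>(lborel \<Otimes>\<^sub>M lborel))"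
    by (simp add: lborel_prod)
  also have "\<dots> = (\<integral>\<^sup>+x. \<integral>\<^sup>+y. f (x, y + t * x) \<partial>lborel \<partial>lborel)"
    by (subst lborel.nn_integral_fst[symmetric]) auto
  also have "\<dots> = (\<integral>\<^sup>+x. \<integral>\<^sup>+y. f (x, y) \<partial>lborel \<partial>lborel)"
    by (intro nn_integral_cong nn_integral_lborel_shift) measurable
  also have "\<dots> = (\<integral>\<^sup>+p. f p \<partial>(lborel \<Otimes>\<^sub>M lborel))"
    by (subst lborel.nn_integral_fst) auto
  finally show ?thesis by (simp add: lborel_prod)
qed

text \<open>Carries the plane to \<open>real \<times> real\<close>, where the shears act; two such
  measures agree once they agree on boxes.\<close>

lemma lborel_complex_eq: "lborel = distr lborel borel (\<lambda>p. Complex (fst p) (snd p))"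
proof (rule lborel_eqI)
  have [measurable]: "(\<lambda>p. Complex (fst p) (snd p)) \<in> borel_measurable borel"
    unfolding Complex_eq by (intro borel_measurable_continuous_onI continuous_intros)
  fix l u :: complex assume le: "\<And>b. b \<in> Basis \<Longrightarrow> l \<bullet> b \<le> u \<bullet> b"
  have "Re l \<le> Re u" "Im l \<le> Im u"
    using le[of 1] le[of \<i>] by (auto simp: Basis_complex_def)
  have "(\<lambda>p. Complex (fst p) (snd p)) -` box l u = box (Re l, Im l) (Re u, Im u)"
    by (auto simp: box_def Basis_complex_def Basis_prod_def)
  then have "emeasure (distr lborel borel (\<lambda>p. Complex (fst p) (snd p))) (box l u)
      = emeasure lborel (box (Re l, Im l) (Re u, Im u))"
    by (subst emeasure_distr) auto
  also have "\<dots> = (\<Prod>b\<in>Basis. ((Re u, Im u) - (Re l, Im l)) \<bullet> b)"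
    by (rule emeasure_lborel_box) (use \<open>Re l \<le> Re u\<close> \<open>Im l \<le> Im u\<close> in \<open>auto simp: Basis_prod_def\<close>)
  also have "(\<Prod>b\<in>Basis. ((Re u, Im u) - (Re l, Im l)) \<bullet> b) = (\<Prod>b\<in>Basis. (u - l) \<bullet> b)"
    by (simp add: Basis_prod_def Basis_complex_def)
  finally show "emeasure (distr lborel borel (\<lambda>p. Complex (fst p) (snd p))) (box l u) = (\<Prod>b\<in>Basis. (u - l) \<bullet> b)" .
qed simp

lemma nn_integral_lborel_complex:
  fixes f :: "complex \<Rightarrow> ennreal"
  assumes [measurable]: "f \<in> borel_measurable borel"
  shows "(\<integral>\<^sup>+z. f z \<partial>lborel) = (\<integral>\<^sup>+p. f (Complex (fst p) (snd p)) \<partial>lborel)"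
proof -
  have [measurable]: "(\<lambda>p. Complex (fst p) (snd p)) \<in> borel_measurable borel"
    unfolding Complex_eq by (intro borel_measurable_continuous_onI continuous_intros)
  show ?thesis
    by (subst lborel_complex_eq, subst nn_integral_distr) auto
qed

text \<open>A rotation by an angle that is not a multiple of pi is a product of three shears; -1 is the square of such a rotation.\<close>

lemma nn_integral_rotation:
  fixes f :: "complex \<Rightarrow> ennreal"
  assumes f: "f \<in> borel_measurable borel" and c: "cmod c = 1"
  shows "(\<integral>\<^sup>+z. f (c * z) \<partial>lborel) = (\<integral>\<^sup>+z. f z \<partial>lborel)"
proof -
  have *: "(\<integral>\<^sup>+z. f (c * z) \<partial>lborel) = (\<integral>\<^sup>+z. f z \<partial>lborel)"
    if c: "cmod c = 1" and "Im c \<noteq> 0" and f [measurable]: "f \<in> borel_measurable borel" for c and f :: "complex \<Rightarrow> ennreal"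
  proof -
    have ab: "(Re c)\<^sup>2 + (Im c)\<^sup>2 = 1" using c by (simp add: cmod_power2[symmetric])
    \<comment> \<open>For c = cis a this is tan (a/2). The rotation by a is the product of a
      horizontal shear by -t, a vertical shear by sin a = Im c, and again the horizontal shear by
      -t.\<close>
    define t where "t = (1 - Re c) / Im c"
    have [measurable]: "(\<lambda>p. Complex (fst p) (snd p)) \<in> borel_measurable borel"
      unfolding Complex_eq by (intro borel_measurable_continuous_onI continuous_intros)
    have cont: "continuous_on UNIV (\<lambda>z::complex. c * z)" by (intro continuous_intros)
    have [measurable]: "(\<lambda>z. f (c * z)) \<in> borel_measurable borel"
      using measurable_compose[OF borel_measurable_continuous_onI[OF cont] f] by simp
    define F where "F = (\<lambda>p. f (Complex (fst p) (snd p)))"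
    have F: "F \<in> borel_measurable borel" unfolding F_def by measurable
    define F1 where "F1 = (\<lambda>p. F (fst p + (-t) * snd p, snd p))"
    have F1: "F1 \<in> borel_measurable borel" unfolding F1_def
      by (rule measurable_compose[OF _ F], intro borel_measurable_continuous_onI continuous_intros)
    define F2 where "F2 = (\<lambda>p. F1 (fst p, snd p + Im c * fst p))"
    have F2: "F2 \<in> borel_measurable borel" unfolding F2_def
      by (rule measurable_compose[OF _ F1], intro borel_measurable_continuous_onI continuous_intros)
    have eq: "f (c * Complex (fst p) (snd p)) = F2 (fst p + (-t) * snd p, snd p)" for p
    proof -
      have t1: "Im c * t = 1 - Re c" using \<open>Im c \<noteq> 0\<close> by (simp add: t_def)
      have t2: "t * (1 + Re c) = Im c"
      proof -
        have "(1 - Re c) * (1 + Re c) = Im c * Im c"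
          using ab by (simp add: algebra_simps power2_eq_square)
        then show ?thesis using \<open>Im c \<noteq> 0\<close> by (simp add: t_def)
      qed
      have y1: "snd p + Im c * (fst p + (-t) * snd p) = Im c * fst p + Re c * snd p"
      proof -
        have "snd p + Im c * (fst p + (-t) * snd p) = snd p + Im c * fst p - (Im c * t) * snd p"
          by (simp add: algebra_simps)
        also have "\<dots> = Im c * fst p + Re c * snd p" unfolding t1 by (simp add: algebra_simps)
        finally show ?thesis .
      qed
      have x2: "fst p + (-t) * snd p + (-t) * (Im c * fst p + Re c * snd p) = Re c * fst p - Im c * snd p"
      proof -
        have "fst p + (-t) * snd p + (-t) * (Im c * fst p + Re c * snd p)
            = fst p - (Im c * t) * fst p - (t * (1 + Re c)) * snd p"
          by (simp add: algebra_simps)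
        also have "\<dots> = Re c * fst p - Im c * snd p" unfolding t1 t2 by (simp add: algebra_simps)
        finally show ?thesis .
      qed
      have "F2 (fst p + (-t) * snd p, snd p) =
         F (fst p + (-t) * snd p + (-t) * (snd p + Im c * (fst p + (-t) * snd p)), snd p + Im c * (fst p + (-t) * snd p))"
        by (simp only: F2_def F1_def fst_conv snd_conv)
      also have "\<dots> = F (Re c * fst p - Im c * snd p, Im c * fst p + Re c * snd p)"
        unfolding y1 x2 ..
      also have "\<dots> = f (c * Complex (fst p) (snd p))"
        unfolding F_def by (intro arg_cong[where f=f]) (simp add: complex_eq_iff)
      finally show ?thesis by simp
    qed
    have "(\<integral>\<^sup>+z. f (c * z) \<partial>lborel) = (\<integral>\<^sup>+p. f (c * Complex (fst p) (snd p)) \<partial>lborel)"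
      by (rule nn_integral_lborel_complex) measurable
    also have "\<dots> = (\<integral>\<^sup>+p. F2 (fst p + (-t) * snd p, snd p) \<partial>lborel)"
      unfolding eq ..
    also have "\<dots> = (\<integral>\<^sup>+p. F2 p \<partial>lborel)" by (rule nn_integral_shear_fst[OF F2])
    also have "\<dots> = (\<integral>\<^sup>+p. F1 p \<partial>lborel)" unfolding F2_def by (rule nn_integral_shear_snd[OF F1])
    also have "\<dots> = (\<integral>\<^sup>+p. F p \<partial>lborel)" unfolding F1_def by (rule nn_integral_shear_fst[OF F])
    also have "\<dots> = (\<integral>\<^sup>+z. f z \<partial>lborel)" unfolding F_def by (rule nn_integral_lborel_complex[symmetric]) measurable
    finally show ?thesis .
  qed
  show ?thesis
  proof (cases "Im c = 0")
    case False
    then show ?thesis using * c f by blast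
  next
    case True
    have "continuous_on UNIV (\<lambda>z::complex. - \<i> * c * z)" by (intro continuous_intros)
    from measurable_compose[OF borel_measurable_continuous_onI[OF this] f]
    have m: "(\<lambda>z. f (- \<i> * c * z)) \<in> borel_measurable borel" by simp
    have "Re c \<noteq> 0" using c True by (auto simp: cmod_def)
    have "(\<integral>\<^sup>+z. f (c * z) \<partial>lborel) = (\<integral>\<^sup>+z. f (- \<i> * c * (\<i> * z)) \<partial>lborel)"
      by (intro nn_integral_cong arg_cong[where f=f]) (simp add: complex_eq_iff)
    also have "\<dots> = (\<integral>\<^sup>+z. f (- \<i> * c * z) \<partial>lborel)"
      by (rule *[OF _ _ m]) auto
    also have "\<dots> = (\<integral>\<^sup>+z. f z \<partial>lborel)"
      by (rule *[OF _ _ f]) (use c \<open>Re c \<noteq> 0\<close> in \<open>auto simp: norm_mult\<close>)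
    finally show ?thesis .
  qed
qed

lemma distr_lborel_rotation:
  assumes "cmod c = 1"
  shows "distr lborel borel (\<lambda>z. c * z) = (lborel :: complex measure)"
proof (rule measure_eqI)
  have "continuous_on UNIV (\<lambda>z::complex. c * z)" by (intro continuous_intros)
  from borel_measurable_continuous_onI[OF this]
  have m: "(\<lambda>z. c * z) \<in> lborel \<rightarrow>\<^sub>M borel" by simp
  fix A assume "A \<in> sets (distr lborel borel (\<lambda>z. c * z))"
  then have A: "A \<in> sets borel" by simp
  have "emeasure (distr lborel borel (\<lambda>z. c * z)) A = (\<integral>\<^sup>+z. indicator A z \<partial>distr lborel borel (\<lambda>z. c * z))"
    using A by simp
  also have "\<dots> = (\<integral>\<^sup>+z. indicator A (c * z) \<partial>lborel)"
    by (rule nn_integral_distr[OF m]) (use A in auto)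
  also have "\<dots> = (\<integral>\<^sup>+z. indicator A z \<partial>lborel)"
    by (rule nn_integral_rotation) (use A assms in auto)
  finally show "emeasure (distr lborel borel (\<lambda>z. c * z)) A = emeasure lborel A" using A by simp
qed simp

lemma distr_lborel_torus:
  assumes "cmod a = 1" "cmod b = 1"
  shows "distr lborel borel (\<lambda>p. (a * fst p, b * snd p)) = (lborel :: C2 measure)"
proof -
  have m: "(\<lambda>z. c * z) \<in> lborel \<rightarrow>\<^sub>M borel" for c :: complex
    using borel_measurable_continuous_onI[of "\<lambda>z::complex. c * z"] by (simp add: continuous_intros)
  have "distr lborel borel (\<lambda>z. a * z) \<Otimes>\<^sub>M distr lborel borel (\<lambda>z. b * z) =
        distr (lborel \<Otimes>\<^sub>M lborel) (borel \<Otimes>\<^sub>M borel) (\<lambda>(z, w). (a * z, b * w))"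
    by (rule pair_measure_distr[OF m m]) (simp add: distr_lborel_rotation assms sigma_finite_lborel)
  then show ?thesis
    by (simp add: distr_lborel_rotation assms lborel_prod borel_prod case_prod_unfold)
qed

lemma distr_lborel_swap: "distr lborel borel prod.swap = (lborel :: C2 measure)"
proof -
  have "(lborel :: complex measure) \<Otimes>\<^sub>M lborel =
     distr (lborel \<Otimes>\<^sub>M lborel) (lborel \<Otimes>\<^sub>M lborel) (\<lambda>(x, y). (y, x))"
    by (rule lborel_pair.distr_pair_swap)
  then have "(lborel :: C2 measure) = distr lborel lborel (\<lambda>(x, y). (y, x))"
    by (simp add: lborel_prod)
  also have "\<dots> = distr lborel borel prod.swap"
    by (intro distr_cong) auto
  finally show ?thesis ..
qed

section \<open>Fourier coefficients and holomorphic functions of two variables\<close>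

text \<open>Period 1 instead of 2 pi, so that Fourier coefficients are integrals over [0, 1] without
  a normalising factor.\<close>

definition circ :: "real \<Rightarrow> complex" where "circ \<theta> = cis (2 * pi * \<theta>)"

definition fourier :: "int \<Rightarrow> (real \<Rightarrow> complex) \<Rightarrow> complex" where
  "fourier j \<psi> = integral {0..1} (\<lambda>\<theta>. circ \<theta> powi (- j) * \<psi> \<theta>)"

lemma norm_circ [simp]: "cmod (circ \<theta>) = 1"
  by (simp add: circ_def)

lemma circ_nonzero [simp]: "circ \<theta> \<noteq> 0"
  using norm_circ[of \<theta>] by force

lemma continuous_on_circ [continuous_intros]: "continuous_on A f \<Longrightarrow> continuous_on A (\<lambda>x. circ (f x))"
  unfolding circ_def by (intro continuous_intros)

lemma continuous_on_circ_powi [continuous_intros]: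
  "continuous_on A f \<Longrightarrow> continuous_on A (\<lambda>x. circ (f x) powi j)"
proof (cases "0 \<le> j")
  case True
  then show ?thesis if "continuous_on A f"
    unfolding power_int_def using continuous_on_power[OF continuous_on_circ[OF that], of "nat j"] by simp
next
  case False
  show ?thesis if "continuous_on A f"
    using False continuous_on_power[OF continuous_on_inverse[OF continuous_on_circ[OF that]], of "nat (- j)"]
    by (simp add: power_int_def)
qed

lemma circ_powi: "circ \<theta> powi k = cis (2 * pi * of_int k * \<theta>)"
  unfolding circ_def by (simp add: cis_power_int mult_ac)

lemma integral_circ_powi: "integral {0..1} (\<lambda>\<theta>. circ \<theta> powi k) = (if k = 0 then 1 else 0)"
proof (cases "k = 0")
  case False
  define c where "c = 2 * complex_of_real pi * \<i> * of_int k"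
  have c: "c \<noteq> 0" using False by (simp add: c_def)
  have eq: "circ \<theta> powi k = exp (c * of_real \<theta>)" for \<theta>
    by (simp add: circ_powi cis_conv_exp c_def mult_ac)
  have "((\<lambda>\<theta>. exp (c * of_real \<theta>)) has_integral (exp (c * of_real 1) / c - exp (c * of_real 0) / c)) {0..1}"
  proof (rule fundamental_theorem_of_calculus)
    fix x :: real
    have "((\<lambda>z. exp (c * z) / c) has_field_derivative exp (c * of_real x)) (at (of_real x))"
      using c by (auto intro!: derivative_eq_intros)
    from has_vector_derivative_real_field[OF this]
    show "((\<lambda>\<theta>. exp (c * of_real \<theta>) / c) has_vector_derivative exp (c * of_real x)) (at x within {0..1})"
      by (rule has_vector_derivative_at_within)
  qed simp
  moreover have "exp c = 1"
  proof -
    have "exp c = circ 1 powi k" using eq[of 1] by simp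
    then show ?thesis by (simp add: circ_def)
  qed
  ultimately show ?thesis using False by (simp add: eq integral_unique)
qed simp

lemma fourier_circ_powi: "fourier j (\<lambda>\<theta>. circ \<theta> powi k) = (if j = k then 1 else 0)"
proof -
  have "fourier j (\<lambda>\<theta>. circ \<theta> powi k) = integral {0..1} (\<lambda>\<theta>. circ \<theta> powi (k - j))"
    unfolding fourier_def by (simp add: power_int_add[symmetric])
  then show ?thesis by (simp add: integral_circ_powi)
qed

lemma fourier_integrable:
  assumes "continuous_on {0..1} \<psi>"
  shows "(\<lambda>\<theta>. circ \<theta> powi j * \<psi> \<theta>) integrable_on {0..1}"
  by (intro integrable_continuous_interval continuous_intros assms)

lemma fourier_cmult: "fourier j (\<lambda>\<theta>. c * \<psi> \<theta>) = c * fourier j \<psi>"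
  unfolding fourier_def by (subst integral_mult_right[symmetric]) (simp add: mult_ac)

lemma fourier_sum:
  assumes "finite I" "\<And>i. i \<in> I \<Longrightarrow> continuous_on {0..1} (\<psi> i)"
  shows "fourier j (\<lambda>\<theta>. \<Sum>i\<in>I. \<psi> i \<theta>) = (\<Sum>i\<in>I. fourier j (\<psi> i))"
  unfolding fourier_def sum_distrib_left
  by (rule integral_sum) (use assms in \<open>auto intro: fourier_integrable\<close>)

text \<open>The power series of F converges uniformly on the circle of radius |t| and may be
  integrated term by term. The case j = 0 is the mean value property; in general negative
  frequencies vanish and frequency j is homogeneous of degree j in t, which is how holomorphy enters
  everything below.\<close>

lemma fourier_holomorphic:
  assumes F: "F holomorphic_on ball 0 R" and t: "cmod t < R"
  shows "fourier j (\<lambda>\<theta>. F (circ \<theta> * t)) =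
     (if 0 \<le> j then (deriv ^^ nat j) F 0 / fact (nat j) * t ^ nat j else 0)"
proof -
  define c where "c = (\<lambda>n. (deriv ^^ n) F 0 / fact n)"
  have sums: "(\<lambda>n. c n * w ^ n) sums F w" if "cmod w < R" for w
    using holomorphic_power_series[OF F, of w] that by (simp add: c_def)
  \<comment> \<open>Summability at a radius strictly beyond |t| puts |t| strictly inside the radius
    of convergence, hence uniform convergence on the closed disc.\<close>
  obtain r where r: "cmod t < r" "r < R" using t dense by blast
  have "summable (\<lambda>n. c n * of_real r ^ n)"
    using sums[of "of_real r"] r norm_ge_zero[of t] by (auto simp: sums_iff)
  from conv_radius_geI[OF this] have cr: "cmod t < conv_radius c"
    using r norm_ge_zero[of t] by (auto intro: less_le_trans[of _ "ereal r"])
  have ul: "uniform_limit (cball 0 (cmod t)) (\<lambda>n w. \<Sum>i<n. c i * w ^ i) (\<lambda>w. \<Sum>i. c i * w ^ i) sequentially"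
    using powser_uniform_limit[OF cr, of 0] by simp
  have ul': "uniform_limit {0..1} (\<lambda>n \<theta>. circ \<theta> powi (- j) * (\<Sum>i<n. c i * (circ \<theta> * t) ^ i))
     (\<lambda>\<theta>. circ \<theta> powi (- j) * F (circ \<theta> * t)) sequentially"
  proof (rule uniform_limitI)
    fix e :: real assume "e > 0"
    from uniform_limitD[OF ul this]
    show "\<forall>\<^sub>F n in sequentially. \<forall>x\<in>{0..1}. dist (circ x powi - j * (\<Sum>i<n. c i * (circ x * t) ^ i)) (circ x powi - j * F (circ x * t)) < e"
    proof eventually_elim
      case (elim n)
      show ?case
      proof
        fix x :: real
        have n: "cmod (circ x * t) = cmod t" by (simp add: norm_mult)
        have "dist (circ x powi - j * (\<Sum>i<n. c i * (circ x * t) ^ i)) (circ x powi - j * F (circ x * t))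
           = dist (\<Sum>i<n. c i * (circ x * t) ^ i) (F (circ x * t))"
          by (simp add: dist_norm right_diff_distrib[symmetric] norm_mult norm_power_int)
        also have F: "F (circ x * t) = (\<Sum>i. c i * (circ x * t) ^ i)"
          using sums[of "circ x * t"] t n by (simp add: sums_iff)
        finally show "dist (circ x powi - j * (\<Sum>i<n. c i * (circ x * t) ^ i)) (circ x powi - j * F (circ x * t)) < e"
          using bspec[OF elim, of "circ x * t"] n F by (simp only: mem_cball dist_0_norm order_refl)
      qed
    qed
  qed
  have cont: "continuous_on {0..1} (\<lambda>\<theta>. circ \<theta> powi (- j) * (\<Sum>i<n. c i * (circ \<theta> * t) ^ i))" for n
    by (intro continuous_intros)
  obtain I J where IJ: "\<And>n. ((\<lambda>\<theta>. circ \<theta> powi (- j) * (\<Sum>i<n. c i * (circ \<theta> * t) ^ i)) has_integral I n) {0..1}"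
    "((\<lambda>\<theta>. circ \<theta> powi (- j) * F (circ \<theta> * t)) has_integral J) {0..1}" "(I \<longlongrightarrow> J) sequentially"
    by (rule uniform_limit_integral[OF ul' cont trivial_limit_sequentially]) (rule that)
  have "I n = (\<Sum>i<n. c i * t ^ i * (if j = int i then 1 else 0))" for n
  proof -
    have "I n = fourier j (\<lambda>\<theta>. \<Sum>i<n. c i * (circ \<theta> * t) ^ i)"
      unfolding fourier_def using integral_unique[OF IJ(1)[of n]] by simp
    also have "\<dots> = (\<Sum>i<n. fourier j (\<lambda>\<theta>. c i * (circ \<theta> * t) ^ i))"
      by (rule fourier_sum) (auto intro!: continuous_intros)
    also have "\<dots> = (\<Sum>i<n. fourier j (\<lambda>\<theta>. (c i * t ^ i) * circ \<theta> powi (int i)))"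
      by (simp add: power_mult_distrib mult_ac)
    finally show ?thesis by (simp only: fourier_cmult fourier_circ_powi)
  qed
  moreover have "(\<Sum>i<n. c i * t ^ i * (if j = int i then 1 else 0)) = (if 0 \<le> j then c (nat j) * t ^ nat j else 0)"
    if "n > nat j" for n
  proof (cases "0 \<le> j")
    case True
    have "(\<Sum>i<n. c i * t ^ i * (if j = int i then 1 else 0)) = (\<Sum>i<n. if i = nat j then c i * t ^ i else 0)"
      using True by (intro sum.cong) auto
    then show ?thesis using True that by simp
  qed (auto intro: sum.neutral)
  ultimately have "eventually (\<lambda>n. I n = (if 0 \<le> j then c (nat j) * t ^ nat j else 0)) sequentially"
    by - (rule eventually_mono[OF eventually_gt_at_top[of "nat j"]], simp only:)
  then have "(I \<longlongrightarrow> (if 0 \<le> j then c (nat j) * t ^ nat j else 0)) sequentially"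
    by (rule tendsto_eventually)
  with IJ(3) have "J = (if 0 \<le> j then c (nat j) * t ^ nat j else 0)"
    using LIMSEQ_unique by blast
  with IJ(2) show ?thesis
    unfolding fourier_def c_def by (simp add: integral_unique)
qed

section \<open>Holomorphic functions of two complex variables\<close>

lemma holomorphic_C2_openD:
  assumes "open \<Omega>" "holomorphic_C2 f \<Omega>" "p \<in> \<Omega>"
  obtains a b where "(f has_derivative (\<lambda>(h, k). a * h + b * k)) (at p)"
  using assms unfolding holomorphic_C2_def by (metis at_within_open)

lemma holomorphic_C2_openI:
  assumes "open \<Omega>" "\<And>p. p \<in> \<Omega> \<Longrightarrow> \<exists>a b. (f has_derivative (\<lambda>(h, k). a * h + b * k)) (at p)"
  shows "holomorphic_C2 f \<Omega>"
  using assms unfolding holomorphic_C2_def by (metis at_within_open)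

lemma holomorphic_C2_continuous_on: "holomorphic_C2 f \<Omega> \<Longrightarrow> continuous_on \<Omega> f"
  unfolding holomorphic_C2_def continuous_on_eq_continuous_within
  by (blast intro: has_derivative_continuous)

lemma has_derivative_C2_fst:
  assumes "(f has_derivative (\<lambda>(h, k). a * h + b * k)) (at (z, w))"
  shows "((\<lambda>z. f (z, w)) has_field_derivative a) (at z)"
proof -
  have "((\<lambda>z. (z, w)) has_derivative (\<lambda>h. (h, 0))) (at z)"
    by (intro derivative_intros)
  from has_derivative_compose[OF this assms] show ?thesis
    by (simp add: has_field_derivative_def case_prod_unfold)
qed

lemma has_derivative_C2_snd:
  assumes "(f has_derivative (\<lambda>(h, k). a * h + b * k)) (at (z, w))"
  shows "((\<lambda>w. f (z, w)) has_field_derivative b) (at w)"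
proof -
  have "((\<lambda>w. (z, w)) has_derivative (\<lambda>k. (0, k))) (at w)"
    by (intro derivative_intros)
  from has_derivative_compose[OF this assms] show ?thesis
    by (simp add: has_field_derivative_def case_prod_unfold)
qed

lemma holomorphic_C2_slice_fst:
  assumes "open \<Omega>" "holomorphic_C2 f \<Omega>" "\<And>z. z \<in> S \<Longrightarrow> (z, w) \<in> \<Omega>"
  shows "(\<lambda>z. f (z, w)) holomorphic_on S"
  unfolding holomorphic_on_def
  by (metis assms holomorphic_C2_openD has_derivative_C2_fst field_differentiable_def field_differentiable_at_within)

lemma holomorphic_C2_slice_snd:
  assumes "open \<Omega>" "holomorphic_C2 f \<Omega>" "\<And>w. w \<in> S \<Longrightarrow> (z, w) \<in> \<Omega>"
  shows "(\<lambda>w. f (z, w)) holomorphic_on S"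
  unfolding holomorphic_on_def
  by (metis assms holomorphic_C2_openD has_derivative_C2_snd field_differentiable_def field_differentiable_at_within)

lemma holomorphic_C2_add:
  assumes "holomorphic_C2 f \<Omega>" "holomorphic_C2 g \<Omega>"
  shows "holomorphic_C2 (\<lambda>x. f x + g x) \<Omega>"
  unfolding holomorphic_C2_def
proof
  fix p assume "p \<in> \<Omega>"
  then obtain a b c d where "(f has_derivative (\<lambda>(h, k). a * h + b * k)) (at p within \<Omega>)"
    "(g has_derivative (\<lambda>(h, k). c * h + d * k)) (at p within \<Omega>)"
    using assms unfolding holomorphic_C2_def by meson
  from has_derivative_add[OF this]
  have "((\<lambda>x. f x + g x) has_derivative (\<lambda>(h, k). (a + c) * h + (b + d) * k)) (at p within \<Omega>)"
    by (simp add: case_prod_unfold algebra_simps)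
  then show "\<exists>a b. ((\<lambda>x. f x + g x) has_derivative (\<lambda>(h, k). a * h + b * k)) (at p within \<Omega>)" by blast
qed

lemma holomorphic_C2_mult:
  assumes "holomorphic_C2 f \<Omega>" "holomorphic_C2 g \<Omega>"
  shows "holomorphic_C2 (\<lambda>x. f x * g x) \<Omega>"
  unfolding holomorphic_C2_def
proof
  fix p assume "p \<in> \<Omega>"
  then obtain a b c d where "(f has_derivative (\<lambda>(h, k). a * h + b * k)) (at p within \<Omega>)"
    "(g has_derivative (\<lambda>(h, k). c * h + d * k)) (at p within \<Omega>)"
    using assms unfolding holomorphic_C2_def by meson
  from has_derivative_mult[OF this]
  have "((\<lambda>x. f x * g x) has_derivative (\<lambda>(h, k). (f p * c + a * g p) * h + (f p * d + b * g p) * k)) (at p within \<Omega>)"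
    by (simp add: case_prod_unfold algebra_simps)
  then show "\<exists>a b. ((\<lambda>x. f x * g x) has_derivative (\<lambda>(h, k). a * h + b * k)) (at p within \<Omega>)" by blast
qed

lemma holomorphic_C2_const: "holomorphic_C2 (\<lambda>x. c) \<Omega>"
  unfolding holomorphic_C2_def by (intro ballI exI[of _ 0]) (auto simp: case_prod_unfold)

lemma holomorphic_C2_fst: "holomorphic_C2 fst \<Omega>"
  unfolding holomorphic_C2_def
  by (intro ballI exI[of _ 1] exI[of _ 0]) (auto simp: case_prod_unfold intro!: derivative_eq_intros)

lemma holomorphic_C2_snd: "holomorphic_C2 snd \<Omega>"
  unfolding holomorphic_C2_def
  by (intro ballI exI[of _ 0] exI[of _ 1]) (auto simp: case_prod_unfold intro!: derivative_eq_intros)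

lemma holomorphic_C2_power:
  assumes "holomorphic_C2 f \<Omega>" shows "holomorphic_C2 (\<lambda>x. f x ^ n) \<Omega>"
  by (induction n) (auto intro: holomorphic_C2_const holomorphic_C2_mult assms)

lemma bergman_L2: "f \<in> bergman_space \<Omega> \<Longrightarrow> f \<in> L2 \<Omega>"
  by (simp add: bergman_space_def)

lemma bergman_holomorphic: "f \<in> bergman_space \<Omega> \<Longrightarrow> holomorphic_C2 f \<Omega>"
  by (simp add: bergman_space_def)

lemma bergman_add: "f \<in> bergman_space \<Omega> \<Longrightarrow> g \<in> bergman_space \<Omega> \<Longrightarrow> (\<lambda>x. f x + g x) \<in> bergman_space \<Omega>"
  by (auto simp: bergman_space_def holomorphic_C2_add)

lemma bergman_cmult: "f \<in> bergman_space \<Omega> \<Longrightarrow> (\<lambda>x. c * f x) \<in> bergman_space \<Omega>"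
  using holomorphic_C2_mult[OF holomorphic_C2_const] by (auto simp: bergman_space_def)

lemma bergman_diff: "f \<in> bergman_space \<Omega> \<Longrightarrow> g \<in> bergman_space \<Omega> \<Longrightarrow> (\<lambda>x. f x - g x) \<in> bergman_space \<Omega>"
  using bergman_add[OF _ bergman_cmult[of g \<Omega> "-1"], of f] by simp

lemma bergman_zero: "(\<lambda>x. 0) \<in> bergman_space \<Omega>"
  by (simp add: bergman_space_def holomorphic_C2_const)

lemma bergman_sum: "(\<And>i. i \<in> I \<Longrightarrow> f i \<in> bergman_space \<Omega>) \<Longrightarrow> (\<lambda>x. \<Sum>i\<in>I. f i x) \<in> bergman_space \<Omega>"
  by (induction I rule: infinite_finite_induct) (auto intro: bergman_zero bergman_add)

lemma indicator_continuous_borel: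
  fixes f :: "'a::euclidean_space \<Rightarrow> 'b::euclidean_space"
  assumes "continuous_on S f" "S \<in> sets borel"
  shows "(\<lambda>x. indicator S x *\<^sub>R f x) \<in> borel_measurable borel"
  using borel_measurable_continuous_on_indicator[OF assms(2,1)] .

section \<open>The Bergman space and its projection\<close>

text \<open>The mean value property is applied to the holomorphic function g^2, so that the square
  of |g| appears directly, with no appeal to convexity.\<close>

lemma circle_mean_square:
  assumes g: "g holomorphic_on ball z0 R" and z: "cmod z < R"
  shows "ennreal ((cmod (g z0))\<^sup>2) \<le> (\<integral>\<^sup>+\<theta>. indicator {0..1} \<theta> * ennreal ((cmod (g (z0 + circ \<theta> * z)))\<^sup>2) \<partial>lborel)"
proof -
  define G where "G = (\<lambda>w. (g (z0 + w))\<^sup>2)"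
  have "(\<lambda>w. z0 + w) ` ball 0 R \<subseteq> ball z0 R" by (auto simp: dist_norm)
  then have G: "G holomorphic_on ball 0 R" unfolding G_def
    using holomorphic_on_compose_gen[of "\<lambda>w. z0 + w" "ball 0 R" g "ball z0 R", OF _ g, unfolded o_def]
    by (intro holomorphic_intros) (simp add: holomorphic_on_add)
  have cont: "continuous_on {0..1} (\<lambda>\<theta>. G (circ \<theta> * z))"
    by (rule continuous_on_compose2[OF holomorphic_on_imp_continuous_on[OF G]])
       (use z in \<open>auto intro!: continuous_intros simp: norm_mult\<close>)
  have "G 0 = fourier 0 (\<lambda>\<theta>. G (circ \<theta> * z))"
    by (subst fourier_holomorphic[OF G z]) simp
  also have "\<dots> = integral {0..1} (\<lambda>\<theta>. G (circ \<theta> * z))" by (simp add: fourier_def)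
  also have "cmod \<dots> \<le> integral {0..1} (\<lambda>\<theta>. cmod (G (circ \<theta> * z)))"
    by (rule integral_norm_bound_integral) (use cont in \<open>auto intro!: integrable_continuous_interval continuous_intros\<close>)
  finally have le: "(cmod (g z0))\<^sup>2 \<le> integral {0..1} (\<lambda>\<theta>. cmod (G (circ \<theta> * z)))"
    by (simp add: G_def norm_power)
  let ?H = "\<lambda>\<theta>. cmod (G (circ \<theta> * z))"
  have cont': "continuous_on {0..1} ?H" using cont by (intro continuous_intros)
  have "(?H has_integral integral {0..1} ?H) {0..1}"
    using cont' by (intro integrable_integral integrable_continuous_interval)
  moreover have "(\<lambda>\<theta>. if \<theta> \<in> {0..1} then ?H \<theta> else 0) = (\<lambda>\<theta>. indicator {0..1} \<theta> *\<^sub>R ?H \<theta>)"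
    by (auto simp: indicator_def)
  ultimately have "((\<lambda>\<theta>. indicator {0..1} \<theta> *\<^sub>R ?H \<theta>) has_integral integral {0..1} ?H) UNIV"
    using has_integral_restrict_UNIV[of "{0..1}" ?H] by simp
  moreover have "(\<lambda>\<theta>. indicator {0..1} \<theta> *\<^sub>R ?H \<theta>) \<in> borel_measurable borel"
    by (rule indicator_continuous_borel[OF cont']) simp
  ultimately have "(\<integral>\<^sup>+\<theta>. ennreal (indicator {0..1} \<theta> *\<^sub>R ?H \<theta>) \<partial>lborel) = integral {0..1} ?H"
    by (intro nn_integral_has_integral_lborel) (auto simp: indicator_def)
  moreover have "ennreal (indicator {0..1} \<theta> *\<^sub>R ?H \<theta>) = indicator {0..1} \<theta> * ennreal ((cmod (g (z0 + circ \<theta> * z)))\<^sup>2)" for \<theta>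
    by (simp add: indicator_def G_def norm_power)
  ultimately show ?thesis using ennreal_leI[OF le] by simp
qed

definition disc_area :: "real \<Rightarrow> real" where "disc_area R = measure lborel (ball (0::complex) R)"

lemma disc_area_pos: "R > 0 \<Longrightarrow> disc_area R > 0"
  unfolding disc_area_def by (rule content_ball_gt_0_iff[THEN iffD2])

lemma emeasure_disc: "R \<ge> 0 \<Longrightarrow> emeasure lborel (ball (z::complex) R) = ennreal (disc_area R)"
  unfolding disc_area_def by (simp add: emeasure_ball content_ball)

lemma indicator_square_borel:
  fixes f :: "'a::euclidean_space \<Rightarrow> complex"
  assumes "continuous_on S f" "S \<in> sets borel"
  shows "(\<lambda>x. indicator S x * ennreal ((cmod (f x))\<^sup>2)) \<in> borel_measurable borel"
proof -
  have "(\<lambda>x. ennreal (indicator S x *\<^sub>R (cmod (f x))\<^sup>2)) \<in> borel_measurable borel"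
    by (intro measurable_compose[OF indicator_continuous_borel measurable_ennreal] continuous_intros assms)
  moreover have "(\<lambda>x. ennreal (indicator S x *\<^sub>R (cmod (f x))\<^sup>2)) = (\<lambda>x. indicator S x * ennreal ((cmod (f x))\<^sup>2))"
    by (auto simp: indicator_def)
  ultimately show ?thesis by (simp only:)
qed

text \<open>Rotation invariance takes the place of polar coordinates: the circle inequality is
  integrated over all z in the disc, Fubini exchanges angle and area, and for each angle the inner
  integral is that of the unrotated function.\<close>

lemma disc_mean_square:
  assumes g: "g holomorphic_on ball z0 R" and R: "R > 0"
  shows "ennreal ((cmod (g z0))\<^sup>2 * disc_area R) \<le>
    (\<integral>\<^sup>+z. indicator (ball z0 R) z * ennreal ((cmod (g z))\<^sup>2) \<partial>lborel)"
proof -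
  define G where "G = (\<lambda>z. indicator (ball 0 R) z * ennreal ((cmod (g (z0 + z)))\<^sup>2))"
  have "continuous_on (ball 0 R) (\<lambda>z. g (z0 + z))"
    by (rule continuous_on_compose2[OF holomorphic_on_imp_continuous_on[OF g]])
       (auto intro!: continuous_intros simp: dist_norm)
  then have G [measurable]: "G \<in> borel_measurable borel"
    unfolding G_def by (rule indicator_square_borel) simp
  have [measurable]: "(\<lambda>(\<theta>::real, z). circ \<theta> * z) \<in> borel_measurable (borel \<Otimes>\<^sub>M borel)"
    unfolding borel_prod case_prod_unfold by (intro borel_measurable_continuous_onI continuous_intros)
  have "ennreal ((cmod (g z0))\<^sup>2 * disc_area R) =
     (\<integral>\<^sup>+z. ennreal ((cmod (g z0))\<^sup>2) * indicator (ball (0::complex) R) z \<partial>lborel)"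
    using emeasure_disc[of R 0] R disc_area_pos[OF R] by (simp add: nn_integral_cmult_indicator ennreal_mult del: emeasure_ball)
  also have "\<dots> \<le> (\<integral>\<^sup>+z. \<integral>\<^sup>+\<theta>. indicator {0..1} \<theta> * G (circ \<theta> * z) \<partial>lborel \<partial>lborel)"
  proof (rule nn_integral_mono)
    fix z :: complex
    show "ennreal ((cmod (g z0))\<^sup>2) * indicator (ball 0 R) z \<le> (\<integral>\<^sup>+\<theta>. indicator {0..1} \<theta> * G (circ \<theta> * z) \<partial>lborel)"
    proof (cases "z \<in> ball 0 R")
      case True
      then have "G (circ \<theta> * z) = ennreal ((cmod (g (z0 + circ \<theta> * z)))\<^sup>2)" for \<theta>
        by (simp add: G_def norm_mult)
      with circle_mean_square[OF g, of z] True show ?thesis by simp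
    qed simp
  qed
  also have "\<dots> = (\<integral>\<^sup>+\<theta>. \<integral>\<^sup>+z. indicator {0..1} \<theta> * G (circ \<theta> * z) \<partial>lborel \<partial>lborel)"
    by (rule lborel_pair.Fubini'[symmetric]) measurable
  also have "\<dots> = (\<integral>\<^sup>+\<theta>. indicator {0..1::real} \<theta> * (\<integral>\<^sup>+z. G z \<partial>lborel) \<partial>lborel)"
  proof (rule nn_integral_cong)
    fix \<theta> :: real
    have [measurable]: "(\<lambda>z. circ \<theta> * z) \<in> borel_measurable borel"
      by (intro borel_measurable_continuous_onI continuous_intros)
    show "(\<integral>\<^sup>+z. indicator {0..1} \<theta> * G (circ \<theta> * z) \<partial>lborel) = indicator {0..1} \<theta> * (\<integral>\<^sup>+z. G z \<partial>lborel)"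
      by (subst nn_integral_cmult) (auto simp: nn_integral_rotation[OF G])
  qed
  also have "\<dots> = (\<integral>\<^sup>+z. G z \<partial>lborel)"
    by (subst nn_integral_multc) auto
  also have "\<dots> = (\<integral>\<^sup>+z. G (- z0 + z) \<partial>lborel)"
    by (subst lborel_distr_plus[of "- z0", symmetric], subst nn_integral_distr) auto
  also have "\<dots> = (\<integral>\<^sup>+z. indicator (ball z0 R) z * ennreal ((cmod (g z))\<^sup>2) \<partial>lborel)"
    by (intro nn_integral_cong) (simp add: G_def indicator_def dist_norm norm_minus_commute)
  finally show ?thesis .
qed

lemma lebesgue_on_nn_integral:
  assumes "\<Omega> \<in> sets borel"
  shows "(\<integral>\<^sup>+x. f x \<partial>lebesgue_on \<Omega>) = (\<integral>\<^sup>+x. indicator \<Omega> x * f x \<partial>lborel)"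
proof -
  have "(\<integral>\<^sup>+x. f x \<partial>lebesgue_on \<Omega>) = (\<integral>\<^sup>+x. f x * indicator \<Omega> x \<partial>lebesgue)"
    by (rule nn_integral_restrict_space) (use assms in simp)
  then show ?thesis by (simp add: nn_integral_completion mult.commute)
qed

lemma continuous_on_lebesgue_measurable:
  fixes f :: "C2 \<Rightarrow> 'b::euclidean_space"
  assumes "open \<Omega>" "continuous_on \<Omega> f"
  shows "f \<in> borel_measurable (lebesgue_on \<Omega>)"
  using assms by (intro continuous_imp_measurable_on_sets_lebesgue) auto

text \<open>The disc inequality is used once in each variable. Evaluation at a point is thus bounded
  in norm, with a constant that depends only on the radius of a bidisc fitting into \<Omega>; read
  backwards, it bounds norms of monomials from below.\<close>

lemma bergman_point_bound:
  assumes op: "open \<Omega>" and h: "h \<in> bergman_space \<Omega>" and R: "R > 0"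
    and sub: "ball z0 R \<times> ball w0 R \<subseteq> \<Omega>"
  shows "cmod (h (z0, w0)) * disc_area R \<le> L2_norm \<Omega> h"
proof -
  have hol: "holomorphic_C2 h \<Omega>" by (rule bergman_holomorphic[OF h])
  have cont: "continuous_on \<Omega> h" by (rule holomorphic_C2_continuous_on[OF hol])
  let ?B = "ball z0 R \<times> ball w0 R"
  let ?f = "\<lambda>p. indicator ?B p * ennreal ((cmod (h p))\<^sup>2)"
  have f: "?f \<in> borel_measurable borel"
    by (rule indicator_square_borel) (use cont sub continuous_on_subset in \<open>auto intro: borel_open open_Times\<close>)
  then have [measurable]: "?f \<in> borel_measurable (borel \<Otimes>\<^sub>M borel)" by (simp only: borel_prod)
  have "ennreal ((cmod (h (z0, w0)))\<^sup>2 * disc_area R * disc_area R)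
     = ennreal ((cmod (h (z0, w0)))\<^sup>2 * disc_area R) * ennreal (disc_area R)"
    using disc_area_pos[OF R] by (subst ennreal_mult) auto
  also have "\<dots> \<le> (\<integral>\<^sup>+w. indicator (ball w0 R) w * ennreal ((cmod (h (z0, w)))\<^sup>2) \<partial>lborel) * ennreal (disc_area R)"
    by (intro mult_right_mono disc_mean_square[OF _ R] holomorphic_C2_slice_snd[OF op hol])
       (use sub R in auto)
  also have "\<dots> = (\<integral>\<^sup>+w. indicator (ball w0 R) w * ennreal ((cmod (h (z0, w)))\<^sup>2 * disc_area R) \<partial>lborel)"
  proof -
    have "continuous_on (ball w0 R) (\<lambda>w. h (z0, w))"
      by (rule continuous_on_compose2[OF cont]) (use sub R in \<open>auto intro!: continuous_intros\<close>)
    then have "(\<lambda>w. indicator (ball w0 R) w * ennreal ((cmod (h (z0, w)))\<^sup>2)) \<in> borel_measurable borel"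
      by (rule indicator_square_borel) simp
    then show ?thesis
      using disc_area_pos[OF R] by (subst nn_integral_multc[symmetric]) (auto simp: ennreal_mult mult.assoc)
  qed
  also have "\<dots> \<le> (\<integral>\<^sup>+w. \<integral>\<^sup>+z. ?f (z, w) \<partial>lborel \<partial>lborel)"
  proof (rule nn_integral_mono)
    fix w :: complex
    show "indicator (ball w0 R) w * ennreal ((cmod (h (z0, w)))\<^sup>2 * disc_area R) \<le> (\<integral>\<^sup>+z. ?f (z, w) \<partial>lborel)"
    proof (cases "w \<in> ball w0 R")
      case True
      have "ennreal ((cmod (h (z0, w)))\<^sup>2 * disc_area R) \<le> (\<integral>\<^sup>+z. indicator (ball z0 R) z * ennreal ((cmod (h (z, w)))\<^sup>2) \<partial>lborel)"
        by (intro disc_mean_square[OF _ R] holomorphic_C2_slice_fst[OF op hol]) (use sub True in auto)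
      also have "\<dots> = (\<integral>\<^sup>+z. ?f (z, w) \<partial>lborel)"
        using True by (intro nn_integral_cong) (simp add: indicator_def)
      finally show ?thesis using True by simp
    qed simp
  qed
  also have "\<dots> = (\<integral>\<^sup>+p. ?f p \<partial>(lborel \<Otimes>\<^sub>M lborel))"
    by (rule lborel_pair.nn_integral_snd) measurable
  also have "\<dots> \<le> (\<integral>\<^sup>+p. indicator \<Omega> p * ennreal ((cmod (h p))\<^sup>2) \<partial>lborel)"
    unfolding lborel_prod using sub by (intro nn_integral_mono) (auto simp: indicator_def)
  also have "\<dots> = ennreal ((L2_norm \<Omega> h)\<^sup>2)"
    using op by (subst lebesgue_on_nn_integral[symmetric]) (auto simp: L2_norm_eq_ennreal bergman_L2[OF h])
  finally have "(cmod (h (z0, w0)) * disc_area R)\<^sup>2 \<le> (L2_norm \<Omega> h)\<^sup>2"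
    by (simp add: ennreal_le_iff power2_eq_square mult_ac)
  then show ?thesis by (rule power2_le_imp_le) simp
qed

lemma ball_subset_ball_add:
  assumes "z \<in> ball z0 r" "r + s \<le> t" shows "ball z s \<subseteq> ball z0 t"
proof
  fix x assume "x \<in> ball z s"
  with assms dist_triangle[of z0 x z] show "x \<in> ball z0 t" by (simp add: dist_commute)
qed

lemma open_C2_bidisc:
  assumes "open (\<Omega> :: C2 set)" "(z0, w0) \<in> \<Omega>"
  obtains R where "R > 0" "ball z0 R \<times> ball w0 R \<subseteq> \<Omega>"
proof -
  obtain A B where AB: "open A" "open B" "z0 \<in> A" "w0 \<in> B" "A \<times> B \<subseteq> \<Omega>"
    using open_prod_elim[OF assms] by (metis mem_Sigma_iff)
  obtain r s where "r > 0" "ball z0 r \<subseteq> A" "s > 0" "ball w0 s \<subseteq> B"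
    using AB open_contains_ball by meson
  then have "min r s > 0" "ball z0 (min r s) \<times> ball w0 (min r s) \<subseteq> \<Omega>"
    using AB(5) by (auto simp: subset_iff)
  then show thesis by (rule that)
qed

lemma bergman_norm_zero:
  assumes "open \<Omega>" "h \<in> bergman_space \<Omega>" "L2_norm \<Omega> h = 0" "x \<in> \<Omega>"
  shows "h x = 0"
proof -
  obtain R where R: "R > 0" "ball (fst x) R \<times> ball (snd x) R \<subseteq> \<Omega>"
    using open_C2_bidisc[of \<Omega> "fst x" "snd x"] assms by auto
  from bergman_point_bound[OF assms(1,2) this] assms(3) disc_area_pos[OF R(1)]
  show ?thesis by (simp add: mult_le_0_iff)
qed

section \<open>Derivative estimates and completeness of the Bergman space\<close>

lemma Cauchy_deriv_bound:
  assumes "f holomorphic_on ball z r" "r > 0" "\<And>x. x \<in> ball z r \<Longrightarrow> cmod (f x) \<le> B"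
  shows "cmod (deriv f z) \<le> 2 * B / r"
proof -
  \<comment> \<open>Half the radius keeps the closed disc inside the domain of f and causes the
    factor 2.\<close>
  have "norm ((deriv ^^ 1) f z) \<le> fact 1 * B / (r/2) ^ 1"
  proof (rule Cauchy_inequality)
    show "f holomorphic_on ball z (r/2)"
      by (rule holomorphic_on_subset[OF assms(1)]) (use assms(2) in auto)
    show "continuous_on (cball z (r/2)) f"
      by (rule continuous_on_subset[OF holomorphic_on_imp_continuous_on[OF assms(1)]]) (use assms(2) in auto)
  qed (use assms in \<open>auto simp: dist_norm\<close>)
  then show ?thesis by (simp add: mult.commute)
qed

text \<open>Around every point within distance R of the centre a bidisc of radius R still fits into
  \<Omega>, so the point bound is uniform there and Cauchy's estimate applies to both
  slices.\<close>

lemma bergman_derivative_bound: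
  assumes op: "open \<Omega>" and h: "h \<in> bergman_space \<Omega>" and R: "R > 0"
    and sub: "ball z0 (2*R) \<times> ball w0 (2*R) \<subseteq> \<Omega>"
    and der: "(h has_derivative (\<lambda>(s, t). a * s + b * t)) (at (z0, w0))"
  shows "cmod a \<le> 2 * L2_norm \<Omega> h / (R * disc_area R)" "cmod b \<le> 2 * L2_norm \<Omega> h / (R * disc_area R)"
proof -
  have hol: "holomorphic_C2 h \<Omega>" by (rule bergman_holomorphic[OF h])
  have bound: "cmod (h (z, w)) \<le> L2_norm \<Omega> h / disc_area R" if "z \<in> ball z0 R" "w \<in> ball w0 R" for z w
  proof -
    have "ball z R \<subseteq> ball z0 (2*R)" "ball w R \<subseteq> ball w0 (2*R)"
      by (rule ball_subset_ball_add[where r = R], use that in simp_all)+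
    then have "ball z R \<times> ball w R \<subseteq> ball z0 (2*R) \<times> ball w0 (2*R)" by blast
    with sub have "ball z R \<times> ball w R \<subseteq> \<Omega>" by blast
    from bergman_point_bound[OF op h R this] show ?thesis
      using disc_area_pos[OF R] by (simp add: field_simps)
  qed
  have sub': "ball z0 R \<times> ball w0 R \<subseteq> \<Omega>" using sub R by auto
  have "a = deriv (\<lambda>z. h (z, w0)) z0"
    using has_derivative_C2_fst[OF der] by (simp add: DERIV_imp_deriv)
  moreover have "cmod (deriv (\<lambda>z. h (z, w0)) z0) \<le> 2 * (L2_norm \<Omega> h / disc_area R) / R"
    by (rule Cauchy_deriv_bound[OF holomorphic_C2_slice_fst[OF op hol] R]) (use sub' R bound in auto)
  ultimately show "cmod a \<le> 2 * L2_norm \<Omega> h / (R * disc_area R)" by (simp add: mult.commute)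
  have "b = deriv (\<lambda>w. h (z0, w)) w0"
    using has_derivative_C2_snd[OF der] by (simp add: DERIV_imp_deriv)
  moreover have "cmod (deriv (\<lambda>w. h (z0, w)) w0) \<le> 2 * (L2_norm \<Omega> h / disc_area R) / R"
    by (rule Cauchy_deriv_bound[OF holomorphic_C2_slice_snd[OF op hol] R]) (use sub' R bound in auto)
  ultimately show "cmod b \<le> 2 * L2_norm \<Omega> h / (R * disc_area R)" by (simp add: mult.commute)
qed

text \<open>Norm-Cauchy sequences have values that are Cauchy at each point and derivatives that are
  locally uniformly Cauchy. The theorem on differentiating a sequence gives the pointwise limit a
  derivative that is again complex linear; \<open>L2_Cauchy_limit\<close> then gives convergence in
  norm.\<close>

lemma bergman_complete:
  fixes F :: "nat \<Rightarrow> C2 \<Rightarrow> complex"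
  assumes op: "open \<Omega>" and F: "\<And>n. F n \<in> bergman_space \<Omega>"
    and Cauchy: "\<And>e. e > 0 \<Longrightarrow> \<exists>N. \<forall>m\<ge>N. \<forall>n\<ge>N. L2_norm \<Omega> (\<lambda>x. F m x - F n x) < e"
  obtains h where "h \<in> bergman_space \<Omega>" "(\<lambda>n. L2_norm \<Omega> (\<lambda>x. F n x - h x)) \<longlonglongrightarrow> 0"
proof -
  define D where "D = (\<lambda>n p. SOME ab. (F n has_derivative (\<lambda>(s, t). fst ab * s + snd ab * t)) (at p))"
  have D: "(F n has_derivative (\<lambda>(s, t). fst (D n p) * s + snd (D n p) * t)) (at p)" if p: "p \<in> \<Omega>" for n p
  proof -
    obtain a b where "(F n has_derivative (\<lambda>(h, k). a * h + b * k)) (at p)"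
      by (rule holomorphic_C2_openD[OF op bergman_holomorphic[OF F] p])
    then have "\<exists>ab. (F n has_derivative (\<lambda>(s, t). fst ab * s + snd ab * t)) (at p)"
      by (intro exI[of _ "(a, b)"]) simp
    then show ?thesis unfolding D_def by (rule someI_ex)
  qed
  define h where "h = (\<lambda>p. lim (\<lambda>n. F n p))"
  have Fdiff: "(\<lambda>x. F m x - F n x) \<in> bergman_space \<Omega>" for m n
    by (intro bergman_diff F)
  have Ddiff: "((\<lambda>x. F m x - F n x) has_derivative
      (\<lambda>(s, t). (fst (D m p) - fst (D n p)) * s + (snd (D m p) - snd (D n p)) * t)) (at p)" if "p \<in> \<Omega>" for m n p
    using has_derivative_diff[OF D[OF that, of m] D[OF that, of n]]
    by (simp add: case_prod_unfold algebra_simps)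
  have local: "\<exists>a b. (\<lambda>n. F n p) \<longlonglongrightarrow> h p \<and> (h has_derivative (\<lambda>(s, t). a * s + b * t)) (at p)"
    if p: "p \<in> \<Omega>" for p
  proof -
    obtain z0 w0 where pz: "p = (z0, w0)" by (cases p)
    obtain R0 where R0: "R0 > 0" "ball z0 R0 \<times> ball w0 R0 \<subseteq> \<Omega>"
      using open_C2_bidisc[OF op] p pz by blast
    \<comment> \<open>A point of \<open>U\<close> is at distance less than R from the centre in each
      coordinate, and the derivative bound there asks for a bidisc of radius 2R: together
      R0.\<close>
    define R where "R = R0 / 3"
    have R: "R > 0" using R0 by (simp add: R_def)
    define U where "U = ball z0 R \<times> ball w0 R"
    have Usub: "ball z (2*R) \<times> ball w (2*R) \<subseteq> \<Omega>" if "(z, w) \<in> U" for z w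
    proof -
      have "ball z (2*R) \<subseteq> ball z0 R0" "ball w (2*R) \<subseteq> ball w0 R0"
        by (rule ball_subset_ball_add[where r = R], use that in \<open>simp_all add: U_def R_def\<close>)+
      then show ?thesis using R0(2) by blast
    qed
    have U\<Omega>: "U \<subseteq> \<Omega>" using Usub R by force
    have opU: "open U" by (simp add: U_def open_Times)
    have cvU: "convex U" by (simp add: U_def convex_Times)
    have pU: "p \<in> U" using R by (simp add: U_def pz)
    define K where "K = 2 / (R * disc_area R)"
    have K: "K > 0" using R disc_area_pos[OF R] by (simp add: K_def)
    have bound: "cmod (fst (D m q) - fst (D n q)) \<le> K * L2_norm \<Omega> (\<lambda>x. F m x - F n x)"
      "cmod (snd (D m q) - snd (D n q)) \<le> K * L2_norm \<Omega> (\<lambda>x. F m x - F n x)" if "q \<in> U" for m n q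
    proof -
      have q\<Omega>: "q \<in> \<Omega>" using that U\<Omega> by blast
      note b = bergman_derivative_bound[OF op Fdiff[of m n] R Usub[of "fst q" "snd q"], of
          "fst (D m q) - fst (D n q)" "snd (D m q) - snd (D n q)"]
      show "cmod (fst (D m q) - fst (D n q)) \<le> K * L2_norm \<Omega> (\<lambda>x. F m x - F n x)"
        using b(1) that Ddiff[OF q\<Omega>, of m n] by (simp add: K_def)
      show "cmod (snd (D m q) - snd (D n q)) \<le> K * L2_norm \<Omega> (\<lambda>x. F m x - F n x)"
        using b(2) that Ddiff[OF q\<Omega>, of m n] by (simp add: K_def)
    qed
    have KC: "\<exists>N. \<forall>m\<ge>N. \<forall>n\<ge>N. K * L2_norm \<Omega> (\<lambda>x. F m x - F n x) < e" if "e > 0" for e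
    proof -
      from Cauchy[of "e / K"] that K obtain N
        where N: "\<And>m n. m \<ge> N \<Longrightarrow> n \<ge> N \<Longrightarrow> L2_norm \<Omega> (\<lambda>x. F m x - F n x) < e / K" by auto
      show ?thesis
        by (rule exI[of _ N]) (use N K in \<open>simp add: field_simps\<close>)
    qed
    have Cauchy1: "Cauchy (\<lambda>n. fst (D n q))" "Cauchy (\<lambda>n. snd (D n q))" if "q \<in> U" for q
    proof -
      show "Cauchy (\<lambda>n. fst (D n q))" unfolding Cauchy_def dist_norm
        using KC bound(1)[OF that] by (meson le_less_trans)
      show "Cauchy (\<lambda>n. snd (D n q))" unfolding Cauchy_def dist_norm
        using KC bound(2)[OF that] by (meson le_less_trans)
    qed
    define A B where "A = (\<lambda>q. lim (\<lambda>n. fst (D n q)))" and "B = (\<lambda>q. lim (\<lambda>n. snd (D n q)))"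
    have limA: "(\<lambda>n. fst (D n q)) \<longlonglongrightarrow> A q" and limB: "(\<lambda>n. snd (D n q)) \<longlonglongrightarrow> B q" if "q \<in> U" for q
      using Cauchy1[OF that] by (simp_all add: A_def B_def Cauchy_convergent_iff convergent_LIMSEQ_iff)
    have Fp: "Cauchy (\<lambda>n. F n p)"
    proof -
      have sub: "ball z0 R \<times> ball w0 R \<subseteq> \<Omega>" using U\<Omega> U_def by simp
      have b: "cmod (F m p - F n p) * disc_area R \<le> L2_norm \<Omega> (\<lambda>x. F m x - F n x)" for m n
        using bergman_point_bound[OF op Fdiff[of m n] R sub] pz by simp
      show ?thesis unfolding Cauchy_def dist_norm
      proof (intro allI impI)
        fix e :: real assume "e > 0"
        then obtain N where N: "\<forall>m\<ge>N. \<forall>n\<ge>N. L2_norm \<Omega> (\<lambda>x. F m x - F n x) < e * disc_area R"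
          using Cauchy[of "e * disc_area R"] disc_area_pos[OF R] by auto
        have "cmod (F m p - F n p) < e" if "m \<ge> N" "n \<ge> N" for m n
        proof -
          have "cmod (F m p - F n p) * disc_area R < e * disc_area R"
            using b[of m n] N that by fastforce
          then show ?thesis using disc_area_pos[OF R] by simp
        qed
        then show "\<exists>M. \<forall>m\<ge>M. \<forall>n\<ge>M. cmod (F m p - F n p) < e" by blast
      qed
    qed
    have "\<exists>g. \<forall>x\<in>U. (\<lambda>n. F n x) \<longlonglongrightarrow> g x \<and> (g has_derivative (\<lambda>(s, t). A x * s + B x * t)) (at x within U)"
    proof (rule has_derivative_sequence[OF cvU, where f' = "\<lambda>n q. (\<lambda>(s, t). fst (D n q) * s + snd (D n q) * t)", OF _ _ pU])
      show "(F n has_derivative (\<lambda>(s, t). fst (D n x) * s + snd (D n x) * t)) (at x within U)" if "x \<in> U" for n x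
        using D that U\<Omega> has_derivative_at_withinI by blast
      show "(\<lambda>n. F n p) \<longlonglongrightarrow> h p"
        using Fp by (simp add: h_def Cauchy_convergent_iff convergent_LIMSEQ_iff)
      fix e :: real assume "e > 0"
      then obtain N where N: "\<And>m n. m \<ge> N \<Longrightarrow> n \<ge> N \<Longrightarrow> K * L2_norm \<Omega> (\<lambda>x. F m x - F n x) < e / 2"
        using KC[of "e/2"] by auto
      have "cmod (fst (D n q) - A q) \<le> e / 2" "cmod (snd (D n q) - B q) \<le> e / 2" if "n \<ge> N" "q \<in> U" for n q
      proof -
        have "(\<lambda>m. cmod (fst (D n q) - fst (D m q))) \<longlonglongrightarrow> cmod (fst (D n q) - A q)"
          by (intro tendsto_intros limA that)
        then show "cmod (fst (D n q) - A q) \<le> e / 2"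
        proof (rule LIMSEQ_le_const2)
          show "\<exists>M. \<forall>m\<ge>M. cmod (fst (D n q) - fst (D m q)) \<le> e / 2"
            using bound(1)[OF that(2)] N that(1) by (meson less_imp_le order_trans)
        qed
        have "(\<lambda>m. cmod (snd (D n q) - snd (D m q))) \<longlonglongrightarrow> cmod (snd (D n q) - B q)"
          by (intro tendsto_intros limB that)
        then show "cmod (snd (D n q) - B q) \<le> e / 2"
        proof (rule LIMSEQ_le_const2)
          show "\<exists>M. \<forall>m\<ge>M. cmod (snd (D n q) - snd (D m q)) \<le> e / 2"
            using bound(2)[OF that(2)] N that(1) by (meson less_imp_le order_trans)
        qed
      qed
      note near = this
      have "norm ((case st of (s, t) \<Rightarrow> fst (D n q) * s + snd (D n q) * t) - (case st of (s, t) \<Rightarrow> A q * s + B q * t)) \<le> e * norm st"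
        if "n \<ge> N" "q \<in> U" for n q st
      proof -
        have "norm ((case st of (s, t) \<Rightarrow> fst (D n q) * s + snd (D n q) * t) - (case st of (s, t) \<Rightarrow> A q * s + B q * t))
           = norm ((fst (D n q) - A q) * fst st + (snd (D n q) - B q) * snd st)"
          by (simp add: case_prod_unfold algebra_simps)
        also have "\<dots> \<le> e / 2 * norm st + e / 2 * norm st"
          using near[OF that] norm_fst_le[of "fst st" "snd st"] norm_snd_le[of "snd st" "fst st"] \<open>e > 0\<close>
          by (intro norm_triangle_le add_mono) (auto simp only: norm_mult prod.collapse intro!: mult_mono norm_ge_zero)
        finally show ?thesis by (simp add: field_simps)
      qed
      then show "\<forall>\<^sub>F n in sequentially. \<forall>x\<in>U. \<forall>h. norm ((case h of (s, t) \<Rightarrow> fst (D n x) * s + snd (D n x) * t) - (case h of (s, t) \<Rightarrow> A x * s + B x * t)) \<le> e * norm h"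
        using eventually_sequentially by blast
    qed
    then obtain g where g: "\<And>x. x \<in> U \<Longrightarrow> (\<lambda>n. F n x) \<longlonglongrightarrow> g x"
      "\<And>x. x \<in> U \<Longrightarrow> (g has_derivative (\<lambda>(s, t). A x * s + B x * t)) (at x within U)" by blast
    have gh: "g x = h x" if "x \<in> U" for x
      using g(1)[OF that] by (simp add: h_def limI)
    have "(g has_derivative (\<lambda>(s, t). A p * s + B p * t)) (at p)"
      using g(2)[OF pU] at_within_open[OF pU opU] by simp
    then have "(h has_derivative (\<lambda>(s, t). A p * s + B p * t)) (at p)"
      by (rule has_derivative_transform_within_open[OF _ opU pU gh])
    moreover have "(\<lambda>n. F n p) \<longlonglongrightarrow> h p" using g(1)[OF pU] gh[OF pU] by simp
    ultimately show ?thesis by blast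
  qed
  have hol: "holomorphic_C2 h \<Omega>"
    by (rule holomorphic_C2_openI[OF op]) (use local in blast)
  have h: "h \<in> L2 \<Omega>" "(\<lambda>n. L2_norm \<Omega> (\<lambda>x. F n x - h x)) \<longlonglongrightarrow> 0"
    by (rule L2_Cauchy_limit[of F \<Omega> h, OF bergman_L2[OF F] Cauchy],
        use local in \<open>auto intro!: AE_I2 continuous_on_lebesgue_measurable[OF op holomorphic_C2_continuous_on[OF hol]]\<close>)+
  with hol that show thesis by (auto simp: bergman_space_def)
qed

text \<open>\<open>V\<close> need not be closed: h lies in its closure and the v n approach it. Two
  subspaces are used, the whole Bergman space for the Bergman projection and the polynomials for
  their density.\<close>

lemma bergman_orthogonal_projection:
  assumes op: "open \<Omega>" and V: "V \<subseteq> bergman_space \<Omega>" and ne: "V \<noteq> {}"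
    and add: "\<And>f g. f \<in> V \<Longrightarrow> g \<in> V \<Longrightarrow> (\<lambda>x. f x + g x) \<in> V"
    and cmult: "\<And>c f. f \<in> V \<Longrightarrow> (\<lambda>x. c * f x) \<in> V"
    and g: "g \<in> L2 \<Omega>"
  obtains h v where "h \<in> bergman_space \<Omega>" "\<And>n::nat. v n \<in> V" "(\<lambda>n. L2_norm \<Omega> (\<lambda>x. v n x - h x)) \<longlonglongrightarrow> 0"
    "\<And>k. k \<in> V \<Longrightarrow> L2_inner \<Omega> (\<lambda>x. g x - h x) k = 0"
proof -
  have V2: "k \<in> L2 \<Omega>" if "k \<in> V" for k using V that bergman_L2 by blast
  define S where "S = (\<lambda>k. (L2_norm \<Omega> (\<lambda>x. g x - k x))\<^sup>2) ` V"
  define d where "d = Inf S"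
  have bdd: "bdd_below S" unfolding S_def by (rule bdd_belowI2[of _ 0]) simp
  have d_le: "d \<le> (L2_norm \<Omega> (\<lambda>x. g x - k x))\<^sup>2" if "k \<in> V" for k
    unfolding d_def by (rule cInf_lower[OF _ bdd]) (use that in \<open>simp add: S_def\<close>)
  have "\<exists>k\<in>V. (L2_norm \<Omega> (\<lambda>x. g x - k x))\<^sup>2 < d + inverse (real (Suc n))" for n
    using cInf_lessD[of S "d + inverse (real (Suc n))"] ne by (auto simp: S_def d_def)
  then obtain v where v: "\<And>n. v n \<in> V"
    "\<And>n. (L2_norm \<Omega> (\<lambda>x. g x - v n x))\<^sup>2 < d + inverse (real (Suc n))" by metis
  have gv: "(\<lambda>x. g x - v n x) \<in> L2 \<Omega>" for n using g V2[OF v(1)] by blast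
  \<comment> \<open>Parallelogram law for the minimising sequence: the midpoint \<open>k\<close> of
    v m and v n belongs to \<open>V\<close>, so its squared distance to g is at least d.\<close>
  have par: "(L2_norm \<Omega> (\<lambda>x. v m x - v n x))\<^sup>2 \<le> 2 * inverse (real (Suc m)) + 2 * inverse (real (Suc n))" for m n
  proof -
    define k where "k = (\<lambda>x. (1/2) * (v m x + v n x))"
    have k: "k \<in> V" unfolding k_def by (intro cmult add v)
    let ?a = "\<lambda>x. g x - v m x" and ?b = "\<lambda>x. g x - v n x"
    let ?c = "\<lambda>x. (-1) * (g x - v n x)"
    have c: "?c \<in> L2 \<Omega>" by (intro L2_cmult gv)
    have nc: "L2_norm \<Omega> ?c = L2_norm \<Omega> ?b" by (subst L2_norm_cmult) simp
    have ic: "L2_inner \<Omega> ?a ?c = - L2_inner \<Omega> ?a ?b" by (subst L2_inner_cmult_right) simp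
    have "(L2_norm \<Omega> (\<lambda>x. ?a x + ?b x))\<^sup>2 + (L2_norm \<Omega> (\<lambda>x. ?a x + ?c x))\<^sup>2
        = 2 * (L2_norm \<Omega> ?a)\<^sup>2 + 2 * (L2_norm \<Omega> ?b)\<^sup>2"
      using L2_norm_add_sq[OF gv[of m] gv[of n]] L2_norm_add_sq[OF gv[of m] c] unfolding nc ic by simp
    moreover have "(L2_norm \<Omega> (\<lambda>x. ?a x + ?c x))\<^sup>2 = (L2_norm \<Omega> (\<lambda>x. v m x - v n x))\<^sup>2"
      by (intro arg_cong[where f = "\<lambda>t. t\<^sup>2"] L2_norm_cong) (simp add: norm_minus_commute)
    moreover have "(L2_norm \<Omega> (\<lambda>x. ?a x + ?b x))\<^sup>2 = 4 * (L2_norm \<Omega> (\<lambda>x. g x - k x))\<^sup>2"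
    proof -
      have "L2_norm \<Omega> (\<lambda>x. ?a x + ?b x) = L2_norm \<Omega> (\<lambda>x. 2 * (g x - k x))"
        by (rule L2_norm_cong) (simp add: k_def algebra_simps)
      also have "\<dots> = 2 * L2_norm \<Omega> (\<lambda>x. g x - k x)" by (simp only: L2_norm_cmult) simp
      finally show ?thesis by (simp add: power_mult_distrib)
    qed
    ultimately show ?thesis using d_le[OF k] v(2)[of m] v(2)[of n] by linarith
  qed
  have Cau: "\<exists>N. \<forall>m\<ge>N. \<forall>n\<ge>N. L2_norm \<Omega> (\<lambda>x. v m x - v n x) < e" if "e > 0" for e
  proof -
    obtain N where N: "inverse (real (Suc N)) < e\<^sup>2 / 4"
      using reals_Archimedean[of "e\<^sup>2 / 4"] \<open>e > 0\<close> by auto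
    have "L2_norm \<Omega> (\<lambda>x. v m x - v n x) < e" if "m \<ge> N" "n \<ge> N" for m n
    proof -
      have "inverse (real (Suc m)) \<le> inverse (real (Suc N))" "inverse (real (Suc n)) \<le> inverse (real (Suc N))"
        using that by (auto simp: field_simps)
      with par[of m n] N have "(L2_norm \<Omega> (\<lambda>x. v m x - v n x))\<^sup>2 < e\<^sup>2" by linarith
      then show ?thesis by (rule power2_less_imp_less) (use \<open>e > 0\<close> in simp)
    qed
    then show ?thesis by blast
  qed
  obtain h where h: "h \<in> bergman_space \<Omega>" "(\<lambda>n. L2_norm \<Omega> (\<lambda>x. v n x - h x)) \<longlonglongrightarrow> 0"
    using bergman_complete[OF op, of v] v(1) V Cau by blast
  have h2: "h \<in> L2 \<Omega>" by (rule bergman_L2[OF h(1)])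
  define u where "u = (\<lambda>x. g x - h x)"
  have u: "u \<in> L2 \<Omega>" unfolding u_def using g h2 by blast
  have d0: "0 \<le> d" unfolding d_def by (rule cInf_greatest) (use ne in \<open>auto simp: S_def\<close>)
  have u_le: "L2_norm \<Omega> u \<le> sqrt d"
  proof (rule LIMSEQ_le_const)
    show "(\<lambda>n. sqrt (d + inverse (real (Suc n))) + L2_norm \<Omega> (\<lambda>x. v n x - h x)) \<longlonglongrightarrow> sqrt d"
      using tendsto_add[OF tendsto_real_sqrt[OF tendsto_add[OF tendsto_const LIMSEQ_inverse_real_of_nat]] h(2), of d] by simp
    have "L2_norm \<Omega> u \<le> sqrt (d + inverse (real (Suc n))) + L2_norm \<Omega> (\<lambda>x. v n x - h x)" for n
    proof -
      have "L2_norm \<Omega> u \<le> L2_norm \<Omega> (\<lambda>x. g x - v n x) + L2_norm \<Omega> (\<lambda>x. v n x - h x)"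
        unfolding u_def by (rule L2_triangle_diff[OF g V2[OF v(1)] h2])
      moreover have "L2_norm \<Omega> (\<lambda>x. g x - v n x) \<le> sqrt (d + inverse (real (Suc n)))"
        by (rule real_le_rsqrt) (use v(2) less_imp_le in blast)
      ultimately show ?thesis by simp
    qed
    then show "\<exists>N. \<forall>n\<ge>N. L2_norm \<Omega> u \<le> sqrt (d + inverse (real (Suc n))) + L2_norm \<Omega> (\<lambda>x. v n x - h x)" by blast
  qed
  \<comment> \<open>Since h - c k may lie outside \<open>V\<close>, minimality is applied to v n - c
    k instead; the discrepancy is the norm of v n - h and disappears in the limit.\<close>
  have d_ge: "sqrt d \<le> L2_norm \<Omega> (\<lambda>x. u x + c * k x)" if k: "k \<in> V" for c k
  proof (rule LIMSEQ_le_const)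
    have ck: "(\<lambda>x. c * k x) \<in> L2 \<Omega>" using V2[OF k] by blast
    show "(\<lambda>n. L2_norm \<Omega> (\<lambda>x. u x + c * k x) + L2_norm \<Omega> (\<lambda>x. v n x - h x)) \<longlonglongrightarrow> L2_norm \<Omega> (\<lambda>x. u x + c * k x)"
      using tendsto_add[OF tendsto_const h(2)] by simp
    have "sqrt d \<le> L2_norm \<Omega> (\<lambda>x. u x + c * k x) + L2_norm \<Omega> (\<lambda>x. v n x - h x)" for n
    proof -
      have m: "(\<lambda>x. v n x + (- c) * k x) \<in> V" by (intro add cmult k v)
      have "sqrt d \<le> L2_norm \<Omega> (\<lambda>x. g x - (v n x + (- c) * k x))"
        by (rule real_le_lsqrt[OF _ d_le[OF m]]) (use d0 in auto)
      also have "\<dots> = L2_norm \<Omega> (\<lambda>x. (u x + c * k x) + (h x - v n x))"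
        by (rule L2_norm_cong) (simp add: u_def algebra_simps)
      also have "\<dots> \<le> L2_norm \<Omega> (\<lambda>x. u x + c * k x) + L2_norm \<Omega> (\<lambda>x. h x - v n x)"
        by (rule L2_triangle[OF L2_add[OF u ck] L2_diff[OF h2 V2[OF v(1)]]])
      finally show ?thesis by (simp only: L2_norm_minus[of \<Omega> h "v n"])
    qed
    then show "\<exists>N. \<forall>n\<ge>N. sqrt d \<le> L2_norm \<Omega> (\<lambda>x. u x + c * k x) + L2_norm \<Omega> (\<lambda>x. v n x - h x)" by blast
  qed
  have "L2_inner \<Omega> u k = 0" if k: "k \<in> V" for k
  proof (rule ccontr)
    assume nz: "L2_inner \<Omega> u k \<noteq> 0"
    define i where "i = L2_inner \<Omega> u k"
    \<comment> \<open>With this t the product of t and the squared norm of k is at most 1, hence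
      below 2, and moving u by -t times its component along k would shorten it. The added 1 keeps
      the denominator positive when k has norm 0.\<close>
    define t where "t = 1 / ((L2_norm \<Omega> k)\<^sup>2 + 1)"
    have tpos: "t > 0" by (simp add: t_def add_nonneg_pos)
    define c where "c = - complex_of_real t * i"
    have "(L2_norm \<Omega> u)\<^sup>2 \<le> (L2_norm \<Omega> (\<lambda>x. u x + c * k x))\<^sup>2"
      using order_trans[OF u_le d_ge[OF k]] by (intro power_mono) auto
    also have "\<dots> = (L2_norm \<Omega> u)\<^sup>2 + (L2_norm \<Omega> (\<lambda>x. c * k x))\<^sup>2 + 2 * Re (L2_inner \<Omega> u (\<lambda>x. c * k x))"
      by (rule L2_norm_add_sq[OF u L2_cmult[OF V2[OF k]]])
    also have "(L2_norm \<Omega> (\<lambda>x. c * k x))\<^sup>2 = t\<^sup>2 * (cmod i)\<^sup>2 * (L2_norm \<Omega> k)\<^sup>2"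
      by (simp only: L2_norm_cmult) (simp add: c_def norm_mult power_mult_distrib)
    also have "L2_inner \<Omega> u (\<lambda>x. c * k x) = cnj c * i" by (simp only: L2_inner_cmult_right i_def)
    also have "\<dots> = of_real (- t * (cmod i)\<^sup>2)"
      by (simp add: c_def complex_norm_square mult.assoc mult.commute del: of_real_power)
    finally have "0 \<le> t\<^sup>2 * (cmod i)\<^sup>2 * (L2_norm \<Omega> k)\<^sup>2 - 2 * t * (cmod i)\<^sup>2" by simp
    also have "\<dots> = t * (cmod i)\<^sup>2 * (t * (L2_norm \<Omega> k)\<^sup>2 - 2)" by (simp add: algebra_simps power2_eq_square)
    finally have nn: "0 \<le> t * (cmod i)\<^sup>2 * (t * (L2_norm \<Omega> k)\<^sup>2 - 2)" .
    have pos: "t * (cmod i)\<^sup>2 > 0" using tpos nz by (simp add: i_def)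
    have "0 \<le> t * (L2_norm \<Omega> k)\<^sup>2 - 2"
    proof (rule ccontr)
      assume "\<not> 0 \<le> t * (L2_norm \<Omega> k)\<^sup>2 - 2"
      then have "t * (L2_norm \<Omega> k)\<^sup>2 - 2 < 0" by simp
      from mult_pos_neg[OF pos this] nn show False by linarith
    qed
    moreover have "t * (L2_norm \<Omega> k)\<^sup>2 \<le> 1" using add_nonneg_pos[OF zero_le_power2[of "L2_norm \<Omega> k"] zero_less_one]
      by (simp add: t_def divide_le_eq)
    ultimately show False by simp
  qed
  with h v(1) that[of h v] show thesis unfolding u_def by blast
qed

text \<open>Justifies the definite description. Two candidates differ by a Bergman function
  orthogonal to itself; it has norm 0 and so vanishes on \<Omega> by the point bound, and off
  \<Omega> both are 0.\<close>

lemma bergman_proj_spec: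
  assumes op: "open \<Omega>" and u: "u \<in> L2 \<Omega>"
  shows "bergman_proj \<Omega> u \<in> bergman_space \<Omega>"
    and "\<And>k. k \<in> bergman_space \<Omega> \<Longrightarrow> L2_inner \<Omega> (\<lambda>x. u x - bergman_proj \<Omega> u x) k = 0"
proof -
  let ?P = "\<lambda>h. h \<in> bergman_space \<Omega> \<and> (\<forall>x. x \<notin> \<Omega> \<longrightarrow> h x = 0) \<and>
        (\<forall>k\<in>bergman_space \<Omega>. L2_inner \<Omega> (\<lambda>x. u x - h x) k = 0)"
  have ne: "bergman_space \<Omega> \<noteq> {}" using bergman_zero by blast
  obtain h v where h: "h \<in> bergman_space \<Omega>" and "\<And>n::nat. v n \<in> bergman_space \<Omega>"
    "(\<lambda>n. L2_norm \<Omega> (\<lambda>x. v n x - h x)) \<longlonglongrightarrow> 0"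
    and horth: "\<And>k. k \<in> bergman_space \<Omega> \<Longrightarrow> L2_inner \<Omega> (\<lambda>x. u x - h x) k = 0"
    by (rule bergman_orthogonal_projection[OF op order_refl ne bergman_add bergman_cmult u]) (assumption+, rule that)
  \<comment> \<open>Resetting the values off \<Omega> affects neither the norm nor derivatives
    within \<Omega>, and meets the clause that fixes the representative.\<close>
  define h' where "h' = (\<lambda>x. if x \<in> \<Omega> then h x else 0)"
  have eq: "h' x = h x" if "x \<in> \<Omega>" for x using that by (simp add: h'_def)
  have "h' \<in> bergman_space \<Omega>"
  proof -
    have "h' \<in> L2 \<Omega>" using L2_cong[of \<Omega> h' h] eq bergman_L2[OF h] by blast
    moreover have "holomorphic_C2 h' \<Omega>"
      unfolding holomorphic_C2_def
    proof
      fix p assume p: "p \<in> \<Omega>"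
      then obtain a b where "(h has_derivative (\<lambda>(h, k). a * h + b * k)) (at p within \<Omega>)"
        using bergman_holomorphic[OF h] unfolding holomorphic_C2_def by meson
      then have "(h' has_derivative (\<lambda>(h, k). a * h + b * k)) (at p within \<Omega>)"
        by - (rule has_derivative_transform[OF p eq])
      then show "\<exists>a b. (h' has_derivative (\<lambda>(h, k). a * h + b * k)) (at p within \<Omega>)" by blast
    qed
    ultimately show ?thesis by (simp add: bergman_space_def)
  qed
  moreover have "L2_inner \<Omega> (\<lambda>x. u x - h' x) k = 0" if "k \<in> bergman_space \<Omega>" for k
    using horth[OF that] L2_inner_cong[of \<Omega> "\<lambda>x. u x - h' x" "\<lambda>x. u x - h x" k k] eq by simp
  ultimately have ex: "?P h'" by (auto simp: h'_def)
  have uniq: "h1 = h2" if "?P h1" "?P h2" for h1 h2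
  proof
    fix x
    show "h1 x = h2 x"
    proof (cases "x \<in> \<Omega>")
      case True
      let ?k = "\<lambda>x. h1 x - h2 x"
      have k: "?k \<in> bergman_space \<Omega>" using that bergman_diff by blast
      have L: "(\<lambda>x. u x - h1 x) \<in> L2 \<Omega>" "(\<lambda>x. u x - h2 x) \<in> L2 \<Omega>" "?k \<in> L2 \<Omega>"
        using that u bergman_L2 k by blast+
      have "L2_inner \<Omega> ?k ?k = L2_inner \<Omega> (\<lambda>x. (u x - h2 x) - (u x - h1 x)) ?k"
        by (rule L2_inner_cong) auto
      also have "\<dots> = 0" using L2_inner_diff_left[OF L(2,1,3)] that k by simp
      finally have "L2_norm \<Omega> ?k = 0" by (simp add: L2_inner_self[OF L(3)])
      from bergman_norm_zero[OF op k this True] show ?thesis by simp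
    next
      case False
      then show ?thesis using that by metis
    qed
  qed
  have "\<exists>!h. ?P h" by (rule ex1I[of ?P, OF ex]) (rule uniq[OF _ ex])
  from theI'[OF this] have "?P (bergman_proj \<Omega> u)" unfolding bergman_proj_def .
  then show "bergman_proj \<Omega> u \<in> bergman_space \<Omega>"
    "\<And>k. k \<in> bergman_space \<Omega> \<Longrightarrow> L2_inner \<Omega> (\<lambda>x. u x - bergman_proj \<Omega> u x) k = 0" by blast+
qed

section \<open>Compactness of Hankel operators\<close>

lemma hankel_L2:
  assumes "open \<Omega>" "(\<lambda>x. \<phi> x * f x) \<in> L2 \<Omega>"
  shows "hankel \<Omega> \<phi> f \<in> L2 \<Omega>"
  unfolding hankel_def by (rule L2_diff[OF assms(2) bergman_L2[OF bergman_proj_spec(1)[OF assms]]])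

lemma hankel_orthogonal:
  assumes "open \<Omega>" "(\<lambda>x. \<phi> x * f x) \<in> L2 \<Omega>" "k \<in> bergman_space \<Omega>"
  shows "L2_inner \<Omega> (hankel \<Omega> \<phi> f) k = 0"
  using bergman_proj_spec(2)[OF assms] by (simp add: hankel_def)

text \<open>The difference of Hankel images is orthogonal to the Bergman space, so among all
  \<open>\<phi>\<close> f - g with g holomorphic it is the shortest. Estimating it thus requires
  only one good g, never the projection itself.\<close>

lemma hankel_diff_le:
  assumes op: "open \<Omega>" and f1: "(\<lambda>x. \<phi> x * f1 x) \<in> L2 \<Omega>" and f2: "(\<lambda>x. \<phi> x * f2 x) \<in> L2 \<Omega>"
    and g: "g \<in> bergman_space \<Omega>"
  shows "L2_norm \<Omega> (\<lambda>x. hankel \<Omega> \<phi> f1 x - hankel \<Omega> \<phi> f2 x) \<le> L2_norm \<Omega> (\<lambda>x. \<phi> x * (f1 x - f2 x) - g x)"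
proof (rule power2_le_imp_le)
  let ?h = "\<lambda>x. hankel \<Omega> \<phi> f1 x - hankel \<Omega> \<phi> f2 x"
  define k where "k = (\<lambda>x. bergman_proj \<Omega> (\<lambda>y. \<phi> y * f1 y) x - bergman_proj \<Omega> (\<lambda>y. \<phi> y * f2 y) x - g x)"
  have k: "k \<in> bergman_space \<Omega>"
    unfolding k_def by (intro bergman_diff bergman_proj_spec op f1 f2 g)
  have h: "?h \<in> L2 \<Omega>" by (rule L2_diff[OF hankel_L2[OF op f1] hankel_L2[OF op f2]])
  have "L2_inner \<Omega> ?h k = 0"
    using L2_inner_diff_left[OF hankel_L2[OF op f1] hankel_L2[OF op f2] bergman_L2[OF k]]
      hankel_orthogonal[OF op f1 k] hankel_orthogonal[OF op f2 k] by simp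
  from L2_pythagoras[OF h bergman_L2[OF k] this]
  have "(L2_norm \<Omega> ?h)\<^sup>2 \<le> (L2_norm \<Omega> (\<lambda>x. ?h x + k x))\<^sup>2" by simp
  also have "L2_norm \<Omega> (\<lambda>x. ?h x + k x) = L2_norm \<Omega> (\<lambda>x. \<phi> x * (f1 x - f2 x) - g x)"
    by (rule L2_norm_cong) (simp add: hankel_def k_def algebra_simps)
  finally show "(L2_norm \<Omega> ?h)\<^sup>2 \<le> (L2_norm \<Omega> (\<lambda>x. \<phi> x * (f1 x - f2 x) - g x))\<^sup>2" .
qed simp

text \<open>Along a subsequence the images H n tend to some g. The squared norm of H n equals the
  inner product of H n with u n = \<open>\<phi>\<close> F n, because H n is orthogonal to the
  projected part. Replacing H n by g costs little, and u n is bounded and tends to 0 pointwise,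
  hence weakly. The functions G n are the projections.\<close>

lemma compact_hankel_weakly_null:
  fixes F :: "nat \<Rightarrow> C2 \<Rightarrow> complex"
  assumes op: "open \<Omega>" and fin: "finite_measure (lebesgue_on \<Omega>)"
    and \<phi>: "\<phi> \<in> borel_measurable (lebesgue_on \<Omega>)" "\<And>x. x \<in> \<Omega> \<Longrightarrow> cmod (\<phi> x) \<le> M"
    and compact: "compact_on_bergman \<Omega> (hankel \<Omega> \<phi>)"
    and F: "\<And>n. F n \<in> bergman_space \<Omega>" and B: "\<And>n. L2_norm \<Omega> (F n) \<le> B"
    and lim: "\<And>x. x \<in> \<Omega> \<Longrightarrow> (\<lambda>n. F n x) \<longlonglongrightarrow> 0"
  obtains r G where "strict_mono (r :: nat \<Rightarrow> nat)" "\<And>n. G n \<in> bergman_space \<Omega>"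
    "(\<lambda>n. L2_norm \<Omega> (\<lambda>x. \<phi> x * F (r n) x - G n x)) \<longlonglongrightarrow> 0"
proof -
  obtain r g where r: "strict_mono r" and g: "g \<in> L2 \<Omega>"
    and conv: "(\<lambda>n. L2_norm \<Omega> (\<lambda>x. hankel \<Omega> \<phi> (F (r n)) x - g x)) \<longlonglongrightarrow> 0"
  proof -
    have "(\<forall>n. F n \<in> bergman_space \<Omega>) \<and> (\<exists>B. \<forall>n. L2_norm \<Omega> (F n) \<le> B)" using F B by blast
    from compact[unfolded compact_on_bergman_def, THEN spec, THEN mp, OF this] that show thesis by blast
  qed
  define M' where "M' = max M 0"
  have \<phi>M: "cmod (\<phi> x) \<le> M'" if "x \<in> \<Omega>" for x using \<phi>(2)[OF that] by (simp add: M'_def)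
  have M'0: "0 \<le> M'" by (simp add: M'_def)
  define u where "u = (\<lambda>n x. \<phi> x * F (r n) x)"
  have u2: "u n \<in> L2 \<Omega>" for n
    unfolding u_def by (rule L2_mult_bounded[OF bergman_L2[OF F] \<phi>])
  have uB: "L2_norm \<Omega> (u n) \<le> M' * B" for n
    unfolding u_def by (rule order_trans[OF L2_norm_mult_bounded[OF bergman_L2[OF F] \<phi>M M'0] mult_left_mono[OF B M'0]])
  have u0: "(\<lambda>n. u n x) \<longlonglongrightarrow> 0" if "x \<in> \<Omega>" for x
    using tendsto_mult_right_zero[OF LIMSEQ_subseq_LIMSEQ[OF lim[OF that] r, unfolded o_def]] by (simp add: u_def)
  define G where "G = (\<lambda>n. bergman_proj \<Omega> (u n))"
  have G: "G n \<in> bergman_space \<Omega>" for n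
    unfolding G_def by (rule bergman_proj_spec[OF op u2])
  let ?H = "\<lambda>n. hankel \<Omega> \<phi> (F (r n))"
  have H: "?H n = (\<lambda>x. u n x - G n x)" for n by (simp add: hankel_def u_def G_def)
  have H2: "?H n \<in> L2 \<Omega>" for n unfolding H by (rule L2_diff[OF u2 bergman_L2[OF G]])
  have HG: "L2_inner \<Omega> (?H n) (G n) = 0" for n
    by (rule hankel_orthogonal[OF op _ G]) (use u2 in \<open>simp add: u_def\<close>)
  have le: "(L2_norm \<Omega> (?H n))\<^sup>2 \<le> L2_norm \<Omega> (\<lambda>x. ?H n x - g x) * (M' * B) + cmod (L2_inner \<Omega> g (u n))" for n
  proof -
    have "complex_of_real ((L2_norm \<Omega> (?H n))\<^sup>2) = L2_inner \<Omega> (?H n) (?H n)"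
      by (rule L2_inner_self[OF H2, symmetric])
    also have "\<dots> = L2_inner \<Omega> (?H n) (\<lambda>x. u n x - G n x)" by (simp only: H)
    also have "\<dots> = L2_inner \<Omega> (?H n) (u n)"
      by (subst L2_inner_diff_right[OF u2 bergman_L2[OF G] H2]) (simp only: HG diff_zero)
    also have "\<dots> = L2_inner \<Omega> (\<lambda>x. ?H n x - g x) (u n) + L2_inner \<Omega> g (u n)"
      using L2_inner_diff_left[OF H2 g u2] by simp
    finally have "(L2_norm \<Omega> (?H n))\<^sup>2 = cmod (L2_inner \<Omega> (\<lambda>x. ?H n x - g x) (u n) + L2_inner \<Omega> g (u n))"
      by (metis L2_norm_nonneg norm_of_real abs_of_nonneg zero_le_power2)
    also have "\<dots> \<le> cmod (L2_inner \<Omega> (\<lambda>x. ?H n x - g x) (u n)) + cmod (L2_inner \<Omega> g (u n))"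
      by (rule norm_triangle_ineq)
    also have "cmod (L2_inner \<Omega> (\<lambda>x. ?H n x - g x) (u n)) \<le> L2_norm \<Omega> (\<lambda>x. ?H n x - g x) * L2_norm \<Omega> (u n)"
      by (rule L2_Cauchy_Schwarz[OF L2_diff[OF H2 g] u2])
    also have "\<dots> \<le> L2_norm \<Omega> (\<lambda>x. ?H n x - g x) * (M' * B)"
      by (rule mult_left_mono[OF uB]) simp
    finally show ?thesis by simp
  qed
  have "(\<lambda>n. L2_norm \<Omega> (\<lambda>x. ?H n x - g x) * (M' * B) + cmod (L2_inner \<Omega> g (u n))) \<longlonglongrightarrow> 0 * (M' * B) + cmod 0"
    by (intro tendsto_intros conv L2_weakly_null[OF u2 uB g u0 fin])
  then have upper: "(\<lambda>n. L2_norm \<Omega> (\<lambda>x. ?H n x - g x) * (M' * B) + cmod (L2_inner \<Omega> g (u n))) \<longlonglongrightarrow> 0"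
    by simp
  have "(\<lambda>n. (L2_norm \<Omega> (?H n))\<^sup>2) \<longlonglongrightarrow> 0"
    by (rule tendsto_sandwich[OF always_eventually always_eventually tendsto_const upper]) (auto intro: le)
  then have "(\<lambda>n. sqrt ((L2_norm \<Omega> (?H n))\<^sup>2)) \<longlonglongrightarrow> sqrt 0" by (rule tendsto_real_sqrt)
  then have "(\<lambda>n. L2_norm \<Omega> (\<lambda>x. \<phi> x * F (r n) x - G n x)) \<longlonglongrightarrow> 0"
    unfolding H by (simp add: u_def)
  with r G that show thesis by blast
qed

section \<open>A quantitative criterion for compactness\<close>

definition mono2 :: "nat \<times> nat \<Rightarrow> C2 \<Rightarrow> complex" where
  "mono2 s x = fst x ^ fst s * snd x ^ snd s"

text \<open>Compactness expressed as smallness up to finitely many linear functionals. The symbols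
  with this property form a vector space closed under uniform limits, which permits the reduction to
  single torus modes; no subsequences appear until the very end.\<close>

definition hankel_estimate :: "C2 set \<Rightarrow> (C2 \<Rightarrow> complex) \<Rightarrow> bool" where
  "hankel_estimate \<Omega> \<phi> \<longleftrightarrow> (\<forall>\<epsilon>>0. \<exists>C S. finite S \<and> 0 \<le> C \<and> (\<forall>f\<in>bergman_space \<Omega>. \<exists>g\<in>bergman_space \<Omega>.
     L2_norm \<Omega> (\<lambda>x. \<phi> x * f x - g x) \<le> \<epsilon> * L2_norm \<Omega> f + C * (\<Sum>s\<in>S. cmod (L2_inner \<Omega> f (mono2 s)))))"

text \<open>A diagonal subsequence makes every monomial coefficient converge. For a given precision
  only finitely many coefficients occur in the estimate, so it shows that the images form a Cauchy
  sequence.\<close>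

lemma hankel_estimate_compact:
  assumes op: "open \<Omega>" and fin: "finite_measure (lebesgue_on \<Omega>)"
    and \<phi>: "\<phi> \<in> borel_measurable (lebesgue_on \<Omega>)" "\<And>x. x \<in> \<Omega> \<Longrightarrow> cmod (\<phi> x) \<le> M"
    and mono: "\<And>s. mono2 s \<in> L2 \<Omega>" and est: "hankel_estimate \<Omega> \<phi>"
  shows "compact_on_bergman \<Omega> (hankel \<Omega> \<phi>)"
  unfolding compact_on_bergman_def
proof (intro allI impI, elim conjE exE)
  fix F :: "nat \<Rightarrow> C2 \<Rightarrow> complex" and B
  assume "\<forall>n. F n \<in> bergman_space \<Omega>" and "\<forall>n. L2_norm \<Omega> (F n) \<le> B"
  then have F: "\<And>n. F n \<in> bergman_space \<Omega>" and B: "\<And>n. L2_norm \<Omega> (F n) \<le> B" by auto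
  have B0: "0 \<le> B" using B[of 0] L2_norm_nonneg order_trans by blast
  \<comment> \<open>By the Cauchy-Schwarz inequality, dividing by \<open>w s\<close> brings all
    coefficients into the unit disc, the common bound required for the diagonal argument. The added
    1 prevents division by 0.\<close>
  define w where "w = (\<lambda>s. B * L2_norm \<Omega> (mono2 s) + 1)"
  have w: "w s > 0" for s using B0 by (simp add: w_def add_nonneg_pos)
  define c where "c = (\<lambda>n s. L2_inner \<Omega> (F n) (mono2 s) / of_real (w s))"
  have c1: "cmod (c n s) \<le> 1" for n s
  proof -
    have "cmod (L2_inner \<Omega> (F n) (mono2 s)) \<le> L2_norm \<Omega> (F n) * L2_norm \<Omega> (mono2 s)"
      by (rule L2_Cauchy_Schwarz[OF bergman_L2[OF F] mono])
    also have "\<dots> \<le> B * L2_norm \<Omega> (mono2 s)" by (rule mult_right_mono[OF B]) simp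
    finally have "cmod (L2_inner \<Omega> (F n) (mono2 s)) \<le> w s" by (simp add: w_def)
    then show ?thesis using w[of s] by (simp add: c_def norm_divide)
  qed
  obtain r where r: "strict_mono (r :: nat \<Rightarrow> nat)" and conv: "\<And>s. \<exists>l. (\<lambda>n. c (r n) s) \<longlonglongrightarrow> l"
    by (rule function_convergent_subsequence[of "UNIV :: (nat \<times> nat) set" c 1]) (use c1 in auto)
  define H where "H = (\<lambda>n. hankel \<Omega> \<phi> (F (r n)))"
  have \<phi>F: "(\<lambda>x. \<phi> x * F n x) \<in> L2 \<Omega>" for n
    by (rule L2_mult_bounded[OF bergman_L2[OF F] \<phi>])
  have H2: "H n \<in> L2 \<Omega>" for n unfolding H_def by (rule hankel_L2[OF op \<phi>F])
  have "\<exists>N. \<forall>m\<ge>N. \<forall>n\<ge>N. L2_norm \<Omega> (\<lambda>x. H m x - H n x) < e" if e: "e > 0" for e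
  proof -
    \<comment> \<open>A difference of two members of the sequence has norm at most 2B, so this share
      of the error is at most e/2.\<close>
    define \<epsilon> where "\<epsilon> = e / (4 * (B + 1))"
    have \<epsilon>: "\<epsilon> > 0" using e B0 by (simp add: \<epsilon>_def)
    obtain C S where S: "finite S" "0 \<le> C" and CS: "\<And>f. f \<in> bergman_space \<Omega> \<Longrightarrow> \<exists>g\<in>bergman_space \<Omega>.
       L2_norm \<Omega> (\<lambda>x. \<phi> x * f x - g x) \<le> \<epsilon> * L2_norm \<Omega> f + C * (\<Sum>s\<in>S. cmod (L2_inner \<Omega> f (mono2 s)))"
      using est \<epsilon> unfolding hankel_estimate_def by meson
    \<comment> \<open>Coefficient differences below d contribute at most e/4 after weighting by
      \<open>w\<close> and multiplication by C; the summand 4 keeps the denominator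
      positive.\<close>
    define d where "d = e / (4 * (C + 1) * (\<Sum>s\<in>S. w s) + 4)"
    have sw: "0 \<le> (\<Sum>s\<in>S. w s)" by (intro sum_nonneg) (use w less_imp_le in blast)
    have dpos: "4 * (C + 1) * (\<Sum>s\<in>S. w s) + 4 > 0" using S sw by (intro add_nonneg_pos) auto
    have d: "d > 0" using e dpos by (simp add: d_def)
    have "\<exists>N. \<forall>m\<ge>N. \<forall>n\<ge>N. cmod (c (r m) s - c (r n) s) < d" for s
    proof -
      obtain l where "(\<lambda>n. c (r n) s) \<longlonglongrightarrow> l" using conv by blast
      then have "Cauchy (\<lambda>n. c (r n) s)" by (rule LIMSEQ_imp_Cauchy)
      then show ?thesis using d unfolding Cauchy_def dist_norm by blast
    qed
    then obtain N where N: "\<And>s m n. m \<ge> N s \<Longrightarrow> n \<ge> N s \<Longrightarrow> cmod (c (r m) s - c (r n) s) < d" by metis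
    define N' where "N' = Max (insert 0 (N ` S))"
    have N': "N s \<le> N'" if "s \<in> S" for s unfolding N'_def using S that by (intro Max_ge) auto
    have "L2_norm \<Omega> (\<lambda>x. H m x - H n x) < e" if "m \<ge> N'" "n \<ge> N'" for m n
    proof -
      let ?f = "\<lambda>x. F (r m) x - F (r n) x"
      have f: "?f \<in> bergman_space \<Omega>" by (intro bergman_diff F)
      obtain g where g: "g \<in> bergman_space \<Omega>"
        "L2_norm \<Omega> (\<lambda>x. \<phi> x * ?f x - g x) \<le> \<epsilon> * L2_norm \<Omega> ?f + C * (\<Sum>s\<in>S. cmod (L2_inner \<Omega> ?f (mono2 s)))"
        using CS[OF f] by blast
      have "L2_norm \<Omega> (\<lambda>x. H m x - H n x) \<le> L2_norm \<Omega> (\<lambda>x. \<phi> x * ?f x - g x)"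
        unfolding H_def by (rule hankel_diff_le[OF op \<phi>F \<phi>F g(1)])
      also note g(2)
      also have "\<epsilon> * L2_norm \<Omega> ?f \<le> \<epsilon> * (2 * B)"
      proof (rule mult_left_mono)
        have "L2_norm \<Omega> ?f \<le> L2_norm \<Omega> (F (r m)) + L2_norm \<Omega> (\<lambda>x. (-1) * F (r n) x)"
          using L2_triangle[OF bergman_L2[OF F] L2_cmult[OF bergman_L2[OF F]], of "r m" "-1" "r n"] by simp
        also have "L2_norm \<Omega> (\<lambda>x. (-1) * F (r n) x) = L2_norm \<Omega> (F (r n))" by (subst L2_norm_cmult) simp
        finally show "L2_norm \<Omega> ?f \<le> 2 * B" using B[of "r m"] B[of "r n"] by simp
      qed (use \<epsilon> in simp)
      also have "\<epsilon> * (2 * B) \<le> e / 2"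
        using e B0 by (simp add: \<epsilon>_def field_simps)
      also have "C * (\<Sum>s\<in>S. cmod (L2_inner \<Omega> ?f (mono2 s))) \<le> C * (\<Sum>s\<in>S. d * w s)"
      proof (intro mult_left_mono sum_mono S)
        fix s assume s: "s \<in> S"
        have "L2_inner \<Omega> ?f (mono2 s) = of_real (w s) * (c (r m) s - c (r n) s)"
          using L2_inner_diff_left[OF bergman_L2[OF F] bergman_L2[OF F] mono, of "r m" "r n" s] w[of s]
          by (simp only: c_def diff_divide_distrib[symmetric]) simp
        then have "cmod (L2_inner \<Omega> ?f (mono2 s)) = w s * cmod (c (r m) s - c (r n) s)"
          using w[of s] by (simp add: norm_mult)
        also have "\<dots> \<le> w s * d"
          using N[of s m n] N'[OF s] that w[of s] by (intro mult_left_mono) auto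
        finally show "cmod (L2_inner \<Omega> ?f (mono2 s)) \<le> d * w s" by (simp add: mult.commute)
      qed
      also have "C * (\<Sum>s\<in>S. d * w s) \<le> e / 4"
      proof -
        have "C * (\<Sum>s\<in>S. d * w s) = C * (\<Sum>s\<in>S. w s) * d" by (simp add: sum_distrib_left[symmetric] mult_ac)
        also have "\<dots> \<le> (e / 4)"
        proof -
          have "4 * (C * (\<Sum>s\<in>S. w s)) \<le> 4 * (C + 1) * (\<Sum>s\<in>S. w s) + 4"
            using sw by (simp add: algebra_simps)
          then have "4 * (C * (\<Sum>s\<in>S. w s)) * d \<le> (4 * (C + 1) * (\<Sum>s\<in>S. w s) + 4) * d"
            using d by (intro mult_right_mono) auto
          also have "\<dots> = e" using dpos by (simp add: d_def)
          finally show ?thesis by simp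
        qed
        finally show ?thesis .
      qed
      finally show ?thesis using e by simp
    qed
    then show ?thesis by blast
  qed
  from L2_Cauchy_subseq[of \<Omega> H, OF fin H2 this]
  obtain r2 h where "strict_mono r2" "h \<in> L2 \<Omega>" "(\<lambda>n. L2_norm \<Omega> (\<lambda>x. H (r2 n) x - h x)) \<longlonglongrightarrow> 0" by blast
  then show "\<exists>r g. strict_mono r \<and> g \<in> L2 \<Omega> \<and>
           (\<lambda>n. L2_norm \<Omega> (\<lambda>x. hankel \<Omega> \<phi> (F (r n)) x - g x)) \<longlonglongrightarrow> 0"
    using r by (intro exI[of _ "r \<circ> r2"] exI[of _ h]) (auto simp: H_def strict_mono_o)
qed

lemma hankel_estimate_zero: "hankel_estimate \<Omega> (\<lambda>x. 0)"
  unfolding hankel_estimate_def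
  by (intro allI impI exI[of _ 0] exI[of _ "{}"]) (auto intro!: bexI[OF _ bergman_zero] simp: L2_norm_def)

lemma hankel_estimate_cmult:
  assumes "hankel_estimate \<Omega> \<phi>"
  shows "hankel_estimate \<Omega> (\<lambda>x. c * \<phi> x)"
  unfolding hankel_estimate_def
proof (intro allI impI)
  fix \<epsilon> :: real assume \<epsilon>: "\<epsilon> > 0"
  define \<delta> where "\<delta> = \<epsilon> / (cmod c + 1)"
  have \<delta>: "\<delta> > 0" using \<epsilon> by (simp add: \<delta>_def add_nonneg_pos)
  obtain C S where S: "finite S" "0 \<le> C" and CS: "\<And>f. f \<in> bergman_space \<Omega> \<Longrightarrow> \<exists>g\<in>bergman_space \<Omega>.
       L2_norm \<Omega> (\<lambda>x. \<phi> x * f x - g x) \<le> \<delta> * L2_norm \<Omega> f + C * (\<Sum>s\<in>S. cmod (L2_inner \<Omega> f (mono2 s)))"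
    using assms \<delta> unfolding hankel_estimate_def by meson
  have "\<exists>g\<in>bergman_space \<Omega>. L2_norm \<Omega> (\<lambda>x. c * \<phi> x * f x - g x) \<le> \<epsilon> * L2_norm \<Omega> f
      + (cmod c * C) * (\<Sum>s\<in>S. cmod (L2_inner \<Omega> f (mono2 s)))" if f: "f \<in> bergman_space \<Omega>" for f
  proof -
    obtain g where g: "g \<in> bergman_space \<Omega>"
      "L2_norm \<Omega> (\<lambda>x. \<phi> x * f x - g x) \<le> \<delta> * L2_norm \<Omega> f + C * (\<Sum>s\<in>S. cmod (L2_inner \<Omega> f (mono2 s)))"
      using CS[OF f] by blast
    have "L2_norm \<Omega> (\<lambda>x. c * \<phi> x * f x - c * g x) = L2_norm \<Omega> (\<lambda>x. c * (\<phi> x * f x - g x))"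
      by (simp add: algebra_simps)
    also have "\<dots> = cmod c * L2_norm \<Omega> (\<lambda>x. \<phi> x * f x - g x)" by (rule L2_norm_cmult)
    also have "\<dots> \<le> cmod c * (\<delta> * L2_norm \<Omega> f + C * (\<Sum>s\<in>S. cmod (L2_inner \<Omega> f (mono2 s))))"
      by (rule mult_left_mono[OF g(2)]) simp
    also have "\<dots> = (cmod c * \<delta>) * L2_norm \<Omega> f + (cmod c * C) * (\<Sum>s\<in>S. cmod (L2_inner \<Omega> f (mono2 s)))"
      by (simp add: algebra_simps)
    also have "(cmod c * \<delta>) * L2_norm \<Omega> f \<le> \<epsilon> * L2_norm \<Omega> f"
    proof (rule mult_right_mono)
      have "cmod c * \<delta> \<le> (cmod c + 1) * \<delta>" using \<delta> by (intro mult_right_mono) auto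
      also have "\<dots> = \<epsilon>" using norm_ge_zero[of c] by (simp add: \<delta>_def add_nonneg_eq_0_iff)
      finally show "cmod c * \<delta> \<le> \<epsilon>" .
    qed simp
    finally show ?thesis using bergman_cmult[OF g(1), of c] by (intro bexI[of _ "\<lambda>x. c * g x"]) auto
  qed
  then show "\<exists>C S. finite S \<and> 0 \<le> C \<and> (\<forall>f\<in>bergman_space \<Omega>. \<exists>g\<in>bergman_space \<Omega>.
     L2_norm \<Omega> (\<lambda>x. c * \<phi> x * f x - g x) \<le> \<epsilon> * L2_norm \<Omega> f + C * (\<Sum>s\<in>S. cmod (L2_inner \<Omega> f (mono2 s))))"
    using S by (intro exI[of _ "cmod c * C"] exI[of _ S]) auto
qed

lemma hankel_estimate_add:
  assumes "hankel_estimate \<Omega> \<phi>" "hankel_estimate \<Omega> \<psi>"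
    and \<phi>: "\<phi> \<in> borel_measurable (lebesgue_on \<Omega>)" "\<And>x. x \<in> \<Omega> \<Longrightarrow> cmod (\<phi> x) \<le> M"
    and \<psi>: "\<psi> \<in> borel_measurable (lebesgue_on \<Omega>)" "\<And>x. x \<in> \<Omega> \<Longrightarrow> cmod (\<psi> x) \<le> N"
    and mono: "\<And>s. mono2 s \<in> L2 \<Omega>"
  shows "hankel_estimate \<Omega> (\<lambda>x. \<phi> x + \<psi> x)"
  unfolding hankel_estimate_def
proof (intro allI impI)
  fix \<epsilon> :: real assume "\<epsilon> > 0"
  then have \<delta>: "\<epsilon> / 2 > 0" by simp
  let ?I = "\<lambda>f s. cmod (L2_inner \<Omega> f (mono2 s))"
  obtain C S where S: "finite S" "0 \<le> C" and CS: "\<And>f. f \<in> bergman_space \<Omega> \<Longrightarrow> \<exists>g\<in>bergman_space \<Omega>.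
       L2_norm \<Omega> (\<lambda>x. \<phi> x * f x - g x) \<le> \<epsilon> / 2 * L2_norm \<Omega> f + C * (\<Sum>s\<in>S. ?I f s)"
    using assms(1) \<delta> unfolding hankel_estimate_def by meson
  obtain D T where T: "finite T" "0 \<le> D" and DT: "\<And>f. f \<in> bergman_space \<Omega> \<Longrightarrow> \<exists>g\<in>bergman_space \<Omega>.
       L2_norm \<Omega> (\<lambda>x. \<psi> x * f x - g x) \<le> \<epsilon> / 2 * L2_norm \<Omega> f + D * (\<Sum>s\<in>T. ?I f s)"
    using assms(2) \<delta> unfolding hankel_estimate_def by meson
  have "\<exists>g\<in>bergman_space \<Omega>. L2_norm \<Omega> (\<lambda>x. (\<phi> x + \<psi> x) * f x - g x) \<le> \<epsilon> * L2_norm \<Omega> f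
      + (C + D) * (\<Sum>s\<in>S \<union> T. ?I f s)" if f: "f \<in> bergman_space \<Omega>" for f
  proof -
    obtain g where g: "g \<in> bergman_space \<Omega>"
      "L2_norm \<Omega> (\<lambda>x. \<phi> x * f x - g x) \<le> \<epsilon> / 2 * L2_norm \<Omega> f + C * (\<Sum>s\<in>S. ?I f s)"
      using CS[OF f] by blast
    obtain h where h: "h \<in> bergman_space \<Omega>"
      "L2_norm \<Omega> (\<lambda>x. \<psi> x * f x - h x) \<le> \<epsilon> / 2 * L2_norm \<Omega> f + D * (\<Sum>s\<in>T. ?I f s)"
      using DT[OF f] by blast
    have l: "(\<lambda>x. \<phi> x * f x - g x) \<in> L2 \<Omega>" "(\<lambda>x. \<psi> x * f x - h x) \<in> L2 \<Omega>"
      using L2_diff[OF L2_mult_bounded[OF bergman_L2[OF f] \<phi>] bergman_L2[OF g(1)]]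
        L2_diff[OF L2_mult_bounded[OF bergman_L2[OF f] \<psi>] bergman_L2[OF h(1)]] by simp_all
    have "L2_norm \<Omega> (\<lambda>x. (\<phi> x + \<psi> x) * f x - (g x + h x)) \<le> L2_norm \<Omega> (\<lambda>x. \<phi> x * f x - g x) + L2_norm \<Omega> (\<lambda>x. \<psi> x * f x - h x)"
      using L2_triangle[OF l] by (simp add: algebra_simps)
    also have "\<dots> \<le> \<epsilon> * L2_norm \<Omega> f + (C * (\<Sum>s\<in>S. ?I f s) + D * (\<Sum>s\<in>T. ?I f s))"
      using g(2) h(2) by simp
    also have "C * (\<Sum>s\<in>S. ?I f s) + D * (\<Sum>s\<in>T. ?I f s) \<le> C * (\<Sum>s\<in>S \<union> T. ?I f s) + D * (\<Sum>s\<in>S \<union> T. ?I f s)"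
      by (intro add_mono mult_left_mono sum_mono2) (use S T in auto)
    finally show ?thesis using bergman_add[OF g(1) h(1)]
      by (intro bexI[of _ "\<lambda>x. g x + h x"]) (auto simp: algebra_simps)
  qed
  then show "\<exists>C S. finite S \<and> 0 \<le> C \<and> (\<forall>f\<in>bergman_space \<Omega>. \<exists>g\<in>bergman_space \<Omega>.
     L2_norm \<Omega> (\<lambda>x. (\<phi> x + \<psi> x) * f x - g x) \<le> \<epsilon> * L2_norm \<Omega> f + C * (\<Sum>s\<in>S. ?I f s))"
    using S T by (intro exI[of _ "C + D"] exI[of _ "S \<union> T"]) auto
qed

text \<open>Replacing \<open>\<phi>\<close> by a uniformly close \<open>\<psi>\<close> changes the
  product with f by at most a small multiple of the norm of f, which is the first term of the
  estimate.\<close>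

lemma hankel_estimate_uniform_limit:
  assumes \<phi>: "\<phi> \<in> borel_measurable (lebesgue_on \<Omega>)" "\<And>x. x \<in> \<Omega> \<Longrightarrow> cmod (\<phi> x) \<le> M"
    and approx: "\<And>e. e > 0 \<Longrightarrow> \<exists>\<psi> N. hankel_estimate \<Omega> \<psi> \<and> \<psi> \<in> borel_measurable (lebesgue_on \<Omega>) \<and>
       (\<forall>x\<in>\<Omega>. cmod (\<psi> x) \<le> N) \<and> (\<forall>x\<in>\<Omega>. cmod (\<phi> x - \<psi> x) \<le> e)"
  shows "hankel_estimate \<Omega> \<phi>"
  unfolding hankel_estimate_def
proof (intro allI impI)
  fix \<epsilon> :: real assume "\<epsilon> > 0"
  then have \<delta>: "\<epsilon> / 2 > 0" by simp
  let ?I = "\<lambda>f s. cmod (L2_inner \<Omega> f (mono2 s))"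
  obtain \<psi> N where \<psi>: "hankel_estimate \<Omega> \<psi>" "\<psi> \<in> borel_measurable (lebesgue_on \<Omega>)"
    "\<And>x. x \<in> \<Omega> \<Longrightarrow> cmod (\<psi> x) \<le> N" "\<And>x. x \<in> \<Omega> \<Longrightarrow> cmod (\<phi> x - \<psi> x) \<le> \<epsilon> / 2"
    using approx[OF \<delta>] by blast
  obtain C S where S: "finite S" "0 \<le> C" and CS: "\<And>f. f \<in> bergman_space \<Omega> \<Longrightarrow> \<exists>g\<in>bergman_space \<Omega>.
       L2_norm \<Omega> (\<lambda>x. \<psi> x * f x - g x) \<le> \<epsilon> / 2 * L2_norm \<Omega> f + C * (\<Sum>s\<in>S. ?I f s)"
    using \<psi>(1) \<delta> unfolding hankel_estimate_def by meson
  have "\<exists>g\<in>bergman_space \<Omega>. L2_norm \<Omega> (\<lambda>x. \<phi> x * f x - g x) \<le> \<epsilon> * L2_norm \<Omega> f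
      + C * (\<Sum>s\<in>S. ?I f s)" if f: "f \<in> bergman_space \<Omega>" for f
  proof -
    obtain g where g: "g \<in> bergman_space \<Omega>"
      "L2_norm \<Omega> (\<lambda>x. \<psi> x * f x - g x) \<le> \<epsilon> / 2 * L2_norm \<Omega> f + C * (\<Sum>s\<in>S. ?I f s)"
      using CS[OF f] by blast
    have "(\<lambda>x. \<phi> x * f x) \<in> L2 \<Omega>" "(\<lambda>x. \<psi> x * f x) \<in> L2 \<Omega>"
      using L2_mult_bounded[OF bergman_L2[OF f] \<phi>] L2_mult_bounded[OF bergman_L2[OF f] \<psi>(2,3)] by simp_all
    then have "L2_norm \<Omega> (\<lambda>x. \<phi> x * f x - g x) \<le> L2_norm \<Omega> (\<lambda>x. \<phi> x * f x - \<psi> x * f x) + L2_norm \<Omega> (\<lambda>x. \<psi> x * f x - g x)"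
      using L2_triangle_diff bergman_L2[OF g(1)] by blast
    also have "L2_norm \<Omega> (\<lambda>x. \<phi> x * f x - \<psi> x * f x) = L2_norm \<Omega> (\<lambda>x. (\<phi> x - \<psi> x) * f x)"
      by (simp add: algebra_simps)
    also have "\<dots> \<le> \<epsilon> / 2 * L2_norm \<Omega> f"
      by (rule L2_norm_mult_bounded[OF bergman_L2[OF f] \<psi>(4)]) (use \<delta> in auto)
    finally show ?thesis using g by (intro bexI[of _ g]) auto
  qed
  then show "\<exists>C S. finite S \<and> 0 \<le> C \<and> (\<forall>f\<in>bergman_space \<Omega>. \<exists>g\<in>bergman_space \<Omega>.
     L2_norm \<Omega> (\<lambda>x. \<phi> x * f x - g x) \<le> \<epsilon> * L2_norm \<Omega> f + C * (\<Sum>s\<in>S. ?I f s))"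
    using S by (intro exI[of _ C] exI[of _ S]) auto
qed

section \<open>Fejer summation and torus invariance\<close>

lemma circ_add: "circ (x + y) = circ x * circ y"
  by (simp add: circ_def cis_mult distrib_left)

lemma circ_plus_1: "circ (1 + x) = circ x"
  by (simp add: circ_add) (simp add: circ_def)

lemma unimodular_circ:
  assumes "cmod a = 1"
  obtains \<alpha> where "0 \<le> \<alpha>" "\<alpha> \<le> 1" "a = circ \<alpha>"
proof -
  have a: "a = cis (Arg2pi a)" using assms Arg2pi_eq[of a] by (simp add: cis_conv_exp mult.commute)
  show thesis
  proof (rule that[of "Arg2pi a / (2 * pi)"])
    show "0 \<le> Arg2pi a / (2 * pi)" using Arg2pi_ge_0[of a] by simp
    show "Arg2pi a / (2 * pi) \<le> 1" using Arg2pi_lt_2pi[of a] by simp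
    show "a = circ (Arg2pi a / (2 * pi))" using a by (simp add: circ_def)
  qed
qed

text \<open>Writing a = circ \<alpha>, rotation shifts the integrand by \<alpha>. The integrand has
  period 1, so the part of the shifted interval beyond 1 is moved back to the beginning.\<close>

lemma fourier_rotate:
  assumes g: "continuous_on (sphere 0 1) g" and a: "cmod a = 1"
  shows "fourier j (\<lambda>\<theta>. g (circ \<theta> * a)) = a powi j * fourier j (\<lambda>\<theta>. g (circ \<theta>))"
proof -
  obtain \<alpha> where \<alpha>: "0 \<le> \<alpha>" "\<alpha> \<le> 1" and a_eq: "a = circ \<alpha>"
    using unimodular_circ[OF a] .
  define h where "h = (\<lambda>\<theta>. circ \<theta> powi (- j) * g (circ \<theta>))"
  have h: "continuous_on S h" for S
    unfolding h_def by (intro continuous_intros continuous_on_compose2[OF g]) auto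
  have int: "h integrable_on {x..y}" for x y
    by (rule integrable_continuous_interval[OF h])
  have per: "h (1 + x) = h x" for x by (simp add: h_def circ_plus_1)
  have "fourier j (\<lambda>\<theta>. g (circ \<theta> * a)) = a powi j * integral {0..1} (h \<circ> ((+) \<alpha>))"
  proof -
    have "circ \<theta> powi (- j) * g (circ \<theta> * a) = a powi j * (h \<circ> ((+) \<alpha>)) \<theta>" for \<theta>
      by (simp add: h_def circ_add a_eq power_int_mult_distrib mult_ac power_int_minus)
    then have "fourier j (\<lambda>\<theta>. g (circ \<theta> * a)) = integral {0..1} (\<lambda>\<theta>. a powi j * (h \<circ> ((+) \<alpha>)) \<theta>)"
      unfolding fourier_def by simp
    then show ?thesis by (simp add: o_def)
  qed
  also have "integral {0..1} (h \<circ> ((+) \<alpha>)) = integral {\<alpha>..1 + \<alpha>} h"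
    using integral_shift_Icc_real[of 0 1 h \<alpha>] by simp
  also have "\<dots> = integral {\<alpha>..1} h + integral {1..1 + \<alpha>} h"
    by (rule Henstock_Kurzweil_Integration.integral_combine[symmetric]) (use \<alpha> int in auto)
  also have "integral {1..1 + \<alpha>} h = integral {0..\<alpha>} h"
  proof -
    have "integral {1..1 + \<alpha>} h = integral {0..\<alpha>} (h \<circ> ((+) 1))"
      using integral_shift_Icc_real[of 0 \<alpha> h 1] by (simp add: add.commute)
    also have "h \<circ> ((+) 1) = h" using per by (simp add: fun_eq_iff)
    finally show ?thesis .
  qed
  also have "integral {\<alpha>..1} h + integral {0..\<alpha>} h = integral {0..1} h"
    using Henstock_Kurzweil_Integration.integral_combine[OF \<alpha> int] by (simp add: add.commute)
  finally show ?thesis by (simp add: fourier_def h_def)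
qed

text \<open>On the unit circle |1 + c|^2 = (1 + c)^2 / c, so the N-th power is a trigonometric
  polynomial with binomial coefficients. For c = cis a it is cos(a/2)^(2N), the kernel of de la
  Vallee Poussin before normalisation.\<close>

lemma fejer_expansion:
  assumes "cmod c = 1"
  shows "complex_of_real ((cmod (1 + c))\<^sup>2 / 4) ^ N = (\<Sum>k\<le>2*N. of_nat ((2*N) choose k) / 4^N * c powi (int k - int N))"
proof -
  have c0: "c \<noteq> 0" using assms by auto
  have cc: "cnj c = inverse c"
  proof -
    have "c * cnj c = 1" using assms by (simp add: complex_norm_square[symmetric])
    then show ?thesis using c0 by (simp add: field_simps)
  qed
  have "complex_of_real ((cmod (1 + c))\<^sup>2 / 4) = (1 + c) * cnj (1 + c) / 4"
    by (simp add: complex_norm_square del: of_real_power)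
  also have "\<dots> = (c + 1)\<^sup>2 * inverse c / 4"
    using c0 by (simp add: cc field_simps power2_eq_square)
  finally have "complex_of_real ((cmod (1 + c))\<^sup>2 / 4) ^ N = (c + 1) ^ (2 * N) * c powi (- int N) / 4 ^ N"
    by (simp add: power_mult_distrib power_divide power_mult power_int_minus power_inverse)
  also have "(c + 1) ^ (2 * N) = (\<Sum>k\<le>2*N. of_nat ((2*N) choose k) * c ^ k)"
    using binomial_ring[of c 1 "2*N"] by simp
  also have "\<dots> * c powi (- int N) / 4 ^ N = (\<Sum>k\<le>2*N. of_nat ((2*N) choose k) / 4^N * c powi (int k - int N))"
    unfolding sum_distrib_right sum_divide_distrib
    by (intro sum.cong) (use c0 in \<open>auto simp: power_int_diff power_int_minus field_simps\<close>)
  finally show ?thesis .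
qed

text \<open>The frequencies and weights must not depend on x, hence the family \<Phi> with a common
  bound and a common modulus of continuity at 0. The mass b of the kernel is its central binomial
  coefficient, of size at least 1/(2N), whereas away from 0 the kernel is at most q^N; since N q^N
  tends to 0, the mass concentrates at 0.\<close>

lemma fejer_approximation:
  fixes \<Phi> :: "'a \<Rightarrow> real \<Rightarrow> complex"
  assumes cont: "\<And>x. x \<in> X \<Longrightarrow> continuous_on {0..1} (\<Phi> x)"
    and bound: "\<And>x \<theta>. x \<in> X \<Longrightarrow> \<theta> \<in> {0..1} \<Longrightarrow> cmod (\<Phi> x \<theta>) \<le> M"
    and equi: "\<And>e. e > 0 \<Longrightarrow> \<exists>d>0. \<forall>x\<in>X. \<forall>\<theta>\<in>{0..1}. cmod (circ \<theta> - 1) < d \<longrightarrow> cmod (\<Phi> x \<theta> - \<Phi> x 0) \<le> e"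
    and e: "e > 0"
  obtains J \<kappa> where "finite J" "\<And>x. x \<in> X \<Longrightarrow> cmod (\<Phi> x 0 - (\<Sum>j\<in>J. \<kappa> j * fourier j (\<Phi> x))) \<le> e"
proof -
  obtain d0 where d0: "d0 > 0" and near0: "\<And>x \<theta>. x \<in> X \<Longrightarrow> \<theta> \<in> {0..1} \<Longrightarrow> cmod (circ \<theta> - 1) < d0 \<Longrightarrow> cmod (\<Phi> x \<theta> - \<Phi> x 0) \<le> e / 2"
    using equi[of "e/2"] e by auto
  define d where "d = min d0 1"
  have d: "d > 0" "d \<le> 1" and near: "\<And>x \<theta>. x \<in> X \<Longrightarrow> \<theta> \<in> {0..1} \<Longrightarrow> cmod (circ \<theta> - 1) < d \<Longrightarrow> cmod (\<Phi> x \<theta> - \<Phi> x 0) \<le> e / 2"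
    using d0 near0 by (auto simp: d_def)
  define M' where "M' = \<bar>M\<bar>"
  \<comment> \<open>By the parallelogram law this is the largest value of |1 + c|^2 / 4 at distance
    at least d from 1. The bound d <= 1 makes it nonnegative.\<close>
  define q where "q = 1 - d\<^sup>2 / 4"
  have d2: "d\<^sup>2 \<le> 1" using d by (simp add: power_le_one)
  have q: "0 \<le> q" "q < 1" using d d2 by (auto simp: q_def)
  \<comment> \<open>N is chosen so that the far part 2 M' q^N is at most e/2 times the mass b; with
    b >= 1/(2N) this asks for 4 M' N q^N < e/2.\<close>
  have "(\<lambda>n. 4 * M' * (of_nat n * q ^ n)) \<longlonglongrightarrow> 4 * M' * 0"
    by (intro tendsto_mult tendsto_const powser_times_n_limit_0) (use q in auto)
  then have "\<forall>\<^sub>F n in sequentially. 4 * M' * (of_nat n * q ^ n) < e / 2"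
    by (rule order_tendstoD) (use e in auto)
  then obtain N where N: "N > 0" "4 * M' * (of_nat N * q ^ N) < e / 2"
    using eventually_conj[OF _ eventually_gt_at_top[of "0::nat"]] by (metis (mono_tags, lifting) eventually_sequentially order_refl)
  define K where "K = (\<lambda>\<theta>. ((cmod (1 + circ \<theta>))\<^sup>2 / 4) ^ N)"
  define b where "b = real ((2*N) choose N) / 4 ^ N"
  have K0: "0 \<le> K \<theta>" for \<theta> by (simp add: K_def)
  have Kcont: "continuous_on S K" for S unfolding K_def by (intro continuous_intros) auto
  have parallel: "(cmod (1 + circ \<theta>))\<^sup>2 / 4 = 1 - (cmod (circ \<theta> - 1))\<^sup>2 / 4" for \<theta>
  proof -
    have "(cmod (1 + circ \<theta>))\<^sup>2 + (cmod (circ \<theta> - 1))\<^sup>2 = 2 * (cmod (circ \<theta>))\<^sup>2 + 2"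
      unfolding cmod_power2 by (simp add: power2_eq_square algebra_simps)
    then show ?thesis by simp
  qed
  have Kfar: "K \<theta> \<le> q ^ N" if "\<not> cmod (circ \<theta> - 1) < d" for \<theta>
  proof -
    have "d\<^sup>2 \<le> (cmod (circ \<theta> - 1))\<^sup>2" using that d by (intro power_mono) auto
    then have "(cmod (1 + circ \<theta>))\<^sup>2 / 4 \<le> q" unfolding parallel q_def by simp
    then show ?thesis unfolding K_def by (intro power_mono) auto
  qed
  have Kexp: "complex_of_real (K \<theta>) = (\<Sum>k\<le>2*N. of_nat ((2*N) choose k) / 4^N * circ \<theta> powi (int k - int N))" for \<theta>
    unfolding K_def using fejer_expansion[of "circ \<theta>" N] by simp
  have int_K\<Phi>: "integral {0..1} (\<lambda>\<theta>. of_real (K \<theta>) * \<psi> \<theta>) = (\<Sum>k\<le>2*N. of_nat ((2*N) choose k) / 4^N * fourier (int N - int k) \<psi>)"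
    if \<psi>: "continuous_on {0..1} \<psi>" for \<psi>
  proof -
    have "integral {0..1} (\<lambda>\<theta>. of_real (K \<theta>) * \<psi> \<theta>) =
      integral {0..1} (\<lambda>\<theta>. \<Sum>k\<le>2*N. of_nat ((2*N) choose k) / 4^N * (circ \<theta> powi (- (int N - int k)) * \<psi> \<theta>))"
      unfolding Kexp by (simp add: sum_distrib_right mult.assoc)
    also have "\<dots> = (\<Sum>k\<le>2*N. integral {0..1} (\<lambda>\<theta>. of_nat ((2*N) choose k) / 4^N * (circ \<theta> powi (- (int N - int k)) * \<psi> \<theta>)))"
      by (rule integral_sum) (auto intro!: integrable_continuous_interval continuous_intros \<psi>)
    finally show ?thesis by (simp only: integral_mult_right fourier_def)
  qed
  have int_K: "integral {0..1} (\<lambda>\<theta>. complex_of_real (K \<theta>)) = of_real b"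
  proof -
    have "integral {0..1} (\<lambda>\<theta>. complex_of_real (K \<theta>)) =
      (\<Sum>k\<le>2*N. of_nat ((2*N) choose k) / 4^N * fourier (int N - int k) (\<lambda>\<theta>. 1))"
      using int_K\<Phi>[of "\<lambda>_. 1"] by simp
    also have "\<dots> = (\<Sum>k\<le>2*N. if k = N then of_nat ((2*N) choose k) / 4^N else 0)"
      using fourier_circ_powi[of _ 0] by (intro sum.cong) auto
    finally show ?thesis by (simp add: b_def)
  qed
  have int_K_real: "integral {0..1} K = b"
    using integral_linear[OF integrable_continuous_interval[OF Kcont] bounded_linear_of_real[where 'a=complex], of 0 1] int_K
    by (simp add: o_def)
  have b: "1 / (2 * real N) \<le> b"
  proof -
    have "4 ^ N / (2 * real N) / 4 ^ N \<le> real ((2*N) choose N) / 4 ^ N"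
      by (rule divide_right_mono[OF central_binomial_lower_bound[OF N(1)]]) simp
    then show ?thesis by (simp add: b_def)
  qed
  then have b0: "b > 0" using N(1) by (simp add: less_le_trans[of 0 "1 / (2 * real N)"])
  define \<kappa> where "\<kappa> = (\<lambda>j. complex_of_nat ((2*N) choose nat (int N - j)) / 4 ^ N / of_real b)"
  define J where "J = (\<lambda>k. int N - int k) ` {..2*N}"
  show thesis
  proof (rule that[of J \<kappa>])
    show "finite J" by (simp add: J_def)
    fix x assume x: "x \<in> X"
    note c = cont[OF x]
    have "(\<Sum>j\<in>J. \<kappa> j * fourier j (\<Phi> x)) = (\<Sum>k\<le>2*N. \<kappa> (int N - int k) * fourier (int N - int k) (\<Phi> x))"
      unfolding J_def by (subst sum.reindex) (auto simp: inj_on_def)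
    also have "\<dots> = integral {0..1} (\<lambda>\<theta>. of_real (K \<theta>) * \<Phi> x \<theta>) / of_real b"
      unfolding int_K\<Phi>[OF c] sum_divide_distrib by (intro sum.cong) (auto simp: \<kappa>_def)
    finally have eq: "(\<Sum>j\<in>J. \<kappa> j * fourier j (\<Phi> x)) = integral {0..1} (\<lambda>\<theta>. of_real (K \<theta>) * \<Phi> x \<theta>) / of_real b" .
    have "\<Phi> x 0 * of_real b = integral {0..1} (\<lambda>\<theta>. of_real (K \<theta>) * \<Phi> x 0)"
      by (simp add: int_K mult.commute)
    then have "\<Phi> x 0 * of_real b - integral {0..1} (\<lambda>\<theta>. of_real (K \<theta>) * \<Phi> x \<theta>) =
      integral {0..1} (\<lambda>\<theta>. of_real (K \<theta>) * \<Phi> x 0 - of_real (K \<theta>) * \<Phi> x \<theta>)"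
      by (simp only:) (rule integral_diff[symmetric]; intro integrable_continuous_interval continuous_intros Kcont c)
    moreover have "cmod (integral {0..1} (\<lambda>\<theta>. of_real (K \<theta>) * \<Phi> x 0 - of_real (K \<theta>) * \<Phi> x \<theta>))
        \<le> integral {0..1} (\<lambda>\<theta>. e / 2 * K \<theta> + 2 * M' * q ^ N)"
    proof (rule integral_norm_bound_integral)
      show "(\<lambda>\<theta>. of_real (K \<theta>) * \<Phi> x 0 - of_real (K \<theta>) * \<Phi> x \<theta>) integrable_on {0..1}"
        by (intro integrable_continuous_interval continuous_intros Kcont c)
      show "(\<lambda>\<theta>. e / 2 * K \<theta> + 2 * M' * q ^ N) integrable_on {0..1}"
        by (intro integrable_continuous_interval continuous_intros Kcont)
      fix \<theta> :: real assume \<theta>: "\<theta> \<in> {0..1}"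
      have n: "norm (of_real (K \<theta>) * \<Phi> x 0 - of_real (K \<theta>) * \<Phi> x \<theta>) = K \<theta> * cmod (\<Phi> x \<theta> - \<Phi> x 0)"
        using K0[of \<theta>] by (simp add: right_diff_distrib[symmetric] norm_mult norm_minus_commute)
      show "norm (of_real (K \<theta>) * \<Phi> x 0 - of_real (K \<theta>) * \<Phi> x \<theta>) \<le> e / 2 * K \<theta> + 2 * M' * q ^ N"
      proof (cases "cmod (circ \<theta> - 1) < d")
        case True
        have "K \<theta> * cmod (\<Phi> x \<theta> - \<Phi> x 0) \<le> K \<theta> * (e / 2)"
          using near[OF x \<theta> True] K0 by (intro mult_left_mono) auto
        moreover have "0 \<le> 2 * M' * q ^ N" using q by (simp add: M'_def)
        ultimately show ?thesis unfolding n by (simp only: mult.commute[of "e / 2"])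
      next
        case False
        have "cmod (\<Phi> x \<theta> - \<Phi> x 0) \<le> cmod (\<Phi> x \<theta>) + cmod (\<Phi> x 0)" by (rule norm_triangle_ineq4)
        also have "\<dots> \<le> 2 * M'" using bound[OF x \<theta>] bound[OF x, of 0] by (simp add: M'_def)
        finally have "K \<theta> * cmod (\<Phi> x \<theta> - \<Phi> x 0) \<le> q ^ N * (2 * M')"
          using Kfar[OF False] q by (intro mult_mono) auto
        moreover have "0 \<le> e / 2 * K \<theta>" using e K0[of \<theta>] by simp
        ultimately show ?thesis unfolding n by (simp add: mult.commute)
      qed
    qed
    moreover have "integral {0..1} (\<lambda>\<theta>. e / 2 * K \<theta> + 2 * M' * q ^ N) = e / 2 * b + 2 * M' * q ^ N"
      by (subst integral_add) (auto intro!: integrable_continuous_interval continuous_intros Kcont simp: int_K_real)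
    moreover have "2 * M' * q ^ N \<le> e / 2 * b"
    proof -
      have "4 * M' * (real N * q ^ N) * b \<le> e / 2 * b" using N(2) b0 by (intro mult_right_mono) auto
      moreover have "2 * M' * q ^ N * 1 \<le> 2 * M' * q ^ N * (2 * real N * b)"
      proof (rule mult_left_mono)
        show "1 \<le> 2 * real N * b" using b N(1) by (simp add: field_simps)
      qed (use q in \<open>simp add: M'_def\<close>)
      ultimately show ?thesis by (simp add: mult_ac)
    qed
    ultimately have "cmod (\<Phi> x 0 * of_real b - integral {0..1} (\<lambda>\<theta>. of_real (K \<theta>) * \<Phi> x \<theta>)) \<le> e * b"
      by simp
    moreover have "\<Phi> x 0 - (\<Sum>j\<in>J. \<kappa> j * fourier j (\<Phi> x)) =
       (\<Phi> x 0 * of_real b - integral {0..1} (\<lambda>\<theta>. of_real (K \<theta>) * \<Phi> x \<theta>)) / of_real b"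
      unfolding eq using b0 by (simp add: diff_divide_distrib)
    ultimately show "cmod (\<Phi> x 0 - (\<Sum>j\<in>J. \<kappa> j * fourier j (\<Phi> x))) \<le> e"
      using b0 by (simp add: norm_divide divide_le_eq)
  qed
qed

section \<open>Sets and measures under the torus action\<close>

definition torus_invariant :: "C2 set \<Rightarrow> bool" where
  "torus_invariant S \<longleftrightarrow> (\<forall>z w a b. (z, w) \<in> S \<longrightarrow> cmod a = 1 \<longrightarrow> cmod b = 1 \<longrightarrow> (a * z, b * w) \<in> S)"

lemma torus_invariantD: "torus_invariant S \<Longrightarrow> (z, w) \<in> S \<Longrightarrow> cmod a = 1 \<Longrightarrow> cmod b = 1 \<Longrightarrow> (a * z, b * w) \<in> S"
  unfolding torus_invariant_def by blast

lemma reinhardt_torus_invariant: "reinhardt \<Omega> \<Longrightarrow> torus_invariant \<Omega>"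
  unfolding reinhardt_def torus_invariant_def by (metis cis_Arg is_Arg_def Arg_def unimodular_circ circ_def)

lemma torus_invariant_closure:
  assumes "torus_invariant S" shows "torus_invariant (closure S)"
  unfolding torus_invariant_def
proof (intro allI impI)
  fix z w a b assume zw: "(z, w) \<in> closure S" and ab: "cmod a = 1" "cmod b = 1"
  have "(\<lambda>p. (a * fst p, b * snd p)) ` closure S \<subseteq> closure S"
  proof (rule image_closure_subset)
    show "continuous_on (closure S) (\<lambda>p. (a * fst p, b * snd p))" by (intro continuous_intros)
    show "(\<lambda>p. (a * fst p, b * snd p)) ` S \<subseteq> closure S"
      using torus_invariantD[OF assms _ ab] closure_subset by fastforce
  qed simp
  with zw show "(a * z, b * w) \<in> closure S" by force
qed

lemma unimodular_factor:
  obtains a where "cmod a = 1" "z = a * of_real (cmod z)"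
proof (cases "z = 0")
  case False
  then show thesis using that[of "z / of_real (cmod z)"] by (simp add: norm_divide)
qed (use that[of 1] in auto)

text \<open>Rotate z to the argument of z'. The rotated point and its negative both lie in S, and z'
  is on the segment between them.\<close>

lemma convex_torus_shrink_fst:
  assumes "convex S" "torus_invariant S" "(z, w) \<in> S" "cmod z' \<le> cmod z"
  shows "(z', w) \<in> S"
proof (cases "z = 0")
  case False
  obtain a where a: "cmod a = 1" "z' = a * of_real (cmod z')" by (rule unimodular_factor)
  obtain c where c: "cmod c = 1" "z = c * of_real (cmod z)" by (rule unimodular_factor)
  \<comment> \<open>Solves 2t - 1 = |z'| / |z|, the position of z' between the two opposite
    points.\<close>
  define t where "t = (1 + cmod z' / cmod z) / 2"
  have t: "0 \<le> t" "t \<le> 1" using False assms(4) by (auto simp: t_def field_simps)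
  have "cmod (a / c) = 1" "cmod (- (a / c)) = 1" using a c by (simp_all add: norm_divide)
  from torus_invariantD[OF assms(2,3) this(1), of 1] torus_invariantD[OF assms(2,3) this(2), of 1]
  have "(a / c * z, w) \<in> S" "(- (a / c) * z, w) \<in> S" by auto
  from convexD[OF assms(1) this, of t "1 - t"] t
  have "t *\<^sub>R (a / c * z, w) + (1 - t) *\<^sub>R (- (a / c) * z, w) \<in> S" by simp
  moreover have "t *\<^sub>R (a / c * z, w) + (1 - t) *\<^sub>R (- (a / c) * z, w) = (of_real (2 * t - 1) * (a / c * z), w)"
    by (simp add: scaleR_conv_of_real algebra_simps diff_divide_distrib)
  moreover have "of_real (2 * t - 1) * (a / c * z) = z'"
  proof -
    have "c \<noteq> 0" using c by auto
    then have "a / c * z = a * of_real (cmod z)" by (subst c(2)) simp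
    then have "of_real (2 * t - 1) * (a / c * z) = a * of_real ((2 * t - 1) * cmod z)" by simp
    also have "(2 * t - 1) * cmod z = cmod z'" using False by (simp add: t_def field_simps)
    finally show ?thesis using a(2) by simp
  qed
  ultimately show ?thesis by simp
qed (use assms in auto)

lemma convex_torus_shrink_snd:
  assumes "convex S" "torus_invariant S" "(z, w) \<in> S" "cmod w' \<le> cmod w"
  shows "(z, w') \<in> S"
proof -
  let ?T = "prod.swap ` S"
  have "(w', z) \<in> ?T"
  proof (rule convex_torus_shrink_fst[of ?T w])
    have "linear (prod.swap :: C2 \<Rightarrow> C2)" by (intro linearI) auto
    then show "convex ?T" by (rule convex_linear_image[OF _ assms(1)])
    show "torus_invariant ?T" unfolding torus_invariant_def
      using torus_invariantD[OF assms(2)] by force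
  qed (use assms in auto)
  then show ?thesis by auto
qed

lemma convex_torus_shrink:
  assumes "convex S" "torus_invariant S" "(z, w) \<in> S" "cmod z' \<le> cmod z" "cmod w' \<le> cmod w"
  shows "(z', w') \<in> S"
  using convex_torus_shrink_snd[OF assms(1,2) convex_torus_shrink_fst[OF assms(1-4)] assms(5)] .

text \<open>Each rotation preserves the integral, so by Fubini the average over all rotations does
  too. It is used to replace a function inside an integral by its torus mode.\<close>

lemma measure_preserving_average:
  fixes T :: "real \<Rightarrow> C2 \<Rightarrow> C2" and G :: "C2 \<Rightarrow> complex"
  assumes T [measurable]: "(\<lambda>(\<theta>, x). T \<theta> x) \<in> borel_measurable (borel \<Otimes>\<^sub>M borel)"
    and pres: "\<And>\<theta>. distr lborel borel (T \<theta>) = lborel"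
    and G: "integrable lborel G"
  shows "integrable lborel (\<lambda>x. LINT \<theta>|lborel. indicator {0..1} \<theta> *\<^sub>R G (T \<theta> x))"
    and "(LINT x|lborel. LINT \<theta>|lborel. indicator {0..1} \<theta> *\<^sub>R G (T \<theta> x)) = (LINT x|lborel. G x)"
proof -
  have [measurable]: "G \<in> borel_measurable borel" using borel_measurable_integrable[OF G] by simp
  have Tm [measurable]: "T \<theta> \<in> borel_measurable borel" for \<theta>
    using measurable_compose[OF measurable_Pair1' T, of \<theta>] by simp
  have int: "integrable lborel (\<lambda>x. G (T \<theta> x))" for \<theta>
    using integrable_distr[of "T \<theta>" lborel borel G] G pres[of \<theta>] by simp
  have eq: "(LINT x|lborel. G (T \<theta> x)) = (LINT x|lborel. G x)" for \<theta>
    using integral_distr[of "T \<theta>" lborel borel G] pres[of \<theta>] by simp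
  have eqn: "(LINT x|lborel. norm (G (T \<theta> x))) = (LINT x|lborel. norm (G x))" for \<theta>
    using integral_distr[of "T \<theta>" lborel borel "\<lambda>x. norm (G x)"] pres[of \<theta>] by simp
  have I: "integrable (lborel \<Otimes>\<^sub>M lborel) (\<lambda>(\<theta>, x). indicator {0..1} \<theta> *\<^sub>R G (T \<theta> x))"
  proof (rule lborel_pair.Fubini_integrable)
    show "(\<lambda>(\<theta>, x). indicator {0..1} \<theta> *\<^sub>R G (T \<theta> x)) \<in> borel_measurable (lborel \<Otimes>\<^sub>M lborel)"
      by measurable
    have N1: "(LINT x|lborel. norm (case (\<theta>, x) of (\<theta>, x) \<Rightarrow> indicator {0..1} \<theta> *\<^sub>R G (T \<theta> x))) =
      indicator {0..1} \<theta> *\<^sub>R (LINT x|lborel. norm (G x))" for \<theta> :: real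
      by (cases "\<theta> \<in> {0..1}") (simp_all add: eqn)
    have N2: "integrable lborel (\<lambda>\<theta>. indicator {0..1::real} \<theta> *\<^sub>R (LINT x|lborel. norm (G x)))"
      by simp
    show "integrable lborel (\<lambda>\<theta>. LINT x|lborel. norm (case (\<theta>, x) of (\<theta>, x) \<Rightarrow> indicator {0..1} \<theta> *\<^sub>R G (T \<theta> x)))"
      using N2 by (simp only: N1)
    show "AE \<theta> in lborel. integrable lborel (\<lambda>x. case (\<theta>, x) of (\<theta>, x) \<Rightarrow> indicator {0..1} \<theta> *\<^sub>R G (T \<theta> x))"
      using int by simp
  qed
  show "integrable lborel (\<lambda>x. LINT \<theta>|lborel. indicator {0..1} \<theta> *\<^sub>R G (T \<theta> x))"
    using lborel_pair.integrable_snd[OF I] by simp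
  have "(LINT x|lborel. LINT \<theta>|lborel. indicator {0..1} \<theta> *\<^sub>R G (T \<theta> x)) =
        (LINT \<theta>|lborel. LINT x|lborel. indicator {0..1} \<theta> *\<^sub>R G (T \<theta> x))"
    by (rule lborel_pair.Fubini_integral[OF I])
  also have "\<dots> = (LINT \<theta>|lborel. indicator {0..1::real} \<theta> *\<^sub>R (LINT x|lborel. G x))"
    by (simp add: eq)
  finally show "(LINT x|lborel. LINT \<theta>|lborel. indicator {0..1} \<theta> *\<^sub>R G (T \<theta> x)) = (LINT x|lborel. G x)"
    by simp
qed

lemma lborel_integral_interval:
  fixes \<psi> :: "real \<Rightarrow> complex"
  assumes "continuous_on {0..1} \<psi>"
  shows "(LINT \<theta>|lborel. indicator {0..1} \<theta> *\<^sub>R \<psi> \<theta>) = integral {0..1} \<psi>"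
  using set_borel_integral_eq_integral(2)[OF borel_integrable_atLeastAtMost', OF assms]
  by (simp add: set_lebesgue_integral_def)

text \<open>The approximating sums are built from the Fourier coefficients alone, so they all
  vanish, yet they come arbitrarily close to g 1. A family with a single member suffices
  here.\<close>

lemma fourier_unique:
  assumes g: "continuous_on (sphere 0 1) g" and zero: "\<And>j. fourier j (\<lambda>\<theta>. g (circ \<theta>)) = 0"
  shows "g 1 = 0"
proof -
  have bd: "bounded (g ` sphere 0 1)"
    by (rule compact_imp_bounded[OF compact_continuous_image[OF g]]) simp
  then obtain M where M: "\<And>x. x \<in> sphere 0 1 \<Longrightarrow> cmod (g x) \<le> M" unfolding bounded_iff by blast
  have c0: "circ 0 = 1" by (simp add: circ_def)
  have "cmod (g 1) \<le> e" if e: "e > 0" for e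
  proof -
    obtain J \<kappa> where "finite J" "\<And>x. x \<in> {()} \<Longrightarrow> cmod (g (circ 0) - (\<Sum>j\<in>J. \<kappa> j * fourier j (\<lambda>\<theta>. g (circ \<theta>)))) \<le> e"
    proof (rule fejer_approximation[of "{()}" "\<lambda>_ \<theta>. g (circ \<theta>)" M e])
      show "continuous_on {0..1} (\<lambda>\<theta>. g (circ \<theta>))"
        by (intro continuous_on_compose2[OF g] continuous_intros) auto
      fix e :: real assume "e > 0"
      then obtain d where "d > 0" "\<And>x. x \<in> sphere 0 1 \<Longrightarrow> dist x 1 < d \<Longrightarrow> dist (g x) (g 1) \<le> e"
        using g[unfolded continuous_on_iff, rule_format, of 1 e] less_imp_le by (metis dist_0_norm mem_sphere norm_one)
      then show "\<exists>d>0. \<forall>x\<in>{()}. \<forall>\<theta>\<in>{0..1}. cmod (circ \<theta> - 1) < d \<longrightarrow> cmod (g (circ \<theta>) - g (circ 0)) \<le> e"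
        by (intro exI[of _ d]) (auto simp: dist_norm c0)
    qed (use M e in auto)
    then show ?thesis using zero by (simp add: c0)
  qed
  then have "cmod (g 1) \<le> 0" by (rule field_le_epsilon[of _ 0, simplified]) auto
  then show ?thesis by simp
qed

text \<open>The weight space of the torus action for the character a^j b^k. Distinct weights give
  orthogonal functions.\<close>

definition torus_mode :: "int \<Rightarrow> int \<Rightarrow> C2 set \<Rightarrow> (C2 \<Rightarrow> complex) \<Rightarrow> bool" where
  "torus_mode j k S u \<longleftrightarrow> (\<forall>z w a b. (z, w) \<in> S \<longrightarrow> cmod a = 1 \<longrightarrow> cmod b = 1 \<longrightarrow>
     u (a * z, b * w) = a powi j * b powi k * u (z, w))"

lemma torus_modeD:
  "torus_mode j k S u \<Longrightarrow> (z, w) \<in> S \<Longrightarrow> cmod a = 1 \<Longrightarrow> cmod b = 1 \<Longrightarrow> u (a * z, b * w) = a powi j * b powi k * u (z, w)"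
  unfolding torus_mode_def by blast

lemma torus_mode_mono2: "torus_mode (int (fst s)) (int (snd s)) S (mono2 s)"
  unfolding torus_mode_def mono2_def by (simp add: power_mult_distrib)

lemma exists_unimodular_powi:
  assumes "d \<noteq> (0::int)" obtains a :: complex where "cmod a = 1" "a powi d \<noteq> 1"
proof (rule that[of "circ (1 / (2 * of_int d))"])
  have "circ (1 / (2 * of_int d)) powi d = cis pi" using assms by (simp add: circ_powi)
  then show "circ (1 / (2 * of_int d)) powi d \<noteq> 1" by simp
qed simp

section \<open>Modes and monomials on convex Reinhardt domains\<close>

locale convex_reinhardt =
  fixes \<Omega> :: "C2 set"
  assumes op: "open \<Omega>" and ne: "\<Omega> \<noteq> {}" and bd: "bounded \<Omega>" and cv: "convex \<Omega>" and rh: "reinhardt \<Omega>"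
begin

lemma tor: "torus_invariant \<Omega>" by (rule reinhardt_torus_invariant[OF rh])

lemma tor_closure: "torus_invariant (closure \<Omega>)" by (rule torus_invariant_closure[OF tor])

lemma cv_closure: "convex (closure \<Omega>)" by (rule convex_closure[OF cv])

lemma compact_cl: "compact (closure \<Omega>)" using bd by simp

lemma borel_\<Omega>: "\<Omega> \<in> sets borel" using op by simp

lemma fin: "finite_measure (lebesgue_on \<Omega>)"
  by (intro finite_measure_lebesgue_on lmeasurable_open bd op)

lemma zero_in: "(0, 0) \<in> \<Omega>"
proof -
  obtain z w where "(z, w) \<in> \<Omega>" using ne by auto
  then show ?thesis by (rule convex_torus_shrink[OF cv tor]) auto
qed

text \<open>A base point at which no monomial vanishes. It normalises homogeneous functions and
  shows that monomials have positive norm.\<close>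

lemma diag_in: obtains \<delta> :: real where "\<delta> > 0" "(of_real \<delta>, of_real \<delta>) \<in> \<Omega>"
proof -
  obtain R where "R > 0" "ball 0 R \<times> ball 0 R \<subseteq> \<Omega>" using open_C2_bidisc[OF op zero_in] .
  then show thesis using that[of "R / 2"] by (auto simp: subset_iff)
qed

lemma continuous_bounded_L2:
  assumes "continuous_on \<Omega> f" "\<And>x. x \<in> \<Omega> \<Longrightarrow> cmod (f x) \<le> M"
  shows "f \<in> L2 \<Omega>"
proof -
  interpret finite_measure "lebesgue_on \<Omega>" by (rule fin)
  have "(\<lambda>x. 1) \<in> L2 \<Omega>" by (simp add: L2_def)
  from L2_mult_bounded[OF this continuous_on_lebesgue_measurable[OF op assms(1)] assms(2)]
  show ?thesis by simp
qed

lemma continuous_cl_L2: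
  assumes "continuous_on (closure \<Omega>) f"
  shows "f \<in> L2 \<Omega>"
proof -
  have "bounded (f ` closure \<Omega>)"
    by (rule compact_imp_bounded[OF compact_continuous_image[OF assms compact_cl]])
  then obtain M where "\<And>x. x \<in> closure \<Omega> \<Longrightarrow> cmod (f x) \<le> M" unfolding bounded_iff by blast
  then show ?thesis
    by (intro continuous_bounded_L2[where M=M] continuous_on_subset[OF assms closure_subset])
       (use closure_subset in blast)
qed

lemma continuous_mono2: "continuous_on S (mono2 s)"
  unfolding mono2_def by (intro continuous_intros)

lemma mono2_bergman: "mono2 s \<in> bergman_space \<Omega>"
proof -
  have "holomorphic_C2 (mono2 s) \<Omega>" unfolding mono2_def
    by (intro holomorphic_C2_mult holomorphic_C2_power holomorphic_C2_fst holomorphic_C2_snd)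
  then show ?thesis using continuous_cl_L2[OF continuous_mono2] by (simp add: bergman_space_def)
qed

lemma mono2_L2: "mono2 s \<in> L2 \<Omega>" by (rule bergman_L2[OF mono2_bergman])

lemma torus_in_iff:
  assumes "cmod a = 1" "cmod b = 1" shows "(a * z, b * w) \<in> \<Omega> \<longleftrightarrow> (z, w) \<in> \<Omega>"
proof
  assume "(a * z, b * w) \<in> \<Omega>"
  moreover have "a \<noteq> 0" "b \<noteq> 0" using assms by auto
  ultimately show "(z, w) \<in> \<Omega>"
    using torus_invariantD[OF tor, of "a * z" "b * w" "inverse a" "inverse b"] assms
    by (simp add: norm_inverse mult.assoc[symmetric])
qed (use torus_invariantD[OF tor _ assms] in blast)

lemma integral_torus:
  fixes f :: "C2 \<Rightarrow> complex"
  assumes f: "continuous_on \<Omega> f" and ab: "cmod a = 1" "cmod b = 1"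
  shows "(LINT x|lebesgue_on \<Omega>. f (a * fst x, b * snd x)) = (LINT x|lebesgue_on \<Omega>. f x)"
proof -
  let ?T = "\<lambda>x :: C2. (a * fst x, b * snd x)"
  let ?F = "\<lambda>x. indicator \<Omega> x *\<^sub>R f x"
  have F: "?F \<in> borel_measurable borel" by (rule indicator_continuous_borel[OF f borel_\<Omega>])
  have T: "?T \<in> borel_measurable borel" by (intro borel_measurable_continuous_onI continuous_intros)
  have ind: "indicator \<Omega> (?T x) = (indicator \<Omega> x :: real)" for x
    using torus_in_iff[OF ab, of "fst x" "snd x"] by (simp add: indicator_def)
  have FT: "(\<lambda>x. indicator \<Omega> x *\<^sub>R f (?T x)) \<in> borel_measurable borel"
    using measurable_compose[OF T F] by (simp add: ind)
  have "(LINT x|lebesgue_on \<Omega>. f (?T x)) = (LINT x|lborel. indicator \<Omega> x *\<^sub>R f (?T x))"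
    by (rule L2_lborel_integral[OF borel_\<Omega> FT])
  also have "\<dots> = (LINT x|lborel. ?F (?T x))" by (simp add: ind)
  also have "\<dots> = (LINT x|distr lborel borel ?T. ?F x)"
    by (rule integral_distr[symmetric]) (use T F in auto)
  also have "\<dots> = (LINT x|lebesgue_on \<Omega>. f x)"
    by (simp add: distr_lborel_torus[OF ab] L2_lborel_integral[OF borel_\<Omega> F])
  finally show ?thesis .
qed

text \<open>Rotating the variable multiplies the inner product by a^(j-j') b^(k-k') without changing
  it. If the weights differ, some unimodular choice makes this factor different from 1.\<close>

lemma torus_modes_orthogonal:
  assumes u: "continuous_on \<Omega> u" "torus_mode j k \<Omega> u"
    and v: "continuous_on \<Omega> v" "torus_mode j' k' \<Omega> v" and neq: "(j, k) \<noteq> (j', k')"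
  shows "L2_inner \<Omega> u v = 0"
proof -
  have key: "L2_inner \<Omega> u v = a powi (j - j') * b powi (k - k') * L2_inner \<Omega> u v" if ab: "cmod a = 1" "cmod b = 1" for a b
  proof -
    have nz: "a \<noteq> 0" "b \<noteq> 0" using ab by auto
    have cnj: "cnj c powi l = inverse (c powi l)" if "cmod c = 1" for c l
    proof -
      have "c * cnj c = 1" using that by (simp add: complex_norm_square[symmetric])
      moreover have "c \<noteq> 0" using that by auto
      ultimately have "cnj c = inverse c" by (simp add: field_simps)
      then show ?thesis by (simp add: power_int_inverse)
    qed
    have "L2_inner \<Omega> u v = (LINT x|lebesgue_on \<Omega>. u (a * fst x, b * snd x) * cnj (v (a * fst x, b * snd x)))"
      unfolding L2_inner_def
      by (rule integral_torus[symmetric, OF _ ab]) (intro continuous_intros u v)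
    also have "\<dots> = (LINT x|lebesgue_on \<Omega>. a powi (j - j') * b powi (k - k') * (u x * cnj (v x)))"
    proof (rule Bochner_Integration.integral_cong)
      fix x assume "x \<in> space (lebesgue_on \<Omega>)"
      then have x: "(fst x, snd x) \<in> \<Omega>" by simp
      show "u (a * fst x, b * snd x) * cnj (v (a * fst x, b * snd x)) = a powi (j - j') * b powi (k - k') * (u x * cnj (v x))"
        unfolding torus_modeD[OF u(2) x ab] torus_modeD[OF v(2) x ab] using nz
        by (simp add: power_int_diff cnj ab field_simps)
    qed simp
    finally show ?thesis by (simp add: L2_inner_def)
  qed
  show ?thesis
  proof (cases "j = j'")
    case True
    then have "k - k' \<noteq> 0" using neq by auto
    then obtain b :: complex where "cmod b = 1" "b powi (k - k') \<noteq> 1" by (rule exists_unimodular_powi)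
    then show ?thesis using key[of 1 b] by (simp add: mult_cancel_right1)
  next
    case False
    then have "j - j' \<noteq> 0" by auto
    then obtain a :: complex where "cmod a = 1" "a powi (j - j') \<noteq> 1" by (rule exists_unimodular_powi)
    then show ?thesis using key[of a 1] by (simp add: mult_cancel_right1)
  qed
qed

text \<open>The projection to weight (j, k), written as an iterated integral so that statements
  about one-dimensional Fourier coefficients apply to either coordinate.\<close>

definition mode :: "int \<Rightarrow> int \<Rightarrow> (C2 \<Rightarrow> complex) \<Rightarrow> C2 \<Rightarrow> complex" where
  "mode j k f x = fourier j (\<lambda>\<alpha>. fourier k (\<lambda>\<beta>. f (circ \<alpha> * fst x, circ \<beta> * snd x)))"

lemma continuous_circ_orbit:
  assumes S: "torus_invariant S" and f: "continuous_on S f" and x: "(z, w) \<in> S"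
  shows "continuous_on A (\<lambda>p. f (circ (fst p) * z, circ (snd p) * w))"
  by (rule continuous_on_compose2[OF f]) (auto intro!: continuous_intros torus_invariantD[OF S x])

text \<open>Fubini for a continuous integrand; it allows the first coordinate to be treated as the
  inner variable.\<close>

lemma mode_swap:
  assumes S: "torus_invariant S" and f: "continuous_on S f" and x: "(z, w) \<in> S"
  shows "mode j k f (z, w) = fourier k (\<lambda>\<beta>. fourier j (\<lambda>\<alpha>. f (circ \<alpha> * z, circ \<beta> * w)))"
proof -
  let ?g = "\<lambda>\<alpha> \<beta>. circ \<alpha> powi - j * (circ \<beta> powi - k * f (circ \<alpha> * z, circ \<beta> * w))"
  have c: "continuous_on (cbox (0, 0) (1, 1)) (\<lambda>(\<alpha>, \<beta>). ?g \<alpha> \<beta>)"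
    unfolding case_prod_unfold by (intro continuous_intros continuous_circ_orbit[OF S f x])
  have "mode j k f (z, w) = integral (cbox 0 1) (\<lambda>\<alpha>. integral (cbox 0 1) (?g \<alpha>))"
    by (simp add: mode_def fourier_def)
  also have "\<dots> = integral (cbox 0 1) (\<lambda>\<beta>. integral (cbox 0 1) (\<lambda>\<alpha>. ?g \<alpha> \<beta>))"
    by (rule integral_swap_continuous[OF c])
  also have "\<dots> = fourier k (\<lambda>\<beta>. fourier j (\<lambda>\<alpha>. f (circ \<alpha> * z, circ \<beta> * w)))"
  proof -
    have "integral {0..1} (\<lambda>\<alpha>. ?g \<alpha> \<beta>) = circ \<beta> powi - k * integral {0..1} (\<lambda>\<alpha>. circ \<alpha> powi - j * f (circ \<alpha> * z, circ \<beta> * w))" for \<beta>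
      by (subst integral_mult_right[symmetric]) (simp add: mult_ac)
    then show ?thesis by (simp add: fourier_def)
  qed
  finally show ?thesis .
qed

text \<open>Expanding in powers of t up to |t| = 1 requires a disc of radius larger than 1. Openness
  yields one real factor beyond 1, and shrinking gives the whole disc.\<close>

lemma dilate_ball_fst:
  assumes "(z, w) \<in> \<Omega>" obtains R where "R > 1" "\<And>t. cmod t < R \<Longrightarrow> (t * z, w) \<in> \<Omega>"
proof -
  have "open ((\<lambda>t :: real. (of_real t * z, w)) -` \<Omega>)"
    by (intro open_vimage[OF op] continuous_intros)
  moreover have "1 \<in> (\<lambda>t :: real. (of_real t * z, w)) -` \<Omega>" using assms by simp
  ultimately obtain e where e: "e > 0" "ball 1 e \<subseteq> (\<lambda>t :: real. (of_real t * z, w)) -` \<Omega>"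
    using open_contains_ball by meson
  have "1 + e / 2 \<in> ball 1 e" using e by (simp add: dist_norm)
  with e have R: "(of_real (1 + e / 2) * z, w) \<in> \<Omega>" by blast
  show thesis
  proof (rule that[of "1 + e / 2"])
    fix t :: complex assume t: "cmod t < 1 + e / 2"
    have "cmod (t * z) \<le> cmod (of_real (1 + e / 2) * z)"
      unfolding norm_mult norm_of_real using t by (intro mult_right_mono) auto
    then show "(t * z, w) \<in> \<Omega>" by (rule convex_torus_shrink_fst[OF cv tor R])
  qed (use e in simp)
qed

lemma dilate_ball_snd:
  assumes "(z, w) \<in> \<Omega>" obtains R where "R > 1" "\<And>t. cmod t < R \<Longrightarrow> (z, t * w) \<in> \<Omega>"
proof -
  have "open ((\<lambda>t :: real. (z, of_real t * w)) -` \<Omega>)"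
    by (intro open_vimage[OF op] continuous_intros)
  moreover have "1 \<in> (\<lambda>t :: real. (z, of_real t * w)) -` \<Omega>" using assms by simp
  ultimately obtain e where e: "e > 0" "ball 1 e \<subseteq> (\<lambda>t :: real. (z, of_real t * w)) -` \<Omega>"
    using open_contains_ball by meson
  have "1 + e / 2 \<in> ball 1 e" using e by (simp add: dist_norm)
  with e have R: "(z, of_real (1 + e / 2) * w) \<in> \<Omega>" by blast
  show thesis
  proof (rule that[of "1 + e / 2"])
    fix t :: complex assume t: "cmod t < 1 + e / 2"
    have "cmod (t * w) \<le> cmod (of_real (1 + e / 2) * w)"
      unfolding norm_mult norm_of_real using t by (intro mult_right_mono) auto
    then show "(z, t * w) \<in> \<Omega>" by (rule convex_torus_shrink_snd[OF cv tor R])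
  qed (use e in simp)
qed

text \<open>\<open>fourier_holomorphic\<close> at t and at 1 involves the same Taylor coefficient,
  which is eliminated between the two.\<close>

lemma fourier_fst_homogeneous:
  assumes f: "holomorphic_C2 f \<Omega>" and x: "(z, w) \<in> \<Omega>" and t: "cmod t \<le> 1"
  shows "fourier j (\<lambda>\<alpha>. f (circ \<alpha> * (t * z), w)) = (if 0 \<le> j then t ^ nat j * fourier j (\<lambda>\<alpha>. f (circ \<alpha> * z, w)) else 0)"
proof -
  obtain R where R: "R > 1" "\<And>t. cmod t < R \<Longrightarrow> (t * z, w) \<in> \<Omega>" by (rule dilate_ball_fst[OF x]) (rule that)
  have "(\<lambda>t. f (t * z, w)) holomorphic_on ball 0 R"
  proof -
    have "(\<lambda>u. f (u, w)) holomorphic_on (\<lambda>t. t * z) ` ball 0 R"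
      by (rule holomorphic_C2_slice_fst[OF op f]) (use R in auto)
    then show ?thesis
      using holomorphic_on_compose[of "\<lambda>t. t * z" "ball 0 R" "\<lambda>u. f (u, w)"] by (simp add: o_def holomorphic_intros)
  qed
  from fourier_holomorphic[OF this, of t j] fourier_holomorphic[OF this, of 1 j] t R(1)
  show ?thesis by (simp add: mult.assoc)
qed

lemma fourier_snd_homogeneous:
  assumes f: "holomorphic_C2 f \<Omega>" and x: "(z, w) \<in> \<Omega>" and t: "cmod t \<le> 1"
  shows "fourier j (\<lambda>\<alpha>. f (z, circ \<alpha> * (t * w))) = (if 0 \<le> j then t ^ nat j * fourier j (\<lambda>\<alpha>. f (z, circ \<alpha> * w)) else 0)"
proof -
  obtain R where R: "R > 1" "\<And>t. cmod t < R \<Longrightarrow> (z, t * w) \<in> \<Omega>" by (rule dilate_ball_snd[OF x]) (rule that)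
  have "(\<lambda>t. f (z, t * w)) holomorphic_on ball 0 R"
  proof -
    have "(\<lambda>u. f (z, u)) holomorphic_on (\<lambda>t. t * w) ` ball 0 R"
      by (rule holomorphic_C2_slice_snd[OF op f]) (use R in auto)
    then show ?thesis
      using holomorphic_on_compose[of "\<lambda>t. t * w" "ball 0 R" "\<lambda>u. f (z, u)"] by (simp add: o_def holomorphic_intros)
  qed
  from fourier_holomorphic[OF this, of t j] fourier_holomorphic[OF this, of 1 j] t R(1)
  show ?thesis by (simp add: mult.assoc)
qed

lemma mode_homogeneous:
  assumes f: "holomorphic_C2 f \<Omega>" and x: "(z, w) \<in> \<Omega>" and s: "cmod s \<le> 1" and t: "cmod t \<le> 1"
  shows "mode j k f (s * z, t * w) = (if 0 \<le> j \<and> 0 \<le> k then s ^ nat j * t ^ nat k * mode j k f (z, w) else 0)"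
proof -
  have cont: "continuous_on \<Omega> f" by (rule holomorphic_C2_continuous_on[OF f])
  have sz: "(s * z, w) \<in> \<Omega>"
    by (rule convex_torus_shrink_fst[OF cv tor x]) (use s in \<open>simp add: norm_mult mult_left_le_one_le\<close>)
  have tw: "(s * z, t * w) \<in> \<Omega>"
    by (rule convex_torus_shrink_snd[OF cv tor sz]) (use t in \<open>simp add: norm_mult mult_left_le_one_le\<close>)
  have rot1: "(circ \<alpha> * (s * z), w) \<in> \<Omega>" for \<alpha>
    using torus_invariantD[OF tor sz, of "circ \<alpha>" 1] by simp
  have rot2: "(z, circ \<beta> * w) \<in> \<Omega>" for \<beta>
    using torus_invariantD[OF tor x, of 1 "circ \<beta>"] by simp
  have step1: "mode j k f (s * z, t * w) = (if 0 \<le> k then t ^ nat k * mode j k f (s * z, w) else 0)"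
    unfolding mode_def fst_conv snd_conv fourier_snd_homogeneous[OF f rot1 t]
    by (simp add: fourier_cmult) (simp add: fourier_def)
  have step2: "mode j k f (s * z, w) = (if 0 \<le> j then s ^ nat j * mode j k f (z, w) else 0)"
    unfolding mode_swap[OF tor cont sz] mode_swap[OF tor cont x] fourier_fst_homogeneous[OF f rot2 s]
    by (simp add: fourier_cmult) (simp add: fourier_def)
  show ?thesis unfolding step1 step2 by simp
qed

text \<open>Homogeneity only compares a point with its contractions. Any point of \<Omega> and the
  base point (\<delta>, \<delta>) have a common contraction, and comparing both with it determines
  the mode up to the constant c.\<close>

lemma mode_holomorphic:
  assumes f: "holomorphic_C2 f \<Omega>"
  obtains c where "\<And>x. x \<in> \<Omega> \<Longrightarrow> mode (int m) (int n) f x = c * mono2 (m, n) x"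
proof -
  obtain \<delta> where \<delta>: "\<delta> > 0" "(complex_of_real \<delta>, complex_of_real \<delta>) \<in> \<Omega>" by (rule diag_in)
  let ?B = "mode (int m) (int n) f"
  have "?B (z, w) = ?B (of_real \<delta>, of_real \<delta>) / of_real \<delta> ^ (m + n) * mono2 (m, n) (z, w)" if x: "(z, w) \<in> \<Omega>" for z w
  proof -
    \<comment> \<open>Makes both t |z| and t |w| at most \<delta>, so that the contracted point is
      also a contraction of the base point.\<close>
    define t where "t = \<delta> / (\<delta> + cmod z + cmod w)"
    have pos: "\<delta> + cmod z + cmod w > 0" using \<delta> by (simp add: add_pos_nonneg)
    have t: "0 < t" "t \<le> 1" using \<delta> pos by (auto simp: t_def field_simps)
    have bound: "t * cmod v / \<delta> \<le> 1" if "cmod v \<le> cmod z + cmod w" for v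
    proof -
      have "t * cmod v / \<delta> = cmod v / (\<delta> + cmod z + cmod w)" using \<delta> by (simp add: t_def)
      also have "\<dots> \<le> 1" using that \<delta> pos by (simp add: divide_le_eq)
      finally show ?thesis .
    qed
    have "of_real t ^ m * of_real t ^ n * ?B (z, w) = ?B (of_real t * z, of_real t * w)"
      using mode_homogeneous[OF f x, of "of_real t" "of_real t" "int m" "int n"] t by simp
    also have "\<dots> = ?B ((of_real t * z / of_real \<delta>) * of_real \<delta>, (of_real t * w / of_real \<delta>) * of_real \<delta>)"
      using \<delta> by simp
    also have "\<dots> = (of_real t * z / of_real \<delta>) ^ m * (of_real t * w / of_real \<delta>) ^ n * ?B (of_real \<delta>, of_real \<delta>)"
      using mode_homogeneous[OF f \<delta>(2), of "of_real t * z / of_real \<delta>" "of_real t * w / of_real \<delta>" "int m" "int n"]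
        bound[of z] bound[of w] t \<delta> by (simp add: norm_mult norm_divide)
    finally show ?thesis using t \<delta>
      by (simp add: mono2_def power_mult_distrib power_divide power_add field_simps)
  qed
  then show thesis using that[of "?B (of_real \<delta>, of_real \<delta>) / of_real \<delta> ^ (m + n)"] by auto
qed

end

lemma continuous_fourier_fst:
  assumes S: "torus_invariant S" and f: "continuous_on S f"
  shows "continuous_on S (\<lambda>x. fourier j (\<lambda>\<theta>. f (circ \<theta> * fst x, snd x)))"
proof -
  have "continuous_on (S \<times> cbox 0 1) (\<lambda>p. f (circ (snd p) * fst (fst p), snd (fst p)))"
  proof (rule continuous_on_compose2[OF f])
    show "(\<lambda>p. (circ (snd p) * fst (fst p), snd (fst p))) ` (S \<times> cbox 0 1) \<subseteq> S"
      using torus_invariantD[OF S, of _ _ _ 1] by fastforce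
  qed (intro continuous_intros)
  then have "continuous_on (S \<times> cbox 0 1) (\<lambda>(x, \<theta>). circ \<theta> powi - j * f (circ \<theta> * fst x, snd x))"
    unfolding case_prod_unfold by (intro continuous_intros)
  from integral_continuous_on_param[OF this] show ?thesis by (simp add: fourier_def)
qed

lemma continuous_fourier_snd:
  assumes S: "torus_invariant S" and f: "continuous_on S f"
  shows "continuous_on S (\<lambda>x. fourier j (\<lambda>\<theta>. f (fst x, circ \<theta> * snd x)))"
proof -
  have "continuous_on (S \<times> cbox 0 1) (\<lambda>p. f (fst (fst p), circ (snd p) * snd (fst p)))"
  proof (rule continuous_on_compose2[OF f])
    show "(\<lambda>p. (fst (fst p), circ (snd p) * snd (fst p))) ` (S \<times> cbox 0 1) \<subseteq> S"
      using torus_invariantD[OF S, of _ _ 1] by fastforce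
  qed (intro continuous_intros)
  then have "continuous_on (S \<times> cbox 0 1) (\<lambda>(x, \<theta>). circ \<theta> powi - j * f (fst x, circ \<theta> * snd x))"
    unfolding case_prod_unfold by (intro continuous_intros)
  from integral_continuous_on_param[OF this] show ?thesis by (simp add: fourier_def)
qed

text \<open>The faces of the boundary are closed discs on which the symbol is holomorphic only
  inside. The formula for the coefficients extends to the rim by letting s tend to 1 along the
  radius.\<close>

lemma fourier_holomorphic_cball:
  assumes F: "F holomorphic_on ball 0 r" and c: "continuous_on (cball 0 r) F" and r: "0 \<le> r"
  shows "\<exists>a. \<forall>u\<in>cball 0 r. fourier j (\<lambda>\<alpha>. F (circ \<alpha> * u)) = (if 0 \<le> j then a * u ^ nat j else 0)"
proof (cases "r = 0")
  \<comment> \<open>A face may degenerate to a point. The open disc is then empty, and the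
    convention 0^0 = 1 makes F 0 the right coefficient.\<close>
  case True
  have "fourier j (\<lambda>\<alpha>. F 0) = F 0 * (if j = 0 then 1 else 0)"
    using fourier_circ_powi[of j 0] fourier_cmult[of j "F 0" "\<lambda>_. 1"] by simp
  then show ?thesis using True by (intro exI[of _ "F 0"]) (auto simp: power_0_left)
next
  case False
  define a where "a = (deriv ^^ nat j) F 0 / fact (nat j)"
  have "fourier j (\<lambda>\<alpha>. F (circ \<alpha> * u)) = (if 0 \<le> j then a * u ^ nat j else 0)" if u: "u \<in> cball 0 r" for u
  proof -
    have inner: "fourier j (\<lambda>\<alpha>. F (circ \<alpha> * (of_real s * u))) = (if 0 \<le> j then a * (of_real s * u) ^ nat j else 0)"
      if s: "s \<in> {0..<1}" for s :: real
    proof -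
      have "cmod (of_real s * u) < r"
      proof (cases "u = 0")
        case u0: False
        have "cmod (of_real s * u) < 1 * cmod u" unfolding norm_mult norm_of_real
          using s u0 by (intro mult_strict_right_mono) auto
        then show ?thesis using u by simp
      qed (use False r in auto)
      then show ?thesis using fourier_holomorphic[OF F] by (simp add: a_def)
    qed
    have "continuous_on ({0..1::real} \<times> cbox 0 1) (\<lambda>p. F (circ (snd p) * (of_real (fst p) * u)))"
    proof (rule continuous_on_compose2[OF c])
      have "cmod (circ \<theta> * (of_real s * u)) \<le> r" if "s \<in> {0..1}" for s \<theta> :: real
        using mult_mono[of "\<bar>s\<bar>" 1 "cmod u" r] that u by (simp add: norm_mult)
      then show "(\<lambda>p. circ (snd p) * (of_real (fst p) * u)) ` ({0..1::real} \<times> cbox 0 1) \<subseteq> cball 0 r" by auto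
    qed (intro continuous_intros)
    then have "continuous_on ({0..1::real} \<times> cbox 0 1) (\<lambda>(s, \<alpha>). circ \<alpha> powi - j * F (circ \<alpha> * (of_real s * u)))"
      unfolding case_prod_unfold by (intro continuous_intros)
    from integral_continuous_on_param[OF this]
    have cont: "continuous_on {0..1} (\<lambda>s::real. fourier j (\<lambda>\<alpha>. F (circ \<alpha> * (of_real s * u))))" by (simp add: fourier_def)
    define D where "D = (\<lambda>s::real. fourier j (\<lambda>\<alpha>. F (circ \<alpha> * (of_real s * u))) - (if 0 \<le> j then a * (of_real s * u) ^ nat j else 0))"
    have "continuous_on (closure {0..<1}) D"
      unfolding D_def using cont by (cases "0 \<le> j") (auto intro!: continuous_intros)
    then have "D 1 = 0"
      by (rule continuous_constant_on_closure) (use inner in \<open>auto simp: D_def\<close>)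
    then show ?thesis by (simp add: D_def)
  qed
  then show ?thesis by blast
qed

section \<open>Modes of continuous functions and completeness of the monomials\<close>

context convex_reinhardt begin

lemma continuous_mode:
  assumes S: "torus_invariant S" and f: "continuous_on S f"
  shows "continuous_on S (mode j k f)"
proof -
  have "continuous_on S (\<lambda>x. fourier j (\<lambda>\<theta>. (\<lambda>y. fourier k (\<lambda>\<beta>. f (fst y, circ \<beta> * snd y))) (circ \<theta> * fst x, snd x)))"
    by (rule continuous_fourier_fst[OF S continuous_fourier_snd[OF S f]])
  then show ?thesis by (simp add: mode_def[abs_def])
qed

lemma torus_mode_mode:
  assumes S: "torus_invariant S" and f: "continuous_on S f"
  shows "torus_mode j k S (mode j k f)"
  unfolding torus_mode_def
proof (intro allI impI)
  fix z w a b assume x: "(z, w) \<in> S" and a: "cmod a = 1" and b: "cmod b = 1"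
  have "fourier k (\<lambda>\<beta>. f (circ \<alpha> * (a * z), circ \<beta> * (b * w))) = b powi k * fourier k (\<lambda>\<beta>. f (circ \<alpha> * (a * z), circ \<beta> * w))" for \<alpha>
  proof -
    have "continuous_on (sphere 0 1) (\<lambda>c. f (circ \<alpha> * (a * z), c * w))"
      by (rule continuous_on_compose2[OF f])
         (use torus_invariantD[OF S x, of "circ \<alpha> * a"] a in \<open>auto intro!: continuous_intros simp: norm_mult mult.assoc\<close>)
    from fourier_rotate[OF this b, of k] show ?thesis by (simp add: mult.assoc)
  qed
  then have "mode j k f (a * z, b * w) = b powi k * fourier j (\<lambda>\<alpha>. fourier k (\<lambda>\<beta>. f (circ \<alpha> * (a * z), circ \<beta> * w)))"
    by (simp add: mode_def fourier_cmult)
  also have "fourier j (\<lambda>\<alpha>. fourier k (\<lambda>\<beta>. f (circ \<alpha> * (a * z), circ \<beta> * w))) = a powi j * mode j k f (z, w)"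
  proof -
    have "continuous_on (sphere 0 1) (\<lambda>c. fourier k (\<lambda>\<beta>. f (fst (c * z, w), circ \<beta> * snd (c * z, w))))"
      by (rule continuous_on_compose2[OF continuous_fourier_snd[OF S f]])
         (use torus_invariantD[OF S x, of _ 1] in \<open>auto intro!: continuous_intros\<close>)
    from fourier_rotate[OF this a, of j] show ?thesis by (simp add: mult.assoc mode_def)
  qed
  finally show "mode j k f (a * z, b * w) = a powi j * b powi k * mode j k f (z, w)" by simp
qed

text \<open>Pairing with a monomial sees only the mode of the same weight. The integrand is averaged
  over rotations, first in w and then in z, which does not alter its integral.\<close>

lemma inner_mono2_mode:
  assumes f: "f \<in> bergman_space \<Omega>"
  shows "L2_inner \<Omega> f (mono2 (m, n)) = L2_inner \<Omega> (mode (int m) (int n) f) (mono2 (m, n))"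
proof -
  let ?e = "\<lambda>x. cnj (mono2 (m, n) x)"
  have fc: "continuous_on \<Omega> f" by (rule holomorphic_C2_continuous_on[OF bergman_holomorphic[OF f]])
  define A where "A = (\<lambda>x. fourier (int n) (\<lambda>\<theta>. f (fst x, circ \<theta> * snd x)))"
  have A: "continuous_on \<Omega> A" unfolding A_def by (rule continuous_fourier_snd[OF tor fc])
  have modeA: "mode (int m) (int n) f x = fourier (int m) (\<lambda>\<alpha>. A (circ \<alpha> * fst x, snd x))" for x
    by (simp add: mode_def A_def)
  define G where "G = (\<lambda>u x. indicator \<Omega> x *\<^sub>R (u x * ?e x))"
  have Gb: "G u \<in> borel_measurable borel" if "continuous_on \<Omega> u" for u
    unfolding G_def by (rule indicator_continuous_borel[OF _ borel_\<Omega>]) (intro continuous_intros that continuous_mono2)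
  have GI: "L2_inner \<Omega> u (mono2 (m, n)) = (LINT x|lborel. G u x)" if "continuous_on \<Omega> u" for u
    unfolding L2_inner_def G_def by (rule L2_lborel_integral[OF borel_\<Omega>]) (use Gb[OF that] in \<open>simp add: G_def\<close>)
  have cnj: "cnj (circ \<theta> ^ l) = circ \<theta> powi - int l" for \<theta> l
  proof -
    have "circ \<theta> * cnj (circ \<theta>) = 1" by (simp add: complex_norm_square[symmetric])
    then have "cnj (circ \<theta>) = inverse (circ \<theta>)" by (simp add: field_simps)
    then show ?thesis by (simp add: power_int_minus power_inverse)
  qed
  let ?T = "\<lambda>\<theta> x :: C2. (fst x, circ \<theta> * snd x)" and ?R = "\<lambda>\<theta> x :: C2. (circ \<theta> * fst x, snd x)"
  have G0: "integrable lborel (G f)"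
  proof -
    have "integrable (lebesgue_on \<Omega>) (\<lambda>x. f x * ?e x)"
      by (rule L2_inner_integrable[OF bergman_L2[OF f] mono2_L2])
    then have "integrable lebesgue (G f)"
      unfolding G_def by (subst (asm) integrable_restrict_space) (use op in auto)
    then show ?thesis using integrable_completion[of "G f" lborel] Gb[OF fc] by simp
  qed
  \<comment> \<open>Rotating w by \<open>circ \<theta>\<close> multiplies the conjugate monomial by
    the power -n of \<open>circ \<theta>\<close>, which is exactly the kernel of the n-th Fourier
    coefficient.\<close>
  have av1: "(LINT \<theta>|lborel. indicator {0..1} \<theta> *\<^sub>R G f (?T \<theta> x)) = G A x" for x
  proof (cases "x \<in> \<Omega>")
    case True
    then have x: "(fst x, snd x) \<in> \<Omega>" by simp
    have in\<Omega>: "?T \<theta> x \<in> \<Omega>" for \<theta> using torus_invariantD[OF tor x, of 1 "circ \<theta>"] by simp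
    have "G f (?T \<theta> x) = (circ \<theta> powi - int n * f (?T \<theta> x)) * ?e x" for \<theta>
      using in\<Omega>[of \<theta>] by (simp add: G_def mono2_def power_mult_distrib cnj[symmetric] mult_ac)
    moreover have "continuous_on {0..1} (\<lambda>\<theta>. (circ \<theta> powi - int n * f (?T \<theta> x)) * ?e x)"
      by (intro continuous_intros continuous_on_compose2[OF fc]) (use in\<Omega> in auto)
    ultimately have "(LINT \<theta>|lborel. indicator {0..1} \<theta> *\<^sub>R G f (?T \<theta> x)) = integral {0..1} (\<lambda>\<theta>. (circ \<theta> powi - int n * f (?T \<theta> x)) * ?e x)"
      using lborel_integral_interval by simp
    also have "\<dots> = A x * ?e x" by (simp add: A_def fourier_def)
    finally show ?thesis using True by (simp add: G_def)
  next
    case False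
    then have "?T \<theta> x \<notin> \<Omega>" for \<theta> using torus_in_iff[of 1 "circ \<theta>" "fst x" "snd x"] by simp
    then show ?thesis using False by (simp add: G_def)
  qed
  have av2: "(LINT \<theta>|lborel. indicator {0..1} \<theta> *\<^sub>R G A (?R \<theta> x)) = G (mode (int m) (int n) f) x" for x
  proof (cases "x \<in> \<Omega>")
    case True
    then have x: "(fst x, snd x) \<in> \<Omega>" by simp
    have in\<Omega>: "?R \<theta> x \<in> \<Omega>" for \<theta> using torus_invariantD[OF tor x, of "circ \<theta>" 1] by simp
    have "G A (?R \<theta> x) = (circ \<theta> powi - int m * A (?R \<theta> x)) * ?e x" for \<theta>
      using in\<Omega>[of \<theta>] by (simp add: G_def mono2_def power_mult_distrib cnj[symmetric] mult_ac)
    moreover have "continuous_on {0..1} (\<lambda>\<theta>. (circ \<theta> powi - int m * A (?R \<theta> x)) * ?e x)"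
      by (intro continuous_intros continuous_on_compose2[OF A]) (use in\<Omega> in auto)
    ultimately have "(LINT \<theta>|lborel. indicator {0..1} \<theta> *\<^sub>R G A (?R \<theta> x)) = integral {0..1} (\<lambda>\<theta>. (circ \<theta> powi - int m * A (?R \<theta> x)) * ?e x)"
      using lborel_integral_interval by simp
    also have "\<dots> = mode (int m) (int n) f x * ?e x" by (simp add: modeA fourier_def)
    finally show ?thesis using True by (simp add: G_def)
  next
    case False
    then have "?R \<theta> x \<notin> \<Omega>" for \<theta> using torus_in_iff[of "circ \<theta>" 1 "fst x" "snd x"] by simp
    then show ?thesis using False by (simp add: G_def)
  qed
  have Tm: "(\<lambda>(\<theta>, x). ?T \<theta> x) \<in> borel_measurable (borel \<Otimes>\<^sub>M borel)" "(\<lambda>(\<theta>, x). ?R \<theta> x) \<in> borel_measurable (borel \<Otimes>\<^sub>M borel)"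
    unfolding borel_prod case_prod_unfold by (intro borel_measurable_continuous_onI continuous_intros)+
  have Td: "distr lborel borel (?T \<theta>) = lborel" "distr lborel borel (?R \<theta>) = lborel" for \<theta>
    using distr_lborel_torus[of 1 "circ \<theta>"] distr_lborel_torus[of "circ \<theta>" 1] by simp_all
  note I1 = measure_preserving_average[OF Tm(1) Td(1) G0, unfolded av1]
  note I2 = measure_preserving_average[OF Tm(2) Td(2) I1(1), unfolded av2]
  show ?thesis
    using GI[OF fc] GI[OF continuous_mode[OF tor fc]] I1(2) I2(2) by simp
qed

text \<open>A mode with nonnegative indices is a multiple of a monomial, and pairing with that
  monomial shows that the multiple is 0; all other modes vanish by homogeneity. Uniqueness of
  Fourier coefficients, first in z and then in w, returns to f itself.\<close>

lemma orthogonal_monomials_zero: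
  assumes f: "f \<in> bergman_space \<Omega>" and orth: "\<And>s. L2_inner \<Omega> f (mono2 s) = 0" and x: "x \<in> \<Omega>"
  shows "f x = 0"
proof -
  have hol: "holomorphic_C2 f \<Omega>" by (rule bergman_holomorphic[OF f])
  have fc: "continuous_on \<Omega> f" by (rule holomorphic_C2_continuous_on[OF hol])
  have mode0: "mode j k f y = 0" if y: "y \<in> \<Omega>" for j k y
  proof (cases "0 \<le> j \<and> 0 \<le> k")
    case True
    define s where "s = (nat j, nat k)"
    obtain c where c: "\<And>y. y \<in> \<Omega> \<Longrightarrow> mode (int (nat j)) (int (nat k)) f y = c * mono2 (nat j, nat k) y"
      by (rule mode_holomorphic[OF hol, of "nat j" "nat k"]) (rule that)
    have c': "mode j k f y = c * mono2 s y" if "y \<in> \<Omega>" for y using c[OF that] True by (simp add: s_def)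
    have "0 = L2_inner \<Omega> (mode j k f) (mono2 s)"
      using inner_mono2_mode[OF f, of "nat j" "nat k"] orth[of s] True by (simp add: s_def)
    also have "\<dots> = L2_inner \<Omega> (\<lambda>y. c * mono2 s y) (mono2 s)"
      by (rule L2_inner_cong) (use c' in auto)
    also have "\<dots> = c * of_real ((L2_norm \<Omega> (mono2 s))\<^sup>2)"
      by (simp only: L2_inner_cmult_left L2_inner_self[OF mono2_L2])
    finally have "c = 0 \<or> L2_norm \<Omega> (mono2 s) = 0" by simp
    moreover have "L2_norm \<Omega> (mono2 s) \<noteq> 0"
    proof
      assume z: "L2_norm \<Omega> (mono2 s) = 0"
      obtain \<delta> :: real where \<delta>: "\<delta> > 0" "(of_real \<delta>, of_real \<delta>) \<in> \<Omega>" by (rule diag_in)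
      from bergman_norm_zero[OF op mono2_bergman z \<delta>(2)] \<delta>(1) show False by (simp add: mono2_def)
    qed
    ultimately show ?thesis using c'[OF y] by simp
  next
    case False
    have "(fst y, snd y) \<in> \<Omega>" using y by simp
    from mode_homogeneous[OF hol this, of 1 1 j k] False show ?thesis by (simp only: if_False mult_1 norm_one order_refl prod.collapse)
  qed
  have "fourier k (\<lambda>\<beta>. f (z, circ \<beta> * w)) = 0" if zw: "(z, w) \<in> \<Omega>" for z w k
  proof -
    let ?g = "\<lambda>c. fourier k (\<lambda>\<beta>. f (fst (c * z, w), circ \<beta> * snd (c * z, w)))"
    have "?g 1 = 0"
    proof (rule fourier_unique)
      show "continuous_on (sphere 0 1) ?g"
        by (rule continuous_on_compose2[OF continuous_fourier_snd[OF tor fc]])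
           (use torus_invariantD[OF tor zw, of _ 1] in \<open>auto intro!: continuous_intros\<close>)
      show "fourier j (\<lambda>\<theta>. ?g (circ \<theta>)) = 0" for j
        using mode0[OF zw, of j k] by (simp add: mode_def)
    qed
    then show ?thesis by simp
  qed
  note z = this
  have xx: "(fst x, snd x) \<in> \<Omega>" using x by simp
  have "f (fst x, 1 * snd x) = 0"
  proof (rule fourier_unique[of "\<lambda>c. f (fst x, c * snd x)"])
    show "continuous_on (sphere 0 1) (\<lambda>c. f (fst x, c * snd x))"
      by (rule continuous_on_compose2[OF fc])
         (use torus_invariantD[OF tor xx, of 1] in \<open>auto intro!: continuous_intros\<close>)
  qed (use z[OF xx] in simp)
  then show ?thesis by simp
qed

text \<open>Instead of summing the power series in norm, project f to the closure of the
  polynomials. The remainder is a Bergman function orthogonal to every monomial, hence zero on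
  \<Omega>.\<close>

lemma polynomials_dense:
  assumes f: "f \<in> bergman_space \<Omega>" and e: "e > 0"
  obtains S a where "finite S" "L2_norm \<Omega> (\<lambda>x. f x - (\<Sum>s\<in>S. a s * mono2 s x)) < e"
proof -
  define V where "V = {p. \<exists>S a. finite S \<and> p = (\<lambda>x. \<Sum>s\<in>S. a s * mono2 s x)}"
  have V: "V \<subseteq> bergman_space \<Omega>"
    unfolding V_def by (auto intro!: bergman_sum bergman_cmult mono2_bergman)
  have ne: "V \<noteq> {}" unfolding V_def by blast
  have add: "(\<lambda>x. p x + q x) \<in> V" if p: "p \<in> V" and q: "q \<in> V" for p q
  proof -
    obtain S a T b where S: "finite S" "p = (\<lambda>x. \<Sum>s\<in>S. a s * mono2 s x)"
      and T: "finite T" "q = (\<lambda>x. \<Sum>s\<in>T. b s * mono2 s x)"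
      using p q unfolding V_def by blast
    define c where "c = (\<lambda>s. (if s \<in> S then a s else 0) + (if s \<in> T then b s else 0))"
    have "(\<Sum>s\<in>S \<union> T. c s * mono2 s x) = p x + q x" for x
    proof -
      have "(\<Sum>s\<in>S \<union> T. (if s \<in> S then a s else 0) * mono2 s x) = p x"
        unfolding S(2) by (rule sum.mono_neutral_cong_right) (use S T in auto)
      moreover have "(\<Sum>s\<in>S \<union> T. (if s \<in> T then b s else 0) * mono2 s x) = q x"
        unfolding T(2) by (rule sum.mono_neutral_cong_right) (use S T in auto)
      ultimately show ?thesis by (simp add: c_def distrib_right sum.distrib)
    qed
    then have "(\<lambda>x. p x + q x) = (\<lambda>x. \<Sum>s\<in>S \<union> T. c s * mono2 s x)" by simp
    then show ?thesis unfolding V_def using S T by blast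
  qed
  have cmult: "(\<lambda>x. c * p x) \<in> V" if p: "p \<in> V" for c p
  proof -
    obtain S a where S: "finite S" "p = (\<lambda>x. \<Sum>s\<in>S. a s * mono2 s x)"
      using p unfolding V_def by blast
    have "(\<lambda>x. c * p x) = (\<lambda>x. \<Sum>s\<in>S. (c * a s) * mono2 s x)"
      by (simp add: S(2) sum_distrib_left mult.assoc)
    with S(1) show ?thesis unfolding V_def mem_Collect_eq
      by (intro exI[of _ S] exI[of _ "\<lambda>s. c * a s"] conjI)
  qed
  have mono: "mono2 s \<in> V" for s
    unfolding V_def mem_Collect_eq by (rule exI[of _ "{s}"], rule exI[of _ "\<lambda>_. 1"]) simp
  obtain h v where h: "h \<in> bergman_space \<Omega>" and v: "\<And>n::nat. v n \<in> V"
    and lim: "(\<lambda>n. L2_norm \<Omega> (\<lambda>x. v n x - h x)) \<longlonglongrightarrow> 0"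
    and orth: "\<And>k. k \<in> V \<Longrightarrow> L2_inner \<Omega> (\<lambda>x. f x - h x) k = 0"
    by (rule bergman_orthogonal_projection[OF op V ne add cmult bergman_L2[OF f]]) (assumption+, rule that)
  have fh: "f x - h x = 0" if "x \<in> \<Omega>" for x
    by (rule orthogonal_monomials_zero[OF bergman_diff[OF f h] orth[OF mono] that])
  obtain n where n: "L2_norm \<Omega> (\<lambda>x. v n x - h x) < e"
    using order_tendstoD(2)[OF lim e] by (auto simp: eventually_sequentially)
  obtain S a where S: "finite S" "v n = (\<lambda>x. \<Sum>s\<in>S. a s * mono2 s x)"
    using v[of n] unfolding V_def by blast
  have "L2_norm \<Omega> (\<lambda>x. f x - (\<Sum>s\<in>S. a s * mono2 s x)) = L2_norm \<Omega> (\<lambda>x. v n x - h x)"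
    by (rule L2_norm_cong) (use fh in \<open>simp add: S norm_minus_commute\<close>)
  with n S(1) show thesis by (intro that[of S a]) auto
qed

text \<open>On the face the coefficient in z is homogeneous although \<phi> is not holomorphic on
  any open set of the plane C^2. Holomorphy is demanded for every v with |v| = |w| because the mode
  integrates over the rotations of w.\<close>

lemma mode_face_fst:
  assumes x: "(z, w) \<in> closure \<Omega>" and \<phi>: "continuous_on (closure \<Omega>) \<phi>"
    and hol: "\<And>v. cmod v = cmod w \<Longrightarrow> (\<lambda>u. \<phi> (u, v)) holomorphic_on ball 0 (cmod z)" and u: "cmod u \<le> 1"
  shows "mode j k \<phi> (u * z, w) = (if 0 \<le> j then u ^ nat j * mode j k \<phi> (z, w) else 0)"
proof -
  have y: "(u * z, w) \<in> closure \<Omega>"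
    by (rule convex_torus_shrink_fst[OF cv_closure tor_closure x]) (use u in \<open>simp add: norm_mult mult_left_le_one_le\<close>)
  have "fourier j (\<lambda>\<alpha>. \<phi> (circ \<alpha> * (u * z), circ \<beta> * w)) =
      (if 0 \<le> j then u ^ nat j * fourier j (\<lambda>\<alpha>. \<phi> (circ \<alpha> * z, circ \<beta> * w)) else 0)" for \<beta>
  proof -
    have "continuous_on (cball 0 (cmod z)) (\<lambda>u. \<phi> (u, circ \<beta> * w))"
      by (rule continuous_on_compose2[OF \<phi>])
         (auto intro!: continuous_intros convex_torus_shrink[OF cv_closure tor_closure x] simp: norm_mult)
    from fourier_holomorphic_cball[OF hol this, of j]
    obtain a where a: "\<And>v. cmod v \<le> cmod z \<Longrightarrow> fourier j (\<lambda>\<alpha>. \<phi> (circ \<alpha> * v, circ \<beta> * w)) = (if 0 \<le> j then a * v ^ nat j else 0)"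
      by (auto simp: norm_mult)
    have "cmod (u * z) \<le> cmod z" using u by (simp add: norm_mult mult_left_le_one_le)
    from a[OF this] a[of z] show ?thesis by (simp add: power_mult_distrib)
  qed
  then show ?thesis
    unfolding mode_swap[OF tor_closure \<phi> y] mode_swap[OF tor_closure \<phi> x]
    by (simp add: fourier_cmult) (simp add: fourier_def)
qed

lemma mode_face_snd:
  assumes x: "(z, w) \<in> closure \<Omega>" and \<phi>: "continuous_on (closure \<Omega>) \<phi>"
    and hol: "\<And>v. cmod v = cmod z \<Longrightarrow> (\<lambda>u. \<phi> (v, u)) holomorphic_on ball 0 (cmod w)" and u: "cmod u \<le> 1"
  shows "mode j k \<phi> (z, u * w) = (if 0 \<le> k then u ^ nat k * mode j k \<phi> (z, w) else 0)"
proof -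
  have "fourier k (\<lambda>\<beta>. \<phi> (circ \<alpha> * z, circ \<beta> * (u * w))) =
      (if 0 \<le> k then u ^ nat k * fourier k (\<lambda>\<beta>. \<phi> (circ \<alpha> * z, circ \<beta> * w)) else 0)" for \<alpha>
  proof -
    have "continuous_on (cball 0 (cmod w)) (\<lambda>u. \<phi> (circ \<alpha> * z, u))"
      by (rule continuous_on_compose2[OF \<phi>])
         (auto intro!: continuous_intros convex_torus_shrink[OF cv_closure tor_closure x] simp: norm_mult)
    from fourier_holomorphic_cball[OF hol this, of k]
    obtain a where a: "\<And>v. cmod v \<le> cmod w \<Longrightarrow> fourier k (\<lambda>\<beta>. \<phi> (circ \<alpha> * z, circ \<beta> * v)) = (if 0 \<le> k then a * v ^ nat k else 0)"
      by (auto simp: norm_mult)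
    have "cmod (u * w) \<le> cmod w" using u by (simp add: norm_mult mult_left_le_one_le)
    from a[OF this] a[of w] show ?thesis by (simp add: power_mult_distrib)
  qed
  then show ?thesis
    unfolding mode_def by (simp add: fourier_cmult) (simp add: fourier_def)
qed

end

section \<open>Concentration of monomials\<close>

text \<open>The case distinction is needed because 0 powr 0 = 0.\<close>

definition wpow :: "real \<Rightarrow> real \<Rightarrow> real" where
  "wpow \<tau> x = (if \<tau> = 0 then 1 else x powr \<tau>)"

lemma wpow_nonneg [simp]: "0 \<le> wpow \<tau> x" by (simp add: wpow_def)

lemma wpow_pos: "x > 0 \<Longrightarrow> wpow \<tau> x = x powr \<tau>" by (simp add: wpow_def)

lemma wpow_power:
  assumes "l > 0" "0 \<le> x" shows "wpow (real m / real l) x ^ l = x ^ m"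
proof (cases "m = 0 \<or> x = 0")
  case True
  then show ?thesis using assms by (auto simp: wpow_def power_0_left)
next
  case False
  then have "(x powr (real m / real l)) ^ l = x powr (real l * (real m / real l))"
    by (intro powr_power) auto
  then show ?thesis using False assms by (simp add: wpow_def powr_realpow)
qed

text \<open>Continuity fails at exponent 0 and base 0: powers of 0 with small positive exponents are
  0, while the limiting value is 1. An upper bound survives, and maximality arguments ask for no
  more.\<close>

lemma wpow_usc:
  assumes lam: "lam \<longlonglongrightarrow> \<tau>" "\<And>i. 0 \<le> lam i" and x: "x \<longlonglongrightarrow> x0" "\<And>i. 0 \<le> x i" and e: "e > 0"
  shows "\<forall>\<^sub>F i in sequentially. wpow (lam i) (x i) \<le> wpow \<tau> x0 + e"
proof -
  have \<tau>0: "0 \<le> \<tau>" using LIMSEQ_le_const[OF lam(1)] lam(2) by blast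
  show ?thesis
  proof (cases "\<tau> = 0")
    case False
    then have pos: "\<tau> > 0" using \<tau>0 by simp
    have "(\<lambda>i. x i powr lam i) \<longlonglongrightarrow> x0 powr \<tau>"
      by (rule tendsto_powr'[OF x(1) lam(1)]) (use pos x in auto)
    then have "\<forall>\<^sub>F i in sequentially. x i powr lam i < x0 powr \<tau> + e"
      by (rule order_tendstoD) (use e in simp)
    moreover have "\<forall>\<^sub>F i in sequentially. lam i > 0"
      by (rule order_tendstoD(1)[OF lam(1) pos])
    ultimately show ?thesis by eventually_elim (use False in \<open>simp add: wpow_def\<close>)
  next
    case True
    obtain X where X: "\<And>i. x i \<le> X" using convergent_imp_bounded[OF x(1)] unfolding bounded_iff
      by (metis (no_types, lifting) UNIV_I abs_le_D1 image_eqI real_norm_def)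
    have X0: "0 \<le> X" using X[of 0] x(2)[of 0] by simp
    \<comment> \<open>A fixed base at least 1 dominates all x i, and its powers tend to 1 however
      the x i behave.\<close>
    have "(\<lambda>i. (X + 1) powr lam i) \<longlonglongrightarrow> (X + 1) powr 0"
      using lam(1) True X0 by (intro tendsto_powr tendsto_const) auto
    then have "\<forall>\<^sub>F i in sequentially. (X + 1) powr lam i < 1 + e"
      by (rule order_tendstoD) (use e X0 in simp)
    then show ?thesis
    proof eventually_elim
      case (elim i)
      have "wpow (lam i) (x i) \<le> (X + 1) powr lam i"
        using X[of i] x(2)[of i] lam(2)[of i] X0 by (auto simp: wpow_def intro: powr_mono2)
      then show ?case using elim True by (simp add: wpow_def)
    qed
  qed
qed

text \<open>The weighted geometric mean of |z| and |w|. For \<tau> = m/(m+n) it is the (m+n)-th root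
  of |z^m w^n|, so monomials of different degrees become comparable.\<close>

definition wmono :: "real \<Rightarrow> C2 \<Rightarrow> real" where
  "wmono \<tau> p = wpow \<tau> (cmod (fst p)) * wpow (1 - \<tau>) (cmod (snd p))"

lemma wmono_nonneg [simp]: "0 \<le> wmono \<tau> p" by (simp add: wmono_def)

lemma wmono_power:
  assumes "m + n > 0" shows "wmono (real m / real (m + n)) p ^ (m + n) = cmod (mono2 (m, n) p)"
proof -
  have "1 - real m / real (m + n) = real n / real (m + n)" using assms
    by (cases "real m + real n = 0") (auto simp: diff_eq_eq add_divide_distrib[symmetric])
  then show ?thesis
    by (simp only: wmono_def power_mult_distrib wpow_power[OF assms norm_ge_zero]) (simp add: mono2_def norm_mult norm_power)
qed

lemma continuous_wmono:
  assumes "0 \<le> \<tau>" "\<tau> \<le> 1" shows "continuous_on S (wmono \<tau>)"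
proof -
  have "continuous_on S (\<lambda>p. wpow \<mu> (f p))" if "0 \<le> \<mu>" "continuous_on S f" "\<And>p. 0 \<le> f p" for \<mu> and f :: "C2 \<Rightarrow> real"
  proof (cases "\<mu> = 0")
    case False
    have "continuous_on S (\<lambda>p. f p powr \<mu>)"
      by (rule continuous_on_powr'[OF that(2) continuous_on_const]) (use that False in auto)
    then show ?thesis using False by (simp add: wpow_def)
  qed (simp add: wpow_def)
  note c = this
  show ?thesis unfolding wmono_def[abs_def]
  proof (rule continuous_on_mult)
    show "continuous_on S (\<lambda>p. wpow \<tau> (cmod (fst p)))"
      by (rule c) (use assms in \<open>auto intro!: continuous_intros\<close>)
    show "continuous_on S (\<lambda>p. wpow (1 - \<tau>) (cmod (snd p)))"
      by (rule c) (use assms in \<open>auto intro!: continuous_intros\<close>)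
  qed
qed

lemma power_shift:
  fixes z :: complex
  assumes "j < 0 \<longrightarrow> z \<noteq> 0" "0 \<le> int m + j" shows "z ^ nat (int m + j) = z powi j * z ^ m"
proof (cases "z = 0")
  case True
  then show ?thesis using assms by (auto simp: nat_add_distrib power_0_left power_int_def)
next
  case False
  have "z ^ nat (int m + j) = z powi (int m + j)" using assms by (simp add: power_int_def)
  then show ?thesis using False by (simp add: power_int_add)
qed

section \<open>Maximisers of weighted monomials\<close>

context convex_reinhardt begin

definition maximizers :: "real \<Rightarrow> C2 set" where
  "maximizers \<tau> = {p \<in> closure \<Omega>. \<forall>q\<in>closure \<Omega>. wmono \<tau> q \<le> wmono \<tau> p}"

lemma maximizers_ex:
  assumes "0 \<le> \<tau>" "\<tau> \<le> 1" obtains p where "p \<in> maximizers \<tau>"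
proof -
  have "closure \<Omega> \<noteq> {}" using ne by simp
  from continuous_attains_sup[OF compact_cl this continuous_wmono[OF assms]] show thesis
    using that by (auto simp: maximizers_def)
qed

lemma maximizers_pos:
  assumes "p \<in> maximizers \<tau>" shows "wmono \<tau> p > 0"
proof -
  obtain \<delta> :: real where \<delta>: "\<delta> > 0" "(of_real \<delta>, of_real \<delta>) \<in> \<Omega>" by (rule diag_in)
  have "0 < wmono \<tau> (of_real \<delta>, of_real \<delta>)" using \<delta> by (simp add: wmono_def wpow_def)
  also have "\<dots> \<le> wmono \<tau> p" using assms \<delta>(2) closure_subset by (auto simp: maximizers_def)
  finally show ?thesis .
qed

lemma maximizers_0: "p \<in> maximizers 0 \<longleftrightarrow> p \<in> closure \<Omega> \<and> (\<forall>q\<in>closure \<Omega>. cmod (snd q) \<le> cmod (snd p))"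
  by (auto simp: maximizers_def wmono_def wpow_def)

lemma maximizers_1: "p \<in> maximizers 1 \<longleftrightarrow> p \<in> closure \<Omega> \<and> (\<forall>q\<in>closure \<Omega>. cmod (fst q) \<le> cmod (fst p))"
  by (auto simp: maximizers_def wmono_def wpow_def)

text \<open>The point of the closure formed by the midpoints of the absolute values is compared with
  two maximisers. If these differed in modulus, strictness of the inequality between arithmetic and
  geometric means would give the midpoint a larger value; both exponents are positive here, so each
  coordinate counts.\<close>

lemma maximizers_unique:
  assumes \<tau>: "0 < \<tau>" "\<tau> < 1" and p: "p \<in> maximizers \<tau>" and q: "q \<in> maximizers \<tau>"
  shows "cmod (fst p) = cmod (fst q)" "cmod (snd p) = cmod (snd q)"
proof -
  define x1 y1 x2 y2 where "x1 = cmod (fst p)" and "y1 = cmod (snd p)" and "x2 = cmod (fst q)" and "y2 = cmod (snd q)"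
  define a b where "a = (x1 + x2) / 2" and "b = (y1 + y2) / 2"
  have wm: "wmono \<tau> r = cmod (fst r) powr \<tau> * cmod (snd r) powr (1 - \<tau>)" for r
    using \<tau> by (simp add: wmono_def wpow_def)
  define \<mu> where "\<mu> = wmono \<tau> p"
  have \<mu>q: "wmono \<tau> q = \<mu>" using p q by (auto simp: maximizers_def \<mu>_def intro: antisym)
  have \<mu>0: "\<mu> > 0" unfolding \<mu>_def by (rule maximizers_pos[OF p])
  have pos: "x1 > 0" "y1 > 0" "x2 > 0" "y2 > 0"
    using \<mu>0 \<mu>q by (auto simp: wm \<mu>_def x1_def y1_def x2_def y2_def)
  have cl: "(of_real x1, of_real y1) \<in> closure \<Omega>" "(of_real x2, of_real y2) \<in> closure \<Omega>"
  proof -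
    have p': "(fst p, snd p) \<in> closure \<Omega>" and q': "(fst q, snd q) \<in> closure \<Omega>"
      using p q by (auto simp: maximizers_def)
    show "(of_real x1, of_real y1) \<in> closure \<Omega>"
      by (rule convex_torus_shrink[OF cv_closure tor_closure p']) (simp_all add: x1_def y1_def)
    show "(of_real x2, of_real y2) \<in> closure \<Omega>"
      by (rule convex_torus_shrink[OF cv_closure tor_closure q']) (simp_all add: x2_def y2_def)
  qed
  have "(1/2) *\<^sub>R (complex_of_real x1, complex_of_real y1) + (1/2) *\<^sub>R (complex_of_real x2, complex_of_real y2) \<in> closure \<Omega>"
    by (rule convexD[OF cv_closure cl]) auto
  moreover have "(1/2) *\<^sub>R (complex_of_real x1, complex_of_real y1) + (1/2) *\<^sub>R (complex_of_real x2, complex_of_real y2) = (of_real a, of_real b)"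
    by (simp add: a_def b_def scaleR_conv_of_real field_simps)
  ultimately have "wmono \<tau> (of_real a, of_real b) \<le> \<mu>" using p by (auto simp: maximizers_def \<mu>_def)
  have ab0: "a > 0" "b > 0" using pos by (simp_all add: a_def b_def)
  have ab: "a powr \<tau> * b powr (1 - \<tau>) \<le> \<mu>" 
  proof -
    show ?thesis using ab0 \<open>wmono \<tau> (of_real a, of_real b) \<le> \<mu>\<close> by (simp add: wm)
  qed
  have sq: "(a * a) powr \<tau> * (b * b) powr (1 - \<tau>) \<le> \<mu> * \<mu>"
  proof -
    have "(a * a) powr \<tau> * (b * b) powr (1 - \<tau>) = (a powr \<tau> * b powr (1 - \<tau>)) * (a powr \<tau> * b powr (1 - \<tau>))"
      using ab0 by (simp add: powr_mult)
    also have "\<dots> \<le> \<mu> * \<mu>" by (rule mult_mono[OF ab ab]) (use \<mu>0 in auto)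
    finally show ?thesis .
  qed
  have eq: "(x1 * x2) powr \<tau> * (y1 * y2) powr (1 - \<tau>) = \<mu> * \<mu>"
  proof -
    have "(x1 * x2) powr \<tau> * (y1 * y2) powr (1 - \<tau>) = wmono \<tau> p * wmono \<tau> q"
      using pos by (simp add: powr_mult wm x1_def y1_def x2_def y2_def)
    then show ?thesis using \<mu>q by (simp add: \<mu>_def)
  qed
  \<comment> \<open>The square of the mean exceeds the product by a quarter of the squared
    difference. This is why \<open>sq\<close> and \<open>eq\<close> were stated for squares and
    products.\<close>
  have id: "a * a = x1 * x2 + (x1 - x2)\<^sup>2 / 4" "b * b = y1 * y2 + (y1 - y2)\<^sup>2 / 4"
    by (simp_all add: a_def b_def power2_eq_square field_simps)
  have le: "x1 * x2 \<le> a * a" "y1 * y2 \<le> b * b" unfolding id by simp_all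
  have p2: "0 < x1 * x2" "0 < y1 * y2" using pos by auto
  have "\<not> x1 * x2 < a * a"
  proof
    assume lt: "x1 * x2 < a * a"
    have "(x1 * x2) powr \<tau> * (y1 * y2) powr (1 - \<tau>) < (a * a) powr \<tau> * (b * b) powr (1 - \<tau>)"
      by (rule mult_less_le_imp_less[OF powr_less_mono2 powr_mono2]) (use \<tau> le p2 lt in auto)
    then show False using sq eq by simp
  qed
  moreover have "\<not> y1 * y2 < b * b"
  proof
    assume lt: "y1 * y2 < b * b"
    have "(x1 * x2) powr \<tau> * (y1 * y2) powr (1 - \<tau>) < (a * a) powr \<tau> * (b * b) powr (1 - \<tau>)"
      by (rule mult_le_less_imp_less[OF powr_mono2 powr_less_mono2]) (use \<tau> le p2 lt in auto)
    then show False using sq eq by simp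
  qed
  ultimately have "x1 = x2" "y1 = y2" using id by auto
  then show "cmod (fst p) = cmod (fst q)" "cmod (snd p) = cmod (snd q)"
    by (simp_all add: x1_def y1_def x2_def y2_def)
qed

text \<open>The gap must be uniform for all nearby exponents, since the ratio of a monomial only
  approximates \<tau>. Otherwise points outside U with exponents tending to \<tau> would accumulate
  at a point outside U which by upper semicontinuity is again a maximiser.\<close>

lemma wmono_gap:
  assumes \<tau>: "0 \<le> \<tau>" "\<tau> \<le> 1" and U: "open U" "maximizers \<tau> \<subseteq> U" and p: "p \<in> maximizers \<tau>"
  obtains d where "d > 0" "\<And>\<tau>' q. 0 \<le> \<tau>' \<Longrightarrow> \<tau>' \<le> 1 \<Longrightarrow> \<bar>\<tau>' - \<tau>\<bar> < d \<Longrightarrow> q \<in> closure \<Omega> - U \<Longrightarrow> wmono \<tau>' q \<le> wmono \<tau> p - d"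
proof (rule ccontr)
  let ?\<mu> = "wmono \<tau> p"
  assume "\<not> thesis"
  then have "\<exists>\<tau>' q. 0 \<le> \<tau>' \<and> \<tau>' \<le> 1 \<and> \<bar>\<tau>' - \<tau>\<bar> < inverse (real (Suc i)) \<and> q \<in> closure \<Omega> - U \<and> ?\<mu> - inverse (real (Suc i)) < wmono \<tau>' q" for i
    using that[of "inverse (real (Suc i))"] by (meson inverse_positive_iff_positive not_le of_nat_0_less_iff zero_less_Suc)
  then obtain lam q where lam: "\<And>i. 0 \<le> lam i" "\<And>i. lam i \<le> 1" "\<And>i. \<bar>lam i - \<tau>\<bar> < inverse (real (Suc i))"
    and q: "\<And>i. q i \<in> closure \<Omega> - U" "\<And>i. ?\<mu> - inverse (real (Suc i)) < wmono (lam i) (q i)"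
    by metis
  have lim: "lam \<longlonglongrightarrow> \<tau>"
  proof (rule LIM_zero_cancel, rule tendsto_rabs_zero_cancel, rule tendsto_sandwich[OF _ _ tendsto_const LIMSEQ_inverse_real_of_nat])
    show "\<forall>\<^sub>F i in sequentially. \<bar>lam i - \<tau>\<bar> \<le> inverse (real (Suc i))"
      using lam(3) by (intro always_eventually) (auto intro: less_imp_le)
  qed simp
  have "compact (closure \<Omega> - U)" by (rule compact_diff[OF compact_cl U(1)])
  then obtain q0 r where q0: "q0 \<in> closure \<Omega> - U" and r: "strict_mono r" and qr: "(q \<circ> r) \<longlonglongrightarrow> q0"
    using q(1) unfolding compact_def by meson
  have lr: "(\<lambda>i. lam (r i)) \<longlonglongrightarrow> \<tau>" using LIMSEQ_subseq_LIMSEQ[OF lim r] by (simp add: o_def)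
  \<comment> \<open>Each factor can be controlled only from above and only up to e, so the passage
    to the limit point first allows slack e and then lets e tend to 0.\<close>
  have le: "?\<mu> \<le> (wpow \<tau> (cmod (fst q0)) + e) * (wpow (1 - \<tau>) (cmod (snd q0)) + e)" if e: "e > 0" for e
  proof -
    have "\<forall>\<^sub>F i in sequentially. wpow (lam (r i)) (cmod (fst (q (r i)))) \<le> wpow \<tau> (cmod (fst q0)) + e"
      by (rule wpow_usc[OF lr _ _ _ e]) (use lam qr in \<open>auto intro!: tendsto_norm tendsto_fst simp: o_def\<close>)
    moreover have "\<forall>\<^sub>F i in sequentially. wpow (1 - lam (r i)) (cmod (snd (q (r i)))) \<le> wpow (1 - \<tau>) (cmod (snd q0)) + e"
      by (rule wpow_usc[OF tendsto_diff[OF tendsto_const lr] _ _ _ e])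
         (use lam qr in \<open>auto intro!: tendsto_norm tendsto_snd simp: o_def\<close>)
    ultimately have "\<forall>\<^sub>F i in sequentially. ?\<mu> - inverse (real (Suc (r i))) \<le> (wpow \<tau> (cmod (fst q0)) + e) * (wpow (1 - \<tau>) (cmod (snd q0)) + e)"
    proof eventually_elim
      case (elim i)
      have "wmono (lam (r i)) (q (r i)) \<le> (wpow \<tau> (cmod (fst q0)) + e) * (wpow (1 - \<tau>) (cmod (snd q0)) + e)"
        unfolding wmono_def using elim e by (intro mult_mono) auto
      then show ?case using q(2)[of "r i"] by linarith
    qed
    moreover have "(\<lambda>i. ?\<mu> - inverse (real (Suc (r i)))) \<longlonglongrightarrow> ?\<mu> - 0"
      using LIMSEQ_subseq_LIMSEQ[OF LIMSEQ_inverse_real_of_nat r] by (intro tendsto_diff tendsto_const) (simp add: o_def)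
    ultimately show ?thesis
      by (metis diff_zero tendsto_upperbound trivial_limit_sequentially)
  qed
  have "((\<lambda>e. (wpow \<tau> (cmod (fst q0)) + e) * (wpow (1 - \<tau>) (cmod (snd q0)) + e)) \<longlongrightarrow>
     (wpow \<tau> (cmod (fst q0)) + 0) * (wpow (1 - \<tau>) (cmod (snd q0)) + 0)) (at_right 0)"
    by (intro tendsto_intros)
  then have "?\<mu> \<le> wmono \<tau> q0"
    unfolding wmono_def add_0_right
    by (rule tendsto_lowerbound) (use le in \<open>auto simp: wmono_def eventually_at_right_less intro: eventually_mono[OF eventually_at_right_less]\<close>)
  then have "q0 \<in> maximizers \<tau>" using p q0 by (auto simp: maximizers_def intro: order_trans)
  then show False using q0 U by blast
qed

text \<open>Outside U a monomial of degree l is at most (\<mu> - d)^l. At a suitable point of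
  \<Omega> it is at least (\<mu> - d/2)^l, and the point bound converts this into a lower bound for
  the norm. The quotient decays geometrically in l.\<close>

lemma monomial_concentration:
  assumes \<tau>: "0 \<le> \<tau>" "\<tau> \<le> 1" and U: "open U" "maximizers \<tau> \<subseteq> U" and e: "e > 0"
  obtains \<eta> N where "\<eta> > 0" "\<And>m n. N \<le> m + n \<Longrightarrow> \<bar>real m / real (m + n) - \<tau>\<bar> < \<eta> \<Longrightarrow>
    L2_norm \<Omega> (\<lambda>x. indicator (- U) x * mono2 (m, n) x) \<le> e * L2_norm \<Omega> (mono2 (m, n))"
proof -
  obtain p where p: "p \<in> maximizers \<tau>" using maximizers_ex[OF \<tau>] .
  define \<mu> where "\<mu> = wmono \<tau> p"
  have \<mu>: "\<mu> > 0" unfolding \<mu>_def by (rule maximizers_pos[OF p])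
  obtain d0 where d0: "d0 > 0" and gap0: "\<And>\<tau>' q. 0 \<le> \<tau>' \<Longrightarrow> \<tau>' \<le> 1 \<Longrightarrow> \<bar>\<tau>' - \<tau>\<bar> < d0 \<Longrightarrow> q \<in> closure \<Omega> - U \<Longrightarrow> wmono \<tau>' q \<le> \<mu> - d0"
    using wmono_gap[OF \<tau> U p] unfolding \<mu>_def by metis
  \<comment> \<open>At most \<mu>, so that \<mu> - d is nonnegative and taking powers preserves the
    inequality.\<close>
  define d where "d = min d0 \<mu>"
  have d: "d > 0" "d \<le> \<mu>" using d0 \<mu> by (auto simp: d_def)
  have gap: "wmono \<tau>' q \<le> \<mu> - d" if "0 \<le> \<tau>'" "\<tau>' \<le> 1" "\<bar>\<tau>' - \<tau>\<bar> < d" "q \<in> closure \<Omega> - U" for \<tau>' q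
    using gap0[OF that(1,2) _ that(4)] that(3) by (simp add: d_def)
  define W where "W = {x. \<mu> - d / 2 < wmono \<tau> x}"
  have W: "open W" unfolding W_def by (intro open_Collect_less continuous_wmono \<tau> continuous_intros)
  have "p \<in> closure \<Omega>" "p \<in> W" using p d by (auto simp: maximizers_def W_def \<mu>_def)
  then have "W \<inter> \<Omega> \<noteq> {}" using W by (metis IntI closure_iff_nhds_not_empty disjoint_iff open_Int_closure_eq_empty)
  then obtain z1 w1 where zw: "(z1, w1) \<in> W \<inter> \<Omega>" by fastforce
  obtain R1 where R1: "R1 > 0" "ball z1 R1 \<times> ball w1 R1 \<subseteq> W \<inter> \<Omega>"
    using open_C2_bidisc[OF open_Int[OF W op] zw] .
  \<comment> \<open>Vanishing coordinates are moved slightly away from 0. At a point with nonzero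
    coordinates \<open>wmono\<close> is continuous in the exponent, including at the ends 0 and
    1.\<close>
  define z w where "z = (if z1 = 0 then of_real (R1 / 2) else z1)" and "w = (if w1 = 0 then of_real (R1 / 2) else w1)"
  have zw0: "z \<noteq> 0" "w \<noteq> 0" using R1 by (auto simp: z_def w_def)
  have "(z, w) \<in> ball z1 R1 \<times> ball w1 R1" using R1 by (auto simp: z_def w_def)
  with R1(2) have "(z, w) \<in> W \<inter> \<Omega>" by blast
  then have zw\<Omega>: "(z, w) \<in> \<Omega>" and zwW: "\<mu> - d / 2 < wmono \<tau> (z, w)" by (simp_all add: W_def)
  obtain R where R: "R > 0" "ball z R \<times> ball w R \<subseteq> \<Omega>" using open_C2_bidisc[OF op zw\<Omega>] .
  have "((\<lambda>\<tau>'. wmono \<tau>' (z, w)) \<longlongrightarrow> wmono \<tau> (z, w)) (nhds \<tau>)"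
    unfolding wmono_def using zw0 by (simp add: wpow_pos) (intro tendsto_intros filterlim_ident; simp)
  from order_tendstoD(1)[OF this zwW] obtain \<eta>0 where \<eta>0: "\<eta>0 > 0" "\<And>\<tau>'. \<bar>\<tau>' - \<tau>\<bar> < \<eta>0 \<Longrightarrow> \<mu> - d / 2 < wmono \<tau>' (z, w)"
    unfolding eventually_nhds_metric dist_real_def by blast
  \<comment> \<open>Ratio of the upper bound off U to the lower bound at the chosen point, per
    degree. The constant \<open>K\<close> below collects the volume of \<Omega> and the constant of
    the point bound.\<close>
  define q where "q = (\<mu> - d) / (\<mu> - d / 2)"
  have q: "0 \<le> q" "q < 1" using d \<mu> by (auto simp: q_def field_simps)
  define K where "K = L2_norm \<Omega> (\<lambda>x. 1) / disc_area R"
  have "(\<lambda>l. K * q ^ l) \<longlonglongrightarrow> K * 0" by (intro tendsto_mult tendsto_const LIMSEQ_power_zero) (use q in auto)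
  then have "\<forall>\<^sub>F l in sequentially. K * q ^ l < e" by (rule order_tendstoD) (use e in simp)
  then obtain N0 where N0: "\<And>l. l \<ge> N0 \<Longrightarrow> K * q ^ l < e" by (auto simp: eventually_sequentially)
  show thesis
  proof (rule that[of "min d \<eta>0" "max N0 1"])
    show "min d \<eta>0 > 0" using d \<eta>0 by simp
    fix m n assume N: "max N0 1 \<le> m + n" and close: "\<bar>real m / real (m + n) - \<tau>\<bar> < min d \<eta>0"
    define l where "l = m + n"
    define \<tau>' where "\<tau>' = real m / real l"
    have l: "l > 0" "l \<ge> N0" using N by (auto simp: l_def)
    have \<tau>': "0 \<le> \<tau>'" "\<tau>' \<le> 1" using l by (auto simp: \<tau>'_def l_def divide_le_eq)
    have cl': "\<bar>\<tau>' - \<tau>\<bar> < d" "\<bar>\<tau>' - \<tau>\<bar> < \<eta>0" using close by (auto simp: \<tau>'_def l_def)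
    have mono: "cmod (mono2 (m, n) x) = wmono \<tau>' x ^ l" for x
      using wmono_power[of m n x] l by (simp add: l_def \<tau>'_def)
    have one: "(\<lambda>x. 1) \<in> L2 \<Omega>" by (rule continuous_cl_L2) (intro continuous_intros)
    have "L2_norm \<Omega> (\<lambda>x. indicator (- U) x * mono2 (m, n) x) = L2_norm \<Omega> (\<lambda>x. (indicator (- U) x * mono2 (m, n) x) * 1)" by simp
    also have "\<dots> \<le> (\<mu> - d) ^ l * L2_norm \<Omega> (\<lambda>x. 1)"
    proof (rule L2_norm_mult_bounded[OF one])
      fix x assume x: "x \<in> \<Omega>"
      show "cmod (indicator (- U) x * mono2 (m, n) x) \<le> (\<mu> - d) ^ l"
      proof (cases "x \<in> U")
        case False
        then have "wmono \<tau>' x \<le> \<mu> - d" using gap[OF \<tau>' cl'(1)] x closure_subset by blast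
        then show ?thesis using False by (simp add: mono power_mono)
      qed (use d in simp)
    qed (use d in simp)
    also have "\<dots> = K * q ^ l * ((\<mu> - d / 2) ^ l * disc_area R)"
      using d disc_area_pos[OF R(1)] by (simp add: K_def q_def power_divide)
    also have "\<dots> \<le> e * L2_norm \<Omega> (mono2 (m, n))"
    proof (rule mult_mono)
      show "K * q ^ l \<le> e" using N0[OF l(2)] by simp
      have "(\<mu> - d / 2) ^ l \<le> cmod (mono2 (m, n) (z, w))"
        unfolding mono using \<eta>0(2)[OF cl'(2)] d by (intro power_mono) auto
      then have "(\<mu> - d / 2) ^ l * disc_area R \<le> cmod (mono2 (m, n) (z, w)) * disc_area R"
        using disc_area_pos[OF R(1)] by (intro mult_right_mono) auto
      also have "\<dots> \<le> L2_norm \<Omega> (mono2 (m, n))" by (rule bergman_point_bound[OF op mono2_bergman R])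
      finally show "(\<mu> - d / 2) ^ l * disc_area R \<le> L2_norm \<Omega> (mono2 (m, n))" .
      show "0 \<le> (\<mu> - d / 2) ^ l * disc_area R" using d disc_area_pos[OF R(1)] by simp
    qed (use e in simp)
    finally show "L2_norm \<Omega> (\<lambda>x. indicator (- U) x * mono2 (m, n) x) \<le> e * L2_norm \<Omega> (mono2 (m, n))" .
  qed
qed


section \<open>Multiplication of monomials by symbols\<close>

text \<open>A fixed shift of the exponents is negligible against a large degree. When j is negative,
  t > 0 forces m to grow with the degree, so m + j does not become negative; likewise for k and 1 -
  t.\<close>

lemma exponent_shift_ratio:
  fixes j k :: int and t \<eta> :: real
  assumes \<eta>: "\<eta> > 0" and t: "0 \<le> t" "t \<le> 1" and jk: "j < 0 \<longrightarrow> t > 0" "k < 0 \<longrightarrow> t < 1"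
  obtains \<eta>' N where "\<eta>' > 0" "\<eta>' \<le> \<eta>" "\<And>m n :: nat. N \<le> m + n \<Longrightarrow> \<bar>real m / real (m + n) - t\<bar> < \<eta>' \<Longrightarrow>
     0 \<le> int m + j \<and> 0 \<le> int n + k \<and> M \<le> nat (int m + j) + nat (int n + k) \<and>
     \<bar>real (nat (int m + j)) / real (nat (int m + j) + nat (int n + k)) - t\<bar> < \<eta>"
proof -
  \<comment> \<open>The bounds t/2 and (1-t)/2 keep m/(m+n) above t/2 and n/(m+n) above (1-t)/2
    where a negative shift requires it. The remaining \<eta>/2 is for the change of the
    ratio.\<close>
  define \<eta>' where "\<eta>' = min (\<eta> / 2) (min (if j < 0 then t / 2 else 1) (if k < 0 then (1 - t) / 2 else 1))"
  have \<eta>': "\<eta>' > 0" "\<eta>' \<le> \<eta> / 2" "j < 0 \<longrightarrow> \<eta>' \<le> t / 2" "k < 0 \<longrightarrow> \<eta>' \<le> (1 - t) / 2"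
    using \<eta> jk unfolding \<eta>'_def by (auto simp del: less_divide_eq_numeral1 le_divide_eq_numeral1 divide_le_eq_numeral1 intro: min.coboundedI2)
  define J where "J = real_of_int (\<bar>j\<bar> + \<bar>k\<bar>)"
  have J0: "0 \<le> J" by (simp add: J_def)
  \<comment> \<open>The summands serve, in turn, the change of degree, the required degree M, the
    change of the ratio, and nonnegativity of m + j and n + k. At t = 0 or t = 1 the quotient with
    zero denominator is 0, so one formula covers the ends.\<close>
  obtain N :: nat where N: "J + real M + 4 * J / \<eta> + 2 * J / t + 2 * J / (1 - t) + 1 \<le> real N" using real_arch_simple by blast
  have terms: "0 \<le> 4 * J / \<eta>" "0 \<le> 2 * J / t" "0 \<le> 2 * J / (1 - t)" using J0 \<eta> t by auto
  show thesis
  proof (rule that[of \<eta>' N])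
    fix m n :: nat assume mn: "N \<le> m + n" and close: "\<bar>real m / real (m + n) - t\<bar> < \<eta>'"
    define l where "l = real m + real n"
    have l: "J + real M + 4 * J / \<eta> + 2 * J / t + 2 * J / (1 - t) + 1 \<le> l"
    proof -
      have "real N \<le> real (m + n)" using mn by (rule of_nat_mono)
      with N show ?thesis by (simp only: l_def of_nat_add)
    qed
    have l0: "l > 0" using l terms J0 by linarith
    have cl: "\<bar>real m / l - t\<bar> < \<eta>'" using close by (simp add: l_def)
    have m0: "0 \<le> int m + j"
    proof (cases "j < 0")
      case True
      then have t0: "t > 0" using jk by simp
      have "real m / l > t / 2" using cl \<eta>'(3)[rule_format, OF True] unfolding abs_less_iff by linarith
      then have "real m > t / 2 * l" using l0 by (simp add: field_simps)
      moreover have "t / 2 * (2 * J / t) \<le> t / 2 * l" using t0 l terms J0 by (intro mult_left_mono) linarith+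
      then have "J \<le> t / 2 * l" using t0 by simp
      ultimately have "real_of_int \<bar>j\<bar> \<le> real m" by (simp add: J_def)
      then show ?thesis by linarith
    qed simp
    have n0: "0 \<le> int n + k"
    proof (cases "k < 0")
      case True
      then have t0: "1 - t > 0" using jk by simp
      have "real n / l = 1 - real m / l" using l0 by (simp add: l_def field_simps)
      then have "real n / l > (1 - t) / 2" using cl \<eta>'(4)[rule_format, OF True] unfolding abs_less_iff diff_divide_distrib by linarith
      then have "real n > (1 - t) / 2 * l" using l0 by (simp add: field_simps)
      moreover have "2 * J / (1 - t) \<le> l" using l terms J0 by linarith
      then have "(1 - t) / 2 * (2 * J / (1 - t)) \<le> (1 - t) / 2 * l" using t0 by (intro mult_left_mono) auto
      then have "J \<le> (1 - t) / 2 * l" using t0 by simp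
      ultimately have "real_of_int \<bar>k\<bar> \<le> real n" by (simp add: J_def)
      then show ?thesis by linarith
    qed simp
    define m' n' where "m' = nat (int m + j)" and "n' = nat (int n + k)"
    have m': "real m' = real m + of_int j" "real n' = real n + of_int k"
      using m0 n0 by (simp_all add: m'_def n'_def)
    define l' where "l' = real m' + real n'"
    have l'_eq: "l' = l + of_int j + of_int k" by (simp add: l'_def m' l_def)
    have Jb: "\<bar>of_int j + of_int k\<bar> \<le> J" "\<bar>real_of_int j\<bar> \<le> J" by (simp_all add: J_def)
    have l'_ge: "real M + 4 * J / \<eta> + 1 \<le> l'" using l Jb terms unfolding l'_eq by linarith
    have l'0: "l' > 0" using l'_ge terms by linarith
    have "\<bar>real m' / l' - real m / l\<bar> \<le> 2 * J / l'"
    proof -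
      have "real m' / l' - real m / l = (of_int j - (real m / l) * (of_int j + of_int k)) / l'"
        using l0 l'0 unfolding m' l'_eq by (simp add: field_simps)
      moreover have "\<bar>of_int j - (real m / l) * (of_int j + of_int k)\<bar> \<le> 2 * J"
      proof -
        have "0 \<le> real m / l" "real m / l \<le> 1" using l0 by (simp_all add: l_def)
        then have "\<bar>(real m / l) * (of_int j + of_int k)\<bar> \<le> 1 * J"
          unfolding abs_mult using Jb by (intro mult_mono) auto
        then show ?thesis using Jb(2) by (intro order_trans[OF abs_triangle_ineq4]) simp
      qed
      ultimately show ?thesis using l'0 by (simp add: abs_divide divide_right_mono)
    qed
    also have "2 * J / l' < \<eta> / 2"
    proof -
      have "4 * J / \<eta> < l'" using l'_ge by simp
      then show ?thesis using \<eta> l'0 by (simp add: field_simps)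
    qed
    finally have "\<bar>real m' / l' - t\<bar> < \<eta>" using cl \<eta>'(2) by linarith
    moreover have "M \<le> m' + n'"
    proof -
      have "real M \<le> real (m' + n')" using l'_ge terms by (simp add: l'_def)
      then show ?thesis by (simp only: of_nat_le_iff)
    qed
    ultimately show "0 \<le> int m + j \<and> 0 \<le> int n + k \<and> M \<le> nat (int m + j) + nat (int n + k) \<and>
      \<bar>real (nat (int m + j)) / real (nat (int m + j) + nat (int n + k)) - t\<bar> < \<eta>"
      using m0 n0 by (simp add: m'_def n'_def l'_def)
  qed (use \<eta>' \<eta> in auto)
qed

lemma mono2_shift:
  assumes "j < 0 \<longrightarrow> fst x \<noteq> 0" "k < 0 \<longrightarrow> snd x \<noteq> 0" "0 \<le> int m + j" "0 \<le> int n + k"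
  shows "mono2 (nat (int m + j), nat (int n + k)) x = fst x powi j * snd x powi k * mono2 (m, n) x"
  using assms by (simp add: mono2_def power_shift)

text \<open>Near the maximisers \<phi> is close to C z^j w^k, so on U the product with the monomial
  is close to C times the shifted monomial. Off U both are negligible by concentration, which is
  applied to the original and to the shifted exponents.\<close>

lemma local_multiplier_estimate:
  assumes \<phi>: "continuous_on (closure \<Omega>) \<phi>" and t: "0 \<le> t" "t \<le> 1"
    and eq: "\<And>p. p \<in> maximizers t \<Longrightarrow> \<phi> p = C * (fst p powi j * snd p powi k)"
    and nz: "\<And>p. C \<noteq> 0 \<Longrightarrow> p \<in> maximizers t \<Longrightarrow> (j < 0 \<longrightarrow> fst p \<noteq> 0) \<and> (k < 0 \<longrightarrow> snd p \<noteq> 0)"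
    and jk: "C \<noteq> 0 \<Longrightarrow> (j < 0 \<longrightarrow> t > 0) \<and> (k < 0 \<longrightarrow> t < 1)"
    and e: "e > 0"
  obtains \<eta> N where "\<eta> > 0" "\<And>m n. N \<le> m + n \<Longrightarrow> \<bar>real m / real (m + n) - t\<bar> < \<eta> \<Longrightarrow>
    \<exists>c. (c \<noteq> 0 \<longrightarrow> 0 \<le> int m + j \<and> 0 \<le> int n + k) \<and>
      L2_norm \<Omega> (\<lambda>x. \<phi> x * mono2 (m, n) x - c * mono2 (nat (int m + j), nat (int n + k)) x) \<le> e * L2_norm \<Omega> (mono2 (m, n))"
proof -
  have "bounded (\<phi> ` closure \<Omega>)" by (rule compact_imp_bounded[OF compact_continuous_image[OF \<phi> compact_cl]])
  then obtain M0 where M0: "\<And>x. x \<in> closure \<Omega> \<Longrightarrow> cmod (\<phi> x) \<le> M0" unfolding bounded_iff by blast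
  define M where "M = max M0 0"
  have M: "0 \<le> M" "\<And>x. x \<in> \<Omega> \<Longrightarrow> cmod (\<phi> x) \<le> M"
    using M0 closure_subset by (fastforce simp: M_def)+
  define \<epsilon> where "\<epsilon> = e / 2"
  have \<epsilon>: "\<epsilon> > 0" using e by (simp add: \<epsilon>_def)
  \<comment> \<open>The open set on which the Laurent monomial has no pole; for C = 0 there is
    nothing to avoid.\<close>
  define O' where "O' = {p :: C2. C \<noteq> 0 \<longrightarrow> (j < 0 \<longrightarrow> fst p \<noteq> 0) \<and> (k < 0 \<longrightarrow> snd p \<noteq> 0)}"
  have "O' = (if C \<noteq> 0 \<and> j < 0 then {p. fst p \<noteq> 0} else UNIV) \<inter> (if C \<noteq> 0 \<and> k < 0 then {p. snd p \<noteq> 0} else UNIV)"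
    by (auto simp: O'_def)
  moreover have "open {p :: C2. fst p \<noteq> 0}" "open {p :: C2. snd p \<noteq> 0}"
    by (intro open_Collect_neq continuous_intros)+
  ultimately have O': "open O'" by auto
  define g where "g = (\<lambda>p. \<phi> p - C * (fst p powi j * snd p powi k))"
  have pw: "continuous_on A (\<lambda>p. f p powi i)" if "continuous_on A f" "i < 0 \<longrightarrow> (\<forall>p\<in>A. f p \<noteq> 0)" for A and f :: "C2 \<Rightarrow> complex" and i
    using that by (cases "i < 0") (auto simp: power_int_def intro!: continuous_intros)
  have g: "continuous_on (closure \<Omega> \<inter> O') g"
  proof (cases "C = 0")
    case False
    then show ?thesis unfolding g_def
      by (intro continuous_intros pw continuous_on_subset[OF \<phi>]) (auto simp: O'_def)
  qed (simp add: g_def continuous_on_subset[OF \<phi>])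
  have "openin (top_of_set (closure \<Omega> \<inter> O')) ((closure \<Omega> \<inter> O') \<inter> g -` ball 0 \<epsilon>)"
    by (rule continuous_openin_preimage_gen[OF g]) simp
  then obtain V where V: "open V" "(closure \<Omega> \<inter> O') \<inter> g -` ball 0 \<epsilon> = (closure \<Omega> \<inter> O') \<inter> V"
    unfolding openin_open by blast
  define U where "U = V \<inter> O'"
  have U: "open U" unfolding U_def using V(1) O' by blast
  have AU: "maximizers t \<subseteq> U"
  proof
    fix p assume p: "p \<in> maximizers t"
    have "p \<in> closure \<Omega>" using p by (simp add: maximizers_def)
    moreover have "p \<in> O'" using nz p by (auto simp: O'_def)
    moreover have "g p = 0" using eq[OF p] by (simp add: g_def)
    ultimately have "p \<in> (closure \<Omega> \<inter> O') \<inter> g -` ball 0 \<epsilon>" using \<epsilon> by simp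
    then show "p \<in> U" unfolding V(2) U_def by blast
  qed
  have near: "cmod (g x) \<le> \<epsilon>" if "x \<in> \<Omega>" "x \<in> U" for x
  proof -
    have "x \<in> (closure \<Omega> \<inter> O') \<inter> V" using that closure_subset by (auto simp: U_def)
    then have "x \<in> g -` ball 0 \<epsilon>" unfolding V(2)[symmetric] by blast
    then show ?thesis by simp
  qed
  \<comment> \<open>The far parts sum to \<delta> (3M + 2\<epsilon>) times the norm of the monomial
    and must stay below \<epsilon>. The bound 1/2 lets \<delta> E' be absorbed into E'.\<close>
  define \<delta> where "\<delta> = min (1 / 2) (\<epsilon> / (3 * M + 2 * \<epsilon> + 1))"
  have den: "3 * M + 2 * \<epsilon> + 1 > 0" using M \<epsilon> by simp
  have "\<delta> > 0" using den \<epsilon> by (simp add: \<delta>_def)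
  moreover have "\<delta> \<le> 1 / 2" unfolding \<delta>_def by (rule min.cobounded1)
  ultimately have \<delta>: "\<delta> > 0" "\<delta> \<le> 1 / 2" by blast+
  have \<delta>2: "\<delta> * (3 * M + 2 * \<epsilon>) \<le> \<epsilon>"
  proof -
    have "\<delta> * (3 * M + 2 * \<epsilon>) \<le> \<epsilon> / (3 * M + 2 * \<epsilon> + 1) * (3 * M + 2 * \<epsilon> + 1)"
      using M \<epsilon> den by (intro mult_mono) (auto simp: \<delta>_def)
    then show ?thesis using den by simp
  qed
  obtain \<eta>1 N1 where \<eta>1: "\<eta>1 > 0" and conc: "\<And>m n. N1 \<le> m + n \<Longrightarrow> \<bar>real m / real (m + n) - t\<bar> < \<eta>1 \<Longrightarrow>
    L2_norm \<Omega> (\<lambda>x. indicator (- U) x * mono2 (m, n) x) \<le> \<delta> * L2_norm \<Omega> (mono2 (m, n))"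
    by (rule monomial_concentration[OF t U AU \<delta>(1)]) (rule that)
  have \<phi>m: "\<phi> \<in> borel_measurable (lebesgue_on \<Omega>)"
    by (rule continuous_on_lebesgue_measurable[OF op continuous_on_subset[OF \<phi> closure_subset]])
  have [measurable]: "U \<in> sets borel" using U by simp
  have indm: "(\<lambda>x. indicator B x :: complex) \<in> borel_measurable (lebesgue_on \<Omega>)" if "B \<in> sets borel" for B
    using that by (intro measurable_restrict_space1) (simp add: borel_measurable_indicator)
  have ind2: "(\<lambda>x. indicator B x * u x) \<in> L2 \<Omega>" if "B \<in> sets borel" "u \<in> L2 \<Omega>" for B u
    by (rule L2_mult_bounded[OF that(2) indm[OF that(1)], where M=1]) (simp add: indicator_def)
  have split: "L2_norm \<Omega> u \<le> L2_norm \<Omega> (\<lambda>x. indicator U x * u x) + L2_norm \<Omega> (\<lambda>x. indicator (- U) x * u x)" if u: "u \<in> L2 \<Omega>" for u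
  proof -
    have "L2_norm \<Omega> u = L2_norm \<Omega> (\<lambda>x. indicator U x * u x + indicator (- U) x * u x)"
      by (rule L2_norm_cong) (simp add: indicator_def)
    also have "\<dots> \<le> L2_norm \<Omega> (\<lambda>x. indicator U x * u x) + L2_norm \<Omega> (\<lambda>x. indicator (- U) x * u x)"
      by (rule L2_triangle[OF ind2[OF _ u] ind2[OF _ u]]) simp_all
    finally show ?thesis .
  qed
  have \<phi>mono: "(\<lambda>x. \<phi> x * mono2 s x) \<in> L2 \<Omega>" for s by (rule L2_mult_bounded[OF mono2_L2 \<phi>m M(2)])
  have far\<phi>: "L2_norm \<Omega> (\<lambda>x. indicator (- U) x * (\<phi> x * mono2 s x)) \<le> M * L2_norm \<Omega> (\<lambda>x. indicator (- U) x * mono2 s x)" for s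
  proof -
    have "L2_norm \<Omega> (\<lambda>x. indicator (- U) x * (\<phi> x * mono2 s x)) = L2_norm \<Omega> (\<lambda>x. \<phi> x * (indicator (- U) x * mono2 s x))"
      by (simp add: mult_ac)
    also have "\<dots> \<le> M * L2_norm \<Omega> (\<lambda>x. indicator (- U) x * mono2 s x)"
      by (rule L2_norm_mult_bounded[OF ind2[OF _ mono2_L2] M(2,1)]) simp
    finally show ?thesis .
  qed
  show thesis
  proof (cases "C = 0")
    \<comment> \<open>With C = 0 the shifted exponents may be negative, so the multiple 0 is chosen
      and no shift takes place.\<close>
    case True
    show thesis
    proof (rule that[of \<eta>1 N1])
      fix m n assume mn: "N1 \<le> m + n" "\<bar>real m / real (m + n) - t\<bar> < \<eta>1"
      let ?e = "mono2 (m, n)"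
      have "L2_norm \<Omega> (\<lambda>x. \<phi> x * ?e x) \<le> L2_norm \<Omega> (\<lambda>x. indicator U x * (\<phi> x * ?e x)) + L2_norm \<Omega> (\<lambda>x. indicator (- U) x * (\<phi> x * ?e x))"
        by (rule split[OF \<phi>mono])
      also have "L2_norm \<Omega> (\<lambda>x. indicator U x * (\<phi> x * ?e x)) = L2_norm \<Omega> (\<lambda>x. (indicator U x * \<phi> x) * ?e x)"
        by (simp add: mult_ac)
      also have "\<dots> \<le> \<epsilon> * L2_norm \<Omega> ?e"
        by (rule L2_norm_mult_bounded[OF mono2_L2]) (use near True \<epsilon> in \<open>auto simp: g_def indicator_def\<close>)
      also have "L2_norm \<Omega> (\<lambda>x. indicator (- U) x * (\<phi> x * ?e x)) \<le> M * (\<delta> * L2_norm \<Omega> ?e)"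
        using order_trans[OF far\<phi> mult_left_mono[OF conc[OF mn] M(1)]] .
      also have "\<epsilon> * L2_norm \<Omega> ?e + M * (\<delta> * L2_norm \<Omega> ?e) = (\<epsilon> + \<delta> * M) * L2_norm \<Omega> ?e" by (simp add: algebra_simps)
      also have "\<dots> \<le> e * L2_norm \<Omega> ?e"
      proof (rule mult_right_mono)
        have "\<delta> * M \<le> \<delta> * (3 * M + 2 * \<epsilon>)" using \<delta> M \<epsilon> by (intro mult_left_mono) auto
        then show "\<epsilon> + \<delta> * M \<le> e" using \<delta>2 by (simp add: \<epsilon>_def)
      qed simp
      finally show "\<exists>c. (c \<noteq> 0 \<longrightarrow> 0 \<le> int m + j \<and> 0 \<le> int n + k) \<and>
        L2_norm \<Omega> (\<lambda>x. \<phi> x * ?e x - c * mono2 (nat (int m + j), nat (int n + k)) x) \<le> e * L2_norm \<Omega> ?e"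
        by (intro exI[of _ 0]) simp
    qed (rule \<eta>1)
  next
    case False
    obtain \<eta> N where \<eta>: "\<eta> > 0" "\<eta> \<le> \<eta>1" and shift: "\<And>m n :: nat. N \<le> m + n \<Longrightarrow> \<bar>real m / real (m + n) - t\<bar> < \<eta> \<Longrightarrow>
     0 \<le> int m + j \<and> 0 \<le> int n + k \<and> N1 \<le> nat (int m + j) + nat (int n + k) \<and>
     \<bar>real (nat (int m + j)) / real (nat (int m + j) + nat (int n + k)) - t\<bar> < \<eta>1"
      by (rule exponent_shift_ratio[OF \<eta>1 t, of j k N1]) (use jk[OF False] in auto)
    show thesis
    proof (rule that[of \<eta> "max N N1"])
      fix m n assume mn0: "max N N1 \<le> m + n" "\<bar>real m / real (m + n) - t\<bar> < \<eta>"
      then have mn: "N1 \<le> m + n" "\<bar>real m / real (m + n) - t\<bar> < \<eta>1" using \<eta> by auto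
      let ?e = "mono2 (m, n)" and ?e' = "mono2 (nat (int m + j), nat (int n + k))"
      have sh: "0 \<le> int m + j" "0 \<le> int n + k" "N1 \<le> nat (int m + j) + nat (int n + k)"
        "\<bar>real (nat (int m + j)) / real (nat (int m + j) + nat (int n + k)) - t\<bar> < \<eta>1"
        using shift[of m n] mn0 by auto
      define E E' where "E = L2_norm \<Omega> ?e" and "E' = cmod C * L2_norm \<Omega> ?e'"
      have E0: "0 \<le> E" "0 \<le> E'" by (simp_all add: E_def E'_def)
      have onU: "?e' x = fst x powi j * snd x powi k * ?e x" if "x \<in> U" for x
        by (rule mono2_shift) (use that sh False in \<open>auto simp: U_def O'_def\<close>)
      have farC: "L2_norm \<Omega> (\<lambda>x. indicator (- U) x * (C * ?e' x)) \<le> \<delta> * E'"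
      proof -
        have "L2_norm \<Omega> (\<lambda>x. indicator (- U) x * (C * ?e' x)) = L2_norm \<Omega> (\<lambda>x. C * (indicator (- U) x * ?e' x))"
          by (simp add: mult_ac)
        also have "\<dots> = cmod C * L2_norm \<Omega> (\<lambda>x. indicator (- U) x * ?e' x)" by (rule L2_norm_cmult)
        also have "\<dots> \<le> cmod C * (\<delta> * L2_norm \<Omega> ?e')" by (rule mult_left_mono[OF conc[OF sh(3,4)]]) simp
        finally show ?thesis by (simp add: E'_def mult_ac)
      qed
      \<comment> \<open>The size of the shifted monomial is not known beforehand. Its part on U is
        at most (M + \<epsilon>) E, and the rest is at most half of E' itself, which bounds E' by 2
        (M + \<epsilon>) E.\<close>
      have "E' = L2_norm \<Omega> (\<lambda>x. C * ?e' x)" unfolding E'_def by (simp only: L2_norm_cmult)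
      also have "\<dots> \<le> L2_norm \<Omega> (\<lambda>x. indicator U x * (C * ?e' x)) + L2_norm \<Omega> (\<lambda>x. indicator (- U) x * (C * ?e' x))"
        by (rule split[OF L2_cmult[OF mono2_L2]])
      also have "L2_norm \<Omega> (\<lambda>x. indicator U x * (C * ?e' x)) = L2_norm \<Omega> (\<lambda>x. (indicator U x * (C * (fst x powi j * snd x powi k))) * ?e x)"
        by (rule L2_norm_cong) (simp add: indicator_def onU mult.assoc)
      also have "\<dots> \<le> (M + \<epsilon>) * E" unfolding E_def
      proof (rule L2_norm_mult_bounded[OF mono2_L2])
        fix x assume x: "x \<in> \<Omega>"
        show "cmod (indicator U x * (C * (fst x powi j * snd x powi k))) \<le> M + \<epsilon>"
        proof (cases "x \<in> U")
          case True
          have "cmod (C * (fst x powi j * snd x powi k)) = cmod (\<phi> x - g x)" by (simp add: g_def)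
          also have "\<dots> \<le> M + \<epsilon>" using norm_triangle_ineq4[of "\<phi> x" "g x"] M(2)[OF x] near[OF x True] by linarith
          finally show ?thesis using True by simp
        qed (use M \<epsilon> in simp)
      qed (use M \<epsilon> in simp)
      finally have "E' \<le> (M + \<epsilon>) * E + \<delta> * E'" using farC by simp
      moreover have "\<delta> * E' \<le> 1 / 2 * E'" using \<delta> E0 by (intro mult_right_mono) auto
      ultimately have E'E: "E' \<le> 2 * ((M + \<epsilon>) * E)" by simp
      let ?u = "\<lambda>x. \<phi> x * ?e x - C * ?e' x"
      have u: "?u \<in> L2 \<Omega>" by (rule L2_diff[OF \<phi>mono L2_cmult[OF mono2_L2]])
      have "L2_norm \<Omega> ?u \<le> L2_norm \<Omega> (\<lambda>x. indicator U x * ?u x) + L2_norm \<Omega> (\<lambda>x. indicator (- U) x * ?u x)"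
        by (rule split[OF u])
      also have "L2_norm \<Omega> (\<lambda>x. indicator U x * ?u x) = L2_norm \<Omega> (\<lambda>x. (indicator U x * g x) * ?e x)"
        by (rule L2_norm_cong) (simp add: indicator_def onU g_def left_diff_distrib mult.assoc)
      also have "\<dots> \<le> \<epsilon> * E" unfolding E_def
        by (rule L2_norm_mult_bounded[OF mono2_L2]) (use near \<epsilon> in \<open>auto simp: indicator_def\<close>)
      also have "L2_norm \<Omega> (\<lambda>x. indicator (- U) x * ?u x) \<le> M * (\<delta> * E) + \<delta> * E'"
      proof -
        have "L2_norm \<Omega> (\<lambda>x. indicator (- U) x * ?u x) =
          L2_norm \<Omega> (\<lambda>x. indicator (- U) x * (\<phi> x * ?e x) + (-1) * (indicator (- U) x * (C * ?e' x)))"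
          by (simp add: algebra_simps)
        also have "\<dots> \<le> L2_norm \<Omega> (\<lambda>x. indicator (- U) x * (\<phi> x * ?e x)) + L2_norm \<Omega> (\<lambda>x. (-1) * (indicator (- U) x * (C * ?e' x)))"
          by (rule L2_triangle[OF ind2[OF _ \<phi>mono] L2_cmult[OF ind2[OF _ L2_cmult[OF mono2_L2]]]]) simp_all
        also have "L2_norm \<Omega> (\<lambda>x. (-1) * (indicator (- U) x * (C * ?e' x))) = L2_norm \<Omega> (\<lambda>x. indicator (- U) x * (C * ?e' x))"
          by (subst L2_norm_cmult) simp
        finally show ?thesis
          using farC order_trans[OF far\<phi> mult_left_mono[OF conc[OF mn] M(1)]] by (simp add: E_def)
      qed
      also have "\<epsilon> * E + (M * (\<delta> * E) + \<delta> * E') \<le> \<epsilon> * E + (M * (\<delta> * E) + \<delta> * (2 * ((M + \<epsilon>) * E)))"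
        using E'E \<delta> by (intro add_mono order_refl mult_left_mono) auto
      also have "\<dots> = (\<epsilon> + \<delta> * (3 * M + 2 * \<epsilon>)) * E" by (simp add: algebra_simps)
      also have "\<dots> \<le> e * E" using \<delta>2 E0 by (intro mult_right_mono) (auto simp: \<epsilon>_def)
      finally show "\<exists>c. (c \<noteq> 0 \<longrightarrow> 0 \<le> int m + j \<and> 0 \<le> int n + k) \<and>
        L2_norm \<Omega> (\<lambda>x. \<phi> x * ?e x - c * ?e' x) \<le> e * L2_norm \<Omega> ?e"
        using sh by (intro exI[of _ C]) (simp add: E_def)
    qed (rule \<eta>)
  qed
qed


definition multiplier_good :: "(C2 \<Rightarrow> complex) \<Rightarrow> int \<Rightarrow> int \<Rightarrow> real \<Rightarrow> nat \<times> nat \<Rightarrow> bool" where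
  "multiplier_good \<psi> j k e s \<longleftrightarrow> (\<exists>c. (c \<noteq> 0 \<longrightarrow> 0 \<le> int (fst s) + j \<and> 0 \<le> int (snd s) + k) \<and>
      L2_norm \<Omega> (\<lambda>x. \<psi> x * mono2 s x - c * mono2 (nat (int (fst s) + j), nat (int (snd s) + k)) x) \<le> e * L2_norm \<Omega> (mono2 s))"

text \<open>For C nonzero the clauses on p exclude poles, where \<open>powi\<close> would return the
  default value 0, and those on t guarantee that the shift by (j, k) keeps exponents nonnegative for
  ratios near t. For C = 0 only the vanishing of \<psi> is asserted.\<close>

definition face_monomial :: "(C2 \<Rightarrow> complex) \<Rightarrow> int \<Rightarrow> int \<Rightarrow> real \<Rightarrow> complex \<Rightarrow> bool" where
  "face_monomial \<psi> j k t C \<longleftrightarrow> (\<forall>p\<in>maximizers t. \<psi> p = C * (fst p powi j * snd p powi k)) \<and>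
     (C \<noteq> 0 \<longrightarrow> (\<forall>p\<in>maximizers t. (j < 0 \<longrightarrow> fst p \<noteq> 0) \<and> (k < 0 \<longrightarrow> snd p \<noteq> 0)) \<and> (j < 0 \<longrightarrow> t > 0) \<and> (k < 0 \<longrightarrow> t < 1))"

text \<open>The local estimates hold for large degree and ratio near t. Finitely many such
  neighbourhoods cover [0, 1], so above a common degree every monomial is good.\<close>

lemma finite_bad_monomials:
  assumes \<psi>: "continuous_on (closure \<Omega>) \<psi>" and face: "\<And>t. 0 \<le> t \<Longrightarrow> t \<le> 1 \<Longrightarrow> \<exists>C. face_monomial \<psi> j k t C"
    and e: "e > 0"
  shows "finite {s. \<not> multiplier_good \<psi> j k e s}"
proof -
  have "\<exists>\<eta> N. \<eta> > 0 \<and> (\<forall>m n. N \<le> m + n \<longrightarrow> \<bar>real m / real (m + n) - t\<bar> < \<eta> \<longrightarrow> multiplier_good \<psi> j k e (m, n))"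
    if t: "t \<in> {0..1}" for t
  proof -
    obtain C where C: "face_monomial \<psi> j k t C" using face t by auto
    have t': "0 \<le> t" "t \<le> 1" using t by auto
    obtain \<eta> N where "\<eta> > 0" "\<And>m n. N \<le> m + n \<Longrightarrow> \<bar>real m / real (m + n) - t\<bar> < \<eta> \<Longrightarrow>
      \<exists>c. (c \<noteq> 0 \<longrightarrow> 0 \<le> int m + j \<and> 0 \<le> int n + k) \<and>
      L2_norm \<Omega> (\<lambda>x. \<psi> x * mono2 (m, n) x - c * mono2 (nat (int m + j), nat (int n + k)) x) \<le> e * L2_norm \<Omega> (mono2 (m, n))"
      by (rule local_multiplier_estimate[OF \<psi> t', of C j k e]) (use C e in \<open>auto simp: face_monomial_def\<close>)
    then show ?thesis unfolding multiplier_good_def fst_conv snd_conv by blast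
  qed
  then obtain \<eta> N where \<eta>: "\<And>t. t \<in> {0..1} \<Longrightarrow> \<eta> t > 0"
    and good: "\<And>t m n. t \<in> {0..1} \<Longrightarrow> N t \<le> m + n \<Longrightarrow> \<bar>real m / real (m + n) - t\<bar> < \<eta> t \<Longrightarrow> multiplier_good \<psi> j k e (m, n)"
    by metis
  have "{0..1} \<subseteq> (\<Union>t\<in>{0..1}. ball t (\<eta> t))" using \<eta> by force
  then obtain D where D: "D \<subseteq> {0..1}" "finite D" "{0..1} \<subseteq> (\<Union>t\<in>D. ball t (\<eta> t))"
    using compactE_image[OF compact_Icc, of "{0..1}" "\<lambda>t. ball t (\<eta> t)"] by (metis open_ball)
  \<comment> \<open>Inserting 1 ensures a positive degree, so that the ratio is a true quotient in
    [0, 1], and covers the case of an empty maximum.\<close>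
  define L where "L = Max (insert 1 (N ` D))"
  have L: "1 \<le> L" "\<And>t. t \<in> D \<Longrightarrow> N t \<le> L" unfolding L_def using D(2) by auto
  have "{s. \<not> multiplier_good \<psi> j k e s} \<subseteq> {..L} \<times> {..L}"
  proof clarify
    fix m n assume bad: "\<not> multiplier_good \<psi> j k e (m, n)"
    have "m + n < L"
    proof (rule ccontr)
      assume "\<not> m + n < L"
      then have mn: "L \<le> m + n" by simp
      then have "real m + real n > 0" using L(1) by linarith
      then have "real m / real (m + n) \<in> {0..1}" by (simp add: divide_le_eq)
      then obtain t where "t \<in> D" "real m / real (m + n) \<in> ball t (\<eta> t)" using D(3) by blast
      then show False using bad good[of t m n] L(2)[of t] mn D(1)
        by (auto simp: dist_real_def abs_minus_commute)
    qed
    then show "m \<in> {..L} \<and> n \<in> {..L}" by simp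
  qed
  then show ?thesis by (rule finite_subset) simp
qed

text \<open>Product and correction share the weight (m + j, n + k). Errors for distinct monomials
  therefore have distinct weights and are orthogonal.\<close>

lemma torus_mode_multiplier:
  assumes \<psi>: "torus_mode j k \<Omega> \<psi>" and c: "c \<noteq> 0 \<longrightarrow> 0 \<le> int (fst s) + j \<and> 0 \<le> int (snd s) + k"
  shows "torus_mode (int (fst s) + j) (int (snd s) + k) \<Omega>
    (\<lambda>x. b * (\<psi> x * mono2 s x - c * mono2 (nat (int (fst s) + j), nat (int (snd s) + k)) x))"
  unfolding torus_mode_def
proof (intro allI impI)
  fix z w a d assume x: "(z, w) \<in> \<Omega>" and ad: "cmod a = 1" "cmod d = 1"
  have nz: "a \<noteq> 0" "d \<noteq> 0" using ad by auto
  let ?l = "nat (int (fst s) + j)" and ?r = "nat (int (snd s) + k)"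
  have 1: "\<psi> (a * z, d * w) = a powi j * d powi k * \<psi> (z, w)" by (rule torus_modeD[OF \<psi> x ad])
  have 2: "mono2 s (a * z, d * w) = a powi int (fst s) * d powi int (snd s) * mono2 s (z, w)"
    by (simp add: mono2_def power_mult_distrib)
  have 3: "c * mono2 (?l, ?r) (a * z, d * w) = a powi (int (fst s) + j) * d powi (int (snd s) + k) * (c * mono2 (?l, ?r) (z, w))"
  proof (cases "c = 0")
    case False
    then have "a powi (int (fst s) + j) = a ^ ?l" "d powi (int (snd s) + k) = d ^ ?r"
      using c by (simp_all add: power_int_def)
    then show ?thesis by (simp add: mono2_def power_mult_distrib)
  qed simp
  have pj: "a powi (int (fst s) + j) = a powi int (fst s) * a powi j" "d powi (int (snd s) + k) = d powi int (snd s) * d powi k"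
    using nz by (simp_all add: power_int_add)
  show "b * (\<psi> (a * z, d * w) * mono2 s (a * z, d * w) - c * mono2 (?l, ?r) (a * z, d * w)) =
     a powi (int (fst s) + j) * d powi (int (snd s) + k) * (b * (\<psi> (z, w) * mono2 s (z, w) - c * mono2 (?l, ?r) (z, w)))"
    unfolding 1 2 3 unfolding pj by (simp add: algebra_simps)
qed

lemma mono2_orthogonal: "s \<noteq> s' \<Longrightarrow> L2_inner \<Omega> (mono2 s) (mono2 s') = 0"
  by (rule torus_modes_orthogonal[OF continuous_mono2 torus_mode_mono2 continuous_mono2 torus_mode_mono2])
     (auto simp: prod_eq_iff)

lemma mono2_norm_pos: "L2_norm \<Omega> (mono2 s) > 0"
proof -
  obtain \<delta> :: real where \<delta>: "\<delta> > 0" "(of_real \<delta>, of_real \<delta>) \<in> \<Omega>" by (rule diag_in)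
  have "L2_norm \<Omega> (mono2 s) \<noteq> 0"
    using bergman_norm_zero[OF op mono2_bergman _ \<delta>(2), of s] \<delta>(1) by (auto simp: mono2_def)
  then show ?thesis using L2_norm_nonneg[of \<Omega> "mono2 s"] by linarith
qed

text \<open>For a polynomial each term is corrected separately. The good terms give orthogonal
  errors, which sum by Pythagoras to e times the norm; the finitely many bad ones are charged to
  their coefficients. Density carries the bound to all f, where half of \<epsilon> pays for the
  approximation.\<close>

lemma hankel_estimate_mode:
  assumes \<psi>: "continuous_on (closure \<Omega>) \<psi>" and mode: "torus_mode j k \<Omega> \<psi>"
    and face: "\<And>t. 0 \<le> t \<Longrightarrow> t \<le> 1 \<Longrightarrow> \<exists>C. face_monomial \<psi> j k t C"
  shows "hankel_estimate \<Omega> \<psi>"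
  unfolding hankel_estimate_def
proof (intro allI impI)
  fix \<epsilon> :: real assume "\<epsilon> > 0"
  define e where "e = \<epsilon> / 2"
  have e: "e > 0" using \<open>\<epsilon> > 0\<close> by (simp add: e_def)
  have "bounded (\<psi> ` closure \<Omega>)" by (rule compact_imp_bounded[OF compact_continuous_image[OF \<psi> compact_cl]])
  then obtain M0 where M0: "\<And>x. x \<in> closure \<Omega> \<Longrightarrow> cmod (\<psi> x) \<le> M0" unfolding bounded_iff by blast
  define M where "M = max M0 0"
  have M: "0 \<le> M" "\<And>x. x \<in> \<Omega> \<Longrightarrow> cmod (\<psi> x) \<le> M"
    using M0 closure_subset by (fastforce simp: M_def)+
  have \<psi>c: "continuous_on \<Omega> \<psi>" by (rule continuous_on_subset[OF \<psi> closure_subset])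
  have \<psi>m: "\<psi> \<in> borel_measurable (lebesgue_on \<Omega>)" by (rule continuous_on_lebesgue_measurable[OF op \<psi>c])
  define S where "S = {s. \<not> multiplier_good \<psi> j k e s}"
  have S: "finite S" unfolding S_def by (rule finite_bad_monomials[OF \<psi> face e])
  \<comment> \<open>One predicate for good and exceptional monomials, so that a single choice
    function results. For an exceptional monomial the multiple 0 with the trivial bound M is a
    witness.\<close>
  define P where "P = (\<lambda>s c. (c \<noteq> 0 \<longrightarrow> 0 \<le> int (fst s) + j \<and> 0 \<le> int (snd s) + k) \<and>
      L2_norm \<Omega> (\<lambda>x. \<psi> x * mono2 s x - c * mono2 (nat (int (fst s) + j), nat (int (snd s) + k)) x) \<le> (if s \<in> S then M else e) * L2_norm \<Omega> (mono2 s))"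
  have "\<exists>c. P s c" for s
  proof (cases "s \<in> S")
    case True
    then show ?thesis using L2_norm_mult_bounded[OF mono2_L2[of s] M(2,1)] unfolding P_def by (intro exI[of _ 0]) simp
  next
    case False
    then have "multiplier_good \<psi> j k e s" by (simp add: S_def)
    then show ?thesis unfolding P_def multiplier_good_def if_not_P[OF False] .
  qed
  then obtain c where cP: "\<And>s. P s (c s)" by metis
  have c: "c s \<noteq> 0 \<longrightarrow> 0 \<le> int (fst s) + j \<and> 0 \<le> int (snd s) + k" for s using cP unfolding P_def by blast
  have cn: "L2_norm \<Omega> (\<lambda>x. \<psi> x * mono2 s x - c s * mono2 (nat (int (fst s) + j), nat (int (snd s) + k)) x)
      \<le> (if s \<in> S then M else e) * L2_norm \<Omega> (mono2 s)" for s using cP unfolding P_def by blast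
  define e' where "e' = (\<lambda>s. mono2 (nat (int (fst s) + j), nat (int (snd s) + k)))"
  \<comment> \<open>The inner product of a polynomial with a monomial is its coefficient times the
    squared norm of the monomial. Bounding M |a s| times the norm by it costs the factor M divided
    by that norm.\<close>
  define C where "C = (\<Sum>s\<in>S. M / L2_norm \<Omega> (mono2 s))"
  have Cs: "M / L2_norm \<Omega> (mono2 s) \<le> C" if "s \<in> S" for s
    unfolding C_def by (rule member_le_sum[OF that _ S]) (use M in auto)
  have C0: "0 \<le> C" unfolding C_def using M by (intro sum_nonneg) auto
  let ?I = "\<lambda>f. \<Sum>s\<in>S. cmod (L2_inner \<Omega> f (mono2 s))"
  have poly: "\<exists>g\<in>bergman_space \<Omega>. L2_norm \<Omega> (\<lambda>x. \<psi> x * (\<Sum>s\<in>T. a s * mono2 s x) - g x)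
      \<le> e * L2_norm \<Omega> (\<lambda>x. \<Sum>s\<in>T. a s * mono2 s x) + C * ?I (\<lambda>x. \<Sum>s\<in>T. a s * mono2 s x)" if T: "finite T" for T a
  proof -
    let ?p = "\<lambda>x. \<Sum>s\<in>T. a s * mono2 s x"
    define g where "g = (\<lambda>x. \<Sum>s\<in>T. (a s * c s) * e' s x)"
    have g: "g \<in> bergman_space \<Omega>" unfolding g_def e'_def by (intro bergman_sum bergman_cmult mono2_bergman)
    define v where "v = (\<lambda>s x. a s * (\<psi> x * mono2 s x - c s * e' s x))"
    have \<psi>mono: "(\<lambda>x. \<psi> x * mono2 s x) \<in> L2 \<Omega>" for s by (rule L2_mult_bounded[OF mono2_L2 \<psi>m M(2)])
    have v2: "v s \<in> L2 \<Omega>" for s unfolding v_def e'_def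
      by (rule L2_cmult[OF L2_diff[OF \<psi>mono L2_cmult[OF mono2_L2]]])
    have vc: "continuous_on \<Omega> (v s)" for s unfolding v_def e'_def
      by (intro continuous_intros \<psi>c continuous_mono2)
    have vm: "torus_mode (int (fst s) + j) (int (snd s) + k) \<Omega> (v s)" for s
      unfolding v_def e'_def by (rule torus_mode_multiplier[OF mode c])
    have vorth: "L2_inner \<Omega> (v s) (v s') = 0" if "s \<noteq> s'" for s s'
      by (rule torus_modes_orthogonal[OF vc vm vc vm]) (use that in \<open>auto simp: prod_eq_iff\<close>)
    have vn: "L2_norm \<Omega> (v s) \<le> (if s \<in> S then M else e) * (cmod (a s) * L2_norm \<Omega> (mono2 s))" for s
    proof -
      have "L2_norm \<Omega> (v s) = cmod (a s) * L2_norm \<Omega> (\<lambda>x. \<psi> x * mono2 s x - c s * e' s x)"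
        unfolding v_def by (rule L2_norm_cmult)
      also have "\<dots> \<le> cmod (a s) * ((if s \<in> S then M else e) * L2_norm \<Omega> (mono2 s))"
        using cn[of s] by (intro mult_left_mono) (simp_all add: e'_def)
      finally show ?thesis by (simp only: mult_ac)
    qed
    have pn: "(L2_norm \<Omega> ?p)\<^sup>2 = (\<Sum>s\<in>T. (cmod (a s) * L2_norm \<Omega> (mono2 s))\<^sup>2)"
      by (subst L2_norm_sum_orthogonal[OF T])
         (auto simp: L2_norm_cmult L2_inner_cmult_left L2_inner_cmult_right mono2_orthogonal intro!: L2_cmult mono2_L2)
    have pi: "L2_inner \<Omega> ?p (mono2 s) = a s * of_real ((L2_norm \<Omega> (mono2 s))\<^sup>2)" if s: "s \<in> T" for s
    proof -
      have "L2_inner \<Omega> ?p (mono2 s) = (\<Sum>s'\<in>T. L2_inner \<Omega> (\<lambda>x. a s' * mono2 s' x) (mono2 s))"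
        by (rule L2_inner_sum_left) (auto intro!: L2_cmult mono2_L2)
      also have "\<dots> = (\<Sum>s'\<in>T. if s' = s then a s * of_real ((L2_norm \<Omega> (mono2 s))\<^sup>2) else 0)"
        by (rule sum.cong) (auto simp: L2_inner_cmult_left mono2_orthogonal L2_inner_self[OF mono2_L2])
      finally show ?thesis using T s by simp
    qed
    have "L2_norm \<Omega> (\<lambda>x. \<psi> x * ?p x - g x) = L2_norm \<Omega> (\<lambda>x. \<Sum>s\<in>T. v s x)"
      by (rule L2_norm_cong) (simp add: v_def g_def sum_distrib_left sum_subtractf[symmetric] algebra_simps)
    also have "\<dots> = L2_norm \<Omega> (\<lambda>x. (\<Sum>s\<in>T - S. v s x) + (\<Sum>s\<in>T \<inter> S. v s x))"
      by (subst sum.Int_Diff[OF T, of _ S]) (simp only: add.commute)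
    also have "\<dots> \<le> L2_norm \<Omega> (\<lambda>x. \<Sum>s\<in>T - S. v s x) + L2_norm \<Omega> (\<lambda>x. \<Sum>s\<in>T \<inter> S. v s x)"
      by (rule L2_triangle) (auto intro: v2)
    also have "L2_norm \<Omega> (\<lambda>x. \<Sum>s\<in>T - S. v s x) \<le> e * L2_norm \<Omega> ?p"
    proof (rule power2_le_imp_le)
      have "(L2_norm \<Omega> (\<lambda>x. \<Sum>s\<in>T - S. v s x))\<^sup>2 = (\<Sum>s\<in>T - S. (L2_norm \<Omega> (v s))\<^sup>2)"
        by (rule L2_norm_sum_orthogonal) (use T v2 vorth in auto)
      also have "\<dots> \<le> (\<Sum>s\<in>T - S. e\<^sup>2 * (cmod (a s) * L2_norm \<Omega> (mono2 s))\<^sup>2)"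
      proof (rule sum_mono)
        fix s assume "s \<in> T - S"
        then have "L2_norm \<Omega> (v s) \<le> e * (cmod (a s) * L2_norm \<Omega> (mono2 s))" using vn[of s] by simp
        then have "(L2_norm \<Omega> (v s))\<^sup>2 \<le> (e * (cmod (a s) * L2_norm \<Omega> (mono2 s)))\<^sup>2" by (rule power_mono) simp
        then show "(L2_norm \<Omega> (v s))\<^sup>2 \<le> e\<^sup>2 * (cmod (a s) * L2_norm \<Omega> (mono2 s))\<^sup>2"
          by (simp only: power_mult_distrib)
      qed
      also have "\<dots> \<le> (\<Sum>s\<in>T. e\<^sup>2 * (cmod (a s) * L2_norm \<Omega> (mono2 s))\<^sup>2)"
        by (rule sum_mono2[OF T]) auto
      also have "\<dots> = e\<^sup>2 * (L2_norm \<Omega> ?p)\<^sup>2" unfolding pn by (rule sum_distrib_left[symmetric])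
      finally show "(L2_norm \<Omega> (\<lambda>x. \<Sum>s\<in>T - S. v s x))\<^sup>2 \<le> (e * L2_norm \<Omega> ?p)\<^sup>2"
        by (simp only: power_mult_distrib)
    qed (use e in simp)
    also have "L2_norm \<Omega> (\<lambda>x. \<Sum>s\<in>T \<inter> S. v s x) \<le> C * ?I ?p"
    proof -
      have "L2_norm \<Omega> (\<lambda>x. \<Sum>s\<in>A. v s x) \<le> (\<Sum>s\<in>A. L2_norm \<Omega> (v s))" if "finite A" for A
        using that
      proof (induction A rule: finite_induct)
        case (insert s A)
        have "L2_norm \<Omega> (\<lambda>x. v s x + (\<Sum>s\<in>A. v s x)) \<le> L2_norm \<Omega> (v s) + L2_norm \<Omega> (\<lambda>x. \<Sum>s\<in>A. v s x)"
          by (rule L2_triangle[OF v2 L2_sum[OF v2]])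
        then show ?case using insert by simp
      qed (simp add: L2_norm_def)
      then have "L2_norm \<Omega> (\<lambda>x. \<Sum>s\<in>T \<inter> S. v s x) \<le> (\<Sum>s\<in>T \<inter> S. L2_norm \<Omega> (v s))" using T by simp
      also have "\<dots> \<le> (\<Sum>s\<in>T \<inter> S. C * cmod (L2_inner \<Omega> ?p (mono2 s)))"
      proof (rule sum_mono)
        fix s assume s: "s \<in> T \<inter> S"
        have np: "L2_norm \<Omega> (mono2 s) > 0" by (rule mono2_norm_pos)
        have "L2_norm \<Omega> (v s) \<le> M * (cmod (a s) * L2_norm \<Omega> (mono2 s))" using vn[of s] s by simp
        also have "\<dots> = M / L2_norm \<Omega> (mono2 s) * (cmod (a s) * (L2_norm \<Omega> (mono2 s))\<^sup>2)"
          using np by (simp add: power2_eq_square)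
        also have "\<dots> \<le> C * (cmod (a s) * (L2_norm \<Omega> (mono2 s))\<^sup>2)"
          by (rule mult_right_mono[OF Cs]) (use s in auto)
        also have "cmod (a s) * (L2_norm \<Omega> (mono2 s))\<^sup>2 = cmod (L2_inner \<Omega> ?p (mono2 s))"
          using s by (simp add: pi norm_mult norm_power)
        finally show "L2_norm \<Omega> (v s) \<le> C * cmod (L2_inner \<Omega> ?p (mono2 s))" .
      qed
      also have "\<dots> \<le> (\<Sum>s\<in>S. C * cmod (L2_inner \<Omega> ?p (mono2 s)))"
        by (rule sum_mono2[OF S]) (use C0 in auto)
      finally show ?thesis by (simp only: sum_distrib_left)
    qed
    finally show ?thesis using g by (intro bexI[of _ g]) simp_all
  qed
  have "\<exists>g\<in>bergman_space \<Omega>. L2_norm \<Omega> (\<lambda>x. \<psi> x * f x - g x) \<le> \<epsilon> * L2_norm \<Omega> f + C * ?I f"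
    if f: "f \<in> bergman_space \<Omega>" for f
  \<comment> \<open>Density is applied with a radius proportional to the norm of f, so a function of
    norm 0 is treated apart.\<close>
  proof (cases "L2_norm \<Omega> f = 0")
    case True
    have "L2_norm \<Omega> (\<lambda>x. \<psi> x * f x - 0) = L2_norm \<Omega> (\<lambda>x. 0)"
      by (rule L2_norm_cong) (simp add: bergman_norm_zero[OF op f True])
    then have "L2_norm \<Omega> (\<lambda>x. \<psi> x * f x - 0) = 0" by (simp add: L2_norm_def)
    moreover have "0 \<le> C * ?I f" using C0 by (intro mult_nonneg_nonneg sum_nonneg) auto
    ultimately show ?thesis using True by (intro bexI[OF _ bergman_zero]) simp
  next
    case False
    define W where "W = (\<Sum>s\<in>S. L2_norm \<Omega> (mono2 s))"
    have W0: "0 \<le> W" unfolding W_def by (intro sum_nonneg) simp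
    have den: "M + e + C * W + 1 > 0" using M e C0 W0 by (intro add_nonneg_pos add_nonneg_nonneg mult_nonneg_nonneg) auto
    \<comment> \<open>The approximation error r enters through M, through e and through the
      coefficients in S; together these amount to at most e times the norm of f.\<close>
    define r where "r = e * L2_norm \<Omega> f / (M + e + C * W + 1)"
    have "L2_norm \<Omega> f > 0" using False L2_norm_nonneg[of \<Omega> f] by linarith
    then have r: "r > 0" using den e by (simp add: r_def)
    obtain T a where T: "finite T" and pf: "L2_norm \<Omega> (\<lambda>x. f x - (\<Sum>s\<in>T. a s * mono2 s x)) < r"
      by (rule polynomials_dense[OF f r])
    let ?p = "\<lambda>x. \<Sum>s\<in>T. a s * mono2 s x"
    have p2: "?p \<in> L2 \<Omega>" by (intro L2_sum L2_cmult mono2_L2)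
    have f2: "f \<in> L2 \<Omega>" by (rule bergman_L2[OF f])
    have fp2: "(\<lambda>x. f x - ?p x) \<in> L2 \<Omega>" by (rule L2_diff[OF f2 p2])
    obtain g where g: "g \<in> bergman_space \<Omega>" "L2_norm \<Omega> (\<lambda>x. \<psi> x * ?p x - g x) \<le> e * L2_norm \<Omega> ?p + C * ?I ?p"
      using poly[OF T, of a] by blast
    have "L2_norm \<Omega> (\<lambda>x. \<psi> x * f x - g x) = L2_norm \<Omega> (\<lambda>x. \<psi> x * (f x - ?p x) + (\<psi> x * ?p x - g x))"
      by (rule L2_norm_cong) (simp add: algebra_simps)
    also have "\<dots> \<le> L2_norm \<Omega> (\<lambda>x. \<psi> x * (f x - ?p x)) + L2_norm \<Omega> (\<lambda>x. \<psi> x * ?p x - g x)"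
      by (rule L2_triangle[OF L2_mult_bounded[OF fp2 \<psi>m M(2)] L2_diff[OF L2_mult_bounded[OF p2 \<psi>m M(2)] bergman_L2[OF g(1)]]])
    also have "L2_norm \<Omega> (\<lambda>x. \<psi> x * (f x - ?p x)) \<le> M * r"
      by (rule order_trans[OF L2_norm_mult_bounded[OF fp2 M(2,1)] mult_left_mono[OF less_imp_le[OF pf] M(1)]])
    also note g(2)
    also have "e * L2_norm \<Omega> ?p \<le> e * (L2_norm \<Omega> f + r)"
    proof (rule mult_left_mono)
      have "L2_norm \<Omega> ?p = L2_norm \<Omega> (\<lambda>x. f x + (-1) * (f x - ?p x))" by (rule L2_norm_cong) simp
      also have "\<dots> \<le> L2_norm \<Omega> f + L2_norm \<Omega> (\<lambda>x. (-1) * (f x - ?p x))" by (rule L2_triangle[OF f2 L2_cmult[OF fp2]])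
      also have "L2_norm \<Omega> (\<lambda>x. (-1) * (f x - ?p x)) = L2_norm \<Omega> (\<lambda>x. f x - ?p x)" by (subst L2_norm_cmult) simp
      finally show "L2_norm \<Omega> ?p \<le> L2_norm \<Omega> f + r" using pf by simp
    qed (use e in simp)
    also have "C * ?I ?p \<le> C * (?I f + r * W)"
    proof (rule mult_left_mono)
      have "cmod (L2_inner \<Omega> ?p (mono2 s)) \<le> cmod (L2_inner \<Omega> f (mono2 s)) + r * L2_norm \<Omega> (mono2 s)" for s
      proof -
        have "L2_inner \<Omega> ?p (mono2 s) = L2_inner \<Omega> f (mono2 s) - L2_inner \<Omega> (\<lambda>x. f x - ?p x) (mono2 s)"
          using L2_inner_diff_left[OF f2 p2 mono2_L2, of s] by simp
        then have "cmod (L2_inner \<Omega> ?p (mono2 s)) \<le> cmod (L2_inner \<Omega> f (mono2 s)) + cmod (L2_inner \<Omega> (\<lambda>x. f x - ?p x) (mono2 s))"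
          by (simp only: norm_triangle_ineq4)
        also have "cmod (L2_inner \<Omega> (\<lambda>x. f x - ?p x) (mono2 s)) \<le> L2_norm \<Omega> (\<lambda>x. f x - ?p x) * L2_norm \<Omega> (mono2 s)"
          by (rule L2_Cauchy_Schwarz[OF fp2 mono2_L2])
        also have "\<dots> \<le> r * L2_norm \<Omega> (mono2 s)" using pf by (intro mult_right_mono) auto
        finally show ?thesis by simp
      qed
      then have "?I ?p \<le> (\<Sum>s\<in>S. cmod (L2_inner \<Omega> f (mono2 s)) + r * L2_norm \<Omega> (mono2 s))" by (rule sum_mono)
      then show "?I ?p \<le> ?I f + r * W" by (simp add: sum.distrib W_def sum_distrib_left)
    qed (rule C0)
    also have "M * r + (e * (L2_norm \<Omega> f + r) + C * (?I f + r * W)) = e * L2_norm \<Omega> f + C * ?I f + r * (M + e + C * W)"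
      by (simp add: algebra_simps)
    also have "r * (M + e + C * W) \<le> r * (M + e + C * W + 1)" using r by (intro mult_left_mono) auto
    also have "r * (M + e + C * W + 1) = e * L2_norm \<Omega> f" using den by (simp add: r_def)
    finally have "L2_norm \<Omega> (\<lambda>x. \<psi> x * f x - g x) \<le> \<epsilon> * L2_norm \<Omega> f + C * ?I f" by (simp add: e_def)
    then show ?thesis using g(1) by blast
  qed
  then show "\<exists>C S. finite S \<and> 0 \<le> C \<and> (\<forall>f\<in>bergman_space \<Omega>. \<exists>g\<in>bergman_space \<Omega>.
     L2_norm \<Omega> (\<lambda>x. \<psi> x * f x - g x) \<le> \<epsilon> * L2_norm \<Omega> f + C * (\<Sum>s\<in>S. cmod (L2_inner \<Omega> f (mono2 s))))"
    using S C0 by blast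
qed


lemma maximizers_closed_cl: "p \<in> maximizers t \<Longrightarrow> p \<in> closure \<Omega>"
  by (simp add: maximizers_def)

section \<open>Sufficiency\<close>

lemma real_point_closure:
  assumes "(z, w) \<in> closure \<Omega>" shows "(of_real (cmod z), of_real (cmod w)) \<in> closure \<Omega>"
  by (rule convex_torus_shrink[OF cv_closure tor_closure assms]) simp_all

text \<open>All maximisers have the same moduli x and y, both positive. They form one torus orbit,
  on which a function of weight (j, k) is determined by its value at (x, y).\<close>

lemma face_monomial_interior:
  assumes \<psi>: "torus_mode j k (closure \<Omega>) \<psi>" and t: "0 < t" "t < 1"
  shows "\<exists>C. face_monomial \<psi> j k t C"
proof -
  obtain p0 where p0: "p0 \<in> maximizers t" using maximizers_ex[of t] t by auto
  define x y where "x = cmod (fst p0)" and "y = cmod (snd p0)"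
  have pos: "x > 0" "y > 0"
    using maximizers_pos[OF p0] t by (auto simp: wmono_def wpow_def x_def y_def zero_less_mult_iff)
  have xy: "(of_real x, of_real y) \<in> closure \<Omega>"
    unfolding x_def y_def by (rule real_point_closure) (use maximizers_closed_cl[OF p0] in simp)
  define C where "C = \<psi> (of_real x, of_real y) / (of_real x powi j * of_real y powi k)"
  have "\<psi> p = C * (fst p powi j * snd p powi k)" "fst p \<noteq> 0" "snd p \<noteq> 0" if p: "p \<in> maximizers t" for p
  proof -
    have n: "cmod (fst p) = x" "cmod (snd p) = y" using maximizers_unique[OF t p p0] by (simp_all add: x_def y_def)
    then show nz: "fst p \<noteq> 0" "snd p \<noteq> 0" using pos by auto
    obtain a where a: "cmod a = 1" "fst p = a * of_real x" using unimodular_factor[of "fst p"] n by metis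
    obtain b where b: "cmod b = 1" "snd p = b * of_real y" using unimodular_factor[of "snd p"] n by metis
    have "\<psi> p = \<psi> (a * of_real x, b * of_real y)" using a(2) b(2) by (metis prod.collapse)
    also have "\<dots> = a powi j * b powi k * \<psi> (of_real x, of_real y)" by (rule torus_modeD[OF \<psi> xy a(1) b(1)])
    also have "\<dots> = C * (fst p powi j * snd p powi k)"
      unfolding a(2) b(2) using pos by (simp add: C_def power_int_mult_distrib)
    finally show "\<psi> p = C * (fst p powi j * snd p powi k)" .
  qed
  then show ?thesis using t unfolding face_monomial_def by (intro exI[of _ C]) auto
qed

text \<open>The face consists of the points with |z| <= x and |w| = y. Weight k settles the
  rotations of w, and \<open>hom\<close> the contractions of z from the rim |z| = x; for negative j
  it makes the mode vanish, so that C = 0.\<close>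

lemma face_monomial_0:
  assumes \<psi>: "torus_mode j k (closure \<Omega>) \<psi>"
    and hom: "\<And>z w u. (z, w) \<in> maximizers 0 \<Longrightarrow> cmod u \<le> 1 \<Longrightarrow> \<psi> (u * z, w) = (if 0 \<le> j then u ^ nat j * \<psi> (z, w) else 0)"
  shows "\<exists>C. face_monomial \<psi> j k 0 C"
proof -
  have cl: "closed (maximizers 0)"
  proof -
    have "maximizers 0 = closure \<Omega> \<inter> (\<Inter>q\<in>closure \<Omega>. {p. cmod (snd q) \<le> cmod (snd p)})"
      by (rule set_eqI) (simp add: maximizers_0)
    moreover have "closed {p :: C2. cmod (snd q) \<le> cmod (snd p)}" for q :: C2
      by (intro closed_Collect_le continuous_intros)
    ultimately show ?thesis by (simp only:) (intro closed_Int closed_INT closed_closure ballI)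
  qed
  have "compact (maximizers 0)"
    using compact_Int_closed[OF compact_cl cl] by (simp add: maximizers_def Int_absorb1 Int_commute Collect_mono_iff inf.absorb2)
  moreover have "maximizers 0 \<noteq> {}" using maximizers_ex[of 0] by auto
  moreover have "continuous_on (maximizers 0) (\<lambda>p. cmod (fst p))" by (intro continuous_intros)
  ultimately obtain p0 where p0: "p0 \<in> maximizers 0" and sup: "\<And>p. p \<in> maximizers 0 \<Longrightarrow> cmod (fst p) \<le> cmod (fst p0)"
    using continuous_attains_sup by meson
  define x y where "x = cmod (fst p0)" and "y = cmod (snd p0)"
  have y: "y > 0" using maximizers_pos[OF p0] by (auto simp: wmono_def wpow_def y_def)
  have "(of_real x, of_real y) \<in> closure \<Omega>"
    unfolding x_def y_def by (rule real_point_closure) (use maximizers_closed_cl[OF p0] in simp)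
  then have xy: "(of_real x, of_real y) \<in> maximizers 0" using p0 by (auto simp: maximizers_0 y_def)
  \<comment> \<open>If x = 0 and j > 0 the quotient by 0 is 0, which is the correct value: the mode
    then vanishes on the whole face.\<close>
  define C where "C = (if 0 \<le> j then \<psi> (of_real x, of_real y) / (of_real x ^ nat j * of_real y powi k) else 0)"
  have "\<psi> p = C * (fst p powi j * snd p powi k)" "snd p \<noteq> 0" if p: "p \<in> maximizers 0" for p
  proof -
    have n: "cmod (fst p) \<le> x" using sup[OF p] by (simp add: x_def)
    have yp: "cmod (snd p) = y" using p p0 by (auto simp: maximizers_0 y_def intro: antisym)
    then show "snd p \<noteq> 0" using y by auto
    obtain b where b: "cmod b = 1" "snd p = b * of_real y" using unimodular_factor[of "snd p"] yp by metis
    \<comment> \<open>For x = 0 this is 0 by convention, in accordance with \<open>fst p\<close>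
      being 0.\<close>
    define u where "u = fst p / of_real x"
    have u: "cmod u \<le> 1" "fst p = u * of_real x" "x = 0 \<Longrightarrow> u = 0"
      using n norm_ge_zero[of "fst p"] by (auto simp: u_def norm_divide divide_le_eq x_def)
    have ux: "(u * of_real x, of_real y) \<in> closure \<Omega>"
      by (rule convex_torus_shrink_fst[OF cv_closure tor_closure maximizers_closed_cl[OF xy]])
         (use u in \<open>simp add: norm_mult mult_left_le_one_le\<close>)
    have "\<psi> p = \<psi> (1 * (u * of_real x), b * of_real y)" using u(2) b(2) by (metis mult_1 prod.collapse)
    also have "\<dots> = 1 powi j * b powi k * \<psi> (u * of_real x, of_real y)" by (rule torus_modeD[OF \<psi> ux _ b(1)]) simp
    also have "\<psi> (u * of_real x, of_real y) = (if 0 \<le> j then u ^ nat j * \<psi> (of_real x, of_real y) else 0)"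
      by (rule hom[OF xy u(1)])
    also have "1 powi j * b powi k * (if 0 \<le> j then u ^ nat j * \<psi> (of_real x, of_real y) else 0) = C * (fst p powi j * snd p powi k)"
    proof (cases "0 \<le> j")
      case True
      then have "fst p powi j = u ^ nat j * of_real x ^ nat j" by (simp add: u(2) power_int_def power_mult_distrib)
      moreover have "snd p powi k = b powi k * of_real y powi k" by (simp add: b(2) power_int_mult_distrib)
      moreover have "x = 0 \<Longrightarrow> nat j \<noteq> 0 \<Longrightarrow> u ^ nat j = 0" using u(3) by (simp add: power_0_left)
      ultimately show ?thesis using True y by (cases "x = 0"; cases "nat j = 0") (simp_all add: C_def)
    qed (simp add: C_def)
    finally show "\<psi> p = C * (fst p powi j * snd p powi k)" .
  qed
  moreover have "C \<noteq> 0 \<Longrightarrow> \<not> j < 0" by (auto simp: C_def split: if_splits)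
  ultimately show ?thesis unfolding face_monomial_def by (intro exI[of _ C]) auto
qed

lemma face_monomial_1:
  assumes \<psi>: "torus_mode j k (closure \<Omega>) \<psi>"
    and hom: "\<And>z w u. (z, w) \<in> maximizers 1 \<Longrightarrow> cmod u \<le> 1 \<Longrightarrow> \<psi> (z, u * w) = (if 0 \<le> k then u ^ nat k * \<psi> (z, w) else 0)"
  shows "\<exists>C. face_monomial \<psi> j k 1 C"
proof -
  have cl: "closed (maximizers 1)"
  proof -
    have "maximizers 1 = closure \<Omega> \<inter> (\<Inter>q\<in>closure \<Omega>. {p. cmod (fst q) \<le> cmod (fst p)})"
      by (rule set_eqI) (simp add: maximizers_1)
    moreover have "closed {p :: C2. cmod (fst q) \<le> cmod (fst p)}" for q :: C2
      by (intro closed_Collect_le continuous_intros)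
    ultimately show ?thesis by (simp only:) (intro closed_Int closed_INT closed_closure ballI)
  qed
  have "compact (maximizers 1)"
    using compact_Int_closed[OF compact_cl cl] by (simp add: maximizers_def Int_absorb1 Int_commute Collect_mono_iff inf.absorb2)
  moreover have "maximizers 1 \<noteq> {}" using maximizers_ex[of 1] by auto
  moreover have "continuous_on (maximizers 1) (\<lambda>p. cmod (snd p))" by (intro continuous_intros)
  ultimately obtain p0 where p0: "p0 \<in> maximizers 1" and sup: "\<And>p. p \<in> maximizers 1 \<Longrightarrow> cmod (snd p) \<le> cmod (snd p0)"
    using continuous_attains_sup by meson
  define x y where "x = cmod (fst p0)" and "y = cmod (snd p0)"
  have x: "x > 0" using maximizers_pos[OF p0] by (auto simp: wmono_def wpow_def x_def)
  have "(of_real x, of_real y) \<in> closure \<Omega>"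
    unfolding x_def y_def by (rule real_point_closure) (use maximizers_closed_cl[OF p0] in simp)
  then have xy: "(of_real x, of_real y) \<in> maximizers 1" using p0 by (auto simp: maximizers_1 x_def)
  define C where "C = (if 0 \<le> k then \<psi> (of_real x, of_real y) / (of_real x powi j * of_real y ^ nat k) else 0)"
  have "\<psi> p = C * (fst p powi j * snd p powi k)" "fst p \<noteq> 0" if p: "p \<in> maximizers 1" for p
  proof -
    have n: "cmod (snd p) \<le> y" using sup[OF p] by (simp add: y_def)
    have xp: "cmod (fst p) = x" using p p0 by (auto simp: maximizers_1 x_def intro: antisym)
    then show "fst p \<noteq> 0" using x by auto
    obtain b where b: "cmod b = 1" "fst p = b * of_real x" using unimodular_factor[of "fst p"] xp by metis
    define u where "u = snd p / of_real y"
    have u: "cmod u \<le> 1" "snd p = u * of_real y" "y = 0 \<Longrightarrow> u = 0"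
      using n norm_ge_zero[of "snd p"] by (auto simp: u_def norm_divide divide_le_eq y_def)
    have ux: "(of_real x, u * of_real y) \<in> closure \<Omega>"
      by (rule convex_torus_shrink_snd[OF cv_closure tor_closure maximizers_closed_cl[OF xy]])
         (use u in \<open>simp add: norm_mult mult_left_le_one_le\<close>)
    have "\<psi> p = \<psi> (b * of_real x, 1 * (u * of_real y))" using u(2) b(2) by (metis mult_1 prod.collapse)
    also have "\<dots> = b powi j * 1 powi k * \<psi> (of_real x, u * of_real y)" by (rule torus_modeD[OF \<psi> ux b(1)]) simp
    also have "\<psi> (of_real x, u * of_real y) = (if 0 \<le> k then u ^ nat k * \<psi> (of_real x, of_real y) else 0)"
      by (rule hom[OF xy u(1)])
    also have "b powi j * 1 powi k * (if 0 \<le> k then u ^ nat k * \<psi> (of_real x, of_real y) else 0) = C * (fst p powi j * snd p powi k)"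
    proof (cases "0 \<le> k")
      case True
      then have "snd p powi k = u ^ nat k * of_real y ^ nat k" by (simp add: u(2) power_int_def power_mult_distrib)
      moreover have "fst p powi j = b powi j * of_real x powi j" by (simp add: b(2) power_int_mult_distrib)
      moreover have "y = 0 \<Longrightarrow> nat k \<noteq> 0 \<Longrightarrow> u ^ nat k = 0" using u(3) by (simp add: power_0_left)
      ultimately show ?thesis using True x by (cases "y = 0"; cases "nat k = 0") (simp_all add: C_def)
    qed (simp add: C_def)
    finally show "\<psi> p = C * (fst p powi j * snd p powi k)" .
  qed
  moreover have "C \<noteq> 0 \<Longrightarrow> \<not> k < 0" by (auto simp: C_def split: if_splits)
  ultimately show ?thesis unfolding face_monomial_def by (intro exI[of _ C]) auto
qed

text \<open>Stated for an abstract rotation \<rho> so that it serves both coordinates. Uniform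
  continuity on the compact closure provides the common modulus of continuity, and
  \<open>dist\<close> makes it depend on |circ \<theta> - 1| alone.\<close>

lemma fejer_rotation:
  fixes \<rho> :: "real \<Rightarrow> C2 \<Rightarrow> C2"
  assumes \<psi>: "continuous_on (closure \<Omega>) \<psi>" and \<rho>0: "\<And>x. \<rho> 0 x = x"
    and \<rho>: "\<And>\<theta> x. x \<in> closure \<Omega> \<Longrightarrow> \<rho> \<theta> x \<in> closure \<Omega>" "\<And>x. continuous_on {0..1} (\<lambda>\<theta>. \<rho> \<theta> x)"
    and dist: "\<And>\<theta> x. dist (\<rho> \<theta> x) x \<le> cmod (circ \<theta> - 1) * norm x" and e: "e > 0"
  obtains J \<kappa> where "finite J" "\<And>x. x \<in> closure \<Omega> \<Longrightarrow> cmod (\<psi> x - (\<Sum>j\<in>J. \<kappa> j * fourier j (\<lambda>\<theta>. \<psi> (\<rho> \<theta> x)))) \<le> e"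
proof -
  have "bounded (\<psi> ` closure \<Omega>)" by (rule compact_imp_bounded[OF compact_continuous_image[OF \<psi> compact_cl]])
  then obtain M where M: "\<And>x. x \<in> closure \<Omega> \<Longrightarrow> cmod (\<psi> x) \<le> M" unfolding bounded_iff by blast
  obtain R where R: "\<And>x. x \<in> closure \<Omega> \<Longrightarrow> norm x \<le> R" "R > 0"
    using compact_imp_bounded[OF compact_cl] unfolding bounded_pos by blast
  have uc: "uniformly_continuous_on (closure \<Omega>) \<psi>" by (rule compact_uniformly_continuous[OF \<psi> compact_cl])
  obtain J \<kappa> where J: "finite J" "\<And>x. x \<in> closure \<Omega> \<Longrightarrow> cmod (\<psi> (\<rho> 0 x) - (\<Sum>j\<in>J. \<kappa> j * fourier j (\<lambda>\<theta>. \<psi> (\<rho> \<theta> x)))) \<le> e"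
  proof (rule fejer_approximation[of "closure \<Omega>" "\<lambda>x \<theta>. \<psi> (\<rho> \<theta> x)" M e])
    show "continuous_on {0..1} (\<lambda>\<theta>. \<psi> (\<rho> \<theta> x))" if "x \<in> closure \<Omega>" for x
      by (rule continuous_on_compose2[OF \<psi> \<rho>(2)]) (rule image_subsetI, rule \<rho>(1)[OF that])
    fix e' :: real assume "e' > 0"
    then obtain d where d: "d > 0" "\<And>x y. x \<in> closure \<Omega> \<Longrightarrow> y \<in> closure \<Omega> \<Longrightarrow> dist y x < d \<Longrightarrow> dist (\<psi> y) (\<psi> x) < e'"
      using uc unfolding uniformly_continuous_on_def by metis
    have "cmod (\<psi> (\<rho> \<theta> x) - \<psi> (\<rho> 0 x)) \<le> e'" if x: "x \<in> closure \<Omega>" and c: "cmod (circ \<theta> - 1) < d / R" for x \<theta>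
    proof -
      have "dist (\<rho> \<theta> x) x \<le> cmod (circ \<theta> - 1) * R"
        by (rule order_trans[OF dist mult_left_mono[OF R(1)[OF x]]]) simp
      also have "\<dots> < d" using c R(2) by (simp add: field_simps)
      finally show ?thesis using d(2)[OF x \<rho>(1)[OF x]] by (simp add: \<rho>0 dist_norm less_imp_le)
    qed
    then show "\<exists>d>0. \<forall>x\<in>closure \<Omega>. \<forall>\<theta>\<in>{0..1}. cmod (circ \<theta> - 1) < d \<longrightarrow> cmod (\<psi> (\<rho> \<theta> x) - \<psi> (\<rho> 0 x)) \<le> e'"
      using d(1) R(2) by (intro exI[of _ "d / R"]) simp
  qed (use M \<rho>(1) e in auto)
  show thesis by (rule that[OF J(1) J(2)[unfolded \<rho>0]])
qed

lemma hankel_estimate_uniform: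
  assumes \<phi>: "continuous_on (closure \<Omega>) \<phi>"
    and approx: "\<And>e. e > 0 \<Longrightarrow> \<exists>J \<kappa> (\<psi> :: int \<Rightarrow> C2 \<Rightarrow> complex). finite J \<and>
      (\<forall>j\<in>J. continuous_on (closure \<Omega>) (\<psi> j) \<and> hankel_estimate \<Omega> (\<psi> j)) \<and>
      (\<forall>x\<in>closure \<Omega>. cmod (\<phi> x - (\<Sum>j\<in>J. \<kappa> j * \<psi> j x)) \<le> e)"
  shows "hankel_estimate \<Omega> \<phi>"
proof -
  have bnd: "\<exists>M. \<forall>x\<in>\<Omega>. cmod (u x) \<le> M" if u: "continuous_on (closure \<Omega>) u" for u
    using compact_imp_bounded[OF compact_continuous_image[OF u compact_cl]] closure_subset
    unfolding bounded_iff by blast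
  have meas: "u \<in> borel_measurable (lebesgue_on \<Omega>)" if u: "continuous_on (closure \<Omega>) u" for u :: "C2 \<Rightarrow> complex"
    by (rule continuous_on_lebesgue_measurable[OF op continuous_on_subset[OF u closure_subset]])
  obtain M where M: "\<And>x. x \<in> \<Omega> \<Longrightarrow> cmod (\<phi> x) \<le> M" using bnd[OF \<phi>] by blast
  show ?thesis
  proof (rule hankel_estimate_uniform_limit[OF meas[OF \<phi>] M])
    fix e :: real assume "e > 0"
    from approx[OF this] obtain J \<kappa> and \<psi> :: "int \<Rightarrow> C2 \<Rightarrow> complex" where a: "finite J \<and>
      (\<forall>j\<in>J. continuous_on (closure \<Omega>) (\<psi> j) \<and> hankel_estimate \<Omega> (\<psi> j)) \<and>
      (\<forall>x\<in>closure \<Omega>. cmod (\<phi> x - (\<Sum>j\<in>J. \<kappa> j * \<psi> j x)) \<le> e)" by (elim exE)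
    then have J: "finite J" and \<psi>: "\<And>j. j \<in> J \<Longrightarrow> continuous_on (closure \<Omega>) (\<psi> j)"
      "\<And>j. j \<in> J \<Longrightarrow> hankel_estimate \<Omega> (\<psi> j)" and ap: "\<And>x. x \<in> closure \<Omega> \<Longrightarrow> cmod (\<phi> x - (\<Sum>j\<in>J. \<kappa> j * \<psi> j x)) \<le> e"
      by blast+
    have "hankel_estimate \<Omega> (\<lambda>x. \<Sum>j\<in>A. \<kappa> j * \<psi> j x) \<and> continuous_on (closure \<Omega>) (\<lambda>x. \<Sum>j\<in>A. \<kappa> j * \<psi> j x)"
      if "finite A" "A \<subseteq> J" for A
      using that
    proof (induction A rule: finite_induct)
      case (insert i A)
      then have c: "continuous_on (closure \<Omega>) (\<lambda>x. \<kappa> i * \<psi> i x)" "continuous_on (closure \<Omega>) (\<lambda>x. \<Sum>j\<in>A. \<kappa> j * \<psi> j x)"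
        using \<psi>(1) by (auto intro!: continuous_intros)
      obtain M1 M2 where "\<And>x. x \<in> \<Omega> \<Longrightarrow> cmod (\<kappa> i * \<psi> i x) \<le> M1" "\<And>x. x \<in> \<Omega> \<Longrightarrow> cmod (\<Sum>j\<in>A. \<kappa> j * \<psi> j x) \<le> M2"
        using bnd[OF c(1)] bnd[OF c(2)] by blast
      from hankel_estimate_add[OF hankel_estimate_cmult[OF \<psi>(2), of i "\<kappa> i"] _ meas[OF c(1)] this(1) meas[OF c(2)] this(2) mono2_L2]
      show ?case using insert c by (auto intro!: continuous_intros)
    qed (simp add: hankel_estimate_zero)
    from this[OF J order_refl] have h: "hankel_estimate \<Omega> (\<lambda>x. \<Sum>j\<in>J. \<kappa> j * \<psi> j x)"
      and c: "continuous_on (closure \<Omega>) (\<lambda>x. \<Sum>j\<in>J. \<kappa> j * \<psi> j x)" by auto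
    obtain N where "\<forall>x\<in>\<Omega>. cmod (\<Sum>j\<in>J. \<kappa> j * \<psi> j x) \<le> N" using bnd[OF c] by blast
    then show "\<exists>\<psi> N. hankel_estimate \<Omega> \<psi> \<and> \<psi> \<in> borel_measurable (lebesgue_on \<Omega>) \<and>
       (\<forall>x\<in>\<Omega>. cmod (\<psi> x) \<le> N) \<and> (\<forall>x\<in>\<Omega>. cmod (\<phi> x - \<psi> x) \<le> e)"
      using h meas[OF c] ap closure_subset by blast
  qed
qed

text \<open>Two summations in one variable, over rotations of z and then of w, lead from \<phi> to
  its modes, and each mode satisfies the estimate by the description of its values on the
  maximisers.\<close>

lemma hankel_compact_sufficient:
  assumes \<phi>: "continuous_on (closure \<Omega>) \<phi>"
    and hol1: "\<And>z w. (z, w) \<in> maximizers 0 \<Longrightarrow> (\<lambda>u. \<phi> (u, w)) holomorphic_on ball 0 (cmod z)"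
    and hol2: "\<And>z w. (z, w) \<in> maximizers 1 \<Longrightarrow> (\<lambda>u. \<phi> (z, u)) holomorphic_on ball 0 (cmod w)"
  shows "compact_on_bergman \<Omega> (hankel \<Omega> \<phi>)"
proof -
  have mode_est: "hankel_estimate \<Omega> (mode j k \<phi>)" for j k
  proof (rule hankel_estimate_mode[of _ j k])
    show c: "continuous_on (closure \<Omega>) (mode j k \<phi>)" by (rule continuous_mode[OF tor_closure \<phi>])
    have tm: "torus_mode j k (closure \<Omega>) (mode j k \<phi>)" by (rule torus_mode_mode[OF tor_closure \<phi>])
    then show "torus_mode j k \<Omega> (mode j k \<phi>)" using closure_subset unfolding torus_mode_def by blast
    fix t :: real assume t: "0 \<le> t" "t \<le> 1"
    consider "t = 0" | "t = 1" | "0 < t" "t < 1" using t by linarith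
    then show "\<exists>C. face_monomial (mode j k \<phi>) j k t C"
    proof cases
      case 1
      have "mode j k \<phi> (u * z, w) = (if 0 \<le> j then u ^ nat j * mode j k \<phi> (z, w) else 0)"
        if zw: "(z, w) \<in> maximizers 0" and u: "cmod u \<le> 1" for z w u
      proof (rule mode_face_fst[OF maximizers_closed_cl[OF zw] \<phi> _ u])
        fix v assume v: "cmod v = cmod w"
        have "(z, v) \<in> closure \<Omega>"
          by (rule convex_torus_shrink_snd[OF cv_closure tor_closure maximizers_closed_cl[OF zw]]) (simp add: v)
        then have "(z, v) \<in> maximizers 0" using zw by (simp add: maximizers_0 v)
        then show "(\<lambda>u. \<phi> (u, v)) holomorphic_on ball 0 (cmod z)" by (rule hol1)
      qed
      then show ?thesis unfolding 1 by (rule face_monomial_0[OF tm])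
    next
      case 2
      have "mode j k \<phi> (z, u * w) = (if 0 \<le> k then u ^ nat k * mode j k \<phi> (z, w) else 0)"
        if zw: "(z, w) \<in> maximizers 1" and u: "cmod u \<le> 1" for z w u
      proof (rule mode_face_snd[OF maximizers_closed_cl[OF zw] \<phi> _ u])
        fix v assume v: "cmod v = cmod z"
        have "(v, w) \<in> closure \<Omega>"
          by (rule convex_torus_shrink_fst[OF cv_closure tor_closure maximizers_closed_cl[OF zw]]) (simp add: v)
        then have "(v, w) \<in> maximizers 1" using zw by (simp add: maximizers_1 v)
        then show "(\<lambda>u. \<phi> (v, u)) holomorphic_on ball 0 (cmod w)" by (rule hol2)
      qed
      then show ?thesis unfolding 2 by (rule face_monomial_1[OF tm])
    next
      case 3
      then show ?thesis by (rule face_monomial_interior[OF tm])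
    qed
  qed
  \<comment> \<open>The modes in z alone, an intermediate stage: they are approximated by full modes
    when w is rotated, and \<phi> is approximated by them.\<close>
  let ?A = "\<lambda>j x. fourier j (\<lambda>\<theta>. \<phi> (circ \<theta> * fst x, snd x))"
  have Ac: "continuous_on (closure \<Omega>) (?A j)" for j by (rule continuous_fourier_fst[OF tor_closure \<phi>])
  have d1: "dist (circ \<theta> * fst x, snd x) x \<le> cmod (circ \<theta> - 1) * norm x" for \<theta> x
  proof -
    have "dist (circ \<theta> * fst x, snd x) x = cmod ((circ \<theta> - 1) * fst x)"
      by (cases x) (simp add: dist_prod_def dist_norm algebra_simps)
    also have "\<dots> \<le> cmod (circ \<theta> - 1) * norm x" unfolding norm_mult
      using norm_fst_le[of "fst x" "snd x"] by (intro mult_left_mono) auto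
    finally show ?thesis .
  qed
  have d2: "dist (fst x, circ \<theta> * snd x) x \<le> cmod (circ \<theta> - 1) * norm x" for \<theta> x
  proof -
    have "dist (fst x, circ \<theta> * snd x) x = cmod ((circ \<theta> - 1) * snd x)"
      by (cases x) (simp add: dist_prod_def dist_norm algebra_simps)
    also have "\<dots> \<le> cmod (circ \<theta> - 1) * norm x" unfolding norm_mult
      using norm_snd_le[of "snd x" "fst x"] by (intro mult_left_mono) auto
    finally show ?thesis .
  qed
  have c0: "circ 0 = 1" by (simp add: circ_def)
  have r1: "(circ \<theta> * fst x, snd x) \<in> closure \<Omega>" and r2: "(fst x, circ \<theta> * snd x) \<in> closure \<Omega>"
    if "x \<in> closure \<Omega>" for \<theta> x
    using torus_invariantD[OF tor_closure, of "fst x" "snd x" "circ \<theta>" 1]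
      torus_invariantD[OF tor_closure, of "fst x" "snd x" 1 "circ \<theta>"] that by simp_all
  have A_est: "hankel_estimate \<Omega> (?A j)" for j
  proof (rule hankel_estimate_uniform[OF Ac])
    fix e :: real assume e: "e > 0"
    obtain J \<kappa> where J: "finite J" "\<And>x. x \<in> closure \<Omega> \<Longrightarrow>
      cmod (?A j x - (\<Sum>k\<in>J. \<kappa> k * fourier k (\<lambda>\<theta>. ?A j (fst x, circ \<theta> * snd x)))) \<le> e"
      by (rule fejer_rotation[OF Ac, of "\<lambda>\<theta> x. (fst x, circ \<theta> * snd x)" e])
         (use r2 d2 e in \<open>auto intro!: continuous_intros simp: c0\<close>)
    have "fourier k (\<lambda>\<theta>. ?A j (fst x, circ \<theta> * snd x)) = mode j k \<phi> x" if "x \<in> closure \<Omega>" for k x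
      using mode_swap[OF tor_closure \<phi>, of "fst x" "snd x" j k] that by simp
    with J(2) have b: "\<And>x. x \<in> closure \<Omega> \<Longrightarrow> cmod (?A j x - (\<Sum>k\<in>J. \<kappa> k * mode j k \<phi> x)) \<le> e" by simp
    show "\<exists>J \<kappa> (\<psi> :: int \<Rightarrow> C2 \<Rightarrow> complex). finite J \<and> (\<forall>k\<in>J. continuous_on (closure \<Omega>) (\<psi> k) \<and> hankel_estimate \<Omega> (\<psi> k)) \<and>
      (\<forall>x\<in>closure \<Omega>. cmod (?A j x - (\<Sum>k\<in>J. \<kappa> k * \<psi> k x)) \<le> e)"
      by (rule exI[of _ J], rule exI[of _ \<kappa>], rule exI[of _ "\<lambda>k. mode j k \<phi>"], intro conjI ballI)
         (use J(1) mode_est continuous_mode[OF tor_closure \<phi>] b in blast)+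
  qed
  have est: "hankel_estimate \<Omega> \<phi>"
  proof (rule hankel_estimate_uniform[OF \<phi>])
    fix e :: real assume e: "e > 0"
    obtain J \<kappa> where J: "finite J" "\<And>x. x \<in> closure \<Omega> \<Longrightarrow> cmod (\<phi> x - (\<Sum>j\<in>J. \<kappa> j * ?A j x)) \<le> e"
      by (rule fejer_rotation[OF \<phi>, of "\<lambda>\<theta> x. (circ \<theta> * fst x, snd x)" e])
         (use r1 d1 e in \<open>auto intro!: continuous_intros simp: c0\<close>)
    show "\<exists>J \<kappa> (\<psi> :: int \<Rightarrow> C2 \<Rightarrow> complex). finite J \<and> (\<forall>k\<in>J. continuous_on (closure \<Omega>) (\<psi> k) \<and> hankel_estimate \<Omega> (\<psi> k)) \<and>
      (\<forall>x\<in>closure \<Omega>. cmod (\<phi> x - (\<Sum>k\<in>J. \<kappa> k * \<psi> k x)) \<le> e)"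
      by (rule exI[of _ J], rule exI[of _ \<kappa>], rule exI[of _ ?A], intro conjI ballI)
         (use J A_est Ac in blast)+
  qed
  have "bounded (\<phi> ` closure \<Omega>)" by (rule compact_imp_bounded[OF compact_continuous_image[OF \<phi> compact_cl]])
  then obtain M where M: "\<And>x. x \<in> closure \<Omega> \<Longrightarrow> cmod (\<phi> x) \<le> M" unfolding bounded_iff by blast
  show ?thesis
    by (rule hankel_estimate_compact[OF op fin _ _ mono2_L2 est, of M])
       (use M closure_subset in \<open>auto intro!: continuous_on_lebesgue_measurable[OF op continuous_on_subset[OF \<phi>]]\<close>)
qed

end

section \<open>Necessity\<close>

text \<open>Since G is not yet known to be holomorphic, the mean square inequality is applied to
  \<gamma> - G z0 with the value at the centre frozen. On small discs the oscillation of G is small,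
  so closeness in L2 becomes locally uniform closeness, and uniform limits of holomorphic functions
  are holomorphic.\<close>

lemma holomorphic_if_L2_close:
  assumes G: "continuous_on (ball 0 s) G"
    and close: "\<And>d. d > 0 \<Longrightarrow> \<exists>\<gamma>. \<gamma> holomorphic_on ball 0 s \<and>
      (\<integral>\<^sup>+z. indicator (ball 0 s) z * ennreal ((cmod (G z - \<gamma> z))\<^sup>2) \<partial>lborel) \<le> ennreal d"
  shows "G holomorphic_on ball (0::complex) s"
proof -
  define P where "P = (\<lambda>n \<gamma>. \<gamma> holomorphic_on ball 0 s \<and>
      (\<integral>\<^sup>+z. indicator (ball 0 s) z * ennreal ((cmod (G z - \<gamma> z))\<^sup>2) \<partial>lborel) \<le> ennreal (inverse (real (Suc n))))"
  have "\<exists>\<gamma>. P n \<gamma>" for n unfolding P_def by (rule close) simp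
  then obtain \<gamma> where \<gamma>: "\<And>n. P n (\<gamma> n)" by metis
  have hol: "\<And>n. \<gamma> n holomorphic_on ball 0 s"
    and L: "\<And>n. (\<integral>\<^sup>+z. indicator (ball 0 s) z * ennreal ((cmod (G z - \<gamma> n z))\<^sup>2) \<partial>lborel) \<le> ennreal (inverse (real (Suc n)))"
    using \<gamma> unfolding P_def by blast+
  show ?thesis
  proof (rule holomorphic_uniform_sequence[OF open_ball hol])
    fix x :: complex assume x: "x \<in> ball 0 s"
    define e0 where "e0 = (s - cmod x) / 3"
    have e0: "e0 > 0" using x by (simp add: e0_def)
    have sub2: "cball x (2 * e0) \<subseteq> ball 0 s"
    proof
      fix y assume "y \<in> cball x (2 * e0)"
      then show "y \<in> ball 0 s" using norm_triangle_ineq2[of y x] e0 by (simp add: dist_norm norm_minus_commute e0_def)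
    qed
    have "uniform_limit (cball x e0) \<gamma> G sequentially"
    proof (rule uniform_limitI)
      fix \<epsilon> :: real assume \<epsilon>: "\<epsilon> > 0"
      have "uniformly_continuous_on (cball x (2 * e0)) G"
        by (rule compact_uniformly_continuous[OF continuous_on_subset[OF G sub2]]) simp
      then obtain r0 where r0: "r0 > 0" "\<And>u v. u \<in> cball x (2 * e0) \<Longrightarrow> v \<in> cball x (2 * e0) \<Longrightarrow> dist v u < r0 \<Longrightarrow> dist (G v) (G u) < \<epsilon> / 4"
        unfolding uniformly_continuous_on_def using \<epsilon> by (metis divide_pos_pos zero_less_numeral)
      define r where "r = min r0 e0"
      have r: "r > 0" "r \<le> e0" "r \<le> r0" using r0 e0 by (auto simp: r_def)
      define a where "a = disc_area r"
      have a: "a > 0" unfolding a_def by (rule disc_area_pos[OF r(1)])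
      \<comment> \<open>Twice the L2 error is then below a \<epsilon>^2/8; the oscillation of G
        contributes as much again, so the mean square stays below a \<epsilon>^2/4.\<close>
      obtain N where N: "inverse (real (Suc N)) < a * \<epsilon>\<^sup>2 / 16"
        using reals_Archimedean[of "a * \<epsilon>\<^sup>2 / 16"] a \<epsilon> by auto
      have "dist (\<gamma> n z0) (G z0) < \<epsilon>" if n: "n \<ge> N" and z0: "z0 \<in> cball x e0" for n z0
      proof -
        have sub: "ball z0 r \<subseteq> cball x (2 * e0)"
        proof
          fix y assume "y \<in> ball z0 r"
          then show "y \<in> cball x (2 * e0)" using dist_triangle[of x y z0] z0 r by simp
        qed
        have z0': "z0 \<in> cball x (2 * e0)" using z0 e0 by simp
        have subs: "ball z0 r \<subseteq> ball 0 s" using sub sub2 by blast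
        have hn: "(\<lambda>z. \<gamma> n z - G z0) holomorphic_on ball z0 r"
          by (intro holomorphic_intros holomorphic_on_subset[OF hol subs])
        have m: "(\<lambda>z. indicator (ball 0 s) z * ennreal ((cmod (G z - \<gamma> n z))\<^sup>2)) \<in> borel_measurable borel"
          by (rule indicator_square_borel) (auto intro!: continuous_intros G holomorphic_on_imp_continuous_on[OF hol])
        have ptw: "indicator (ball z0 r) z * ennreal ((cmod (\<gamma> n z - G z0))\<^sup>2) \<le>
           2 * (indicator (ball 0 s) z * ennreal ((cmod (G z - \<gamma> n z))\<^sup>2)) + ennreal (\<epsilon>\<^sup>2 / 8) * indicator (ball z0 r) z" for z
        proof (cases "z \<in> ball z0 r")
          case True
          then have zz: "z \<in> cball x (2 * e0)" "z \<in> ball 0 s" using sub subs by auto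
          have "cmod (G z - G z0) \<le> \<epsilon> / 4"
            using r0(2)[OF z0' zz(1)] True r by (simp add: dist_norm norm_minus_commute)
          then have g: "(cmod (G z - G z0))\<^sup>2 \<le> (\<epsilon> / 4)\<^sup>2" by (rule power_mono) simp
          have "(cmod (\<gamma> n z - G z0))\<^sup>2 \<le> (cmod (G z - \<gamma> n z) + cmod (G z - G z0))\<^sup>2"
            using norm_triangle_ineq4[of "G z - G z0" "G z - \<gamma> n z"] by (intro power_mono) (auto simp: add.commute)
          also have "\<dots> \<le> 2 * (cmod (G z - \<gamma> n z))\<^sup>2 + 2 * (cmod (G z - G z0))\<^sup>2"
            using sum_squares_bound[of "cmod (G z - \<gamma> n z)" "cmod (G z - G z0)"] by (simp add: power2_sum)
          also have "\<dots> \<le> 2 * (cmod (G z - \<gamma> n z))\<^sup>2 + \<epsilon>\<^sup>2 / 8" using g by (simp add: power2_eq_square)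
          finally have "ennreal ((cmod (\<gamma> n z - G z0))\<^sup>2) \<le> ennreal (2 * (cmod (G z - \<gamma> n z))\<^sup>2 + \<epsilon>\<^sup>2 / 8)"
            by (rule ennreal_leI)
          then show ?thesis using True zz by (simp add: ennreal_plus ennreal_mult)
        qed simp
        have "ennreal ((cmod (\<gamma> n z0 - G z0))\<^sup>2 * a) \<le> (\<integral>\<^sup>+z. indicator (ball z0 r) z * ennreal ((cmod (\<gamma> n z - G z0))\<^sup>2) \<partial>lborel)"
          unfolding a_def by (rule disc_mean_square[OF hn r(1)])
        also have "\<dots> \<le> (\<integral>\<^sup>+z. 2 * (indicator (ball 0 s) z * ennreal ((cmod (G z - \<gamma> n z))\<^sup>2)) + ennreal (\<epsilon>\<^sup>2 / 8) * indicator (ball z0 r) z \<partial>lborel)"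
          by (rule nn_integral_mono) (rule ptw)
        also have "\<dots> = 2 * (\<integral>\<^sup>+z. indicator (ball 0 s) z * ennreal ((cmod (G z - \<gamma> n z))\<^sup>2) \<partial>lborel) + ennreal (\<epsilon>\<^sup>2 / 8) * ennreal a"
        proof -
          have m2: "(\<lambda>z. 2 * (indicator (ball 0 s) z * ennreal ((cmod (G z - \<gamma> n z))\<^sup>2))) \<in> borel_measurable lborel"
            using m by simp
          have "(\<integral>\<^sup>+z. ennreal (\<epsilon>\<^sup>2 / 8) * indicator (ball z0 r) z \<partial>lborel) = ennreal (\<epsilon>\<^sup>2 / 8) * ennreal a"
            using emeasure_disc[of r z0] r(1) by (simp add: nn_integral_cmult_indicator a_def)
          moreover have "(\<integral>\<^sup>+z. 2 * (indicator (ball 0 s) z * ennreal ((cmod (G z - \<gamma> n z))\<^sup>2)) \<partial>lborel) =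
             2 * (\<integral>\<^sup>+z. indicator (ball 0 s) z * ennreal ((cmod (G z - \<gamma> n z))\<^sup>2) \<partial>lborel)"
            by (rule nn_integral_cmult) (use m in simp)
          moreover have "(\<lambda>z. ennreal (\<epsilon>\<^sup>2 / 8) * indicator (ball z0 r) z) \<in> borel_measurable lborel"
            by (intro borel_measurable_times_ennreal borel_measurable_const borel_measurable_indicator) simp
          ultimately show ?thesis by (simp add: nn_integral_add[OF m2])
        qed
        also have "\<dots> \<le> 2 * ennreal (inverse (real (Suc n))) + ennreal (\<epsilon>\<^sup>2 / 8) * ennreal a"
          by (intro add_mono mult_left_mono L) auto
        also have "\<dots> = ennreal (2 * inverse (real (Suc n)) + \<epsilon>\<^sup>2 / 8 * a)"
        proof -
          have "2 * ennreal (inverse (real (Suc n))) = ennreal (2 * inverse (real (Suc n)))"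
            unfolding ennreal_numeral[symmetric] by (rule ennreal_mult[symmetric]) auto
          moreover have "ennreal (\<epsilon>\<^sup>2 / 8) * ennreal a = ennreal (\<epsilon>\<^sup>2 / 8 * a)"
            by (rule ennreal_mult[symmetric]) (use a in auto)
          ultimately show ?thesis using a by (simp only:) (rule ennreal_plus[symmetric], auto)
        qed
        finally have "(cmod (\<gamma> n z0 - G z0))\<^sup>2 * a \<le> 2 * inverse (real (Suc n)) + \<epsilon>\<^sup>2 / 8 * a"
          using a by (subst (asm) ennreal_le_iff) (auto intro: add_nonneg_nonneg)
        moreover have "inverse (real (Suc n)) \<le> inverse (real (Suc N))" using n by (simp add: field_simps)
        moreover have "\<epsilon>\<^sup>2 / 4 * a = \<epsilon>\<^sup>2 / 8 * a + 2 * (\<epsilon>\<^sup>2 / 16 * a)" by simp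
        moreover have "inverse (real (Suc N)) < \<epsilon>\<^sup>2 / 16 * a" using N by (simp add: mult.commute)
        ultimately have "(cmod (\<gamma> n z0 - G z0))\<^sup>2 * a < (\<epsilon>\<^sup>2 / 4) * a" by linarith
        then have "(cmod (\<gamma> n z0 - G z0))\<^sup>2 < \<epsilon>\<^sup>2 / 4" using a by (simp add: mult_less_cancel_right_pos)
        also have "\<dots> \<le> \<epsilon>\<^sup>2" by simp
        finally have "cmod (\<gamma> n z0 - G z0) < \<epsilon>" by (rule power2_less_imp_less) (use \<epsilon> in simp)
        then show ?thesis by (simp add: dist_norm)
      qed
      then show "\<forall>\<^sub>F n in sequentially. \<forall>z0\<in>cball x e0. dist (\<gamma> n z0) (G z0) < \<epsilon>"
        using eventually_sequentially by blast
    qed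
    moreover have "cball x e0 \<subseteq> ball 0 s" using sub2 e0 by auto
    ultimately show "\<exists>d>0. cball x d \<subseteq> ball 0 s \<and> uniform_limit (cball x d) \<gamma> G sequentially"
      using e0 by blast
  qed
qed

section \<open>Interchanging the coordinates\<close>

lemma swap_image_eq_vimage: "prod.swap ` (\<Omega> :: C2 set) = prod.swap -` \<Omega>"
proof (intro set_eqI iffI)
  fix p assume "p \<in> prod.swap -` \<Omega>"
  then show "p \<in> prod.swap ` \<Omega>" by (intro image_eqI[of _ _ "prod.swap p"]) auto
qed auto

text \<open>What compactness provides for necessity, phrased without the Bergman projection. In this
  form it passes to the domain with interchanged coordinates, so only one of the two faces has to be
  treated.\<close>

definition null_approx :: "C2 set \<Rightarrow> (C2 \<Rightarrow> complex) \<Rightarrow> bool" where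
  "null_approx \<Omega> \<phi> \<longleftrightarrow> (\<forall>F B. (\<forall>n::nat. F n \<in> bergman_space \<Omega>) \<longrightarrow> (\<forall>n. L2_norm \<Omega> (F n) \<le> B) \<longrightarrow>
     (\<forall>x\<in>\<Omega>. (\<lambda>n. F n x) \<longlonglongrightarrow> 0) \<longrightarrow>
     (\<exists>r G. strict_mono (r :: nat \<Rightarrow> nat) \<and> (\<forall>n. G n \<in> bergman_space \<Omega>) \<and>
       (\<lambda>n. L2_norm \<Omega> (\<lambda>x. \<phi> x * F (r n) x - G n x)) \<longlonglongrightarrow> 0))"

lemma swap_bergman:
  assumes op: "open \<Omega>" and f: "f \<in> bergman_space (prod.swap ` \<Omega>)"
  shows "f \<circ> prod.swap \<in> bergman_space \<Omega>"
    and "\<And>g. continuous_on (prod.swap ` \<Omega>) g \<Longrightarrow> L2_norm \<Omega> (g \<circ> prod.swap) = L2_norm (prod.swap ` \<Omega>) g"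
proof -
  let ?S = "prod.swap :: C2 \<Rightarrow> C2"
  have vim: "?S ` \<Omega> = ?S -` \<Omega>" by (rule swap_image_eq_vimage)
  have cS: "continuous_on A ?S" for A by (simp add: prod.swap_def[abs_def]) (intro continuous_intros)
  have opS: "open (?S ` \<Omega>)" unfolding vim by (rule open_vimage[OF op cS])
  have Sb: "?S \<in> borel_measurable borel" by (rule borel_measurable_continuous_onI[OF cS])
  have ind: "indicator (?S ` \<Omega>) (?S x) = indicator \<Omega> x" for x by (auto simp: indicator_def vim)
  have sq: "(\<integral>\<^sup>+x. ennreal ((cmod ((g \<circ> ?S) x))\<^sup>2) \<partial>lebesgue_on \<Omega>) = (\<integral>\<^sup>+x. ennreal ((cmod (g x))\<^sup>2) \<partial>lebesgue_on (?S ` \<Omega>))"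
    if g: "continuous_on (?S ` \<Omega>) g" for g :: "C2 \<Rightarrow> complex"
  proof -
    let ?h = "\<lambda>x. indicator (?S ` \<Omega>) x * ennreal ((cmod (g x))\<^sup>2)"
    have h: "?h \<in> borel_measurable borel" by (rule indicator_square_borel[OF g]) (use opS in simp)
    have "(\<integral>\<^sup>+x. ennreal ((cmod ((g \<circ> ?S) x))\<^sup>2) \<partial>lebesgue_on \<Omega>) = (\<integral>\<^sup>+x. ?h (?S x) \<partial>lborel)"
      by (subst lebesgue_on_nn_integral) (use op in \<open>simp_all add: ind\<close>)
    also have "\<dots> = (\<integral>\<^sup>+x. ?h x \<partial>distr lborel borel ?S)"
      by (rule nn_integral_distr[symmetric]) (use h Sb in auto)
    also have "\<dots> = (\<integral>\<^sup>+x. ennreal ((cmod (g x))\<^sup>2) \<partial>lebesgue_on (?S ` \<Omega>))"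
      by (subst lebesgue_on_nn_integral) (use opS in \<open>simp_all add: distr_lborel_swap\<close>)
    finally show ?thesis .
  qed
  have meas: "g \<circ> ?S \<in> borel_measurable (lebesgue_on \<Omega>)" if g: "continuous_on (?S ` \<Omega>) g" for g :: "C2 \<Rightarrow> complex"
    by (rule continuous_on_lebesgue_measurable[OF op continuous_on_compose[OF cS g]])
  show "L2_norm \<Omega> (g \<circ> ?S) = L2_norm (?S ` \<Omega>) g" if g: "continuous_on (?S ` \<Omega>) g" for g
    unfolding L2_norm_def
    by (subst (1 2) integral_eq_nn_integral)
       (use meas[OF g] continuous_on_lebesgue_measurable[OF opS g] sq[OF g] in \<open>auto simp: o_def\<close>)
  have hol: "holomorphic_C2 f (?S ` \<Omega>)" by (rule bergman_holomorphic[OF f])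
  have fc: "continuous_on (?S ` \<Omega>) f" by (rule holomorphic_C2_continuous_on[OF hol])
  have "holomorphic_C2 (f \<circ> ?S) \<Omega>"
  proof (rule holomorphic_C2_openI[OF op])
    fix p assume "p \<in> \<Omega>"
    then obtain a b where d: "(f has_derivative (\<lambda>(h, k). a * h + b * k)) (at (?S p))"
      using holomorphic_C2_openD[OF opS hol, of "?S p"] by blast
    have "(?S has_derivative ?S) (at p)"
      by (intro bounded_linear_imp_has_derivative linear_linear[THEN iffD2] linearI) auto
    from has_derivative_compose[OF this d] have "(f \<circ> ?S has_derivative (\<lambda>(h, k). b * h + a * k)) (at p)"
      by (simp add: o_def case_prod_unfold add.commute)
    then show "\<exists>a b. (f \<circ> ?S has_derivative (\<lambda>(h, k). a * h + b * k)) (at p)" by blast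
  qed
  moreover have "integrable (lebesgue_on \<Omega>) (\<lambda>x. (cmod ((f \<circ> ?S) x))\<^sup>2)"
  proof (rule integrableI_bounded)
    show "(\<lambda>x. (cmod ((f \<circ> ?S) x))\<^sup>2) \<in> borel_measurable (lebesgue_on \<Omega>)" using meas[OF fc] by measurable
    have "(\<integral>\<^sup>+x. ennreal (norm ((cmod ((f \<circ> ?S) x))\<^sup>2)) \<partial>lebesgue_on \<Omega>) = (\<integral>\<^sup>+x. ennreal ((cmod (f x))\<^sup>2) \<partial>lebesgue_on (?S ` \<Omega>))"
      using sq[OF fc] by simp
    also have "\<dots> < \<infinity>" by (subst L2_norm_eq_ennreal[OF bergman_L2[OF f], symmetric]) simp
    finally show "(\<integral>\<^sup>+x. ennreal (norm ((cmod ((f \<circ> ?S) x))\<^sup>2)) \<partial>lebesgue_on \<Omega>) < \<infinity>" .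
  qed
  ultimately show "f \<circ> ?S \<in> bergman_space \<Omega>" using meas[OF fc] by (simp add: bergman_space_def L2_def)
qed

lemma null_approx_swap:
  assumes op: "open \<Omega>" and \<phi>: "continuous_on \<Omega> \<phi>" and null: "null_approx \<Omega> \<phi>"
  shows "null_approx (prod.swap ` \<Omega>) (\<phi> \<circ> prod.swap)"
  unfolding null_approx_def
proof (intro allI impI)
  let ?S = "prod.swap :: C2 \<Rightarrow> C2" and ?O = "prod.swap ` \<Omega>"
  fix F :: "nat \<Rightarrow> C2 \<Rightarrow> complex" and B
  assume F: "\<forall>n. F n \<in> bergman_space ?O" and B: "\<forall>n. L2_norm ?O (F n) \<le> B" and lim: "\<forall>x\<in>?O. (\<lambda>n. F n x) \<longlonglongrightarrow> 0"
  have cS: "continuous_on A ?S" for A by (simp add: prod.swap_def[abs_def]) (intro continuous_intros)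
  have vim: "?O = ?S -` \<Omega>" by (rule swap_image_eq_vimage)
  have opS: "open ?O" unfolding vim by (rule open_vimage[OF op cS])
  have SS: "?S ` ?O = \<Omega>" by (simp add: image_image)
  have c: "continuous_on ?O (F n)" for n using F holomorphic_C2_continuous_on[OF bergman_holomorphic] by blast
  have "\<forall>n. F n \<circ> ?S \<in> bergman_space \<Omega>" using swap_bergman(1)[OF op] F by blast
  moreover have "\<forall>n. L2_norm \<Omega> (F n \<circ> ?S) \<le> B" using swap_bergman(2)[OF op F[THEN spec] c] B by simp
  moreover have "\<forall>x\<in>\<Omega>. (\<lambda>n. (F n \<circ> ?S) x) \<longlonglongrightarrow> 0" using lim by simp
  ultimately obtain r G where r: "strict_mono (r :: nat \<Rightarrow> nat)" and G: "\<And>n. G n \<in> bergman_space \<Omega>"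
    and conv: "(\<lambda>n. L2_norm \<Omega> (\<lambda>x. \<phi> x * (F (r n) \<circ> ?S) x - G n x)) \<longlonglongrightarrow> 0"
    using null[unfolded null_approx_def, rule_format, of "\<lambda>n. F n \<circ> ?S" B] by blast
  have G': "G n \<circ> ?S \<in> bergman_space ?O" for n
    using swap_bergman(1)[OF opS, of "G n"] G[of n] SS by simp
  have Gc: "continuous_on \<Omega> (G n)" for n using G holomorphic_C2_continuous_on[OF bergman_holomorphic] by blast
  have "L2_norm ?O (\<lambda>x. (\<phi> \<circ> ?S) x * F (r n) x - (G n \<circ> ?S) x) = L2_norm \<Omega> (\<lambda>x. \<phi> x * (F (r n) \<circ> ?S) x - G n x)" for n
  proof -
    have "continuous_on (?S ` ?O) (\<lambda>x. \<phi> x * (F (r n) \<circ> ?S) x - G n x)"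
      unfolding SS by (intro continuous_intros \<phi> Gc continuous_on_compose[OF cS c])
    from swap_bergman(2)[OF opS _ this, of "G 0"] G[of 0] show ?thesis unfolding SS by (simp add: o_def)
  qed
  then show "\<exists>r G. strict_mono r \<and> (\<forall>n. G n \<in> bergman_space ?O) \<and>
       (\<lambda>n. L2_norm ?O (\<lambda>x. (\<phi> \<circ> ?S) x * F (r n) x - G n x)) \<longlonglongrightarrow> 0"
    using r G' conv by (intro exI[of _ r] exI[of _ "\<lambda>n. G n \<circ> ?S"]) simp
qed

context convex_reinhardt begin

text \<open>Inside the open set the second coordinate can be enlarged slightly, so its maximal
  modulus is attained only on the boundary.\<close>

lemma snd_less_maximizer:
  assumes m: "(z0, w0) \<in> maximizers 0" and x: "(z, w) \<in> \<Omega>"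
  shows "cmod w < cmod w0"
proof -
  obtain R where R: "R > 1" "\<And>t. cmod t < R \<Longrightarrow> (z, t * w) \<in> \<Omega>" by (rule dilate_ball_snd[OF x]) (rule that)
  have w0: "cmod w0 > 0" using maximizers_pos[OF m] by (auto simp: wmono_def wpow_def)
  define t where "t = (1 + R) / 2"
  have t: "1 < t" "t < R" using R(1) by (auto simp: t_def)
  have "(z, of_real t * w) \<in> \<Omega>" using R(2)[of "of_real t"] t by simp
  then have "(z, of_real t * w) \<in> closure \<Omega>" using closure_subset by blast
  then have "t * cmod w \<le> cmod w0" using m t by (fastforce simp: maximizers_0 norm_mult)
  moreover have "cmod w < t * cmod w" if "w \<noteq> 0" using mult_strict_right_mono[OF t(1), of "cmod w"] that by simp
  ultimately show ?thesis using w0 by (metis less_le_trans norm_zero)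
qed

text \<open>The open bidisc lies in the closure and hence in its interior, which for an open convex
  set is the set itself.\<close>

lemma bidisc_subset:
  assumes m: "(z0, w0) \<in> closure \<Omega>" shows "ball 0 (cmod z0) \<times> ball 0 (cmod w0) \<subseteq> \<Omega>"
proof -
  have "ball 0 (cmod z0) \<times> ball 0 (cmod w0) \<subseteq> closure \<Omega>"
    by (auto intro!: convex_torus_shrink[OF cv_closure tor_closure m])
  then have "ball 0 (cmod z0) \<times> ball 0 (cmod w0) \<subseteq> interior (closure \<Omega>)"
    by (intro interior_maximal open_Times open_ball)
  then show ?thesis using convex_interior_closure[OF cv] op by (simp add: interior_open)
qed

text \<open>The functions are ((w + w0)/(2 w0))^n, normalised in L2 of the disc |w| < |w0|. The base
  has modulus below 1 in that disc and 1 at w0. The normalising integrals decay more slowly than any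
  geometric sequence, so after normalisation the functions still tend to 0 away from w0.
  Independence of z is what later permits division on a slice.\<close>

lemma peak_sequence:
  assumes m: "(z0, w0) \<in> maximizers 0"
  obtains F :: "nat \<Rightarrow> C2 \<Rightarrow> complex" and B where
    "\<And>n. F n \<in> bergman_space \<Omega>" "\<And>n. L2_norm \<Omega> (F n) \<le> B" "\<And>x. x \<in> \<Omega> \<Longrightarrow> (\<lambda>n. F n x) \<longlonglongrightarrow> 0"
    "\<And>n A. continuous_on A (F n)" "\<And>n z w. F n (z, w) = F n (0, w)" "\<And>n w. cmod w < cmod w0 \<Longrightarrow> F n (0, w) \<noteq> 0"
    "\<And>n. (\<integral>\<^sup>+w. indicator (ball 0 (cmod w0)) w * ennreal ((cmod (F n (0, w)))\<^sup>2) \<partial>lborel) = 1"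
    "\<And>\<delta> \<eta>. \<delta> > 0 \<Longrightarrow> \<eta> > 0 \<Longrightarrow> \<exists>N. \<forall>n\<ge>N. \<forall>w. cmod w < cmod w0 \<longrightarrow> \<not> dist w w0 < \<delta> \<longrightarrow> (cmod (F n (0, w)))\<^sup>2 < \<eta>"
proof -
  define b where "b = cmod w0"
  have b: "b > 0" using maximizers_pos[OF m] by (auto simp: wmono_def wpow_def b_def)
  have w0: "w0 \<noteq> 0" using b by (auto simp: b_def)
  obtain a where a: "a > 0" "\<And>x. x \<in> \<Omega> \<Longrightarrow> norm x < a" using bd unfolding bounded_pos
    by (metis add.commute add_strict_increasing2 le_less_trans less_add_one norm_ge_zero zero_less_one)
  have \<Omega>sub: "x \<in> ball 0 a \<times> ball 0 b" if "x \<in> \<Omega>" for x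
  proof -
    have "cmod (fst x) < a" using a(2)[OF that] norm_fst_le[of "fst x" "snd x"] by simp
    moreover have "cmod (snd x) < b" unfolding b_def by (rule snd_less_maximizer[OF m, of "fst x"]) (use that in simp)
    ultimately show ?thesis by (simp add: mem_Times_iff)
  qed
  define q where "q = (\<lambda>w. cmod (w + w0) / (2 * b))"
  have q0: "0 \<le> q w" for w using b by (simp add: q_def)
  have q1: "q w < 1" if "cmod w < b" for w
    using norm_triangle_ineq[of w w0] that b by (simp add: q_def divide_less_eq b_def)
  define f where "f = (\<lambda>(n::nat) w. ((w + w0) / (2 * w0)) ^ n)"
  have fq: "cmod (f n w) = q w ^ n" for n w by (simp add: f_def q_def norm_power norm_divide norm_mult b_def)
  have fhol: "f n holomorphic_on A" for n A unfolding f_def by (intro holomorphic_intros) (use w0 in auto)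
  have fc: "continuous_on A (f n)" for n A by (rule holomorphic_on_imp_continuous_on[OF fhol])
  let ?I = "\<lambda>n w. indicator (ball 0 b) w * ennreal ((cmod (f n w))\<^sup>2)"
  have Im: "?I n \<in> borel_measurable borel" for n by (rule indicator_square_borel[OF fc]) simp
  define \<kappa> where "\<kappa> = (\<lambda>n. \<integral>\<^sup>+w. ?I n w \<partial>lborel)"
  have \<kappa>_fin: "\<kappa> n < \<infinity>" for n
  proof -
    have pw: "?I n w \<le> indicator (ball 0 b) w" for w
    proof (cases "w \<in> ball 0 b")
      case True
      then have "q w ^ n \<le> 1" using q1[of w] q0[of w] by (intro power_le_one) auto
      then have "(q w ^ n)\<^sup>2 \<le> 1" by (rule power_le_one[rotated]) (use q0[of w] in simp)
      then show ?thesis using True by (simp add: fq)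
    qed simp
    have "\<kappa> n \<le> (\<integral>\<^sup>+w. indicator (ball (0::complex) b) w \<partial>lborel)" unfolding \<kappa>_def by (rule nn_integral_mono) (rule pw)
    also have "\<dots> < \<infinity>" using emeasure_disc[of b 0] b by simp
    finally show ?thesis .
  qed
  have \<kappa>_ge: "ennreal ((1 - \<tau> / 2) ^ (2 * n) * disc_area (\<tau> * b)) \<le> \<kappa> n" if \<tau>: "0 < \<tau>" "\<tau> < 1" for \<tau> n
  proof -
    \<comment> \<open>Centre of the disc of radius \<tau> |w0| that touches the circle from inside
      at w0. The base has modulus 1 - \<tau>/2 there, and the mean square inequality on this disc
      bounds the integral from below.\<close>
    define w1 where "w1 = of_real (1 - \<tau>) * w0"
    have n1: "cmod w1 = (1 - \<tau>) * b" using \<tau> unfolding w1_def norm_mult norm_of_real by (simp add: b_def)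
    have sub: "ball w1 (\<tau> * b) \<subseteq> ball 0 b"
    proof
      fix y assume "y \<in> ball w1 (\<tau> * b)"
      then have "cmod y < (1 - \<tau>) * b + \<tau> * b" using norm_triangle_ineq2[of y w1] n1 by (simp add: dist_norm norm_minus_commute)
      then show "y \<in> ball 0 b" by (simp add: algebra_simps)
    qed
    have "q w1 = 1 - \<tau> / 2"
    proof -
      have "w1 + w0 = of_real (2 - \<tau>) * w0" by (simp add: w1_def algebra_simps)
      then have "cmod (w1 + w0) = (2 - \<tau>) * b" using \<tau> by (simp only: norm_mult norm_of_real b_def)
      then show ?thesis using b by (simp add: q_def field_simps)
    qed
    then have "ennreal ((1 - \<tau> / 2) ^ (2 * n) * disc_area (\<tau> * b)) = ennreal ((cmod (f n w1))\<^sup>2 * disc_area (\<tau> * b))"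
      by (simp add: fq power_mult[symmetric] mult.commute)
    also have "\<dots> \<le> (\<integral>\<^sup>+w. indicator (ball w1 (\<tau> * b)) w * ennreal ((cmod (f n w))\<^sup>2) \<partial>lborel)"
      by (rule disc_mean_square[OF fhol]) (use \<tau> b in simp)
    also have "\<dots> \<le> \<kappa> n" unfolding \<kappa>_def by (intro nn_integral_mono) (use sub in \<open>auto simp: indicator_def\<close>)
    finally show ?thesis .
  qed
  define c where "c = (\<lambda>n. enn2real (\<kappa> n))"
  have c\<kappa>: "\<kappa> n = ennreal (c n)" for n unfolding c_def using \<kappa>_fin[of n] by simp
  have c_ge: "(1 - \<tau> / 2) ^ (2 * n) * disc_area (\<tau> * b) \<le> c n" if \<tau>: "0 < \<tau>" "\<tau> < 1" for \<tau> n
    using \<kappa>_ge[OF \<tau>, of n] unfolding c\<kappa> by (simp add: ennreal_le_iff c_def)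
  have cpos: "c n > 0" for n
  proof -
    have "0 < (1 - (1/2) / 2 :: real) ^ (2 * n) * disc_area (1/2 * b)" using disc_area_pos[of "1/2 * b"] b by simp
    also have "\<dots> \<le> c n" by (rule c_ge) auto
    finally show ?thesis .
  qed
  have decay: "(\<lambda>n. p ^ n / c n) \<longlonglongrightarrow> 0" if p: "0 \<le> p" "p < 1" for p
  proof -
    \<comment> \<open>Then d = (1 - \<tau>/2)^2 is at least 1 - \<tau> = (1 + p)/2, which exceeds
      p.\<close>
    define \<tau> where "\<tau> = (1 - p) / 2"
    have \<tau>: "0 < \<tau>" "\<tau> < 1" using p by (auto simp: \<tau>_def)
    define d where "d = (1 - \<tau> / 2)\<^sup>2"
    have "p < d"
    proof -
      have "d = 1 - \<tau> + \<tau>\<^sup>2 / 4" by (simp add: d_def power2_eq_square algebra_simps)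
      moreover have "0 \<le> \<tau>\<^sup>2 / 4" by simp
      ultimately show ?thesis using p unfolding \<tau>_def by argo
    qed
    then have pd: "0 \<le> p / d" "p / d < 1" "d > 0" using p by auto
    have K: "disc_area (\<tau> * b) > 0" using disc_area_pos \<tau> b by simp
    have lim: "(\<lambda>n. (p / d) ^ n / disc_area (\<tau> * b)) \<longlonglongrightarrow> 0 / disc_area (\<tau> * b)"
      by (intro tendsto_divide tendsto_const LIMSEQ_power_zero) (use pd K p in auto)
    have up: "p ^ n / c n \<le> (p / d) ^ n / disc_area (\<tau> * b)" for n
    proof -
      have "d ^ n * disc_area (\<tau> * b) \<le> c n" using c_ge[OF \<tau>, of n] by (simp add: d_def power_mult)
      then have "p ^ n / c n \<le> p ^ n / (d ^ n * disc_area (\<tau> * b))"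
        using pd K p by (intro divide_left_mono) (auto intro!: mult_pos_pos cpos)
      then show ?thesis by (simp add: power_divide)
    qed
    show ?thesis
    proof (rule tendsto_sandwich)
      show "\<forall>\<^sub>F n in sequentially. 0 \<le> p ^ n / c n"
        by (rule always_eventually) (use divide_nonneg_pos[OF zero_le_power[OF p(1)] cpos] in blast)
      show "\<forall>\<^sub>F n in sequentially. p ^ n / c n \<le> (p / d) ^ n / disc_area (\<tau> * b)"
        by (rule always_eventually) (use up in blast)
      show "(\<lambda>n. (p / d) ^ n / disc_area (\<tau> * b)) \<longlonglongrightarrow> 0" using lim by simp
    qed (rule tendsto_const)
  qed
  define F :: "nat \<Rightarrow> C2 \<Rightarrow> complex" where "F = (\<lambda>n x. f n (snd x) / of_real (sqrt (c n)))"
  have Fsq: "(cmod (F n (z, w)))\<^sup>2 = (cmod (f n w))\<^sup>2 / c n" for n z w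
    using cpos[of n] by (simp add: F_def norm_divide power_divide)
  have Fcont: "continuous_on A (F n)" for A n
    unfolding F_def using cpos[of n] by (intro continuous_intros continuous_on_compose2[OF fc]) auto
  have F: "F n \<in> bergman_space \<Omega>" for n
  proof -
    have "holomorphic_C2 (\<lambda>x. (1 / of_real (sqrt (c n))) * ((1 / (2 * w0)) * (snd x + w0)) ^ n) \<Omega>"
      by (rule holomorphic_C2_mult holomorphic_C2_power holomorphic_C2_add holomorphic_C2_const holomorphic_C2_snd)+
    moreover have "(\<lambda>x. (1 / of_real (sqrt (c n))) * ((1 / (2 * w0)) * (snd x + w0)) ^ n) = F n"
      by (simp add: F_def f_def fun_eq_iff)
    ultimately show ?thesis using continuous_cl_L2[OF Fcont] by (simp add: bergman_space_def)
  qed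
  have FN: "(\<integral>\<^sup>+w. indicator (ball 0 b) w * ennreal ((cmod (F n (0, w)))\<^sup>2) \<partial>lborel) = 1" for n
  proof -
    have "(\<integral>\<^sup>+w. indicator (ball 0 b) w * ennreal ((cmod (F n (0, w)))\<^sup>2) \<partial>lborel) = (\<integral>\<^sup>+w. ?I n w * ennreal (1 / c n) \<partial>lborel)"
      using cpos[of n] by (intro nn_integral_cong) (simp add: Fsq divide_inverse ennreal_mult mult.assoc)
    also have "\<dots> = \<kappa> n * ennreal (1 / c n)" unfolding \<kappa>_def by (rule nn_integral_multc) (use Im in simp)
    also have "\<dots> = ennreal (c n * (1 / c n))" unfolding c\<kappa> using cpos[of n] by (subst ennreal_mult) auto
    also have "\<dots> = 1" using cpos[of n] by simp
    finally show ?thesis .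
  qed
  have FB: "L2_norm \<Omega> (F n) \<le> sqrt (disc_area a)" for n
  proof (rule real_le_rsqrt)
    let ?J = "\<lambda>x :: C2. indicator (ball 0 a \<times> ball 0 b) x * ennreal ((cmod (F n x))\<^sup>2)"
    have "?J \<in> borel_measurable borel" by (rule indicator_square_borel[OF Fcont]) (simp add: open_Times)
    then have J: "?J \<in> borel_measurable (lborel \<Otimes>\<^sub>M lborel)" by (simp add: lborel_prod)
    have "ennreal ((L2_norm \<Omega> (F n))\<^sup>2) = (\<integral>\<^sup>+x. indicator \<Omega> x * ennreal ((cmod (F n x))\<^sup>2) \<partial>lborel)"
      by (subst L2_norm_eq_ennreal[OF bergman_L2[OF F]]) (rule lebesgue_on_nn_integral[OF borel_\<Omega>])
    also have "\<dots> \<le> (\<integral>\<^sup>+x. ?J x \<partial>lborel)"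
      by (intro nn_integral_mono) (use \<Omega>sub in \<open>auto simp: indicator_def\<close>)
    also have "\<dots> = (\<integral>\<^sup>+w. \<integral>\<^sup>+z. ?J (z, w) \<partial>lborel \<partial>lborel)"
      using lborel_pair.nn_integral_snd[OF J] by (simp add: lborel_prod)
    also have "\<dots> = (\<integral>\<^sup>+w. ennreal (disc_area a) * (indicator (ball 0 b) w * ennreal ((cmod (F n (0, w)))\<^sup>2)) \<partial>lborel)"
    proof (rule nn_integral_cong)
      fix w :: complex
      have "(\<integral>\<^sup>+z. ?J (z, w) \<partial>lborel) = (\<integral>\<^sup>+z. (indicator (ball 0 b) w * ennreal ((cmod (F n (0, w)))\<^sup>2)) * indicator (ball (0::complex) a) z \<partial>lborel)"
        by (intro nn_integral_cong) (simp add: indicator_def F_def)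
      also have "\<dots> = (indicator (ball 0 b) w * ennreal ((cmod (F n (0, w)))\<^sup>2)) * ennreal (disc_area a)"
        using emeasure_disc[of a 0] a(1) by (subst nn_integral_cmult_indicator) auto
      finally show "(\<integral>\<^sup>+z. ?J (z, w) \<partial>lborel) = ennreal (disc_area a) * (indicator (ball 0 b) w * ennreal ((cmod (F n (0, w)))\<^sup>2))"
        by (simp add: mult.commute)
    qed
    also have "\<dots> = ennreal (disc_area a)"
    proof -
      have "continuous_on (ball 0 b) (\<lambda>w. F n (0, w))" by (intro continuous_on_compose2[OF Fcont[of UNIV]] continuous_intros) auto
      then have "(\<lambda>w. indicator (ball 0 b) w * ennreal ((cmod (F n (0, w)))\<^sup>2)) \<in> borel_measurable borel"
        by (rule indicator_square_borel) simp
      then show ?thesis by (subst nn_integral_cmult) (simp_all add: FN)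
    qed
    finally show "(L2_norm \<Omega> (F n))\<^sup>2 \<le> disc_area a"
      using disc_area_pos[OF a(1)] by (simp add: ennreal_le_iff)
  qed
  have Flim: "(\<lambda>n. F n x) \<longlonglongrightarrow> 0" if x: "x \<in> \<Omega>" for x
  proof -
    have w: "cmod (snd x) < b" using \<Omega>sub[OF x] by (auto simp: mem_Times_iff)
    have qq: "0 \<le> (q (snd x))\<^sup>2" "(q (snd x))\<^sup>2 < 1" using q0 q1[OF w] by (auto simp: power_less_one_iff abs_square_less_1)
    have "(cmod (F n x))\<^sup>2 = ((q (snd x))\<^sup>2) ^ n / c n" for n
      using Fsq[of n "fst x" "snd x"] by (simp add: fq power_mult[symmetric] mult.commute)
    then have "(\<lambda>n. (cmod (F n x))\<^sup>2) \<longlonglongrightarrow> 0" using decay[OF qq] by simp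
    then have "(\<lambda>n. sqrt ((cmod (F n x))\<^sup>2)) \<longlonglongrightarrow> sqrt 0" by (rule tendsto_real_sqrt)
    then show ?thesis by - (rule tendsto_norm_zero_cancel, simp)
  qed
  have far_decay: "\<exists>N. \<forall>n\<ge>N. \<forall>w. cmod w < b \<longrightarrow> \<not> dist w w0 < \<delta> \<longrightarrow> (cmod (F n (0, w)))\<^sup>2 < \<eta>"
    if \<delta>: "\<delta> > 0" and \<eta>: "\<eta> > 0" for \<delta> \<eta>
  proof -
    \<comment> \<open>By the parallelogram law |w + w0|^2 is at most 4 b^2 - \<delta>^2 when w keeps
      distance \<delta> from w0. The maximum with 0 provides for large \<delta>.\<close>
    define p where "p = max 0 (1 - \<delta>\<^sup>2 / (4 * b\<^sup>2))"
    have p: "0 \<le> p" "p < 1" using \<delta> b by (auto simp: p_def)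
    have far: "(q w)\<^sup>2 \<le> p" if "cmod w < b" "\<not> dist w w0 < \<delta>" for w
    proof -
      have "(cmod (w + w0))\<^sup>2 + (cmod (w - w0))\<^sup>2 = 2 * (cmod w)\<^sup>2 + 2 * b\<^sup>2"
        unfolding b_def cmod_power2 by (simp add: power2_eq_square algebra_simps)
      moreover have "(cmod w)\<^sup>2 \<le> b\<^sup>2" using that by (intro power_mono) auto
      moreover have "\<delta>\<^sup>2 \<le> (cmod (w - w0))\<^sup>2" using that \<delta> by (intro power_mono) (auto simp: dist_norm)
      ultimately have "(cmod (w + w0))\<^sup>2 \<le> 4 * b\<^sup>2 - \<delta>\<^sup>2" by linarith
      then have "(q w)\<^sup>2 \<le> (4 * b\<^sup>2 - \<delta>\<^sup>2) / (4 * b\<^sup>2)"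
        using b by (simp add: q_def power_divide power_mult_distrib divide_right_mono)
      also have "\<dots> = 1 - \<delta>\<^sup>2 / (4 * b\<^sup>2)" using b by (simp add: diff_divide_distrib)
      finally show ?thesis by (simp add: p_def)
    qed
    have "\<forall>\<^sub>F n in sequentially. p ^ n / c n < \<eta>" by (rule order_tendstoD(2)[OF decay[OF p] \<eta>])
    then obtain N where N: "\<And>n. n \<ge> N \<Longrightarrow> p ^ n / c n < \<eta>" by (auto simp: eventually_sequentially)
    have "(cmod (F n (0, w)))\<^sup>2 < \<eta>" if n: "n \<ge> N" and w: "cmod w < b" "\<not> dist w w0 < \<delta>" for n w
    proof -
      have "((q w)\<^sup>2) ^ n \<le> p ^ n" by (rule power_mono[OF far[OF w]]) simp
      then have "(cmod (F n (0, w)))\<^sup>2 \<le> p ^ n / c n"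
        using cpos[of n] by (simp add: Fsq fq divide_right_mono power_mult[symmetric] mult.commute)
      then show ?thesis using N[OF n] by simp
    qed
    then show ?thesis by blast
  qed
  have F_nz: "F n (0, w) \<noteq> 0" if "cmod w < b" for n w
  proof -
    have "w + w0 \<noteq> 0" using that by (metis add.commute b_def less_irrefl minus_unique norm_minus_cancel)
    then show ?thesis using w0 cpos[of n] by (simp add: F_def f_def)
  qed
  have F_z: "F n (z, w) = F n (0, w)" for n z w by (simp add: F_def)
  show thesis
    by (rule that[OF F FB Flim Fcont F_z F_nz[unfolded b_def] FN[unfolded b_def] far_decay[unfolded b_def]])
qed


text \<open>Let H be the error between \<phi> times a peak function and a Bergman function. Its norm
  is small while the peak function keeps mass near w0, so on some slice near w0 the error is small
  relative to the constant value of the peak function there. Dividing by that value produces a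
  holomorphic function close to \<phi> on the slice, and by uniform continuity close to \<phi> on
  the face.\<close>

lemma hankel_necessary_fst:
  assumes \<phi>: "continuous_on (closure \<Omega>) \<phi>" and null: "null_approx \<Omega> \<phi>" and m: "(z0, w0) \<in> maximizers 0"
  shows "(\<lambda>u. \<phi> (u, w0)) holomorphic_on ball 0 (cmod z0)"
proof -
  have cl0: "(z0, w0) \<in> closure \<Omega>" by (rule maximizers_closed_cl[OF m])
  define s b where "s = cmod z0" and "b = cmod w0"
  have b: "b > 0" using maximizers_pos[OF m] by (auto simp: wmono_def wpow_def b_def)
  have w0: "w0 \<noteq> 0" using b by (auto simp: b_def)
  have bidisc: "ball 0 s \<times> ball 0 b \<subseteq> \<Omega>" using bidisc_subset[OF cl0] by (simp add: s_def b_def)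
  obtain F B where F: "\<And>n. F n \<in> bergman_space \<Omega>" and FB: "\<And>n. L2_norm \<Omega> (F n) \<le> B"
    and Flim: "\<And>x. x \<in> \<Omega> \<Longrightarrow> (\<lambda>n. F n x) \<longlonglongrightarrow> 0" and Fcont: "\<And>n A. continuous_on A (F n)"
    and F_z: "\<And>n z w. F n (z, w) = F n (0, w)" and F_nz: "\<And>n w. cmod w < b \<Longrightarrow> F n (0, w) \<noteq> 0"
    and FN: "\<And>n. (\<integral>\<^sup>+w. indicator (ball 0 b) w * ennreal ((cmod (F n (0, w)))\<^sup>2) \<partial>lborel) = 1"
    and far_decay: "\<And>\<delta> \<eta>. \<delta> > 0 \<Longrightarrow> \<eta> > 0 \<Longrightarrow> \<exists>N. \<forall>n\<ge>N. \<forall>w. cmod w < b \<longrightarrow> \<not> dist w w0 < \<delta> \<longrightarrow> (cmod (F n (0, w)))\<^sup>2 < \<eta>"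
    by (rule peak_sequence[OF m, folded b_def]) (rule that)
  obtain r G where r: "strict_mono (r :: nat \<Rightarrow> nat)" and G: "\<And>n. G n \<in> bergman_space \<Omega>"
    and conv: "(\<lambda>n. L2_norm \<Omega> (\<lambda>x. \<phi> x * F (r n) x - G n x)) \<longlonglongrightarrow> 0"
  proof -
    have "\<exists>r G. strict_mono (r :: nat \<Rightarrow> nat) \<and> (\<forall>n. G n \<in> bergman_space \<Omega>) \<and>
       (\<lambda>n. L2_norm \<Omega> (\<lambda>x. \<phi> x * F (r n) x - G n x)) \<longlonglongrightarrow> 0"
      using null[unfolded null_approx_def, THEN spec[of _ F], THEN spec[of _ B]] F FB Flim by simp
    then show thesis using that by blast
  qed
  have \<phi>c: "continuous_on \<Omega> \<phi>" by (rule continuous_on_subset[OF \<phi> closure_subset])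
  have Gc: "continuous_on \<Omega> (G n)" for n by (rule holomorphic_C2_continuous_on[OF bergman_holomorphic[OF G]])
  have slice_cl: "(z, w0) \<in> closure \<Omega>" if "z \<in> ball 0 s" for z
    by (rule convex_torus_shrink_fst[OF cv_closure tor_closure cl0]) (use that in \<open>simp add: s_def\<close>)
  show ?thesis
    unfolding s_def[symmetric]
  proof (rule holomorphic_if_L2_close)
    show cs: "continuous_on (ball 0 s) (\<lambda>u. \<phi> (u, w0))"
      by (rule continuous_on_compose2[OF \<phi>]) (auto intro!: continuous_intros slice_cl)
    fix d :: real assume d: "d > 0"
    \<comment> \<open>An upper bound for the area of the slice that stays positive when s = 0. With
      \<epsilon> = d/(4A), moving from w to w0 costs at most d/2.\<close>
    define A where "A = disc_area s + 1"
    have A: "A > 0" "disc_area s \<le> A" by (auto simp: A_def disc_area_def add_nonneg_pos)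
    define \<epsilon> where "\<epsilon> = d / (4 * A)"
    have \<epsilon>: "\<epsilon> > 0" using d A by (simp add: \<epsilon>_def)
    have "uniformly_continuous_on (closure \<Omega>) \<phi>" by (rule compact_uniformly_continuous[OF \<phi> compact_cl])
    then obtain \<delta> where \<delta>: "\<delta> > 0" "\<And>x y. x \<in> closure \<Omega> \<Longrightarrow> y \<in> closure \<Omega> \<Longrightarrow> dist y x < \<delta> \<Longrightarrow> dist (\<phi> y) (\<phi> x) < sqrt \<epsilon>"
      unfolding uniformly_continuous_on_def using \<epsilon> by (metis real_sqrt_gt_zero)
    \<comment> \<open>Away from w0 the peak function then has mass at most \<eta> times the area of
      the disc, that is 1/2, which leaves at least 1/2 near w0.\<close>
    define \<eta> where "\<eta> = 1 / (2 * disc_area b)"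
    have \<eta>: "\<eta> > 0" using disc_area_pos[OF b] by (simp add: \<eta>_def)
    obtain N1 where N1: "\<And>n w. n \<ge> N1 \<Longrightarrow> cmod w < b \<Longrightarrow> \<not> dist w w0 < \<delta> \<Longrightarrow> (cmod (F n (0, w)))\<^sup>2 < \<eta>"
      using far_decay[OF \<delta>(1) \<eta>] by blast
    have "d / 8 > 0" using d by simp
    then have "\<forall>\<^sub>F n in sequentially. L2_norm \<Omega> (\<lambda>x. \<phi> x * F (r n) x - G n x) < sqrt (d / 8)"
      by (intro order_tendstoD(2)[OF conv]) simp
    then obtain N2 where N2: "\<And>n. n \<ge> N2 \<Longrightarrow> L2_norm \<Omega> (\<lambda>x. \<phi> x * F (r n) x - G n x) < sqrt (d / 8)" by (auto simp: eventually_sequentially)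
    define n where "n = max N1 N2"
    define k where "k = r n"
    have k: "N1 \<le> k" using seq_suble[OF r, of n] by (simp add: k_def n_def)
    define H where "H = (\<lambda>x. \<phi> x * F k x - G n x)"
    have Hc: "continuous_on \<Omega> H" unfolding H_def by (intro continuous_intros \<phi>c Fcont Gc)
    have H2: "H \<in> L2 \<Omega>" unfolding H_def k_def
    proof (rule L2_diff[OF _ bergman_L2[OF G]])
      obtain M where M: "\<And>x. x \<in> closure \<Omega> \<Longrightarrow> cmod (\<phi> x) \<le> M"
        using compact_imp_bounded[OF compact_continuous_image[OF \<phi> compact_cl]] unfolding bounded_iff by blast
      show "(\<lambda>x. \<phi> x * F (r n) x) \<in> L2 \<Omega>"
        by (rule L2_mult_bounded[OF bergman_L2[OF F] continuous_on_lebesgue_measurable[OF op \<phi>c]]) (use M closure_subset in blast)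
    qed
    have HN: "L2_norm \<Omega> H < sqrt (d / 8)" using N2[of n] by (simp add: H_def k_def n_def)
    let ?V = "\<lambda>w. \<integral>\<^sup>+z. indicator (ball 0 s) z * ennreal ((cmod (H (z, w)))\<^sup>2) \<partial>lborel"
    \<comment> \<open>If every slice near w0 violated the bound, integrating over these slices would
      give H a squared norm of at least d/4 times the mass 1/2, contrary to the choice of n.\<close>
    have "\<exists>w. cmod w < b \<and> dist w w0 < \<delta> \<and> ?V w \<le> ennreal (d / 4 * (cmod (F k (0, w)))\<^sup>2)"
    proof (rule ccontr)
      assume nex: "\<not> ?thesis"
      have big: "ennreal (d / 4 * (cmod (F k (0, w)))\<^sup>2) \<le> ?V w" if "cmod w < b" "dist w w0 < \<delta>" for w
      proof -
        have "\<not> ?V w \<le> ennreal (d / 4 * (cmod (F k (0, w)))\<^sup>2)" using nex that by blast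
        then show ?thesis by simp
      qed
      let ?E = "\<lambda>w. indicator (ball 0 b) w * ennreal ((cmod (F k (0, w)))\<^sup>2)"
      have F0: "continuous_on B (\<lambda>w. F k (0, w))" for B by (intro continuous_on_compose2[OF Fcont[of UNIV]] continuous_intros) auto
      have near_m: "(\<lambda>w. indicator (ball 0 b \<inter> ball w0 \<delta>) w * ennreal ((cmod (F k (0, w)))\<^sup>2)) \<in> borel_measurable borel"
        by (rule indicator_square_borel[OF F0]) (simp add: open_Int)
      have "1 \<le> (\<integral>\<^sup>+w. indicator (ball 0 b \<inter> ball w0 \<delta>) w * ennreal ((cmod (F k (0, w)))\<^sup>2) + ennreal \<eta> * indicator (ball 0 b) w \<partial>lborel)"
        unfolding FN[of k, symmetric]
      proof (rule nn_integral_mono)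
        fix w :: complex
        show "?E w \<le> indicator (ball 0 b \<inter> ball w0 \<delta>) w * ennreal ((cmod (F k (0, w)))\<^sup>2) + ennreal \<eta> * indicator (ball 0 b) w"
        proof (cases "w \<in> ball 0 b \<and> w \<notin> ball w0 \<delta>")
          case True
          then have "(cmod (F k (0, w)))\<^sup>2 \<le> \<eta>" using N1[OF k, of w] by (auto simp: dist_commute)
          then show ?thesis using True by (simp add: ennreal_leI)
        qed (auto simp: indicator_def)
      qed
      also have "\<dots> = (\<integral>\<^sup>+w. indicator (ball 0 b \<inter> ball w0 \<delta>) w * ennreal ((cmod (F k (0, w)))\<^sup>2) \<partial>lborel) + ennreal \<eta> * ennreal (disc_area b)"
      proof -
        have m1: "(\<lambda>w. indicator (ball 0 b \<inter> ball w0 \<delta>) w * ennreal ((cmod (F k (0, w)))\<^sup>2)) \<in> borel_measurable lborel"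
          using near_m by simp
        have m2: "(\<lambda>w. ennreal \<eta> * indicator (ball (0::complex) b) w) \<in> borel_measurable lborel"
          by (intro borel_measurable_times_ennreal borel_measurable_const borel_measurable_indicator) simp
        show ?thesis
          unfolding nn_integral_add[OF m1 m2] using emeasure_disc[of b 0] b by (simp add: nn_integral_cmult_indicator)
      qed
      also have "ennreal \<eta> * ennreal (disc_area b) \<le> ennreal (1 / 2)"
        using \<eta> disc_area_pos[OF b] by (subst ennreal_mult[symmetric]) (auto simp: \<eta>_def)
      finally have half: "1 \<le> (\<integral>\<^sup>+w. indicator (ball 0 b \<inter> ball w0 \<delta>) w * ennreal ((cmod (F k (0, w)))\<^sup>2) \<partial>lborel) + ennreal (1 / 2)"
        by (simp add: add_left_mono)
      have half': "ennreal (1 / 2) \<le> (\<integral>\<^sup>+w. indicator (ball 0 b \<inter> ball w0 \<delta>) w * ennreal ((cmod (F k (0, w)))\<^sup>2) \<partial>lborel)" (is "_ \<le> ?X")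
      proof (rule ccontr)
        assume "\<not> ennreal (1 / 2) \<le> ?X"
        then have "?X < ennreal (1 / 2)" by simp
        then have "?X + ennreal (1 / 2) < ennreal (1 / 2) + ennreal (1 / 2)"
          by (simp only: add.commute[of ?X] ennreal_add_left_cancel_less) simp
        also have "ennreal (1 / 2) + ennreal (1 / 2) = 1" by (subst ennreal_plus[symmetric]) simp_all
        finally show False using half by simp
      qed
      have "ennreal (d / 8) = ennreal (d / 4) * ennreal (1 / 2)" by (subst ennreal_mult[symmetric]) (use d in simp_all)
      also have "\<dots> \<le> ennreal (d / 4) * ?X" by (rule mult_left_mono[OF half']) simp
      also have "\<dots> = (\<integral>\<^sup>+w. ennreal (d / 4) * (indicator (ball 0 b \<inter> ball w0 \<delta>) w * ennreal ((cmod (F k (0, w)))\<^sup>2)) \<partial>lborel)"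
        by (rule nn_integral_cmult[symmetric]) (use near_m in simp)
      also have "\<dots> \<le> (\<integral>\<^sup>+w. \<integral>\<^sup>+z. indicator (ball 0 s \<times> ball 0 b) (z, w) * ennreal ((cmod (H (z, w)))\<^sup>2) \<partial>lborel \<partial>lborel)"
      proof (rule nn_integral_mono)
        fix w :: complex
        show "ennreal (d / 4) * (indicator (ball 0 b \<inter> ball w0 \<delta>) w * ennreal ((cmod (F k (0, w)))\<^sup>2)) \<le>
          (\<integral>\<^sup>+z. indicator (ball 0 s \<times> ball 0 b) (z, w) * ennreal ((cmod (H (z, w)))\<^sup>2) \<partial>lborel)"
        proof (cases "w \<in> ball 0 b \<inter> ball w0 \<delta>")
          case True
          then have "ennreal (d / 4 * (cmod (F k (0, w)))\<^sup>2) \<le> ?V w" by (intro big) (auto simp: dist_commute)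
          also have "?V w = (\<integral>\<^sup>+z. indicator (ball 0 s \<times> ball 0 b) (z, w) * ennreal ((cmod (H (z, w)))\<^sup>2) \<partial>lborel)"
            using True by (intro nn_integral_cong) (simp add: indicator_def)
          also have "ennreal (d / 4 * (cmod (F k (0, w)))\<^sup>2) = ennreal (d / 4) * ennreal ((cmod (F k (0, w)))\<^sup>2)"
            by (rule ennreal_mult) (use d in auto)
          finally show ?thesis using True by simp
        qed simp
      qed
      also have "\<dots> = (\<integral>\<^sup>+x. indicator (ball 0 s \<times> ball 0 b) x * ennreal ((cmod (H x))\<^sup>2) \<partial>lborel)"
      proof -
        have "(\<lambda>x. indicator (ball 0 s \<times> ball 0 b) x * ennreal ((cmod (H x))\<^sup>2)) \<in> borel_measurable borel"
          by (rule indicator_square_borel[OF continuous_on_subset[OF Hc bidisc]]) (simp add: open_Times)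
        then have "(\<lambda>x. indicator (ball 0 s \<times> ball 0 b) x * ennreal ((cmod (H x))\<^sup>2)) \<in> borel_measurable (lborel \<Otimes>\<^sub>M lborel)"
          by (simp add: lborel_prod)
        from lborel_pair.nn_integral_snd[OF this] show ?thesis by (simp add: lborel_prod)
      qed
      also have "\<dots> \<le> (\<integral>\<^sup>+x. indicator \<Omega> x * ennreal ((cmod (H x))\<^sup>2) \<partial>lborel)"
        by (intro nn_integral_mono) (use bidisc in \<open>auto simp: indicator_def\<close>)
      also have "\<dots> = ennreal ((L2_norm \<Omega> H)\<^sup>2)"
        by (subst L2_norm_eq_ennreal[OF H2]) (rule lebesgue_on_nn_integral[OF borel_\<Omega>, symmetric])
      finally have "d / 8 \<le> (L2_norm \<Omega> H)\<^sup>2" by (simp add: ennreal_le_iff)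
      moreover have "(L2_norm \<Omega> H)\<^sup>2 < (sqrt (d / 8))\<^sup>2" using HN by (intro power_strict_mono) auto
      ultimately show False using d by simp
    qed
    then obtain w where w: "cmod w < b" "dist w w0 < \<delta>" "?V w \<le> ennreal (d / 4 * (cmod (F k (0, w)))\<^sup>2)" by blast
    \<comment> \<open>The peak function does not depend on z, so on the slice it is this nonzero
      constant and the quotient \<gamma> remains holomorphic.\<close>
    define v where "v = F k (0, w)"
    have v0: "v \<noteq> 0" unfolding v_def by (rule F_nz[OF w(1)])
    have Fv: "F k (z, w) = v" for z unfolding v_def by (rule F_z)
    define \<gamma> where "\<gamma> = (\<lambda>z. G n (z, w) / v)"
    have slice: "(z, w) \<in> \<Omega>" if "z \<in> ball 0 s" for z using bidisc that w(1) by auto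
    have \<gamma>: "\<gamma> holomorphic_on ball 0 s" unfolding \<gamma>_def
      by (intro holomorphic_intros holomorphic_C2_slice_fst[OF op bergman_holomorphic[OF G]] slice) (use v0 in auto)
    have "(\<integral>\<^sup>+z. indicator (ball 0 s) z * ennreal ((cmod (\<phi> (z, w0) - \<gamma> z))\<^sup>2) \<partial>lborel) \<le>
       (\<integral>\<^sup>+z. ennreal (2 * \<epsilon>) * indicator (ball 0 s) z + ennreal (2 / (cmod v)\<^sup>2) * (indicator (ball 0 s) z * ennreal ((cmod (H (z, w)))\<^sup>2)) \<partial>lborel)"
    proof (rule nn_integral_mono)
      fix z :: complex
      show "indicator (ball 0 s) z * ennreal ((cmod (\<phi> (z, w0) - \<gamma> z))\<^sup>2) \<le>
        ennreal (2 * \<epsilon>) * indicator (ball 0 s) z + ennreal (2 / (cmod v)\<^sup>2) * (indicator (ball 0 s) z * ennreal ((cmod (H (z, w)))\<^sup>2))"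
      proof (cases "z \<in> ball 0 s")
        case True
        have "dist (\<phi> (z, w)) (\<phi> (z, w0)) < sqrt \<epsilon>"
          by (rule \<delta>(2)) (use slice[OF True] slice_cl[OF True] closure_subset w(2) in \<open>auto simp: dist_prod_def\<close>)
        then have "cmod (\<phi> (z, w0) - \<phi> (z, w)) \<le> sqrt \<epsilon>" by (simp add: dist_norm norm_minus_commute)
        then have e1: "(cmod (\<phi> (z, w0) - \<phi> (z, w)))\<^sup>2 \<le> \<epsilon>"
          using power_mono[of "cmod (\<phi> (z, w0) - \<phi> (z, w))" "sqrt \<epsilon>" 2] \<epsilon> by simp
        have e2: "cmod (\<phi> (z, w) - \<gamma> z) = cmod (H (z, w)) / cmod v"
          using v0 by (simp add: \<gamma>_def H_def Fv norm_divide[symmetric] diff_divide_distrib)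
        have "(cmod (\<phi> (z, w0) - \<gamma> z))\<^sup>2 \<le> (cmod (\<phi> (z, w0) - \<phi> (z, w)) + cmod (\<phi> (z, w) - \<gamma> z))\<^sup>2"
          using norm_triangle_ineq[of "\<phi> (z, w0) - \<phi> (z, w)" "\<phi> (z, w) - \<gamma> z"] by (intro power_mono) auto
        also have "\<dots> \<le> 2 * (cmod (\<phi> (z, w0) - \<phi> (z, w)))\<^sup>2 + 2 * (cmod (\<phi> (z, w) - \<gamma> z))\<^sup>2"
          using sum_squares_bound[of "cmod (\<phi> (z, w0) - \<phi> (z, w))" "cmod (\<phi> (z, w) - \<gamma> z)"] by (simp add: power2_sum)
        also have "\<dots> \<le> 2 * \<epsilon> + 2 / (cmod v)\<^sup>2 * (cmod (H (z, w)))\<^sup>2"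
          using e1 unfolding e2 by (simp add: power_divide)
        finally have "ennreal ((cmod (\<phi> (z, w0) - \<gamma> z))\<^sup>2) \<le> ennreal (2 * \<epsilon> + 2 / (cmod v)\<^sup>2 * (cmod (H (z, w)))\<^sup>2)" by (rule ennreal_leI)
        also have "\<dots> = ennreal (2 * \<epsilon>) + ennreal (2 / (cmod v)\<^sup>2) * ennreal ((cmod (H (z, w)))\<^sup>2)"
          using \<epsilon> by (subst ennreal_plus) (auto simp: ennreal_mult[symmetric])
        finally show ?thesis using True by simp
      qed simp
    qed
    also have "\<dots> = ennreal (2 * \<epsilon>) * emeasure lborel (ball (0::complex) s) + ennreal (2 / (cmod v)\<^sup>2) * ?V w"
    proof -
      have "continuous_on (ball 0 s) (\<lambda>z. H (z, w))" by (intro continuous_on_compose2[OF Hc] continuous_intros) (use slice in auto)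
      then have m: "(\<lambda>z. indicator (ball 0 s) z * ennreal ((cmod (H (z, w)))\<^sup>2)) \<in> borel_measurable borel"
        by (rule indicator_square_borel) simp
      have m1: "(\<lambda>z. ennreal (2 * \<epsilon>) * indicator (ball (0::complex) s) z) \<in> borel_measurable lborel"
        by (intro borel_measurable_times_ennreal borel_measurable_const borel_measurable_indicator) simp
      have m2: "(\<lambda>z. ennreal (2 / (cmod v)\<^sup>2) * (indicator (ball 0 s) z * ennreal ((cmod (H (z, w)))\<^sup>2))) \<in> borel_measurable lborel"
        by (rule borel_measurable_times_ennreal) (use m in simp_all)
      show ?thesis unfolding nn_integral_add[OF m1 m2]
        using m by (subst nn_integral_cmult) (auto simp: nn_integral_cmult_indicator)
    qed
    also have "\<dots> \<le> ennreal (2 * \<epsilon>) * ennreal A + ennreal (2 / (cmod v)\<^sup>2) * ennreal (d / 4 * (cmod v)\<^sup>2)"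
    proof (intro add_mono mult_left_mono)
      show "emeasure lborel (ball (0::complex) s) \<le> ennreal A"
        using emeasure_disc[of s 0] A by (simp add: s_def ennreal_leI)
      show "?V w \<le> ennreal (d / 4 * (cmod v)\<^sup>2)" using w(3) by (simp add: v_def)
    qed auto
    also have "\<dots> = ennreal (2 * \<epsilon> * A + 2 / (cmod v)\<^sup>2 * (d / 4 * (cmod v)\<^sup>2))"
      using \<epsilon> A d by (subst ennreal_plus) (auto simp: ennreal_mult[symmetric])
    also have "2 * \<epsilon> * A + 2 / (cmod v)\<^sup>2 * (d / 4 * (cmod v)\<^sup>2) = d"
      using v0 A by (simp add: \<epsilon>_def field_simps)
    finally show "\<exists>\<gamma>. \<gamma> holomorphic_on ball 0 s \<and>
      (\<integral>\<^sup>+z. indicator (ball 0 s) z * ennreal ((cmod (\<phi> (z, w0) - \<gamma> z))\<^sup>2) \<partial>lborel) \<le> ennreal d"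
      using \<gamma> by blast
  qed
qed

end

section \<open>Holomorphic discs in the boundary\<close>

text \<open>The image of a nonconstant function is open and would contain points off the real
  axis.\<close>

lemma holomorphic_real_constant:
  assumes h: "h holomorphic_on ball 0 1" and real: "\<And>t. t \<in> ball 0 1 \<Longrightarrow> Im (h t) = 0"
  shows "h constant_on ball (0::complex) 1"
proof (rule ccontr)
  assume "\<not> ?thesis"
  then have "open (h ` ball 0 1)" by (intro open_mapping_thm[OF h open_ball connected_ball open_ball subset_refl])
  moreover have "h 0 \<in> h ` ball 0 1" by simp
  ultimately obtain e where e: "e > 0" "ball (h 0) e \<subseteq> h ` ball 0 1" by (meson open_contains_ball)
  have "h 0 + \<i> * of_real (e / 2) \<in> ball (h 0) e" using e(1) by (simp add: dist_norm norm_mult)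
  then obtain t where t: "t \<in> ball 0 1" "h 0 + \<i> * of_real (e / 2) = h t" using e(2) by blast
  have "Im (h t) = Im (h 0) + e / 2" unfolding t(2)[symmetric] by simp
  then show False using real[OF t(1)] real[of 0] e(1) by simp
qed

text \<open>The open disc of radius |h t| does not contain h t, so the hypothesis at one point does
  not reach that point. For nonconstant h the maximum principle supplies t' with a larger modulus,
  and the union of the discs contains the range of h.\<close>

lemma holomorphic_compose_discs:
  assumes h: "h holomorphic_on ball 0 1"
    and \<psi>: "\<And>t. t \<in> ball 0 1 \<Longrightarrow> \<psi> holomorphic_on ball 0 (cmod (h t))"
  shows "(\<lambda>t. \<psi> (h t)) holomorphic_on ball (0::complex) 1"
proof (cases "h constant_on ball 0 1")
  case True
  then obtain k where k: "\<And>t. t \<in> ball 0 1 \<Longrightarrow> h t = k" unfolding constant_on_def by blast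
  show ?thesis by (rule holomorphic_transform[OF holomorphic_on_const[of "\<psi> k"]]) (simp add: k)
next
  case False
  let ?U = "\<Union>t\<in>ball 0 1. ball 0 (cmod (h t))"
  have "\<exists>t'\<in>ball 0 1. cmod (h t) < cmod (h t')" if t: "t \<in> ball 0 1" for t
  proof (rule ccontr)
    assume "\<not> ?thesis"
    then have "\<And>z. z \<in> ball 0 1 \<Longrightarrow> cmod (h z) \<le> cmod (h t)" by (meson not_less)
    from maximum_modulus_principle[OF h open_ball connected_ball open_ball subset_refl t this] False show False by simp
  qed
  then have im: "h ` ball 0 1 \<subseteq> ?U" by fastforce
  have "\<psi> holomorphic_on ?U" by (rule holomorphic_on_UN_open) (use \<psi> in auto)
  from holomorphic_on_compose_gen[OF h this im] show ?thesis by (simp add: o_def)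
qed

context convex_reinhardt begin

lemma swap_convex_reinhardt: "convex_reinhardt (prod.swap ` \<Omega>)"
proof
  have lin: "linear (prod.swap :: C2 \<Rightarrow> C2)" by (intro linearI) auto
  have cS: "continuous_on UNIV (prod.swap :: C2 \<Rightarrow> C2)" by (simp add: prod.swap_def[abs_def]) (intro continuous_intros)
  show "open (prod.swap ` \<Omega>)" unfolding swap_image_eq_vimage by (rule open_vimage[OF op cS])
  show "prod.swap ` \<Omega> \<noteq> {}" using ne by simp
  show "bounded (prod.swap ` \<Omega>)"
    by (rule bounded_linear_image[OF bd]) (rule linear_conv_bounded_linear[THEN iffD1, OF lin])
  show "convex (prod.swap ` \<Omega>)" by (rule convex_linear_image[OF lin cv])
  show "reinhardt (prod.swap ` \<Omega>)" using rh unfolding reinhardt_def by force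
qed

lemma closure_swap: "closure (prod.swap ` \<Omega>) = prod.swap ` closure \<Omega>"
proof -
  have lin: "linear (prod.swap :: C2 \<Rightarrow> C2)" by (intro linearI) auto
  show ?thesis by (rule closure_injective_linear_image[OF lin, symmetric]) simp
qed

lemma frontier_swap: "frontier (prod.swap ` \<Omega>) = prod.swap ` frontier \<Omega>"
  using op convex_reinhardt.op[OF swap_convex_reinhardt]
  by (simp add: frontier_def interior_open closure_swap image_set_diff)

lemma maximizers_swap: "(w, z) \<in> convex_reinhardt.maximizers (prod.swap ` \<Omega>) 0 \<longleftrightarrow> (z, w) \<in> maximizers 1"
proof -
  interpret S: convex_reinhardt "prod.swap ` \<Omega>" by (rule swap_convex_reinhardt)
  have "(w, z) \<in> prod.swap ` closure \<Omega> \<longleftrightarrow> (z, w) \<in> closure \<Omega>" by force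
  then show ?thesis unfolding S.maximizers_0 maximizers_1 closure_swap by simp
qed

lemma continuous_swap:
  assumes "continuous_on (closure \<Omega>) \<phi>" shows "continuous_on (closure (prod.swap ` \<Omega>)) (\<phi> \<circ> prod.swap)"
proof -
  have "continuous_on UNIV (prod.swap :: C2 \<Rightarrow> C2)" by (simp add: prod.swap_def[abs_def]) (intro continuous_intros)
  then have "continuous_on (closure (prod.swap ` \<Omega>)) (prod.swap :: C2 \<Rightarrow> C2)" by (rule continuous_on_subset) simp
  then show ?thesis
    by (rule continuous_on_compose) (use assms in \<open>simp add: closure_swap image_image\<close>)
qed

text \<open>The supporting hyperplane at f 0 gives a linear form whose real part attains its maximum
  at an interior point of the disc, hence is constant. Torus invariance strengthens the hyperplane
  inequality to |Az| + |Bw| <= c, and equality makes both A f1 and B f2 real, thus constant. If A or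
  B is 0, the inequality says that the other coordinate has maximal modulus.\<close>

lemma frontier_disc:
  assumes f: "holomorphic_map_C2 f (ball 0 1)" and fr: "f ` ball 0 1 \<subseteq> frontier \<Omega>"
  shows "(\<exists>w0. \<forall>t\<in>ball 0 1. snd (f t) = w0 \<and> (fst (f t), w0) \<in> maximizers 0) \<or>
    (\<exists>z0. \<forall>t\<in>ball 0 1. fst (f t) = z0 \<and> (z0, snd (f t)) \<in> maximizers 1) \<or>
    (\<exists>p. \<forall>t\<in>ball 0 1. f t = p)"
proof -
  have cl: "f t \<in> closure \<Omega>" "f t \<notin> \<Omega>" if "t \<in> ball 0 1" for t
  proof -
    have "f t \<in> frontier \<Omega>" using fr that by blast
    then show "f t \<in> closure \<Omega>" "f t \<notin> \<Omega>" using op by (simp_all add: frontier_def interior_open)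
  qed
  have "f 0 \<in> closure \<Omega>" "f 0 \<notin> rel_interior \<Omega>" using cl[of 0] rel_interior_open[OF op] by auto
  then obtain a where a: "a \<noteq> 0" "\<And>y. y \<in> closure \<Omega> \<Longrightarrow> a \<bullet> f 0 \<le> a \<bullet> y"
    by (rule supporting_hyperplane_relative_frontier[OF cv]) (rule that)
  \<comment> \<open>Sign and conjugation turn the real inner product with a into -Re (A z + B w), so
    the lower bound from the hyperplane becomes an upper bound for a complex linear form.\<close>
  define A B where "A = - cnj (fst a)" and "B = - cnj (snd a)"
  have AB: "A \<noteq> 0 \<or> B \<noteq> 0" using a(1) by (auto simp: A_def B_def prod_eq_iff)
  define f1 f2 where "f1 = (\<lambda>t. fst (f t))" and "f2 = (\<lambda>t. snd (f t))"
  have h: "f1 holomorphic_on ball 0 1" "f2 holomorphic_on ball 0 1"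
    using f by (auto simp: holomorphic_map_C2_def f1_def f2_def)
  have inner: "a \<bullet> y = - Re (A * fst y + B * snd y)" for y
    by (cases y) (simp add: A_def B_def inner_prod_def inner_complex_def)
  define c where "c = Re (A * f1 0 + B * f2 0)"
  have le: "Re (A * z + B * w) \<le> c" if "(z, w) \<in> closure \<Omega>" for z w
    using a(2)[OF that] unfolding inner c_def f1_def f2_def by simp
  \<comment> \<open>The two coordinates may be rotated independently until A z and B w are both
    nonnegative reals.\<close>
  have abs_le: "cmod (A * z) + cmod (B * w) \<le> c" if zw: "(z, w) \<in> closure \<Omega>" for z w
  proof -
    have unimod: "\<exists>e. cmod e = 1 \<and> e * u = of_real (cmod u)" for u :: complex
    proof (cases "u = 0")
      case False
      have "cnj u / of_real (cmod u) * u = of_real (cmod u)"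
        using False complex_norm_square[of u] by (simp add: field_simps power2_eq_square)
      moreover have "cmod (cnj u / of_real (cmod u)) = 1" using False by (simp add: norm_divide)
      ultimately show ?thesis by blast
    qed (auto intro: exI[of _ 1])
    obtain d e where d: "cmod d = 1" "d * (A * z) = of_real (cmod (A * z))"
      and e: "cmod e = 1" "e * (B * w) = of_real (cmod (B * w))" using unimod[of "A * z"] unimod[of "B * w"] by blast
    have "A * (d * z) + B * (e * w) = of_real (cmod (A * z) + cmod (B * w))"
      using d(2) e(2) by (simp add: mult.left_commute)
    then show ?thesis using le[OF torus_invariantD[OF tor_closure zw d(1) e(1)]] by simp
  qed
  have cl': "(f1 t, f2 t) \<in> closure \<Omega>" if "t \<in> ball 0 1" for t using cl(1)[OF that] by (simp add: f1_def f2_def)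
  define g where "g = (\<lambda>t. A * f1 t + B * f2 t)"
  \<comment> \<open>The exponential converts the real part of g into a modulus, to which the maximum
    principle applies.\<close>
  have "(\<lambda>t. exp (g t)) constant_on ball 0 1"
  proof (rule maximum_modulus_principle[OF _ open_ball connected_ball open_ball subset_refl])
    show "(\<lambda>t. exp (g t)) holomorphic_on ball 0 1" unfolding g_def by (intro holomorphic_intros h)
    show "cmod (exp (g t)) \<le> cmod (exp (g 0))" if "t \<in> ball 0 1" for t
      using le[OF cl'[OF that]] by (simp add: norm_exp_eq_Re g_def c_def)
  qed simp
  then obtain k where k: "\<And>t. t \<in> ball 0 1 \<Longrightarrow> exp (g t) = k" unfolding constant_on_def by blast
  have gc: "Re (g t) = c" if "t \<in> ball 0 1" for t
  proof -
    have "cmod (exp (g t)) = cmod (exp (g 0))" using k[OF that] k[of 0] by simp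
    then show ?thesis by (simp add: norm_exp_eq_Re g_def c_def)
  qed
  \<comment> \<open>The real parts sum to c, the moduli to at most c, and each real part is at most
    its modulus; hence equality holds in both.\<close>
  have parts: "Re (A * f1 t) = cmod (A * f1 t)" "Re (B * f2 t) = cmod (B * f2 t)" if "t \<in> ball 0 1" for t
    using abs_le[OF cl'[OF that]] gc[OF that] complex_Re_le_cmod[of "A * f1 t"] complex_Re_le_cmod[of "B * f2 t"]
    by (simp_all add: g_def)
  have Im0: "Im u = 0" if "Re u = cmod u" for u using that cmod_power2[of u] by simp
  have con1: "\<exists>z0. \<forall>t\<in>ball 0 1. f1 t = z0" if "A \<noteq> 0"
  proof -
    have "(\<lambda>t. A * f1 t) constant_on ball 0 1"
      by (rule holomorphic_real_constant) (use h Im0[OF parts(1)] in \<open>auto intro: holomorphic_intros\<close>)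
    then obtain k where "\<And>t. t \<in> ball 0 1 \<Longrightarrow> A * f1 t = k" unfolding constant_on_def by blast
    then have "\<forall>t\<in>ball 0 1. f1 t = k / A" using that by (auto simp: field_simps)
    then show ?thesis by blast
  qed
  have con2: "\<exists>w0. \<forall>t\<in>ball 0 1. f2 t = w0" if "B \<noteq> 0"
  proof -
    have "(\<lambda>t. B * f2 t) constant_on ball 0 1"
      by (rule holomorphic_real_constant) (use h Im0[OF parts(2)] in \<open>auto intro: holomorphic_intros\<close>)
    then obtain k where "\<And>t. t \<in> ball 0 1 \<Longrightarrow> B * f2 t = k" unfolding constant_on_def by blast
    then have "\<forall>t\<in>ball 0 1. f2 t = k / B" using that by (auto simp: field_simps)
    then show ?thesis by blast
  qed
  consider "A \<noteq> 0" "B \<noteq> 0" | "A = 0" "B \<noteq> 0" | "A \<noteq> 0" "B = 0" using AB by blast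
  then show ?thesis
  proof cases
    case 1
    obtain z0 where z0: "\<And>t. t \<in> ball 0 1 \<Longrightarrow> f1 t = z0" using con1[OF 1(1)] by blast
    obtain w0 where w0: "\<And>t. t \<in> ball 0 1 \<Longrightarrow> f2 t = w0" using con2[OF 1(2)] by blast
    have "\<forall>t\<in>ball 0 1. f t = (z0, w0)" using z0 w0 by (auto simp: f1_def f2_def prod_eq_iff)
    then show ?thesis by blast
  next
    case 2
    obtain w0 where w0: "\<And>t. t \<in> ball 0 1 \<Longrightarrow> f2 t = w0" using con2[OF 2(2)] by blast
    have c: "c = cmod B * cmod w0" using parts(2)[of 0] w0[of 0] by (simp add: c_def 2(1) norm_mult)
    have "cmod w \<le> cmod w0" if "(z, w) \<in> closure \<Omega>" for z w
      using abs_le[OF that] 2 by (simp add: c norm_mult)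
    then have "(f1 t, w0) \<in> maximizers 0" if "t \<in> ball 0 1" for t
      using cl'[OF that] w0[OF that] by (auto simp: maximizers_0)
    then show ?thesis using w0 unfolding f1_def f2_def by blast
  next
    case 3
    obtain z0 where z0: "\<And>t. t \<in> ball 0 1 \<Longrightarrow> f1 t = z0" using con1[OF 3(1)] by blast
    have c: "c = cmod A * cmod z0" using parts(1)[of 0] z0[of 0] by (simp add: c_def 3(2) norm_mult)
    have "cmod z \<le> cmod z0" if "(z, w) \<in> closure \<Omega>" for z w
      using abs_le[OF that] 3 by (simp add: c norm_mult)
    then have "(z0, f2 t) \<in> maximizers 1" if "t \<in> ball 0 1" for t
      using cl'[OF that] z0[OF that] by (auto simp: maximizers_1)
    then show ?thesis using z0 unfolding f1_def f2_def by blast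
  qed
qed

text \<open>The disc with first coordinate |z0| t and second coordinate w0 stays in the closure by
  shrinking and avoids \<Omega> because no point of \<Omega> attains |w0|. For z0 = 0 the target
  disc is empty.\<close>

lemma holomorphic_disc_fst:
  assumes disc: "\<And>f. holomorphic_map_C2 f (ball 0 1) \<Longrightarrow> f ` ball 0 1 \<subseteq> frontier \<Omega> \<Longrightarrow> (\<phi> \<circ> f) holomorphic_on ball 0 1"
    and m: "(z0, w0) \<in> maximizers 0"
  shows "(\<lambda>u. \<phi> (u, w0)) holomorphic_on ball 0 (cmod z0)"
proof (cases "z0 = 0")
  case False
  define f :: "complex \<Rightarrow> C2" where "f = (\<lambda>t. (of_real (cmod z0) * t, w0))"
  have r: "cmod z0 > 0" using False by simp
  have "(\<phi> \<circ> f) holomorphic_on ball 0 1"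
  proof (rule disc)
    show "holomorphic_map_C2 f (ball 0 1)"
      unfolding holomorphic_map_C2_def f_def fst_conv snd_conv by (intro conjI holomorphic_intros)
    show "f ` ball 0 1 \<subseteq> frontier \<Omega>"
    proof
      fix p assume "p \<in> f ` ball 0 1"
      then obtain t where t: "cmod t < 1" "p = (of_real (cmod z0) * t, w0)" by (auto simp: f_def)
      have "p \<in> closure \<Omega>" unfolding t(2)
        by (rule convex_torus_shrink_fst[OF cv_closure tor_closure maximizers_closed_cl[OF m]])
           (use t(1) in \<open>simp add: norm_mult mult_left_le\<close>)
      moreover have "p \<notin> \<Omega>" using snd_less_maximizer[OF m] t(2) by blast
      ultimately show "p \<in> frontier \<Omega>" using op by (simp add: frontier_def interior_open)
    qed
  qed
  moreover have "(\<lambda>u :: complex. u / of_real (cmod z0)) ` ball 0 (cmod z0) \<subseteq> ball 0 1"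
  proof (rule image_subsetI)
    fix u :: complex assume "u \<in> ball 0 (cmod z0)"
    then show "u / of_real (cmod z0) \<in> ball 0 1" unfolding mem_ball_0 using r by (simp add: norm_divide)
  qed
  moreover have "(\<lambda>u :: complex. u / of_real (cmod z0)) holomorphic_on ball 0 (cmod z0)" by (intro holomorphic_intros) (use r in auto)
  ultimately have "((\<phi> \<circ> f) \<circ> (\<lambda>u. u / of_real (cmod z0))) holomorphic_on ball 0 (cmod z0)"
    by (meson holomorphic_on_compose_gen)
  moreover have "(\<phi> \<circ> f) \<circ> (\<lambda>u. u / of_real (cmod z0)) = (\<lambda>u. \<phi> (u, w0))" using r by (auto simp: f_def fun_eq_iff)
  ultimately show ?thesis by simp
qed (simp add: holomorphic_on_def)

lemma holomorphic_disc_snd: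
  assumes disc: "\<And>f. holomorphic_map_C2 f (ball 0 1) \<Longrightarrow> f ` ball 0 1 \<subseteq> frontier \<Omega> \<Longrightarrow> (\<phi> \<circ> f) holomorphic_on ball 0 1"
    and m: "(z0, w0) \<in> maximizers 1"
  shows "(\<lambda>u. \<phi> (z0, u)) holomorphic_on ball 0 (cmod w0)"
proof -
  interpret S: convex_reinhardt "prod.swap ` \<Omega>" by (rule swap_convex_reinhardt)
  have "(\<lambda>u. (\<phi> \<circ> prod.swap) (u, z0)) holomorphic_on ball 0 (cmod w0)"
  proof (rule S.holomorphic_disc_fst)
    show "(w0, z0) \<in> S.maximizers 0" using m by (simp add: maximizers_swap)
    fix f assume f: "holomorphic_map_C2 f (ball 0 1)" "f ` ball 0 1 \<subseteq> frontier (prod.swap ` \<Omega>)"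
    have "(\<phi> \<circ> (prod.swap \<circ> f)) holomorphic_on ball 0 1"
    proof (rule disc)
      show "holomorphic_map_C2 (prod.swap \<circ> f) (ball 0 1)" using f(1) by (simp add: holomorphic_map_C2_def)
      have "(prod.swap \<circ> f) ` ball 0 1 \<subseteq> prod.swap ` prod.swap ` frontier \<Omega>"
        using f(2) unfolding frontier_swap image_comp[symmetric] by (rule image_mono)
      then show "(prod.swap \<circ> f) ` ball 0 1 \<subseteq> frontier \<Omega>" by (simp add: image_image)
    qed
    then show "(\<phi> \<circ> prod.swap \<circ> f) holomorphic_on ball 0 1" by (simp add: comp_assoc)
  qed
  then show ?thesis by simp
qed

end

lemma (in convex_reinhardt) null_approx_if_compact:
  assumes \<phi>: "continuous_on (closure \<Omega>) \<phi>" and compact: "compact_on_bergman \<Omega> (hankel \<Omega> \<phi>)"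
  shows "null_approx \<Omega> \<phi>"
  unfolding null_approx_def
proof (intro allI impI)
  fix F :: "nat \<Rightarrow> C2 \<Rightarrow> complex" and B
  assume F: "\<forall>n. F n \<in> bergman_space \<Omega>" and B: "\<forall>n. L2_norm \<Omega> (F n) \<le> B" and lim: "\<forall>x\<in>\<Omega>. (\<lambda>n. F n x) \<longlonglongrightarrow> 0"
  obtain M where M: "\<And>x. x \<in> closure \<Omega> \<Longrightarrow> cmod (\<phi> x) \<le> M"
    using compact_imp_bounded[OF compact_continuous_image[OF \<phi> compact_cl]] unfolding bounded_iff by blast
  have \<phi>m: "\<phi> \<in> borel_measurable (lebesgue_on \<Omega>)"
    by (rule continuous_on_lebesgue_measurable[OF op continuous_on_subset[OF \<phi> closure_subset]])
  have M': "\<And>x. x \<in> \<Omega> \<Longrightarrow> cmod (\<phi> x) \<le> M" using M closure_subset by blast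
  obtain r G where "strict_mono (r :: nat \<Rightarrow> nat)" "\<And>n. G n \<in> bergman_space \<Omega>"
    "(\<lambda>n. L2_norm \<Omega> (\<lambda>x. \<phi> x * F (r n) x - G n x)) \<longlonglongrightarrow> 0"
    by (rule compact_hankel_weakly_null[OF op fin \<phi>m M' compact, of F B]) (use F B lim that in auto)
  then show "\<exists>r G. strict_mono (r :: nat \<Rightarrow> nat) \<and> (\<forall>n. G n \<in> bergman_space \<Omega>) \<and>
      (\<lambda>n. L2_norm \<Omega> (\<lambda>x. \<phi> x * F (r n) x - G n x)) \<longlonglongrightarrow> 0" by blast
qed

lemma (in convex_reinhardt) hankel_necessary_snd:
  assumes \<phi>: "continuous_on (closure \<Omega>) \<phi>" and null: "null_approx \<Omega> \<phi>" and m: "(z0, w0) \<in> maximizers 1"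
  shows "(\<lambda>u. \<phi> (z0, u)) holomorphic_on ball 0 (cmod w0)"
proof -
  interpret S: convex_reinhardt "prod.swap ` \<Omega>" by (rule swap_convex_reinhardt)
  have "(\<lambda>u. (\<phi> \<circ> prod.swap) (u, z0)) holomorphic_on ball 0 (cmod w0)"
  proof (rule S.hankel_necessary_fst[OF continuous_swap[OF \<phi>]])
    show "null_approx (prod.swap ` \<Omega>) (\<phi> \<circ> prod.swap)"
      by (rule null_approx_swap[OF op continuous_on_subset[OF \<phi> closure_subset] null])
    show "(w0, z0) \<in> S.maximizers 0" using m by (simp add: maximizers_swap)
  qed
  then show ?thesis by simp
qed

theorem theorem1:
  fixes \<Omega> :: "(complex \<times> complex) set"
    and \<phi> :: "complex \<times> complex \<Rightarrow> complex"
  assumes "open \<Omega>" and "connected \<Omega>" and "\<Omega> \<noteq> {}"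
    and "bounded \<Omega>" and "convex \<Omega>" and "reinhardt \<Omega>"
    and "continuous_on (closure \<Omega>) \<phi>"
  shows "compact_on_bergman \<Omega> (hankel \<Omega> \<phi>) \<longleftrightarrow>
    (\<forall>f. holomorphic_map_C2 f (ball 0 1) \<and> f ` ball 0 1 \<subseteq> frontier \<Omega> \<longrightarrow>
         (\<phi> \<circ> f) holomorphic_on ball 0 1)"
proof -
  interpret convex_reinhardt \<Omega> by unfold_locales (use assms in auto)
  note \<phi> = assms(7)
  show ?thesis
  proof (intro iffI allI impI; (elim conjE)?)
    fix f :: "complex \<Rightarrow> C2"
    assume compact: "compact_on_bergman \<Omega> (hankel \<Omega> \<phi>)"
      and f: "holomorphic_map_C2 f (ball 0 1)" "f ` ball 0 1 \<subseteq> frontier \<Omega>"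
    have null: "null_approx \<Omega> \<phi>" by (rule null_approx_if_compact[OF \<phi> compact])
    have f1: "(\<lambda>t. fst (f t)) holomorphic_on ball 0 1" and f2: "(\<lambda>t. snd (f t)) holomorphic_on ball 0 1"
      using f(1) by (auto simp: holomorphic_map_C2_def)
    consider (snd) w0 where "\<And>t. t \<in> ball 0 1 \<Longrightarrow> snd (f t) = w0 \<and> (fst (f t), w0) \<in> maximizers 0"
      | (fst) z0 where "\<And>t. t \<in> ball 0 1 \<Longrightarrow> fst (f t) = z0 \<and> (z0, snd (f t)) \<in> maximizers 1"
      | (const) p where "\<And>t. t \<in> ball 0 1 \<Longrightarrow> f t = p"
      using frontier_disc[OF f] by blast
    then show "(\<phi> \<circ> f) holomorphic_on ball 0 1"
    proof cases
      case snd
      \<comment> \<open>The disc need not be parametrised linearly; necessity is available at each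
        of its points as a maximiser, with a radius that varies with t.\<close>
      have "(\<lambda>t. \<phi> (fst (f t), w0)) holomorphic_on ball 0 1"
        by (rule holomorphic_compose_discs[OF f1, where \<psi> = "\<lambda>u. \<phi> (u, w0)"])
           (use hankel_necessary_fst[OF \<phi> null] snd in blast)
      moreover have "\<phi> (fst (f t), w0) = (\<phi> \<circ> f) t" if "t \<in> ball 0 1" for t
        using snd[OF that] by (metis comp_apply prod.collapse)
      ultimately show ?thesis by (rule holomorphic_transform)
    next
      case fst
      have "(\<lambda>t. \<phi> (z0, snd (f t))) holomorphic_on ball 0 1"
        by (rule holomorphic_compose_discs[OF f2, where \<psi> = "\<lambda>u. \<phi> (z0, u)"])
           (use hankel_necessary_snd[OF \<phi> null] fst in blast)
      moreover have "\<phi> (z0, snd (f t)) = (\<phi> \<circ> f) t" if "t \<in> ball 0 1" for t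
        using fst[OF that] by (metis comp_apply prod.collapse)
      ultimately show ?thesis by (rule holomorphic_transform)
    next
      case const
      show ?thesis by (rule holomorphic_transform[OF holomorphic_on_const[of "\<phi> p"]]) (simp add: const)
    qed
  next
    assume "\<forall>f. holomorphic_map_C2 f (ball 0 1) \<and> f ` ball 0 1 \<subseteq> frontier \<Omega> \<longrightarrow> (\<phi> \<circ> f) holomorphic_on ball 0 1"
    then have disc: "\<And>f. holomorphic_map_C2 f (ball 0 1) \<Longrightarrow> f ` ball 0 1 \<subseteq> frontier \<Omega> \<Longrightarrow> (\<phi> \<circ> f) holomorphic_on ball 0 1"
      by blast
    show "compact_on_bergman \<Omega> (hankel \<Omega> \<phi>)"
      by (rule hankel_compact_sufficient[OF \<phi> holomorphic_disc_fst[OF disc] holomorphic_disc_snd[OF disc]])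
  qed
qed


end
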